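(* Let $(\mathcal C,\mathbb E,\mathfrak s)$ be an extriangulated category with weak-kernels. Then $\mathsf{def}\,\mathcal C$ is a Serre subcategory of $\operatorname{mod}\mathcal C$, so that there is a Serre quotient $$\mathsf{def}\,\mathcal C\longrightarrow\operatorname{mod}\mathcal C\xrightarrow{\;Q\;}\frac{\operatorname{mod}\mathcal C}{\mathsf{def}\,\mathcal C}.$$ Moreover, if the quotient functor $Q$ has a right adjoint, then there is a localization sequence $$\mathsf{def}\,\mathcal C\longrightarrow\operatorname{mod}\mathcal C\xrightarrow{\;Q\;}\mathsf{lex}\,\mathcal C$$ in which the right adjoint $R:\mathsf{lex}\,\mathcal C\to\operatorname{mod}\mathcal C$ of $Q$ is the canonical inclusion.
   Context: All categories and functors are additive; subcategories are full, additive and closed under isomorphisms. Extriangulated category (Nakaoka–Palu). Let $\mathcal C$ be an additive category and $\mathbb E:\mathcal C^{op}\times\mathcal C\to\mathsf{Ab}$ a biadditive functor. An element $\delta\in\mathbb E(X,Z)$ is an $\mathbb E$-extension; for $z:Z\to Z'$ and $x:X'\to X$ put $z_*\delta=\mathbb E(X,z)(\delta)$, $x^*\delta=\mathbb E(x,Z)(\delta)$. A morphism $(z,x):\delta\to\delta'$ from $\delta\in\mathbb E(X,Z)$ to $\delta'\in\mathbb E(X',Z')$ is a pair $z:Z\to Z'$, $x:X\to X'$ with $z_*\delta=x^*\delta'$. Two sequences $Z\to Y\to X$, $Z\to Y'\to X$ are equivalent if there is an isomorphism $Y\cong Y'$ compatible with the maps from $Z$ and to $X$. A realization $\mathfrak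 s$ assigns to each $\delta\in\mathbb E(X,Z)$ an equivalence class $\mathfrak s(\delta)=[Z\xrightarrow{g}Y\xrightarrow{f}X]$ such that every morphism $(z,x):\delta\to\delta'$ extends to a commutative diagram $(z,y,x)$ between representing sequences. It is additive if $\mathfrak s(0)=[Z\to Z\oplus X\to X]$ (split) and $\mathfrak s(\delta\oplus\delta')=\mathfrak s(\delta)\oplus\mathfrak s(\delta')$. The triple $(\mathcal C,\mathbb E,\mathfrak s)$ is extriangulated if $\mathbb E$ is biadditive (ET1), $\mathfrak s$ is an additive realization (ET2), and: (ET3) if $\mathfrak s(\delta)=[Z\xrightarrow{g}Y\xrightarrow{f}X]$, $\mathfrak s(\delta')=[Z'\xrightarrow{g'}Y'\xrightarrow{f'}X']$ and $yg=g'z$, there is $x:X\to X'$ with $xf=f'y$ and $(z,x):\delta\to\delta'$ a morphism; (ET4) if $\delta\in\mathbb E(X,Z)$, $\delta'\in\mathbb E(A,Y)$ with $\mathfrak s(\delta)=[Z\xrightarrow{g}Y\xrightarrow{f}X]$, $\mathfrak s(\delta')=[Y\xrightarrow{b}B\xrightarrow{a}A]$, there are an object $C$, morphisms $g'=bg:Z\to B$, $f':B\to C$, $b':X\to C$, $a':C\to A$ with $b'f=f'b$, $a'f'=a$, and $\delta''\in\mathbb E(C,Z)$ with $\mathfrak s(\delta'')=[Z\xrightarrow{g'}B\xrightarrow{f'}C]$, such that $X\xrightarrow{b'}C\xrightarrow{a'}A$ realizes $f_*\delta'$, $b'^*\delta''=\delta$ and $g_*\delta''=a'^*\delta'$; (ET3)$^{op}$,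 (ET4)$^{op}$: the duals of (ET3), (ET4). A conflation is a sequence $Z\xrightarrow{g}Y\xrightarrow{f}X$ realizing some $\delta\in\mathbb E(X,Z)$; then $g$ is an inflation and $f$ a deflation. $\operatorname{mod}\mathcal C$ is the category of finitely presented contravariant functors $F:\mathcal C\to\mathsf{Ab}$, i.e. those with an exact sequence $\mathcal C(-,X_1)\to\mathcal C(-,X_0)\to F\to0$. $\mathcal C$ has weak-kernels if for each $f:X\to Y$ there is $g:W\to X$ with $\mathcal C(-,W)\to\mathcal C(-,X)\to\mathcal C(-,Y)$ exact; then $\operatorname{mod}\mathcal C$ is abelian with exact inclusion into the category of all contravariant functors $\mathcal C\to\mathsf{Ab}$. $\mathsf{def}\,\mathcal C\subseteq\operatorname{mod}\mathcal C$ is the full subcategory of functors isomorphic to defects, i.e. to $\operatorname{Cok}(\mathcal C(-,Y)\xrightarrow{f\circ-}\mathcal C(-,X))$ for some conflation $Z\to Y\xrightarrow{f}X$. $\mathsf{lex}\,\mathcal C\subseteq\operatorname{mod}\mathcal C$ is the full subcategory of left exact functors, i.e. those $F$ with $0\to F(X)\to F(Y)\to F(Z)$ exact for every conflation $Z\to Y\to X$. A localization sequence $\mathcal S\to\mathcal A\xrightarrow{Q}\mathcal B$ consists of an abelian category $\mathcal A$, a Serre subcategory $\mathcal S$ with its inclusion, and a functor $Q$ which, up to an equivalence $\mathcal A/\mathcal S\simeq\mathcal B$, is the Serre quotient functor, such that both the inclusion $\mathcal S\to\mathcal A$ and $Q$ admit right adjoints. *)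

theory Defs
  imports "HOL-Algebra.Coset"
begin

text \<open>
  Abelian groups are the multiplicatively written commutative groups of HOL-Algebra. So in a
  Hom-group \<open>\<otimes>\<close> is the addition of morphisms and \<open>\<one>\<close> is the zero morphism; composition of
  morphisms is \<open>\<cdot>\<close>.
\<close>

section \<open>Additive and abelian categories\<close>

record ('o, 'm) cat =
  Obj :: "'o set"
  Hom :: "'o \<Rightarrow> 'o \<Rightarrow> 'm monoid"
  Idt :: "'o \<Rightarrow> 'm"
  Comp :: "'m \<Rightarrow> 'm \<Rightarrow> 'm"  (infixr "\<cdot>\<index>" 75)

definition mor :: "('o, 'm) cat \<Rightarrow> 'o \<Rightarrow> 'o \<Rightarrow> 'm set" where
  "mor C X Y = {f. X \<in> Obj C \<and> Y \<in> Obj C \<and> f \<in> carrier (Hom C X Y)}"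

text \<open>
  Hom-sets are disjoint, so a morphism determines its source and its target; this is why
  composition, and the action of functors on morphisms, need no object arguments.
\<close>

locale preadditive_category =
  fixes C :: "('o, 'm) cat" (structure)
  assumes hom_group: "X \<in> Obj C \<Longrightarrow> Y \<in> Obj C \<Longrightarrow> comm_group (Hom C X Y)"
    and hom_disjoint: "f \<in> mor C X Y \<Longrightarrow> f \<in> mor C X' Y' \<Longrightarrow> X = X' \<and> Y = Y'"
    and id_mor: "X \<in> Obj C \<Longrightarrow> Idt C X \<in> mor C X X"
    and comp_mor: "f \<in> mor C X Y \<Longrightarrow> g \<in> mor C Y Z \<Longrightarrow> g \<cdot> f \<in> mor C X Z"
    and comp_id_right: "f \<in> mor C X Y \<Longrightarrow> f \<cdot> Idt C X = f"
    and comp_id_left: "f \<in> mor C X Y \<Longrightarrow> Idt C Y \<cdot> f = f"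
    and comp_assoc: "f \<in> mor C W X \<Longrightarrow> g \<in> mor C X Y \<Longrightarrow> h \<in> mor C Y Z \<Longrightarrow>
          (h \<cdot> g) \<cdot> f = h \<cdot> (g \<cdot> f)"
    and comp_add_left: "f \<in> mor C X Y \<Longrightarrow> g \<in> mor C Y Z \<Longrightarrow> g' \<in> mor C Y Z \<Longrightarrow>
          (g \<otimes>\<^bsub>Hom C Y Z\<^esub> g') \<cdot> f = (g \<cdot> f) \<otimes>\<^bsub>Hom C X Z\<^esub> (g' \<cdot> f)"
    and comp_add_right: "f \<in> mor C X Y \<Longrightarrow> f' \<in> mor C X Y \<Longrightarrow> g \<in> mor C Y Z \<Longrightarrow>
          g \<cdot> (f \<otimes>\<^bsub>Hom C X Y\<^esub> f') = (g \<cdot> f) \<otimes>\<^bsub>Hom C X Z\<^esub> (g \<cdot> f')"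

definition is_zero_object :: "('o, 'm) cat \<Rightarrow> 'o \<Rightarrow> bool" where
  "is_zero_object C Z \<longleftrightarrow> Z \<in> Obj C \<and>
     (\<forall>X\<in>Obj C. (\<exists>!f. f \<in> mor C X Z) \<and> (\<exists>!f. f \<in> mor C Z X))"

definition is_biproduct ::
  "('o, 'm) cat \<Rightarrow> 'o \<Rightarrow> 'o \<Rightarrow> 'o \<Rightarrow> 'm \<Rightarrow> 'm \<Rightarrow> 'm \<Rightarrow> 'm \<Rightarrow> bool" where
  "is_biproduct C X Y P i j p q \<longleftrightarrow>
     i \<in> mor C X P \<and> j \<in> mor C Y P \<and> p \<in> mor C P X \<and> q \<in> mor C P Y \<and>
     p \<cdot>\<^bsub>C\<^esub> i = Idt C X \<and> q \<cdot>\<^bsub>C\<^esub> j = Idt C Y \<and>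
     p \<cdot>\<^bsub>C\<^esub> j = \<one>\<^bsub>Hom C Y X\<^esub> \<and> q \<cdot>\<^bsub>C\<^esub> i = \<one>\<^bsub>Hom C X Y\<^esub> \<and>
     (i \<cdot>\<^bsub>C\<^esub> p) \<otimes>\<^bsub>Hom C P P\<^esub> (j \<cdot>\<^bsub>C\<^esub> q) = Idt C P"

locale additive_category = preadditive_category +
  assumes has_zero_object: "\<exists>Z. is_zero_object C Z"
    and has_biproducts: "X \<in> Obj C \<Longrightarrow> Y \<in> Obj C \<Longrightarrow> \<exists>P i j p q. is_biproduct C X Y P i j p q"

definition is_iso :: "('o, 'm) cat \<Rightarrow> 'o \<Rightarrow> 'o \<Rightarrow> 'm \<Rightarrow> bool" where
  "is_iso C X Y f \<longleftrightarrow>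
     f \<in> mor C X Y \<and> (\<exists>g\<in>mor C Y X. g \<cdot>\<^bsub>C\<^esub> f = Idt C X \<and> f \<cdot>\<^bsub>C\<^esub> g = Idt C Y)"

definition is_mono :: "('o, 'm) cat \<Rightarrow> 'o \<Rightarrow> 'o \<Rightarrow> 'm \<Rightarrow> bool" where
  "is_mono C X Y f \<longleftrightarrow> f \<in> mor C X Y \<and>
     (\<forall>W. \<forall>g\<in>mor C W X. \<forall>h\<in>mor C W X. f \<cdot>\<^bsub>C\<^esub> g = f \<cdot>\<^bsub>C\<^esub> h \<longrightarrow> g = h)"

definition is_epi :: "('o, 'm) cat \<Rightarrow> 'o \<Rightarrow> 'o \<Rightarrow> 'm \<Rightarrow> bool" where
  "is_epi C X Y f \<longleftrightarrow> f \<in> mor C X Y \<and>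
     (\<forall>W. \<forall>g\<in>mor C Y W. \<forall>h\<in>mor C Y W. g \<cdot>\<^bsub>C\<^esub> f = h \<cdot>\<^bsub>C\<^esub> f \<longrightarrow> g = h)"

definition is_kernel :: "('o, 'm) cat \<Rightarrow> 'o \<Rightarrow> 'o \<Rightarrow> 'o \<Rightarrow> 'm \<Rightarrow> 'm \<Rightarrow> bool" where
  "is_kernel C K X Y k f \<longleftrightarrow>
     k \<in> mor C K X \<and> f \<in> mor C X Y \<and> f \<cdot>\<^bsub>C\<^esub> k = \<one>\<^bsub>Hom C K Y\<^esub> \<and>
     (\<forall>W. \<forall>h\<in>mor C W X. f \<cdot>\<^bsub>C\<^esub> h = \<one>\<^bsub>Hom C W Y\<^esub> \<longrightarrow>
        (\<exists>!u. u \<in> mor C W K \<and> k \<cdot>\<^bsub>C\<^esub> u = h))"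

definition is_cokernel :: "('o, 'm) cat \<Rightarrow> 'o \<Rightarrow> 'o \<Rightarrow> 'o \<Rightarrow> 'm \<Rightarrow> 'm \<Rightarrow> bool" where
  "is_cokernel C X Y L f c \<longleftrightarrow>
     f \<in> mor C X Y \<and> c \<in> mor C Y L \<and> c \<cdot>\<^bsub>C\<^esub> f = \<one>\<^bsub>Hom C X L\<^esub> \<and>
     (\<forall>W. \<forall>h\<in>mor C Y W. h \<cdot>\<^bsub>C\<^esub> f = \<one>\<^bsub>Hom C X W\<^esub> \<longrightarrow>
        (\<exists>!u. u \<in> mor C L W \<and> u \<cdot>\<^bsub>C\<^esub> c = h))"

locale abelian_category = additive_category +
  assumes has_kernels: "f \<in> mor C X Y \<Longrightarrow> \<exists>K k. is_kernel C K X Y k f"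
    and has_cokernels: "f \<in> mor C X Y \<Longrightarrow> \<exists>L c. is_cokernel C X Y L f c"
    and mono_normal: "is_mono C X Y f \<Longrightarrow> \<exists>Z g. is_kernel C X Y Z f g"
    and epi_normal: "is_epi C X Y f \<Longrightarrow> \<exists>W g. is_cokernel C W X Y g f"

definition full_subcategory :: "('o, 'm) cat \<Rightarrow> 'o set \<Rightarrow> ('o, 'm) cat" where
  "full_subcategory C S = C\<lparr>Obj := S\<rparr>"

definition opposite :: "('o, 'm) cat \<Rightarrow> ('o, 'm) cat" where
  "opposite C = \<lparr>Obj = Obj C, Hom = (\<lambda>X Y. Hom C Y X), Idt = Idt C, Comp = (\<lambda>g f. f \<cdot>\<^bsub>C\<^esub> g)\<rparr>"


section \<open>Additive functors, equivalences, adjunctions\<close>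

record ('o, 'm, 'p, 'n) functor_data =
  OMap :: "'o \<Rightarrow> 'p"
  AMap :: "'m \<Rightarrow> 'n"

locale additive_functor =
  A: additive_category A + B: additive_category B
  for A :: "('o, 'm) cat" and B :: "('p, 'n) cat" and F :: "('o, 'm, 'p, 'n) functor_data" +
  assumes obj: "X \<in> Obj A \<Longrightarrow> OMap F X \<in> Obj B"
    and arr: "X \<in> Obj A \<Longrightarrow> Y \<in> Obj A \<Longrightarrow>
          AMap F \<in> hom (Hom A X Y) (Hom B (OMap F X) (OMap F Y))"
    and ident: "X \<in> Obj A \<Longrightarrow> AMap F (Idt A X) = Idt B (OMap F X)"
    and compose: "f \<in> mor A X Y \<Longrightarrow> g \<in> mor A Y Z \<Longrightarrow>
          AMap F (g \<cdot>\<^bsub>A\<^esub> f) = AMap F g \<cdot>\<^bsub>B\<^esub> AMap F f"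

definition id_functor :: "('o, 'm, 'o, 'm) functor_data" where
  "id_functor = \<lparr>OMap = id, AMap = id\<rparr>"

definition comp_functor :: "('p, 'n, 'q, 'k) functor_data \<Rightarrow> ('o, 'm, 'p, 'n) functor_data \<Rightarrow>
    ('o, 'm, 'q, 'k) functor_data" where
  "comp_functor G F = \<lparr>OMap = OMap G \<circ> OMap F, AMap = AMap G \<circ> AMap F\<rparr>"

definition naturally_isomorphic :: "('o, 'm) cat \<Rightarrow> ('p, 'n) cat \<Rightarrow>
    ('o, 'm, 'p, 'n) functor_data \<Rightarrow> ('o, 'm, 'p, 'n) functor_data \<Rightarrow> bool" where
  "naturally_isomorphic A B F G \<longleftrightarrow> (\<exists>\<tau>.
     (\<forall>X\<in>Obj A. is_iso B (OMap F X) (OMap G X) (\<tau> X)) \<and>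
     (\<forall>X Y. \<forall>f\<in>mor A X Y. AMap G f \<cdot>\<^bsub>B\<^esub> \<tau> X = \<tau> Y \<cdot>\<^bsub>B\<^esub> AMap F f))"

definition is_equivalence :: "('o, 'm) cat \<Rightarrow> ('p, 'n) cat \<Rightarrow>
    ('o, 'm, 'p, 'n) functor_data \<Rightarrow> bool" where
  "is_equivalence A B F \<longleftrightarrow> additive_functor A B F \<and>
     (\<exists>G. additive_functor B A G \<and>
        naturally_isomorphic A A (comp_functor G F) id_functor \<and>
        naturally_isomorphic B B (comp_functor F G) id_functor)"

definition is_right_adjoint :: "('o, 'm) cat \<Rightarrow> ('p, 'n) cat \<Rightarrow>
    ('o, 'm, 'p, 'n) functor_data \<Rightarrow> ('p, 'n, 'o, 'm) functor_data \<Rightarrow> bool" where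
  "is_right_adjoint A B F G \<longleftrightarrow> additive_functor A B F \<and> additive_functor B A G \<and>
     (\<exists>\<phi>. (\<forall>X\<in>Obj A. \<forall>Y\<in>Obj B. bij_betw (\<phi> X Y) (mor B (OMap F X) Y) (mor A X (OMap G Y))) \<and>
          (\<forall>X' X Y Y'. \<forall>a\<in>mor A X' X. \<forall>b\<in>mor B Y Y'. \<forall>h\<in>mor B (OMap F X) Y.
             \<phi> X' Y' (b \<cdot>\<^bsub>B\<^esub> (h \<cdot>\<^bsub>B\<^esub> AMap F a)) = AMap G b \<cdot>\<^bsub>A\<^esub> (\<phi> X Y h \<cdot>\<^bsub>A\<^esub> a)))"

definition has_right_adjoint :: "('o, 'm) cat \<Rightarrow> ('p, 'n) cat \<Rightarrow>
    ('o, 'm, 'p, 'n) functor_data \<Rightarrow> bool" where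
  "has_right_adjoint A B F \<longleftrightarrow> (\<exists>G. is_right_adjoint A B F G)"


section \<open>Serre subcategories and Serre quotients\<close>

definition short_exact :: "('o, 'm) cat \<Rightarrow> 'o \<Rightarrow> 'o \<Rightarrow> 'o \<Rightarrow> 'm \<Rightarrow> 'm \<Rightarrow> bool" where
  "short_exact A X Y Z f g \<longleftrightarrow> is_kernel A X Y Z f g \<and> is_cokernel A X Y Z f g"

text \<open>A full subcategory is given by its set of objects.\<close>

definition serre_subcategory :: "('o, 'm) cat \<Rightarrow> 'o set \<Rightarrow> bool" where
  "serre_subcategory A S \<longleftrightarrow> abelian_category A \<and> S \<subseteq> Obj A \<and>
     (\<exists>Z\<in>S. is_zero_object A Z) \<and>
     (\<forall>X Y Z f g. short_exact A X Y Z f g \<longrightarrow> (Y \<in> S \<longleftrightarrow> X \<in> S \<and> Z \<in> S))"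

text \<open>
  The Serre quotient is the localization of \<open>A\<close> at the class \<open>quot_inv A S\<close> of morphisms whose
  kernel and cokernel lie in \<open>S\<close>. A morphism \<open>X \<rightarrow> Y\<close> of the quotient is an equivalence class of
  roofs \<open>X \<leftarrow>s\<midarrow> X' \<midarrow>f\<rightarrow> Y\<close> with \<open>s\<close> in that class, representing \<open>f s\<inverse>\<close>. Operations on classes
  are given as the set of all roofs equivalent to the result for some choice of representatives.
\<close>

definition quot_inv :: "('o, 'm) cat \<Rightarrow> 'o set \<Rightarrow> 'o \<Rightarrow> 'o \<Rightarrow> 'm set" where
  "quot_inv A S X Y = {s \<in> mor A X Y.
     (\<exists>K\<in>S. \<exists>k. is_kernel A K X Y k s) \<and> (\<exists>L\<in>S. \<exists>c. is_cokernel A X Y L s c)}"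

definition roofs :: "('o, 'm) cat \<Rightarrow> 'o set \<Rightarrow> 'o \<Rightarrow> 'o \<Rightarrow> ('m \<times> 'm) set" where
  "roofs A S X Y = {(s, f). \<exists>X'. s \<in> quot_inv A S X' X \<and> f \<in> mor A X' Y}"

definition roof_rel :: "('o, 'm) cat \<Rightarrow> 'o set \<Rightarrow> 'o \<Rightarrow> 'o \<Rightarrow> (('m \<times> 'm) \<times> ('m \<times> 'm)) set" where
  "roof_rel A S X Y = {((s, f), (t, g)). \<exists>X1 X2 P u v.
     s \<in> quot_inv A S X1 X \<and> f \<in> mor A X1 Y \<and> t \<in> quot_inv A S X2 X \<and> g \<in> mor A X2 Y \<and>
     u \<in> mor A P X1 \<and> v \<in> mor A P X2 \<and>
     s \<cdot>\<^bsub>A\<^esub> u = t \<cdot>\<^bsub>A\<^esub> v \<and> s \<cdot>\<^bsub>A\<^esub> u \<in> quot_inv A S P X \<and> f \<cdot>\<^bsub>A\<^esub> u = g \<cdot>\<^bsub>A\<^esub> v}"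

definition roof_add :: "('o, 'm) cat \<Rightarrow> 'o set \<Rightarrow> 'o \<Rightarrow> 'o \<Rightarrow>
    ('m \<times> 'm) set \<Rightarrow> ('m \<times> 'm) set \<Rightarrow> ('m \<times> 'm) set" where
  "roof_add A S X Y a b = {r. \<exists>X' s f g. s \<in> quot_inv A S X' X \<and> f \<in> mor A X' Y \<and> g \<in> mor A X' Y \<and>
     (s, f) \<in> a \<and> (s, g) \<in> b \<and> ((s, f \<otimes>\<^bsub>Hom A X' Y\<^esub> g), r) \<in> roof_rel A S X Y}"

definition roof_comp :: "('o, 'm) cat \<Rightarrow> 'o set \<Rightarrow>
    ('m \<times> 'm) set \<Rightarrow> ('m \<times> 'm) set \<Rightarrow> ('m \<times> 'm) set" where
  "roof_comp A S b a = {r. \<exists>X Y Z X' Y' P s f t g t' f'.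
     s \<in> quot_inv A S X' X \<and> f \<in> mor A X' Y \<and> (s, f) \<in> a \<and>
     t \<in> quot_inv A S Y' Y \<and> g \<in> mor A Y' Z \<and> (t, g) \<in> b \<and>
     t' \<in> quot_inv A S P X' \<and> f' \<in> mor A P Y' \<and> f \<cdot>\<^bsub>A\<^esub> t' = t \<cdot>\<^bsub>A\<^esub> f' \<and>
     ((s \<cdot>\<^bsub>A\<^esub> t', g \<cdot>\<^bsub>A\<^esub> f'), r) \<in> roof_rel A S X Z}"

definition roof_of :: "('o, 'm) cat \<Rightarrow> 'o set \<Rightarrow> 'm \<Rightarrow> ('m \<times> 'm) set" where
  "roof_of A S f = {r. \<exists>X Y. f \<in> mor A X Y \<and> ((Idt A X, f), r) \<in> roof_rel A S X Y}"

definition serre_quotient :: "('o, 'm) cat \<Rightarrow> 'o set \<Rightarrow> ('o, ('m \<times> 'm) set) cat" where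
  "serre_quotient A S = \<lparr>
     Obj = Obj A,
     Hom = (\<lambda>X Y. \<lparr>carrier = roofs A S X Y // roof_rel A S X Y,
                   mult = roof_add A S X Y,
                   one = roof_of A S \<one>\<^bsub>Hom A X Y\<^esub>\<rparr>),
     Idt = (\<lambda>X. roof_of A S (Idt A X)),
     Comp = roof_comp A S\<rparr>"

definition quotient_functor :: "('o, 'm) cat \<Rightarrow> 'o set \<Rightarrow>
    ('o, 'm, 'o, ('m \<times> 'm) set) functor_data" where
  "quotient_functor A S = \<lparr>OMap = id, AMap = roof_of A S\<rparr>"

definition is_serre_quotient :: "('o, 'm) cat \<Rightarrow> 'o set \<Rightarrow> ('p, 'n) cat \<Rightarrow>
    ('o, 'm, 'p, 'n) functor_data \<Rightarrow> bool" where
  "is_serre_quotient A S B Q \<longleftrightarrow> serre_subcategory A S \<and>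
     additive_functor A (serre_quotient A S) (quotient_functor A S) \<and> additive_functor A B Q \<and>
     (\<exists>E. is_equivalence (serre_quotient A S) B E \<and>
          naturally_isomorphic A B (comp_functor E (quotient_functor A S)) Q)"

definition localization_sequence :: "('o, 'm) cat \<Rightarrow> 'o set \<Rightarrow> ('p, 'n) cat \<Rightarrow>
    ('o, 'm, 'p, 'n) functor_data \<Rightarrow> bool" where
  "localization_sequence A S B Q \<longleftrightarrow> is_serre_quotient A S B Q \<and>
     has_right_adjoint (full_subcategory A S) A id_functor \<and> has_right_adjoint A B Q"


section \<open>Extriangulated categories\<close>

text \<open>
  A bifunctor \<open>E : C\<^sup>o\<^sup>p \<times> C \<rightarrow> Ab\<close>: \<open>EGrp E X Z\<close> is \<open>E(X, Z)\<close>, and for \<open>x : X' \<rightarrow> X\<close> and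
  \<open>z : Z \<rightarrow> Z'\<close> the map \<open>E(x, z) : E(X, Z) \<rightarrow> E(X', Z')\<close> is \<open>EMap E x z\<close>.
\<close>

record ('o, 'm, 'e) bifunctor =
  EGrp :: "'o \<Rightarrow> 'o \<Rightarrow> 'e monoid"
  EMap :: "'m \<Rightarrow> 'm \<Rightarrow> 'e \<Rightarrow> 'e"

locale biadditive_functor =
  fixes C :: "('o, 'm) cat" (structure) and E :: "('o, 'm, 'e) bifunctor"
  assumes ext_group: "X \<in> Obj C \<Longrightarrow> Z \<in> Obj C \<Longrightarrow> comm_group (EGrp E X Z)"
    and ext_map: "x \<in> mor C X' X \<Longrightarrow> z \<in> mor C Z Z' \<Longrightarrow>
          EMap E x z \<in> hom (EGrp E X Z) (EGrp E X' Z')"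
    and ext_id: "X \<in> Obj C \<Longrightarrow> Z \<in> Obj C \<Longrightarrow> \<delta> \<in> carrier (EGrp E X Z) \<Longrightarrow>
          EMap E (Idt C X) (Idt C Z) \<delta> = \<delta>"
    and ext_comp: "x \<in> mor C X' X \<Longrightarrow> x' \<in> mor C X'' X' \<Longrightarrow> z \<in> mor C Z Z' \<Longrightarrow> z' \<in> mor C Z' Z'' \<Longrightarrow>
          \<delta> \<in> carrier (EGrp E X Z) \<Longrightarrow>
          EMap E (x \<cdot> x') (z' \<cdot> z) \<delta> = EMap E x' z' (EMap E x z \<delta>)"
    and ext_add_left: "x \<in> mor C X' X \<Longrightarrow> x' \<in> mor C X' X \<Longrightarrow> z \<in> mor C Z Z' \<Longrightarrow>
          \<delta> \<in> carrier (EGrp E X Z) \<Longrightarrow>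
          EMap E (x \<otimes>\<^bsub>Hom C X' X\<^esub> x') z \<delta> = EMap E x z \<delta> \<otimes>\<^bsub>EGrp E X' Z'\<^esub> EMap E x' z \<delta>"
    and ext_add_right: "x \<in> mor C X' X \<Longrightarrow> z \<in> mor C Z Z' \<Longrightarrow> z' \<in> mor C Z Z' \<Longrightarrow>
          \<delta> \<in> carrier (EGrp E X Z) \<Longrightarrow>
          EMap E x (z \<otimes>\<^bsub>Hom C Z Z'\<^esub> z') \<delta> = EMap E x z \<delta> \<otimes>\<^bsub>EGrp E X' Z'\<^esub> EMap E x z' \<delta>"

text \<open>\<open>push C E X z \<delta>\<close> is \<open>z\<^sub>* \<delta>\<close> and \<open>pull C E Z x \<delta>\<close> is \<open>x\<^sup>* \<delta>\<close>, for \<open>\<delta>\<close> in \<open>E(X, Z)\<close>.\<close>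

definition push :: "('o, 'm) cat \<Rightarrow> ('o, 'm, 'e) bifunctor \<Rightarrow> 'o \<Rightarrow> 'm \<Rightarrow> 'e \<Rightarrow> 'e" where
  "push C E X z \<delta> = EMap E (Idt C X) z \<delta>"

definition pull :: "('o, 'm) cat \<Rightarrow> ('o, 'm, 'e) bifunctor \<Rightarrow> 'o \<Rightarrow> 'm \<Rightarrow> 'e \<Rightarrow> 'e" where
  "pull C E Z x \<delta> = EMap E x (Idt C Z) \<delta>"

definition ext_morphism :: "('o, 'm) cat \<Rightarrow> ('o, 'm, 'e) bifunctor \<Rightarrow>
    'o \<Rightarrow> 'o \<Rightarrow> 'e \<Rightarrow> 'o \<Rightarrow> 'o \<Rightarrow> 'e \<Rightarrow> 'm \<Rightarrow> 'm \<Rightarrow> bool" where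
  "ext_morphism C E X Z \<delta> X' Z' \<delta>' z x \<longleftrightarrow>
     \<delta> \<in> carrier (EGrp E X Z) \<and> \<delta>' \<in> carrier (EGrp E X' Z') \<and>
     z \<in> mor C Z Z' \<and> x \<in> mor C X X' \<and> push C E X z \<delta> = pull C E Z' x \<delta>'"

definition sequences :: "('o, 'm) cat \<Rightarrow> 'o \<Rightarrow> 'o \<Rightarrow> ('m \<times> 'm) set" where
  "sequences C Z X = {(g, f). \<exists>Y. g \<in> mor C Z Y \<and> f \<in> mor C Y X}"

definition seq_equiv :: "('o, 'm) cat \<Rightarrow> 'o \<Rightarrow> 'o \<Rightarrow> (('m \<times> 'm) \<times> ('m \<times> 'm)) set" where
  "seq_equiv C Z X = {((g, f), (g', f')). \<exists>Y Y' y.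
     g \<in> mor C Z Y \<and> f \<in> mor C Y X \<and> g' \<in> mor C Z Y' \<and> f' \<in> mor C Y' X \<and>
     is_iso C Y Y' y \<and> y \<cdot>\<^bsub>C\<^esub> g = g' \<and> f' \<cdot>\<^bsub>C\<^esub> y = f}"

text \<open>\<open>s X Z \<delta>\<close> is the equivalence class \<open>\<ss>(\<delta>)\<close> for \<open>\<delta>\<close> in \<open>E(X, Z)\<close>.\<close>

type_synonym ('o, 'm, 'e) realization = "'o \<Rightarrow> 'o \<Rightarrow> 'e \<Rightarrow> ('m \<times> 'm) set"

definition realizes :: "('o, 'm) cat \<Rightarrow> ('o, 'm, 'e) bifunctor \<Rightarrow> ('o, 'm, 'e) realization \<Rightarrow>
    'o \<Rightarrow> 'o \<Rightarrow> 'o \<Rightarrow> 'm \<Rightarrow> 'm \<Rightarrow> 'e \<Rightarrow> bool" where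
  "realizes C E s Z Y X g f \<delta> \<longleftrightarrow>
     \<delta> \<in> carrier (EGrp E X Z) \<and> g \<in> mor C Z Y \<and> f \<in> mor C Y X \<and> (g, f) \<in> s X Z \<delta>"

definition conflation :: "('o, 'm) cat \<Rightarrow> ('o, 'm, 'e) bifunctor \<Rightarrow> ('o, 'm, 'e) realization \<Rightarrow>
    'o \<Rightarrow> 'o \<Rightarrow> 'o \<Rightarrow> 'm \<Rightarrow> 'm \<Rightarrow> bool" where
  "conflation C E s Z Y X g f \<longleftrightarrow> (\<exists>\<delta>. realizes C E s Z Y X g f \<delta>)"

definition is_realization ::
  "('o, 'm) cat \<Rightarrow> ('o, 'm, 'e) bifunctor \<Rightarrow> ('o, 'm, 'e) realization \<Rightarrow> bool" where
  "is_realization C E s \<longleftrightarrow>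
     (\<forall>X\<in>Obj C. \<forall>Z\<in>Obj C. \<forall>\<delta>\<in>carrier (EGrp E X Z). s X Z \<delta> \<in> sequences C Z X // seq_equiv C Z X) \<and>
     (\<forall>Z Y X g f \<delta> Z' Y' X' g' f' \<delta>' z x.
        realizes C E s Z Y X g f \<delta> \<and> realizes C E s Z' Y' X' g' f' \<delta>' \<and>
        ext_morphism C E X Z \<delta> X' Z' \<delta>' z x \<longrightarrow>
        (\<exists>y\<in>mor C Y Y'. y \<cdot>\<^bsub>C\<^esub> g = g' \<cdot>\<^bsub>C\<^esub> z \<and> f' \<cdot>\<^bsub>C\<^esub> y = x \<cdot>\<^bsub>C\<^esub> f))"

text \<open>
  In the second condition \<open>i\<^sub>Z, j\<^sub>Z, p\<^sub>Z, q\<^sub>Z\<close> are the structure maps of \<open>Z \<oplus> Z'\<close>, and similarly for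
  \<open>Y\<close> and \<open>X\<close>. The extension \<open>\<delta> \<oplus> \<delta>'\<close> is the element of \<open>E(X \<oplus> X', Z \<oplus> Z')\<close> corresponding to
  \<open>(\<delta>, 0, 0, \<delta>')\<close>, i.e.\ \<open>E(p\<^sub>X, i\<^sub>Z)(\<delta>) + E(q\<^sub>X, j\<^sub>Z)(\<delta>')\<close>.
\<close>

definition additive_realization ::
  "('o, 'm) cat \<Rightarrow> ('o, 'm, 'e) bifunctor \<Rightarrow> ('o, 'm, 'e) realization \<Rightarrow> bool" where
  "additive_realization C E s \<longleftrightarrow> is_realization C E s \<and>
     (\<forall>Z X Y i j p q. is_biproduct C Z X Y i j p q \<longrightarrow>
        realizes C E s Z Y X i q \<one>\<^bsub>EGrp E X Z\<^esub>) \<and>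
     (\<forall>Z Y X g f \<delta> Z' Y' X' g' f' \<delta>' ZZ i\<^sub>Z j\<^sub>Z p\<^sub>Z q\<^sub>Z YY i\<^sub>Y j\<^sub>Y p\<^sub>Y q\<^sub>Y XX i\<^sub>X j\<^sub>X p\<^sub>X q\<^sub>X.
        realizes C E s Z Y X g f \<delta> \<and> realizes C E s Z' Y' X' g' f' \<delta>' \<and>
        is_biproduct C Z Z' ZZ i\<^sub>Z j\<^sub>Z p\<^sub>Z q\<^sub>Z \<and> is_biproduct C Y Y' YY i\<^sub>Y j\<^sub>Y p\<^sub>Y q\<^sub>Y \<and>
        is_biproduct C X X' XX i\<^sub>X j\<^sub>X p\<^sub>X q\<^sub>X \<longrightarrow>
        realizes C E s ZZ YY XX
          ((i\<^sub>Y \<cdot>\<^bsub>C\<^esub> g \<cdot>\<^bsub>C\<^esub> p\<^sub>Z) \<otimes>\<^bsub>Hom C ZZ YY\<^esub> (j\<^sub>Y \<cdot>\<^bsub>C\<^esub> g' \<cdot>\<^bsub>C\<^esub> q\<^sub>Z))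
          ((i\<^sub>X \<cdot>\<^bsub>C\<^esub> f \<cdot>\<^bsub>C\<^esub> p\<^sub>Y) \<otimes>\<^bsub>Hom C YY XX\<^esub> (j\<^sub>X \<cdot>\<^bsub>C\<^esub> f' \<cdot>\<^bsub>C\<^esub> q\<^sub>Y))
          (EMap E p\<^sub>X i\<^sub>Z \<delta> \<otimes>\<^bsub>EGrp E XX ZZ\<^esub> EMap E q\<^sub>X j\<^sub>Z \<delta>'))"

definition ET3 ::
  "('o, 'm) cat \<Rightarrow> ('o, 'm, 'e) bifunctor \<Rightarrow> ('o, 'm, 'e) realization \<Rightarrow> bool" where
  "ET3 C E s \<longleftrightarrow> (\<forall>Z Y X g f \<delta> Z' Y' X' g' f' \<delta>' z y.
     realizes C E s Z Y X g f \<delta> \<and> realizes C E s Z' Y' X' g' f' \<delta>' \<and>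
     z \<in> mor C Z Z' \<and> y \<in> mor C Y Y' \<and> y \<cdot>\<^bsub>C\<^esub> g = g' \<cdot>\<^bsub>C\<^esub> z \<longrightarrow>
     (\<exists>x. x \<in> mor C X X' \<and> x \<cdot>\<^bsub>C\<^esub> f = f' \<cdot>\<^bsub>C\<^esub> y \<and> ext_morphism C E X Z \<delta> X' Z' \<delta>' z x))"

definition ET4 ::
  "('o, 'm) cat \<Rightarrow> ('o, 'm, 'e) bifunctor \<Rightarrow> ('o, 'm, 'e) realization \<Rightarrow> bool" where
  "ET4 C E s \<longleftrightarrow> (\<forall>Z Y X g f \<delta> B A b a \<delta>'.
     realizes C E s Z Y X g f \<delta> \<and> realizes C E s Y B A b a \<delta>' \<longrightarrow>
     (\<exists>W g' f' b' a' \<delta>''.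
        g' = b \<cdot>\<^bsub>C\<^esub> g \<and> f' \<in> mor C B W \<and> b' \<in> mor C X W \<and> a' \<in> mor C W A \<and>
        b' \<cdot>\<^bsub>C\<^esub> f = f' \<cdot>\<^bsub>C\<^esub> b \<and> a' \<cdot>\<^bsub>C\<^esub> f' = a \<and>
        realizes C E s Z B W g' f' \<delta>'' \<and>
        realizes C E s X W A b' a' (push C E A f \<delta>') \<and>
        pull C E Z b' \<delta>'' = \<delta> \<and> push C E W g \<delta>'' = pull C E Y a' \<delta>'))"

text \<open>The structure on the opposite category, used to state the dual axioms.\<close>

definition opposite_ext :: "('o, 'm, 'e) bifunctor \<Rightarrow> ('o, 'm, 'e) bifunctor" where
  "opposite_ext E = \<lparr>EGrp = (\<lambda>X Z. EGrp E Z X), EMap = (\<lambda>x z. EMap E z x)\<rparr>"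

definition opposite_real :: "('o, 'm, 'e) realization \<Rightarrow> ('o, 'm, 'e) realization" where
  "opposite_real s = (\<lambda>X Z \<delta>. {(f, g). (g, f) \<in> s Z X \<delta>})"

locale extriangulated_category = additive_category C + biadditive_functor C E
  for C :: "('o, 'm) cat" (structure) and E :: "('o, 'm, 'e) bifunctor" and
    s :: "('o, 'm, 'e) realization" +
  assumes additive_realization: "additive_realization C E s"
    and ET3: "ET3 C E s"
    and ET4: "ET4 C E s"
    and ET3_op: "ET3 (opposite C) (opposite_ext E) (opposite_real s)"
    and ET4_op: "ET4 (opposite C) (opposite_ext E) (opposite_real s)"


section \<open>Contravariant functors to abelian groups\<close>

record ('o, 'm, 'u) presheaf =
  Val :: "'o \<Rightarrow> 'u monoid"
  Act :: "'m \<Rightarrow> 'u \<Rightarrow> 'u"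

locale contravariant_functor =
  fixes C :: "('o, 'm) cat" (structure) and F :: "('o, 'm, 'u) presheaf"
  assumes val_group: "X \<in> Obj C \<Longrightarrow> comm_group (Val F X)"
    and act_hom: "a \<in> mor C X Y \<Longrightarrow> Act F a \<in> hom (Val F Y) (Val F X)"
    and act_id: "X \<in> Obj C \<Longrightarrow> u \<in> carrier (Val F X) \<Longrightarrow> Act F (Idt C X) u = u"
    and act_comp: "a \<in> mor C X Y \<Longrightarrow> b \<in> mor C Y Z \<Longrightarrow> u \<in> carrier (Val F Z) \<Longrightarrow>
          Act F (b \<cdot> a) u = Act F a (Act F b u)"
    and act_add: "a \<in> mor C X Y \<Longrightarrow> a' \<in> mor C X Y \<Longrightarrow> u \<in> carrier (Val F Y) \<Longrightarrow>
          Act F (a \<otimes>\<^bsub>Hom C X Y\<^esub> a') u = Act F a u \<otimes>\<^bsub>Val F X\<^esub> Act F a' u"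

text \<open>
  The two functors may take values in groups over different types, so that the representable
  functors, with values over the type of morphisms of \<open>C\<close>, can be related to the others.
\<close>

definition nat_trans :: "('o, 'm) cat \<Rightarrow> ('o, 'm, 'u) presheaf \<Rightarrow> ('o, 'm, 'v) presheaf \<Rightarrow>
    ('o \<Rightarrow> 'u \<Rightarrow> 'v) \<Rightarrow> bool" where
  "nat_trans C F G \<eta> \<longleftrightarrow> (\<forall>X\<in>Obj C. \<eta> X \<in> hom (Val F X) (Val G X)) \<and>
     (\<forall>X Y. \<forall>a\<in>mor C X Y. \<forall>u\<in>carrier (Val F Y). \<eta> X (Act F a u) = Act G a (\<eta> Y u))"

definition presheaf_isomorphic ::
  "('o, 'm) cat \<Rightarrow> ('o, 'm, 'u) presheaf \<Rightarrow> ('o, 'm, 'v) presheaf \<Rightarrow> bool" where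
  "presheaf_isomorphic C F G \<longleftrightarrow>
     (\<exists>\<eta>. nat_trans C F G \<eta> \<and> (\<forall>X\<in>Obj C. \<eta> X \<in> iso (Val F X) (Val G X)))"

definition representable :: "('o, 'm) cat \<Rightarrow> 'o \<Rightarrow> ('o, 'm, 'm) presheaf" where
  "representable C X = \<lparr>Val = (\<lambda>W. Hom C W X), Act = (\<lambda>a h. h \<cdot>\<^bsub>C\<^esub> a)\<rparr>"

definition cokernel_presheaf :: "('o, 'm) cat \<Rightarrow> ('o, 'm, 'u) presheaf \<Rightarrow> ('o, 'm, 'v) presheaf \<Rightarrow>
    ('o \<Rightarrow> 'u \<Rightarrow> 'v) \<Rightarrow> ('o, 'm, 'v set) presheaf" where
  "cokernel_presheaf C F G \<eta> = \<lparr>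
     Val = (\<lambda>X. Val G X Mod (\<eta> X ` carrier (Val F X))),
     Act = (\<lambda>a S. \<Union>{(\<eta> X ` carrier (Val F X)) #>\<^bsub>Val G X\<^esub> Act G a u |X Y u. a \<in> mor C X Y \<and> u \<in> S})\<rparr>"

definition finitely_presented :: "('o, 'm) cat \<Rightarrow> ('o, 'm, 'u) presheaf \<Rightarrow> bool" where
  "finitely_presented C F \<longleftrightarrow> contravariant_functor C F \<and>
     (\<exists>X1\<in>Obj C. \<exists>X0\<in>Obj C. \<exists>\<alpha> \<beta>.
        nat_trans C (representable C X1) (representable C X0) \<alpha> \<and>
        nat_trans C (representable C X0) F \<beta> \<and>
        (\<forall>W\<in>Obj C.
           \<alpha> W ` carrier (Hom C W X1) = kernel (Hom C W X0) (Val F W) (\<beta> W) \<and>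
           \<beta> W ` carrier (Hom C W X0) = carrier (Val F W)))"

text \<open>
  A morphism of functors is a natural transformation together with its source and target; it is
  normalized outside the objects of \<open>C\<close> and the carriers of the groups, so that equality of
  morphisms is equality of natural transformations.
\<close>

type_synonym ('o, 'm, 'u) presheaf_mor =
  "('o, 'm, 'u) presheaf \<times> ('o \<Rightarrow> 'u \<Rightarrow> 'u) \<times> ('o, 'm, 'u) presheaf"

definition normal_trans :: "('o, 'm) cat \<Rightarrow> ('o, 'm, 'u) presheaf \<Rightarrow>
    ('o \<Rightarrow> 'u \<Rightarrow> 'u) \<Rightarrow> ('o \<Rightarrow> 'u \<Rightarrow> 'u)" where
  "normal_trans C F \<eta> = (\<lambda>X\<in>Obj C. \<lambda>u\<in>carrier (Val F X). \<eta> X u)"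

definition presheaf_cat :: "'u itself \<Rightarrow> ('o, 'm) cat \<Rightarrow>
    (('o, 'm, 'u) presheaf, ('o, 'm, 'u) presheaf_mor) cat" where
  "presheaf_cat _ C = \<lparr>
     Obj = {F. contravariant_functor C F},
     Hom = (\<lambda>F G. \<lparr>
        carrier = {(F, \<eta>, G) |\<eta>. nat_trans C F G \<eta> \<and> \<eta> = normal_trans C F \<eta>},
        mult = (\<lambda>(_, \<eta>, _) (_, \<theta>, _).
          (F, normal_trans C F (\<lambda>X u. \<eta> X u \<otimes>\<^bsub>Val G X\<^esub> \<theta> X u), G)),
        one = (F, normal_trans C F (\<lambda>X u. \<one>\<^bsub>Val G X\<^esub>), G)\<rparr>),
     Idt = (\<lambda>F. (F, normal_trans C F (\<lambda>X u. u), F)),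
     Comp = (\<lambda>(_, \<theta>, H) (F, \<eta>, _). (F, normal_trans C F (\<lambda>X u. \<theta> X (\<eta> X u)), H))\<rparr>"

definition mod_cat :: "'u itself \<Rightarrow> ('o, 'm) cat \<Rightarrow>
    (('o, 'm, 'u) presheaf, ('o, 'm, 'u) presheaf_mor) cat" where
  "mod_cat U C = full_subcategory (presheaf_cat U C) {F. finitely_presented C F}"

definition def_objects :: "'u itself \<Rightarrow> ('o, 'm) cat \<Rightarrow> ('o, 'm, 'e) bifunctor \<Rightarrow>
    ('o, 'm, 'e) realization \<Rightarrow> ('o, 'm, 'u) presheaf set" where
  "def_objects U C E s = {F \<in> Obj (mod_cat U C). \<exists>Z Y X g f. conflation C E s Z Y X g f \<and>
     presheaf_isomorphic C F
       (cokernel_presheaf C (representable C Y) (representable C X) (\<lambda>W h. f \<cdot>\<^bsub>C\<^esub> h))}"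

definition lex_objects :: "'u itself \<Rightarrow> ('o, 'm) cat \<Rightarrow> ('o, 'm, 'e) bifunctor \<Rightarrow>
    ('o, 'm, 'e) realization \<Rightarrow> ('o, 'm, 'u) presheaf set" where
  "lex_objects U C E s = {F \<in> Obj (mod_cat U C). \<forall>Z Y X g f. conflation C E s Z Y X g f \<longrightarrow>
     kernel (Val F X) (Val F Y) (Act F f) = {\<one>\<^bsub>Val F X\<^esub>} \<and>
     Act F f ` carrier (Val F X) = kernel (Val F Y) (Val F Z) (Act F g)}"

definition lex_cat :: "'u itself \<Rightarrow> ('o, 'm) cat \<Rightarrow> ('o, 'm, 'e) bifunctor \<Rightarrow>
    ('o, 'm, 'e) realization \<Rightarrow> (('o, 'm, 'u) presheaf, ('o, 'm, 'u) presheaf_mor) cat" where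
  "lex_cat U C E s = full_subcategory (mod_cat U C) (lex_objects U C E s)"

definition has_weak_kernels :: "('o, 'm) cat \<Rightarrow> bool" where
  "has_weak_kernels C \<longleftrightarrow> (\<forall>X Y. \<forall>f\<in>mor C X Y. \<exists>W. \<exists>g\<in>mor C W X. \<forall>V\<in>Obj C.
     (\<lambda>h. g \<cdot>\<^bsub>C\<^esub> h) ` carrier (Hom C V W) = kernel (Hom C V X) (Hom C V Y) (\<lambda>h. f \<cdot>\<^bsub>C\<^esub> h))"

text \<open>
  The groups over the type \<open>'u\<close> play the role of \<open>Ab\<close>. The convention that the Hom-groups
  of \<open>C\<close> are objects of \<open>Ab\<close> becomes the condition that every Hom-set embeds into \<open>'u\<close>. It holds
  in particular for \<open>'u = 'm\<close>.
\<close>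

definition locally_small :: "'u itself \<Rightarrow> ('o, 'm) cat \<Rightarrow> bool" where
  "locally_small _ C \<longleftrightarrow>
     (\<forall>X\<in>Obj C. \<forall>Y\<in>Obj C. \<exists>\<iota> :: 'm \<Rightarrow> 'u. inj_on \<iota> (carrier (Hom C X Y)))"

end

theory Submission
  imports Defs
begin

text \<open>
  A finitely presented functor is a defect iff it is effaceable: each of its elements is killed by
  some deflation. Since deflations compose and can be pulled back, they behave like the coverings
  of a topology. Effaceable functors form a Serre subcategory, and the morphisms with effaceable
  kernel and cokernel are the local isomorphisms, i.e.\ the locally injective and locally surjective
  morphisms; they admit a calculus of right fractions.

  The objects \<open>L\<close> such that \<open>Hom(-, L)\<close> inverts all local isomorphisms are exactly the left exact
  functors. If the quotient functor has a right adjoint, its values are such objects and its unit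
  consists of local isomorphisms; hence left exact functors form a reflective subcategory equivalent
  to the quotient, and the kernel of the unit is the coreflection onto the effaceable functors.
\<close>

section \<open>Preadditive categories\<close>

text \<open>Arguments are made on elements, refining along deflations, so kernels and cokernels in
  \<open>mod_cat U C\<close> have to be pointwise. The obstacle is that representable functors take
  values over the type of morphisms and need not be objects of \<open>mod_cat U C\<close>. They are
  replaced by presentations: a generator \<open>x\<close> of \<open>F\<close> over \<open>X0\<close>
  with relations \<open>a\<close> from \<open>X1\<close> to \<open>X0\<close>, so that morphisms
  from \<open>F\<close> to \<open>G\<close> are the elements of \<open>G(X0)\<close> killed by
  \<open>a\<close>.

  Left exactness is the sheaf condition for single deflations. For a conflation Z -> Y -> X, the
  cokernel of C(-,Z) -> C(-,Y) embeds into C(-,X), with the defect as cokernel; mapping this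
  embedding into a closed L compares L(X) with the kernel of L(Y) -> L(Z). Conversely, a morphism
  into a left exact L extends along a local isomorphism, because its value at a local lift is killed
  by the inflation and so descends along the deflation.

  The unit of the adjunction is invertible a priori only in the quotient. That it is a local
  isomorphism is saturation, which rests on the fact that a morphism equal to zero in the quotient
  is zero after composition with a local isomorphism.\<close>

lemma full_mor [simp]:
  "T \<subseteq> Obj C \<Longrightarrow> f \<in> mor (full_subcategory C T) X Y \<longleftrightarrow> X \<in> T \<and> Y \<in> T \<and> f \<in> mor C X Y"
  by (auto simp: mor_def full_subcategory_def)

lemma full_simps [simp]:
  "Obj (full_subcategory C T) = T"
  "Hom (full_subcategory C T) = Hom C"
  "Idt (full_subcategory C T) = Idt C"
  "Comp (full_subcategory C T) = Comp C"
  by (simp_all add: full_subcategory_def)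

context preadditive_category
begin

text \<open>Disjointness of the Hom-sets makes source and target functions of the morphism. Typing
  side conditions then become equations that simplification solves, with no search for the objects
  in between.\<close>

definition arr :: "'m \<Rightarrow> bool" where
  "arr f \<longleftrightarrow> (\<exists>X Y. f \<in> mor C X Y)"

definition src :: "'m \<Rightarrow> 'o" where
  "src f = (THE X. \<exists>Y. f \<in> mor C X Y)"

definition tgt :: "'m \<Rightarrow> 'o" where
  "tgt f = (THE Y. \<exists>X. f \<in> mor C X Y)"

lemma mor_arr: "f \<in> mor C X Y \<Longrightarrow> arr f \<and> src f = X \<and> tgt f = Y"
  unfolding arr_def src_def tgt_def using hom_disjoint by blast

lemma mor_iff: "f \<in> mor C X Y \<longleftrightarrow> arr f \<and> src f = X \<and> tgt f = Y"
  using mor_arr unfolding arr_def by metis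

lemma mor_Obj: "f \<in> mor C X Y \<Longrightarrow> X \<in> Obj C" "f \<in> mor C X Y \<Longrightarrow> Y \<in> Obj C"
  by (auto simp: mor_def)

lemma src_Obj [simp]: "arr f \<Longrightarrow> src f \<in> Obj C"
  and tgt_Obj [simp]: "arr f \<Longrightarrow> tgt f \<in> Obj C"
  using mor_Obj mor_iff by blast+

lemma carrier_Hom_iff: "X \<in> Obj C \<Longrightarrow> Y \<in> Obj C \<Longrightarrow> f \<in> carrier (Hom C X Y) \<longleftrightarrow> f \<in> mor C X Y"
  by (simp add: mor_def)

lemma mor_carrier: "f \<in> mor C X Y \<Longrightarrow> f \<in> carrier (Hom C X Y)"
  by (simp add: mor_def)

lemma arr_comp [simp]:
  assumes "arr f" "arr g" "tgt f = src g"
  shows "arr (g \<cdot> f)" "src (g \<cdot> f) = src f" "tgt (g \<cdot> f) = tgt g"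
  using comp_mor[of f "src f" "tgt f" g "tgt g"] assms by (simp_all add: mor_iff)

lemma arr_Idt [simp]:
  assumes "X \<in> Obj C"
  shows "arr (Idt C X)" "src (Idt C X) = X" "tgt (Idt C X) = X"
  using id_mor[OF assms] by (simp_all add: mor_iff)

lemma comp_Idt [simp]:
  shows "arr f \<Longrightarrow> src f = X \<Longrightarrow> f \<cdot> Idt C X = f"
    and "arr f \<Longrightarrow> tgt f = X \<Longrightarrow> Idt C X \<cdot> f = f"
  by (auto intro: comp_id_right comp_id_left simp: mor_iff)

lemma assoc [simp]:
  "arr f \<Longrightarrow> arr g \<Longrightarrow> arr h \<Longrightarrow> tgt f = src g \<Longrightarrow> tgt g = src h \<Longrightarrow> (h \<cdot> g) \<cdot> f = h \<cdot> (g \<cdot> f)"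
  using comp_assoc by (simp add: mor_iff)

text \<open>Simplification brings composites into right-associated form, where an equation
  \<open>g \<cdot> f = k \<cdot> h\<close> no longer matches inside a longer chain. This form,
  instantiated at the equation, rewrites such chains; \<open>comp_eq_ext1\<close> is the variant
  with a single morphism on the right.\<close>

lemma comp_eq_ext:
  assumes "g \<cdot> f = k \<cdot> h" "arr g" "arr f" "tgt f = src g" "arr k" "arr h" "tgt h = src k"
    "arr x" "tgt x = src f" "tgt x = src h"
  shows "g \<cdot> (f \<cdot> x) = k \<cdot> (h \<cdot> x)"
  using assms assoc by metis

lemma comp_eq_ext1:
  assumes "g \<cdot> f = k" "arr g" "arr f" "tgt f = src g" "arr x" "tgt x = src f"
  shows "g \<cdot> (f \<cdot> x) = k \<cdot> x"
  using assms assoc by metis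

lemma Hom_group [simp]: "X \<in> Obj C \<Longrightarrow> Y \<in> Obj C \<Longrightarrow> group (Hom C X Y)"
  using hom_group by (simp add: comm_group_def)

lemma zero_arr [simp]:
  assumes "X \<in> Obj C" "Y \<in> Obj C"
  shows "arr \<one>\<^bsub>Hom C X Y\<^esub>" "src \<one>\<^bsub>Hom C X Y\<^esub> = X" "tgt \<one>\<^bsub>Hom C X Y\<^esub> = Y"
proof -
  have "\<one>\<^bsub>Hom C X Y\<^esub> \<in> mor C X Y"
    using assms by (simp add: mor_def group.is_monoid monoid.one_closed)
  then show "arr \<one>\<^bsub>Hom C X Y\<^esub>" "src \<one>\<^bsub>Hom C X Y\<^esub> = X" "tgt \<one>\<^bsub>Hom C X Y\<^esub> = Y"
    by (simp_all add: mor_iff)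
qed

lemma add_arr [simp]:
  assumes "arr f" "arr g" "src f = X" "src g = X" "tgt f = Y" "tgt g = Y"
  shows "arr (f \<otimes>\<^bsub>Hom C X Y\<^esub> g)" "src (f \<otimes>\<^bsub>Hom C X Y\<^esub> g) = X" "tgt (f \<otimes>\<^bsub>Hom C X Y\<^esub> g) = Y"
proof -
  have "f \<in> mor C X Y" "g \<in> mor C X Y" using assms by (simp_all add: mor_iff)
  then have "f \<otimes>\<^bsub>Hom C X Y\<^esub> g \<in> mor C X Y"
    by (simp add: mor_def group.is_monoid monoid.m_closed)
  then show "arr (f \<otimes>\<^bsub>Hom C X Y\<^esub> g)" "src (f \<otimes>\<^bsub>Hom C X Y\<^esub> g) = X" "tgt (f \<otimes>\<^bsub>Hom C X Y\<^esub> g) = Y"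
    by (simp_all add: mor_iff)
qed

lemma neg_arr [simp]:
  assumes "arr f" "src f = X" "tgt f = Y"
  shows "arr (inv\<^bsub>Hom C X Y\<^esub> f)" "src (inv\<^bsub>Hom C X Y\<^esub> f) = X" "tgt (inv\<^bsub>Hom C X Y\<^esub> f) = Y"
proof -
  have "f \<in> mor C X Y" using assms by (simp_all add: mor_iff)
  then have "inv\<^bsub>Hom C X Y\<^esub> f \<in> mor C X Y"
    by (simp add: mor_def group.inv_closed)
  then show "arr (inv\<^bsub>Hom C X Y\<^esub> f)" "src (inv\<^bsub>Hom C X Y\<^esub> f) = X" "tgt (inv\<^bsub>Hom C X Y\<^esub> f) = Y"
    by (simp_all add: mor_iff)
qed

lemma distrib [simp]:
  shows "arr f \<Longrightarrow> arr g \<Longrightarrow> arr g' \<Longrightarrow> tgt f = Y \<Longrightarrow> src g = Y \<Longrightarrow> src g' = Y \<Longrightarrow>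
      tgt g = Z \<Longrightarrow> tgt g' = Z \<Longrightarrow>
      (g \<otimes>\<^bsub>Hom C Y Z\<^esub> g') \<cdot> f = (g \<cdot> f) \<otimes>\<^bsub>Hom C (src f) Z\<^esub> (g' \<cdot> f)"
    and "arr f \<Longrightarrow> arr f' \<Longrightarrow> arr g \<Longrightarrow> src f = X \<Longrightarrow> src f' = X \<Longrightarrow> tgt f = Y \<Longrightarrow> tgt f' = Y \<Longrightarrow>
      src g = Y \<Longrightarrow> g \<cdot> (f \<otimes>\<^bsub>Hom C X Y\<^esub> f') = (g \<cdot> f) \<otimes>\<^bsub>Hom C X (tgt g)\<^esub> (g \<cdot> f')"
  by (rule comp_add_left comp_add_right; simp add: mor_iff)+

lemma add_simps:
  assumes "arr f" "src f = X" "tgt f = Y"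
  shows "\<one>\<^bsub>Hom C X Y\<^esub> \<otimes>\<^bsub>Hom C X Y\<^esub> f = f" "f \<otimes>\<^bsub>Hom C X Y\<^esub> \<one>\<^bsub>Hom C X Y\<^esub> = f"
    "inv\<^bsub>Hom C X Y\<^esub> f \<otimes>\<^bsub>Hom C X Y\<^esub> f = \<one>\<^bsub>Hom C X Y\<^esub>"
    "f \<otimes>\<^bsub>Hom C X Y\<^esub> inv\<^bsub>Hom C X Y\<^esub> f = \<one>\<^bsub>Hom C X Y\<^esub>"
proof -
  have f: "f \<in> mor C X Y" using assms by (simp add: mor_iff)
  then interpret group "Hom C X Y" by (simp add: mor_def)
  from f have "f \<in> carrier (Hom C X Y)" by (simp add: mor_def)
  then show "\<one>\<^bsub>Hom C X Y\<^esub> \<otimes>\<^bsub>Hom C X Y\<^esub> f = f" "f \<otimes>\<^bsub>Hom C X Y\<^esub> \<one>\<^bsub>Hom C X Y\<^esub> = f"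
    "inv\<^bsub>Hom C X Y\<^esub> f \<otimes>\<^bsub>Hom C X Y\<^esub> f = \<one>\<^bsub>Hom C X Y\<^esub>"
    "f \<otimes>\<^bsub>Hom C X Y\<^esub> inv\<^bsub>Hom C X Y\<^esub> f = \<one>\<^bsub>Hom C X Y\<^esub>" by simp_all
qed

lemma add_ac:
  assumes "f \<in> mor C X Y" "g \<in> mor C X Y"
  shows "f \<otimes>\<^bsub>Hom C X Y\<^esub> g = g \<otimes>\<^bsub>Hom C X Y\<^esub> f"
    and "h \<in> mor C X Y \<Longrightarrow>
      (f \<otimes>\<^bsub>Hom C X Y\<^esub> g) \<otimes>\<^bsub>Hom C X Y\<^esub> h = f \<otimes>\<^bsub>Hom C X Y\<^esub> (g \<otimes>\<^bsub>Hom C X Y\<^esub> h)"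
proof -
  interpret comm_group "Hom C X Y" using assms hom_group by (simp add: mor_def)
  show "f \<otimes>\<^bsub>Hom C X Y\<^esub> g = g \<otimes>\<^bsub>Hom C X Y\<^esub> f"
    using assms by (simp add: mor_def m_comm)
  show "(f \<otimes>\<^bsub>Hom C X Y\<^esub> g) \<otimes>\<^bsub>Hom C X Y\<^esub> h = f \<otimes>\<^bsub>Hom C X Y\<^esub> (g \<otimes>\<^bsub>Hom C X Y\<^esub> h)"
    if "h \<in> mor C X Y" using assms that by (simp add: mor_def m_assoc)
qed

lemma idem_zero:
  assumes "f \<in> mor C X Y" "f \<otimes>\<^bsub>Hom C X Y\<^esub> f = f"
  shows "f = \<one>\<^bsub>Hom C X Y\<^esub>"
proof -
  interpret group "Hom C X Y" using assms by (simp add: mor_def)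
  show ?thesis using assms by (simp add: mor_def)
qed

lemma comp_zero [simp]:
  shows "arr f \<Longrightarrow> src f = Y \<Longrightarrow> X \<in> Obj C \<Longrightarrow> f \<cdot> \<one>\<^bsub>Hom C X Y\<^esub> = \<one>\<^bsub>Hom C X (tgt f)\<^esub>"
    and "arr f \<Longrightarrow> tgt f = Y \<Longrightarrow> Z \<in> Obj C \<Longrightarrow> \<one>\<^bsub>Hom C Y Z\<^esub> \<cdot> f = \<one>\<^bsub>Hom C (src f) Z\<^esub>"
proof -
  assume *: "arr f" "src f = Y" "X \<in> Obj C"
  let ?z = "\<one>\<^bsub>Hom C X Y\<^esub>"
  have Y: "Y \<in> Obj C" using * by auto
  have "f \<cdot> ?z = f \<cdot> (?z \<otimes>\<^bsub>Hom C X Y\<^esub> ?z)" using * Y by (simp add: add_simps)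
  also have "\<dots> = (f \<cdot> ?z) \<otimes>\<^bsub>Hom C X (tgt f)\<^esub> (f \<cdot> ?z)" using * Y by simp
  finally show "f \<cdot> ?z = \<one>\<^bsub>Hom C X (tgt f)\<^esub>"
    using * Y by (intro idem_zero) (simp_all add: mor_iff)
next
  assume *: "arr f" "tgt f = Y" "Z \<in> Obj C"
  let ?z = "\<one>\<^bsub>Hom C Y Z\<^esub>"
  have Y: "Y \<in> Obj C" using * by auto
  have "?z \<cdot> f = (?z \<otimes>\<^bsub>Hom C Y Z\<^esub> ?z) \<cdot> f" using * Y by (simp add: add_simps)
  also have "\<dots> = (?z \<cdot> f) \<otimes>\<^bsub>Hom C (src f) Z\<^esub> (?z \<cdot> f)" using * Y by simp
  finally show "?z \<cdot> f = \<one>\<^bsub>Hom C (src f) Z\<^esub>"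
    using * Y by (intro idem_zero) (simp_all add: mor_iff)
qed

lemma add_eq_zero_neg:
  assumes "f \<in> mor C X Y" "g \<in> mor C X Y" "f \<otimes>\<^bsub>Hom C X Y\<^esub> g = \<one>\<^bsub>Hom C X Y\<^esub>"
  shows "g = inv\<^bsub>Hom C X Y\<^esub> f"
proof -
  interpret comm_group "Hom C X Y" using assms hom_group by (simp add: mor_def)
  show ?thesis using assms inv_equality[of g f] m_comm[of f g] by (simp add: mor_def)
qed

lemma comp_neg [simp]:
  shows "arr f \<Longrightarrow> arr g \<Longrightarrow> src f = X \<Longrightarrow> tgt f = Y \<Longrightarrow> src g = Y \<Longrightarrow>
      g \<cdot> (inv\<^bsub>Hom C X Y\<^esub> f) = inv\<^bsub>Hom C X (tgt g)\<^esub> (g \<cdot> f)"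
    and "arr f \<Longrightarrow> arr g \<Longrightarrow> tgt f = Y \<Longrightarrow> src g = Y \<Longrightarrow> tgt g = Z \<Longrightarrow>
      (inv\<^bsub>Hom C Y Z\<^esub> g) \<cdot> f = inv\<^bsub>Hom C (src f) Z\<^esub> (g \<cdot> f)"
proof -
  assume *: "arr f" "arr g" "src f = X" "tgt f = Y" "src g = Y"
  let ?n = "inv\<^bsub>Hom C X Y\<^esub> f"
  have O: "X \<in> Obj C" "Y \<in> Obj C" using * by auto
  have "(g \<cdot> f) \<otimes>\<^bsub>Hom C X (tgt g)\<^esub> (g \<cdot> ?n) = g \<cdot> (f \<otimes>\<^bsub>Hom C X Y\<^esub> ?n)"
    using * by simp
  also have "\<dots> = \<one>\<^bsub>Hom C X (tgt g)\<^esub>" using * O by (simp add: add_simps)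
  finally show "g \<cdot> ?n = inv\<^bsub>Hom C X (tgt g)\<^esub> (g \<cdot> f)"
    using * by (intro add_eq_zero_neg) (simp_all add: mor_iff)
next
  assume *: "arr f" "arr g" "tgt f = Y" "src g = Y" "tgt g = Z"
  let ?n = "inv\<^bsub>Hom C Y Z\<^esub> g"
  have O: "Z \<in> Obj C" "Y \<in> Obj C" using * by auto
  have "(g \<cdot> f) \<otimes>\<^bsub>Hom C (src f) Z\<^esub> (?n \<cdot> f) = (g \<otimes>\<^bsub>Hom C Y Z\<^esub> ?n) \<cdot> f"
    using * by simp
  also have "\<dots> = \<one>\<^bsub>Hom C (src f) Z\<^esub>" using * O by (simp add: add_simps)
  finally show "?n \<cdot> f = inv\<^bsub>Hom C (src f) Z\<^esub> (g \<cdot> f)"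
    using * by (intro add_eq_zero_neg) (simp_all add: mor_iff)
qed

lemma diff_zero_iff:
  assumes "f \<in> mor C X Y" "g \<in> mor C X Y"
  shows "f \<otimes>\<^bsub>Hom C X Y\<^esub> inv\<^bsub>Hom C X Y\<^esub> g = \<one>\<^bsub>Hom C X Y\<^esub> \<longleftrightarrow> f = g"
proof -
  interpret comm_group "Hom C X Y" using assms hom_group by (simp add: mor_def)
  show ?thesis using assms inv_equality[of f "inv\<^bsub>Hom C X Y\<^esub> g"] by (auto simp: mor_def)
qed

text \<open>If the identity of \<open>Z\<close> is zero, composing with it shows that every morphism
  from or to \<open>Z\<close> is zero. The equational form passes at once to the quotient, where
  identities and zero morphisms are the images of those of the given category.\<close>

lemma zero_object_iff:
  "is_zero_object C Z \<longleftrightarrow> Z \<in> Obj C \<and> Idt C Z = \<one>\<^bsub>Hom C Z Z\<^esub>"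
proof
  assume *: "is_zero_object C Z"
  then have Z: "Z \<in> Obj C" "\<exists>!f. f \<in> mor C Z Z" unfolding is_zero_object_def by auto
  moreover have "Idt C Z \<in> mor C Z Z" "\<one>\<^bsub>Hom C Z Z\<^esub> \<in> mor C Z Z"
    using Z by (simp_all add: mor_iff)
  ultimately show "Z \<in> Obj C \<and> Idt C Z = \<one>\<^bsub>Hom C Z Z\<^esub>" by blast
next
  assume Z: "Z \<in> Obj C \<and> Idt C Z = \<one>\<^bsub>Hom C Z Z\<^esub>"
  have "f = \<one>\<^bsub>Hom C X Z\<^esub>" if "f \<in> mor C X Z" for f X
  proof -
    have "f = Idt C Z \<cdot> f" using that by (simp add: mor_iff)
    also have "\<dots> = \<one>\<^bsub>Hom C X Z\<^esub>" using that Z by (simp add: mor_iff)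
    finally show ?thesis .
  qed
  moreover have "f = \<one>\<^bsub>Hom C Z X\<^esub>" if "f \<in> mor C Z X" for f X
  proof -
    have "f = f \<cdot> Idt C Z" using that by (simp add: mor_iff)
    also have "\<dots> = \<one>\<^bsub>Hom C Z X\<^esub>" using that Z by (simp add: mor_iff)
    finally show ?thesis .
  qed
  moreover have "\<one>\<^bsub>Hom C X Z\<^esub> \<in> mor C X Z" "\<one>\<^bsub>Hom C Z X\<^esub> \<in> mor C Z X" if "X \<in> Obj C" for X
    using Z that by (simp_all add: mor_iff)
  ultimately show "is_zero_object C Z" unfolding is_zero_object_def using Z by blast
qed

lemma zero_object_mor:
  assumes "is_zero_object C Z"
  shows "f \<in> mor C X Z \<Longrightarrow> f = \<one>\<^bsub>Hom C X Z\<^esub>" "f \<in> mor C Z X \<Longrightarrow> f = \<one>\<^bsub>Hom C Z X\<^esub>"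
proof -
  have Z: "Z \<in> Obj C" using assms zero_object_iff by simp
  show "f = \<one>\<^bsub>Hom C X Z\<^esub>" if "f \<in> mor C X Z"
  proof -
    have "\<one>\<^bsub>Hom C X Z\<^esub> \<in> mor C X Z" using that Z by (auto simp: mor_iff)
    with that show ?thesis using assms mor_Obj unfolding is_zero_object_def by blast
  qed
  show "f = \<one>\<^bsub>Hom C Z X\<^esub>" if "f \<in> mor C Z X"
  proof -
    have "\<one>\<^bsub>Hom C Z X\<^esub> \<in> mor C Z X" using that Z by (auto simp: mor_iff)
    with that show ?thesis using assms mor_Obj unfolding is_zero_object_def by blast
  qed
qed

lemma preadditive_full:
  assumes "T \<subseteq> Obj C"
  shows "preadditive_category (full_subcategory C T)"
proof -
  show ?thesis
    using assms
    by (intro preadditive_category.intro) (auto simp: mor_iff subset_iff intro: hom_group)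
qed

end

lemma (in additive_category) additive_full:
  assumes T: "T \<subseteq> Obj C" and zero: "is_zero_object C Z" "Z \<in> T"
    and bi: "\<And>X Y P i j p q. X \<in> T \<Longrightarrow> Y \<in> T \<Longrightarrow> is_biproduct C X Y P i j p q \<Longrightarrow> P \<in> T"
  shows "additive_category (full_subcategory C T)"
proof -
  interpret T: preadditive_category "full_subcategory C T" by (rule preadditive_full[OF T])
  show ?thesis
  proof
    show "\<exists>Z. is_zero_object (full_subcategory C T) Z"
      using zero T unfolding is_zero_object_def by (intro exI[of _ Z]) (auto simp: subset_iff)
    show "\<exists>P i j p q. is_biproduct (full_subcategory C T) X Y P i j p q"
      if "X \<in> Obj (full_subcategory C T)" "Y \<in> Obj (full_subcategory C T)" for X Y
    proof -
      have "X \<in> Obj C" "Y \<in> Obj C" using that T by auto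
      then obtain P i j p q where *: "is_biproduct C X Y P i j p q"
        using has_biproducts by blast
      then have "P \<in> T" using bi that unfolding full_simps by blast
      then have "is_biproduct (full_subcategory C T) X Y P i j p q"
        using * that unfolding is_biproduct_def full_simps full_mor[OF T] by blast
      then show ?thesis by blast
    qed
  qed
qed

section \<open>Calculus of right fractions\<close>

text \<open>The axioms of a calculus of right fractions for the class \<open>quot_inv A S\<close>.
  They are assumed here and verified for effaceable functors at the end, by arguments on elements;
  the category of roofs is built from them and from additivity.\<close>

locale right_fractions = additive_category A for A :: "('o, 'm) cat" (structure) +
  fixes S :: "'o set"
  assumes W_id: "X \<in> Obj A \<Longrightarrow> Idt A X \<in> quot_inv A S X X"
    and W_comp: "s \<in> quot_inv A S X Y \<Longrightarrow> t \<in> quot_inv A S Y Z \<Longrightarrow> t \<cdot> s \<in> quot_inv A S X Z"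
    and W_ore: "s \<in> quot_inv A S X' X \<Longrightarrow> f \<in> mor A Y X \<Longrightarrow>
          \<exists>P. \<exists>s'\<in>quot_inv A S P Y. \<exists>f'\<in>mor A P X'. s \<cdot> f' = f \<cdot> s'"
    and W_cancel: "s \<in> quot_inv A S Y Z \<Longrightarrow> f \<in> mor A X Y \<Longrightarrow> g \<in> mor A X Y \<Longrightarrow>
          s \<cdot> f = s \<cdot> g \<Longrightarrow> \<exists>P. \<exists>t\<in>quot_inv A S P X. f \<cdot> t = g \<cdot> t"
begin

abbreviation W :: "'o \<Rightarrow> 'o \<Rightarrow> 'm set" where
  "W \<equiv> quot_inv A S"

abbreviation roof_class :: "'o \<Rightarrow> 'o \<Rightarrow> 'm \<Rightarrow> 'm \<Rightarrow> ('m \<times> 'm) set" where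
  "roof_class X Y s f \<equiv> roof_rel A S X Y `` {(s, f)}"

abbreviation B :: "('o, ('m \<times> 'm) set) cat" where
  "B \<equiv> serre_quotient A S"

abbreviation Q :: "('o, 'm, 'o, ('m \<times> 'm) set) functor_data" where
  "Q \<equiv> quotient_functor A S"

lemma W_mor: "s \<in> W X Y \<Longrightarrow> s \<in> mor A X Y"
  by (simp add: quot_inv_def)

lemma W_arr: "s \<in> W X Y \<Longrightarrow> arr s \<and> src s = X \<and> tgt s = Y"
  using W_mor mor_iff by blast

section \<open>Equivalence of roofs\<close>

lemma roof_relI:
  assumes "s \<in> W X1 X" "f \<in> mor A X1 Y" "t \<in> W X2 X" "g \<in> mor A X2 Y"
    "u \<in> mor A P X1" "v \<in> mor A P X2" "s \<cdot> u = t \<cdot> v" "s \<cdot> u \<in> W P X" "f \<cdot> u = g \<cdot> v"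
  shows "((s, f), (t, g)) \<in> roof_rel A S X Y"
  unfolding roof_rel_def using assms by blast

lemma roof_relE:
  assumes "((s, f), (t, g)) \<in> roof_rel A S X Y"
  obtains X1 X2 P u v where "s \<in> W X1 X" "f \<in> mor A X1 Y" "t \<in> W X2 X" "g \<in> mor A X2 Y"
    "u \<in> mor A P X1" "v \<in> mor A P X2" "s \<cdot> u = t \<cdot> v" "s \<cdot> u \<in> W P X" "f \<cdot> u = g \<cdot> v"
  using assms unfolding roof_rel_def by blast

lemma common_refinement:
  assumes "s \<in> W X1 X" "t \<in> W X2 X"
  obtains P u v where "u \<in> mor A P X1" "v \<in> W P X2" "s \<cdot> u = t \<cdot> v" "s \<cdot> u \<in> W P X"
  using W_ore[OF assms(1) W_mor[OF assms(2)]] W_comp assms(2) by metis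

text \<open>One refinement can witness two equivalences at once. The two given witnesses are
  dominated by an Ore square; the resulting maps to \<open>X1\<close> agree after composition with
  \<open>s\<close>, hence after refining by some \<open>w\<close>, and those to \<open>X2\<close>
  agree after a further \<open>w'\<close>. This makes addition of roofs well defined.\<close>

lemma roof_rel_common:
  assumes "((s, f), (t, f')) \<in> roof_rel A S X Y" "((s, g), (t, g')) \<in> roof_rel A S X Z"
  obtains X1 X2 P u v where "s \<in> W X1 X" "f \<in> mor A X1 Y" "t \<in> W X2 X" "f' \<in> mor A X2 Y"
    "g \<in> mor A X1 Z" "g' \<in> mor A X2 Z"
    "u \<in> mor A P X1" "v \<in> mor A P X2" "s \<cdot> u = t \<cdot> v" "s \<cdot> u \<in> W P X" "f \<cdot> u = f' \<cdot> v"
    "g \<cdot> u = g' \<cdot> v"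
proof -
  from assms(1) obtain X1 X2 P u v where 1: "s \<in> W X1 X" "f \<in> mor A X1 Y" "t \<in> W X2 X"
    "f' \<in> mor A X2 Y" "u \<in> mor A P X1" "v \<in> mor A P X2" "s \<cdot> u = t \<cdot> v" "s \<cdot> u \<in> W P X"
    "f \<cdot> u = f' \<cdot> v" by (rule roof_relE)
  from assms(2) obtain X1' X2' P' u' v' where 2: "s \<in> W X1' X" "g \<in> mor A X1' Z" "t \<in> W X2' X"
    "g' \<in> mor A X2' Z" "u' \<in> mor A P' X1'" "v' \<in> mor A P' X2'" "s \<cdot> u' = t \<cdot> v'"
    "s \<cdot> u' \<in> W P' X" "g \<cdot> u' = g' \<cdot> v'" by (rule roof_relE)
  have eq: "X1' = X1" "X2' = X2" using 1 2 W_mor hom_disjoint by blast+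
  note [simp] = 1(1,3)[THEN W_arr] 1(2,4,5,6)[THEN mor_arr] 2(2,4,5,6)[THEN mor_arr] eq
  obtain R p p' where p: "p \<in> W R P" "p' \<in> mor A R P'" "(s \<cdot> u') \<cdot> p' = (s \<cdot> u) \<cdot> p"
    using W_ore[OF 2(8) W_mor[OF 1(8)]] by blast
  note [simp] = p(1)[THEN W_arr] p(2)[THEN mor_arr]
  have e: "s \<cdot> u' \<cdot> p' = s \<cdot> u \<cdot> p" using p(3) by simp
  obtain R1 w where w: "w \<in> W R1 R" "(u \<cdot> p) \<cdot> w = (u' \<cdot> p') \<cdot> w"
    using W_cancel[OF 1(1), of "u \<cdot> p" R "u' \<cdot> p'"] e by (auto simp: mor_iff)
  note [simp] = w(1)[THEN W_arr]
  have "t \<cdot> v \<cdot> p = s \<cdot> u \<cdot> p" "t \<cdot> v' \<cdot> p' = s \<cdot> u' \<cdot> p'"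
    by (simp_all add: 1(7)[THEN comp_eq_ext] 2(7)[THEN comp_eq_ext])
  then have "t \<cdot> v \<cdot> p = t \<cdot> v' \<cdot> p'" using e by simp
  then have "t \<cdot> v \<cdot> p \<cdot> w = t \<cdot> v' \<cdot> p' \<cdot> w"
    using comp_eq_ext[of t "v \<cdot> p" t "v' \<cdot> p'" w] by simp
  then obtain R2 w' where w': "w' \<in> W R2 R1" "(v \<cdot> p \<cdot> w) \<cdot> w' = (v' \<cdot> p' \<cdot> w) \<cdot> w'"
    using W_cancel[OF 1(3), of "v \<cdot> p \<cdot> w" R1 "v' \<cdot> p' \<cdot> w"] by (auto simp: mor_iff)
  note [simp] = w'(1)[THEN W_arr]
  let ?a = "u \<cdot> p \<cdot> w \<cdot> w'" and ?b = "v \<cdot> p \<cdot> w \<cdot> w'"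
  have a': "?a = u' \<cdot> p' \<cdot> w \<cdot> w'" using w(2)[THEN comp_eq_ext1, of w'] by simp
  have b': "?b = v' \<cdot> p' \<cdot> w \<cdot> w'" using w'(2) by simp
  have "(s \<cdot> u) \<cdot> p \<cdot> w \<cdot> w' \<in> W R2 X"
    using W_comp 1(8) p(1) w(1) w'(1) by blast
  then have W: "s \<cdot> ?a \<in> W R2 X" by simp
  show ?thesis
  proof (rule that[where u = ?a and v = ?b and P = R2, OF 1(1-4)])
    show "s \<cdot> ?a = t \<cdot> ?b" by (simp add: 1(7)[THEN comp_eq_ext])
    show "f \<cdot> ?a = f' \<cdot> ?b" by (simp add: 1(9)[THEN comp_eq_ext])
    show "g \<cdot> ?a = g' \<cdot> ?b" unfolding a' b' by (simp add: 2(9)[THEN comp_eq_ext])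
  qed (use W 2 in \<open>simp_all add: mor_iff\<close>)
qed

lemma roof_rel_refl:
  assumes "s \<in> W X1 X" "f \<in> mor A X1 Y"
  shows "((s, f), (s, f)) \<in> roof_rel A S X Y"
proof -
  note [simp] = assms(1)[THEN W_arr] assms(2)[THEN mor_arr]
  have "X1 \<in> Obj A" using assms mor_Obj by blast
  then show ?thesis
    by (intro roof_relI[OF assms assms, of "Idt A X1" X1 "Idt A X1"]) (use assms in \<open>simp_all add: mor_iff\<close>)
qed

lemma roof_rel_sym:
  assumes "(r, r') \<in> roof_rel A S X Y"
  shows "(r', r) \<in> roof_rel A S X Y"
proof -
  obtain s f t g where r: "r = (s, f)" "r' = (t, g)" by (cases r, cases r')
  from assms[unfolded r] obtain X1 X2 P u v where 1: "s \<in> W X1 X" "f \<in> mor A X1 Y" "t \<in> W X2 X"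
    "g \<in> mor A X2 Y" "u \<in> mor A P X1" "v \<in> mor A P X2" "s \<cdot> u = t \<cdot> v" "s \<cdot> u \<in> W P X"
    "f \<cdot> u = g \<cdot> v" by (rule roof_relE)
  show ?thesis unfolding r by (rule roof_relI[OF 1(3,4,1,2,6,5)]) (use 1 in simp_all)
qed

text \<open>The two witnesses overlap in the middle roof: after an Ore square their maps to
  \<open>X2\<close> agree once composed with \<open>t\<close>, and cancellation makes them equal
  after refining by \<open>w\<close>.\<close>

lemma roof_rel_trans:
  assumes "((s, f), (t, g)) \<in> roof_rel A S X Y" "((t, g), (r, h)) \<in> roof_rel A S X Y"
  shows "((s, f), (r, h)) \<in> roof_rel A S X Y"
proof -
  from assms(1) obtain X1 X2 P u v where 1: "s \<in> W X1 X" "f \<in> mor A X1 Y" "t \<in> W X2 X"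
    "g \<in> mor A X2 Y" "u \<in> mor A P X1" "v \<in> mor A P X2" "s \<cdot> u = t \<cdot> v" "s \<cdot> u \<in> W P X"
    "f \<cdot> u = g \<cdot> v" by (rule roof_relE)
  from assms(2) obtain X2' X3 P' u' v' where 2: "t \<in> W X2' X" "g \<in> mor A X2' Y" "r \<in> W X3 X"
    "h \<in> mor A X3 Y" "u' \<in> mor A P' X2'" "v' \<in> mor A P' X3" "t \<cdot> u' = r \<cdot> v'"
    "t \<cdot> u' \<in> W P' X" "g \<cdot> u' = h \<cdot> v'" by (rule roof_relE)
  have eq: "X2' = X2" using 1 2 W_mor hom_disjoint by blast+
  note [simp] = 1(1,3)[THEN W_arr] 1(2,4,5,6)[THEN mor_arr] 2(3)[THEN W_arr]
    2(2,4,5,6)[THEN mor_arr] eq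
  obtain R p p' where p: "p \<in> W R P" "p' \<in> mor A R P'" "(t \<cdot> u') \<cdot> p' = (s \<cdot> u) \<cdot> p"
    using W_ore[OF 2(8) W_mor[OF 1(8)]] by blast
  note [simp] = p(1)[THEN W_arr] p(2)[THEN mor_arr]
  have "t \<cdot> v \<cdot> p = t \<cdot> u' \<cdot> p'" using p(3) 1(7)[THEN comp_eq_ext, of p] by simp
  then obtain R1 w where w: "w \<in> W R1 R" "(v \<cdot> p) \<cdot> w = (u' \<cdot> p') \<cdot> w"
    using W_cancel[OF 1(3), of "v \<cdot> p" R "u' \<cdot> p'"] by (auto simp: mor_iff)
  note [simp] = w(1)[THEN W_arr]
  have w2: "v \<cdot> p \<cdot> w = u' \<cdot> p' \<cdot> w" using w(2) by simp
  have "(s \<cdot> u) \<cdot> p \<cdot> w \<in> W R1 X" using W_comp 1(8) p(1) w(1) by blast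
  then have W: "s \<cdot> u \<cdot> p \<cdot> w \<in> W R1 X" by simp
  show ?thesis
  proof (rule roof_relI[OF 1(1,2) 2(3,4), of "u \<cdot> p \<cdot> w" R1 "v' \<cdot> p' \<cdot> w"])
    show "s \<cdot> u \<cdot> p \<cdot> w = r \<cdot> v' \<cdot> p' \<cdot> w"
      by (simp add: 1(7)[THEN comp_eq_ext] w2 2(7)[THEN comp_eq_ext])
    show "f \<cdot> u \<cdot> p \<cdot> w = h \<cdot> v' \<cdot> p' \<cdot> w"
      by (simp add: 1(9)[THEN comp_eq_ext] w2 2(9)[THEN comp_eq_ext])
  qed (use W in \<open>simp_all add: mor_iff\<close>)
qed

lemma roofs_iff: "(s, f) \<in> roofs A S X Y \<longleftrightarrow> (\<exists>X1. s \<in> W X1 X \<and> f \<in> mor A X1 Y)"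
  by (auto simp: roofs_def)

lemma equiv_roofs: "equiv (roofs A S X Y) (roof_rel A S X Y)"
proof (rule equivI)
  show "roof_rel A S X Y \<subseteq> roofs A S X Y \<times> roofs A S X Y"
    by (auto simp: roof_rel_def roofs_def)
  show "refl_on (roofs A S X Y) (roof_rel A S X Y)"
    unfolding refl_on_def using roof_rel_refl by (auto simp: roofs_iff)
  show "sym (roof_rel A S X Y)" unfolding sym_def using roof_rel_sym by blast
  show "trans (roof_rel A S X Y)" unfolding trans_def using roof_rel_trans by (metis surj_pair)
qed

lemma roof_class_eq_iff:
  assumes "s \<in> W X1 X" "f \<in> mor A X1 Y" "t \<in> W X2 X" "g \<in> mor A X2 Y"
  shows "roof_class X Y s f = roof_class X Y t g \<longleftrightarrow> ((s, f), (t, g)) \<in> roof_rel A S X Y"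
  by (rule eq_equiv_class_iff[OF equiv_roofs]) (use assms in \<open>auto simp: roofs_iff\<close>)

lemma roof_class_eq:
  "((s, f), (t, g)) \<in> roof_rel A S X Y \<Longrightarrow> roof_class X Y s f = roof_class X Y t g"
  by (rule equiv_class_eq[OF equiv_roofs])

lemma mor_B_iff:
  "a \<in> mor B X Y \<longleftrightarrow> X \<in> Obj A \<and> Y \<in> Obj A \<and> (\<exists>X1 s f. s \<in> W X1 X \<and> f \<in> mor A X1 Y \<and> a = roof_class X Y s f)"
proof -
  have "carrier (Hom B X Y) = roofs A S X Y // roof_rel A S X Y" "Obj B = Obj A"
    by (simp_all add: serre_quotient_def)
  then show ?thesis unfolding mor_def[of B] by (simp add: quotient_def Bex_def roofs_iff split_paired_Ex) blast
qed

lemma roof_class_mor [intro]: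
  assumes "s \<in> W X1 X" "f \<in> mor A X1 Y"
  shows "roof_class X Y s f \<in> mor B X Y"
  unfolding mor_B_iff
  using assms mor_Obj(2)[OF W_mor[OF assms(1)]] mor_Obj(2)[OF assms(2)] by blast

text \<open>Only the composite denominator has to lie in \<open>W\<close>, not \<open>w\<close>
  itself. Refinements arise in this form from \<open>common_refinement\<close>, where
  \<open>u\<close> is an arbitrary morphism.\<close>

lemma roof_class_refine:
  assumes "s \<in> W X1 X" "f \<in> mor A X1 Y" "w \<in> mor A P X1" "s \<cdot> w \<in> W P X"
  shows "roof_class X Y s f = roof_class X Y (s \<cdot> w) (f \<cdot> w)"
proof (rule roof_class_eq)
  note [simp] = assms(1)[THEN W_arr] assms(2,3)[THEN mor_arr]
  have "P \<in> Obj A" using assms mor_Obj by blast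
  then show "((s, f), (s \<cdot> w, f \<cdot> w)) \<in> roof_rel A S X Y"
    by (intro roof_relI[OF assms(1,2,4) _ assms(3), of _ "Idt A P"])
      (use assms in \<open>simp_all add: mor_iff\<close>)
qed

lemma roof_class_common:
  assumes "a \<in> mor B X Y" "b \<in> mor B X Z"
  obtains P s f g where "s \<in> W P X" "f \<in> mor A P Y" "g \<in> mor A P Z"
    "a = roof_class X Y s f" "b = roof_class X Z s g"
proof -
  from assms obtain X1 s f X2 t g where *: "s \<in> W X1 X" "f \<in> mor A X1 Y" "a = roof_class X Y s f"
    "t \<in> W X2 X" "g \<in> mor A X2 Z" "b = roof_class X Z t g" unfolding mor_B_iff by blast
  obtain P u v where "u \<in> mor A P X1" "v \<in> W P X2" "s \<cdot> u = t \<cdot> v" "s \<cdot> u \<in> W P X"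
    using common_refinement[OF *(1,4)] .
  note uv = this
  note [simp] = *(1,4)[THEN W_arr] *(2,5)[THEN mor_arr] uv(1)[THEN mor_arr] uv(2)[THEN W_arr]
  show ?thesis
  proof (rule that[OF uv(4), of "f \<cdot> u" "g \<cdot> v"])
    show "a = roof_class X Y (s \<cdot> u) (f \<cdot> u)"
      unfolding *(3) by (rule roof_class_refine[OF *(1,2) uv(1,4)])
    show "b = roof_class X Z (s \<cdot> u) (g \<cdot> v)"
      unfolding *(6) uv(3) by (rule roof_class_refine[OF *(4,5)]) (use uv W_mor in auto)
  qed (simp_all add: mor_iff)
qed

text \<open>\<open>roof_add\<close> collects the results of all choices of representatives with a
  common denominator. That these form a single class is \<open>roof_rel_common\<close>: one
  refinement identifies both pairs of numerators, hence their sums.\<close>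

lemma roof_add_class:
  assumes "s \<in> W X1 X" "f \<in> mor A X1 Y" "g \<in> mor A X1 Y"
  shows "roof_add A S X Y (roof_class X Y s f) (roof_class X Y s g) =
    roof_class X Y s (f \<otimes>\<^bsub>Hom A X1 Y\<^esub> g)"
proof -
  have add: "((s, f \<otimes>\<^bsub>Hom A X1 Y\<^esub> g), (t, f' \<otimes>\<^bsub>Hom A X2 Y\<^esub> g')) \<in> roof_rel A S X Y"
    if h: "((s, f), (t, f')) \<in> roof_rel A S X Y" "((s, g), (t, g')) \<in> roof_rel A S X Y" "t \<in> W X2 X"
    for t f' g' X2
  proof -
    obtain X1' X2' P u v where 1: "s \<in> W X1' X" "f \<in> mor A X1' Y" "t \<in> W X2' X" "f' \<in> mor A X2' Y"
      "g \<in> mor A X1' Y" "g' \<in> mor A X2' Y"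
      "u \<in> mor A P X1'" "v \<in> mor A P X2'" "s \<cdot> u = t \<cdot> v" "s \<cdot> u \<in> W P X" "f \<cdot> u = f' \<cdot> v"
      "g \<cdot> u = g' \<cdot> v" using h(1,2) by (rule roof_rel_common)
    have eq: "X1' = X1" "X2' = X2" using 1 assms h W_mor hom_disjoint by blast+
    note [simp] = 1(1,3)[THEN W_arr] 1(2,4,5,6,7,8)[THEN mor_arr] eq
    show ?thesis
      by (rule roof_relI[of s X1 X _ Y t X2 _ u P v]) (use 1 in \<open>simp_all add: mor_iff\<close>)
  qed
  note [simp] = assms(1)[THEN W_arr] assms(2,3)[THEN mor_arr]
  show ?thesis
  proof (rule subset_antisym; rule subsetI)
    fix r assume "r \<in> roof_add A S X Y (roof_class X Y s f) (roof_class X Y s g)"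
    then obtain X' t f' g' where "t \<in> W X' X" "((s, f), (t, f')) \<in> roof_rel A S X Y"
      "((s, g), (t, g')) \<in> roof_rel A S X Y"
      and r: "((t, f' \<otimes>\<^bsub>Hom A X' Y\<^esub> g'), r) \<in> roof_rel A S X Y"
      unfolding roof_add_def by blast
    from add[OF this(2,3,1)] r show "r \<in> roof_class X Y s (f \<otimes>\<^bsub>Hom A X1 Y\<^esub> g)"
      using equiv_roofs[of X Y] unfolding equiv_def trans_def by blast
  next
    fix r assume "r \<in> roof_class X Y s (f \<otimes>\<^bsub>Hom A X1 Y\<^esub> g)"
    then show "r \<in> roof_add A S X Y (roof_class X Y s f) (roof_class X Y s g)"
      unfolding roof_add_def using assms roof_rel_refl by blast
  qed
qed

text \<open>The composite has to be independent of both representatives and of the Ore square. These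
  ambiguities are removed by two refinements: one over \<open>X\<close> that makes the domains of
  the two composites comparable, then one that makes the lifts \<open>f'\<close> and
  \<open>f2'\<close> comparable over \<open>Y\<close>.\<close>

lemma roof_comp_class:
  assumes "s \<in> W X1 X" "f \<in> mor A X1 Y" "t \<in> W Y1 Y" "g \<in> mor A Y1 Z"
    and "t' \<in> W P X1" "f' \<in> mor A P Y1" "f \<cdot> t' = t \<cdot> f'"
  shows "roof_comp A S (roof_class Y Z t g) (roof_class X Y s f) = roof_class X Z (s \<cdot> t') (g \<cdot> f')"
proof -
  have comp: "((s \<cdot> t', g \<cdot> f'), (s2 \<cdot> t2', g2 \<cdot> f2')) \<in> roof_rel A S X Z"
    if sf: "((s, f), (s2, f2)) \<in> roof_rel A S X Y" and tg: "((t, g), (t2, g2)) \<in> roof_rel A S Y Z"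
      and th: "s2 \<in> W X2 X" "t2' \<in> W P2 X2" "t2 \<in> W Y2 Y" "f2' \<in> mor A P2 Y2" "f2 \<cdot> t2' = t2 \<cdot> f2'"
    for s2 f2 t2 g2 t2' f2' X2 Y2 P2
  proof -
    from sf obtain X1' X2' R u1 u2 where 1: "s \<in> W X1' X" "f \<in> mor A X1' Y" "s2 \<in> W X2' X"
      "f2 \<in> mor A X2' Y" "u1 \<in> mor A R X1'" "u2 \<in> mor A R X2'" "s \<cdot> u1 = s2 \<cdot> u2" "s \<cdot> u1 \<in> W R X"
      "f \<cdot> u1 = f2 \<cdot> u2" by (rule roof_relE)
    from tg obtain Y1' Y2' T v1 v2 where 2: "t \<in> W Y1' Y" "g \<in> mor A Y1' Z" "t2 \<in> W Y2' Y"
      "g2 \<in> mor A Y2' Z" "v1 \<in> mor A T Y1'" "v2 \<in> mor A T Y2'" "t \<cdot> v1 = t2 \<cdot> v2" "t \<cdot> v1 \<in> W T Y"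
      "g \<cdot> v1 = g2 \<cdot> v2" by (rule roof_relE)
    have eq: "X1' = X1" "X2' = X2" "Y1' = Y1" "Y2' = Y2"
      using 1 2 assms th W_mor hom_disjoint by blast+
    note [simp] = assms(1,3,5)[THEN W_arr] th(1-3)[THEN W_arr] assms(2,4,6)[THEN mor_arr]
      th(4)[THEN mor_arr] 1(4-6)[THEN mor_arr] 2(4-6)[THEN mor_arr] eq
    have st: "s \<cdot> t' \<in> W P X" "s2 \<cdot> t2' \<in> W P2 X" using assms th W_comp by blast+
    \<comment> \<open>First refinement: the denominators \<open>s \<cdot> t'\<close>,
      \<open>s \<cdot> u1\<close> and \<open>s2 \<cdot> t2'\<close> over \<open>X\<close> are
      brought together. Cancelling \<open>s\<close> and \<open>s2\<close> then yields
      \<open>x\<close>, \<open>y\<close> and \<open>z\<close> with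
      \<open>t' \<cdot> x = u1 \<cdot> z\<close> and
      \<open>t2' \<cdot> y = u2 \<cdot> z\<close>.\<close>
    obtain K1 a1 c where K1: "a1 \<in> mor A K1 P" "c \<in> W K1 R" "(s \<cdot> t') \<cdot> a1 = (s \<cdot> u1) \<cdot> c"
      "(s \<cdot> t') \<cdot> a1 \<in> W K1 X" using common_refinement[OF st(1) 1(8)] .
    note [simp] = K1(1)[THEN mor_arr] K1(2)[THEN W_arr]
    obtain K2 b1 a2 where K2: "b1 \<in> mor A K2 K1" "a2 \<in> W K2 P2"
      "((s \<cdot> t') \<cdot> a1) \<cdot> b1 = (s2 \<cdot> t2') \<cdot> a2" "((s \<cdot> t') \<cdot> a1) \<cdot> b1 \<in> W K2 X"
      using common_refinement[OF K1(4) st(2)] .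
    note [simp] = K2(1)[THEN mor_arr] K2(2)[THEN W_arr]
    have e1: "s \<cdot> t' \<cdot> a1 = s \<cdot> u1 \<cdot> c" using K1(3) by simp
    have e1': "s \<cdot> (t' \<cdot> a1 \<cdot> b1) = s \<cdot> (u1 \<cdot> c \<cdot> b1)"
      using e1[THEN comp_eq_ext, of b1] by simp
    have e2: "s2 \<cdot> (t2' \<cdot> a2) = s2 \<cdot> (u2 \<cdot> c \<cdot> b1)"
    proof -
      have "s2 \<cdot> t2' \<cdot> a2 = s \<cdot> t' \<cdot> a1 \<cdot> b1" using K2(3) by simp
      also have "\<dots> = s2 \<cdot> u2 \<cdot> c \<cdot> b1" unfolding e1' by (simp add: 1(7)[THEN comp_eq_ext])
      finally show ?thesis .
    qed
    obtain K3 w where w: "w \<in> W K3 K2" "(t' \<cdot> a1 \<cdot> b1) \<cdot> w = (u1 \<cdot> c \<cdot> b1) \<cdot> w"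
      using W_cancel[OF assms(1) _ _ e1', of K2] by (auto simp: mor_iff)
    note [simp] = w(1)[THEN W_arr]
    have "s2 \<cdot> (t2' \<cdot> a2 \<cdot> w) = s2 \<cdot> (u2 \<cdot> c \<cdot> b1 \<cdot> w)"
      using e2[THEN comp_eq_ext, of w] by simp
    then obtain K4 w' where w': "w' \<in> W K4 K3" "(t2' \<cdot> a2 \<cdot> w) \<cdot> w' = (u2 \<cdot> c \<cdot> b1 \<cdot> w) \<cdot> w'"
      using W_cancel[OF th(1), of "t2' \<cdot> a2 \<cdot> w" K3 "u2 \<cdot> c \<cdot> b1 \<cdot> w"] by (auto simp: mor_iff)
    note [simp] = w'(1)[THEN W_arr]
    define x where "x = a1 \<cdot> b1 \<cdot> w \<cdot> w'"
    define y where "y = a2 \<cdot> w \<cdot> w'"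
    define z where "z = c \<cdot> b1 \<cdot> w \<cdot> w'"
    have [simp]: "arr x" "src x = K4" "tgt x = P" "arr y" "src y = K4" "tgt y = P2"
      "arr z" "src z = K4" "tgt z = R" by (simp_all add: x_def y_def z_def)
    have x: "t' \<cdot> x = u1 \<cdot> z" using w(2)[THEN comp_eq_ext1, of w'] by (simp add: x_def z_def)
    have y: "t2' \<cdot> y = u2 \<cdot> z" using w'(2) by (simp add: y_def z_def)
    have xy: "s \<cdot> t' \<cdot> x = s2 \<cdot> t2' \<cdot> y"
      using K2(3)[THEN comp_eq_ext1, of "w \<cdot> w'"] by (simp add: x_def y_def)
    have "(((s \<cdot> t') \<cdot> a1) \<cdot> b1) \<cdot> w \<cdot> w' \<in> W K4 X" using W_comp K2(4) w(1) w'(1) by blast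
    then have Wx: "s \<cdot> t' \<cdot> x \<in> W K4 X" by (simp add: x_def)
    have fx: "t \<cdot> f' \<cdot> x = f \<cdot> u1 \<cdot> z" using assms(7)[THEN comp_eq_ext, of x] by (simp add: x)
    have fy: "t2 \<cdot> f2' \<cdot> y = f \<cdot> u1 \<cdot> z"
      using th(5)[THEN comp_eq_ext, of y] by (simp add: y 1(9)[THEN comp_eq_ext])
    \<comment> \<open>Second refinement: both \<open>t \<cdot> f' \<cdot> x\<close> and
      \<open>t2 \<cdot> f2' \<cdot> y\<close> equal \<open>f \<cdot> u1 \<cdot> z\<close>, which an
      Ore square lifts along \<open>t \<cdot> v1\<close>. Cancelling \<open>t\<close> and
      \<open>t2\<close> identifies the lifts, up to further refinement, with
      \<open>v1 \<cdot> r\<close> and \<open>v2 \<cdot> r\<close>, and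
      \<open>g \<cdot> v1 = g2 \<cdot> v2\<close>.\<close>
    have "f \<cdot> u1 \<cdot> z \<in> mor A K4 Y" by (simp add: mor_iff)
    then obtain K5 d r where d: "d \<in> W K5 K4" "r \<in> mor A K5 T" "(t \<cdot> v1) \<cdot> r = (f \<cdot> u1 \<cdot> z) \<cdot> d"
      using W_ore[OF 2(8)] by blast
    note [simp] = d(1)[THEN W_arr] d(2)[THEN mor_arr]
    have "t \<cdot> (f' \<cdot> x \<cdot> d) = t \<cdot> (v1 \<cdot> r)" using fx[THEN comp_eq_ext, of d] d(3) by simp
    then obtain K6 e where e: "e \<in> W K6 K5" "(f' \<cdot> x \<cdot> d) \<cdot> e = (v1 \<cdot> r) \<cdot> e"
      using W_cancel[OF assms(3), of "f' \<cdot> x \<cdot> d" K5 "v1 \<cdot> r"] by (auto simp: mor_iff)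
    note [simp] = e(1)[THEN W_arr]
    have "t2 \<cdot> (f2' \<cdot> y \<cdot> d) = t2 \<cdot> (v2 \<cdot> r)"
      using fy[THEN comp_eq_ext, of d] d(3) 2(7)[THEN comp_eq_ext, of r] by simp
    then have "t2 \<cdot> (f2' \<cdot> y \<cdot> d \<cdot> e) = t2 \<cdot> (v2 \<cdot> r \<cdot> e)"
      using comp_eq_ext[of t2 "f2' \<cdot> y \<cdot> d" t2 "v2 \<cdot> r" e] by simp
    then obtain K7 e' where e': "e' \<in> W K7 K6" "(f2' \<cdot> y \<cdot> d \<cdot> e) \<cdot> e' = (v2 \<cdot> r \<cdot> e) \<cdot> e'"
      using W_cancel[OF th(3), of "f2' \<cdot> y \<cdot> d \<cdot> e" K6 "v2 \<cdot> r \<cdot> e"] by (auto simp: mor_iff)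
    note [simp] = e'(1)[THEN W_arr]
    have f1: "f' \<cdot> x \<cdot> d \<cdot> e \<cdot> e' = v1 \<cdot> r \<cdot> e \<cdot> e'" using e(2)[THEN comp_eq_ext1, of e'] by simp
    have f2: "f2' \<cdot> y \<cdot> d \<cdot> e \<cdot> e' = v2 \<cdot> r \<cdot> e \<cdot> e'" using e'(2) by simp
    have "(s \<cdot> t' \<cdot> x) \<cdot> d \<cdot> e \<cdot> e' \<in> W K7 X" using W_comp Wx d(1) e(1) e'(1) by blast
    then have Wf: "s \<cdot> t' \<cdot> x \<cdot> d \<cdot> e \<cdot> e' \<in> W K7 X" by simp
    show ?thesis
    proof (rule roof_relI[OF st(1) _ st(2), of _ _ _ "x \<cdot> d \<cdot> e \<cdot> e'" K7 "y \<cdot> d \<cdot> e \<cdot> e'"])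
      show "(s \<cdot> t') \<cdot> x \<cdot> d \<cdot> e \<cdot> e' = (s2 \<cdot> t2') \<cdot> y \<cdot> d \<cdot> e \<cdot> e'"
        using xy[THEN comp_eq_ext, of "d \<cdot> e \<cdot> e'"] by simp
      show "(g \<cdot> f') \<cdot> x \<cdot> d \<cdot> e \<cdot> e' = (g2 \<cdot> f2') \<cdot> y \<cdot> d \<cdot> e \<cdot> e'"
        using 2(9)[THEN comp_eq_ext, of "r \<cdot> e \<cdot> e'"] by (simp add: f1 f2)
    qed (use Wf in \<open>simp_all add: mor_iff\<close>)
  qed
  note [simp] = assms(1,3,5)[THEN W_arr] assms(2,4,6)[THEN mor_arr]
  show ?thesis
  proof (rule subset_antisym; rule subsetI)
    fix r assume "r \<in> roof_comp A S (roof_class Y Z t g) (roof_class X Y s f)"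
    then obtain X0 Y0 Z0 X2 Y2 P2 s2 f2 t2 g2 t2' f2' where
      *: "s2 \<in> W X2 X0" "f2 \<in> mor A X2 Y0" "((s, f), (s2, f2)) \<in> roof_rel A S X Y"
      "t2 \<in> W Y2 Y0" "g2 \<in> mor A Y2 Z0" "((t, g), (t2, g2)) \<in> roof_rel A S Y Z"
      "t2' \<in> W P2 X2" "f2' \<in> mor A P2 Y2" "f2 \<cdot> t2' = t2 \<cdot> f2'"
      "((s2 \<cdot> t2', g2 \<cdot> f2'), r) \<in> roof_rel A S X0 Z0"
      unfolding roof_comp_def by blast
    have eq: "X0 = X" "Y0 = Y" "Z0 = Z"
      using roof_relE[OF *(3)] roof_relE[OF *(6)] *(1,2,4,5) W_mor hom_disjoint by metis+
    from comp[OF *(3,6) _ *(7) _ *(8,9)] *(1,4,10) show "r \<in> roof_class X Z (s \<cdot> t') (g \<cdot> f')"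
      using equiv_roofs[of X Z] eq unfolding equiv_def trans_def by blast
  next
    fix r assume "r \<in> roof_class X Z (s \<cdot> t') (g \<cdot> f')"
    then show "r \<in> roof_comp A S (roof_class Y Z t g) (roof_class X Y s f)"
      unfolding roof_comp_def using assms roof_rel_refl by blast
  qed
qed

end

section \<open>Identity functors and reflexivity of natural isomorphism\<close>

lemma additive_functor_id:
  assumes "additive_category A"
  shows "additive_functor A A id_functor"
proof -
  interpret additive_category A by fact
  show ?thesis by unfold_locales (simp_all add: id_functor_def hom_def)
qed

lemma (in preadditive_category) is_iso_Idt: "X \<in> Obj C \<Longrightarrow> is_iso C X X (Idt C X)"
  unfolding is_iso_def by (simp add: mor_iff)

lemma (in preadditive_category) naturally_isomorphic_refl:
  assumes "\<And>X. X \<in> Obj D \<Longrightarrow> OMap F X \<in> Obj C"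
    and "\<And>f X Y. f \<in> mor D X Y \<Longrightarrow> AMap F f \<in> mor C (OMap F X) (OMap F Y)"
  shows "naturally_isomorphic D C F F"
  unfolding naturally_isomorphic_def
proof (intro exI[of _ "\<lambda>X. Idt C (OMap F X)"] conjI ballI allI)
  fix X Y f assume "f \<in> mor D X Y"
  from mor_arr[OF assms(2)[OF this]]
  show "AMap F f \<cdot> Idt C (OMap F X) = Idt C (OMap F Y) \<cdot> AMap F f" by simp
qed (use assms(1) is_iso_Idt in blast)

lemma additive_functor_mor:
  assumes "additive_functor A B F" "f \<in> mor A X Y"
  shows "AMap F f \<in> mor B (OMap F X) (OMap F Y)"
proof -
  interpret additive_functor A B F by fact
  have "X \<in> Obj A" "Y \<in> Obj A" "f \<in> carrier (Hom A X Y)" using assms(2) by (auto simp: mor_def)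
  with arr[of X Y] obj show ?thesis by (auto simp: mor_def hom_def)
qed

lemma comp_id_functor [simp]:
  "comp_functor F id_functor = F" "comp_functor id_functor F = F"
  by (simp_all add: comp_functor_def id_functor_def)

lemma id_functor_sel [simp]: "OMap id_functor = id" "AMap id_functor = id"
  by (simp_all add: id_functor_def)

lemma is_equivalence_id:
  assumes "additive_category A"
  shows "is_equivalence A A id_functor"
proof -
  interpret additive_category A by fact
  have "naturally_isomorphic A A id_functor id_functor" by (rule naturally_isomorphic_refl) auto
  then show ?thesis
    unfolding is_equivalence_def using additive_functor_id[OF assms]
    by (intro conjI exI[of _ id_functor]) simp_all
qed

section \<open>The quotient as an additive category\<close>

context right_fractions
begin

lemma B_simps [simp]:
  "Obj B = Obj A" "mult (Hom B X Y) = roof_add A S X Y"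
  "one (Hom B X Y) = roof_of A S \<one>\<^bsub>Hom A X Y\<^esub>" "Idt B X = roof_of A S (Idt A X)"
  "Comp B = roof_comp A S"
  by (simp_all add: serre_quotient_def)

lemma Q_simps [simp]: "OMap Q = id" "AMap Q = roof_of A S"
  by (simp_all add: quotient_functor_def)

lemma carrier_B_iff: "X \<in> Obj A \<Longrightarrow> Y \<in> Obj A \<Longrightarrow> a \<in> carrier (Hom B X Y) \<longleftrightarrow> a \<in> mor B X Y"
  by (simp add: mor_def)

lemma roof_of_class:
  assumes "f \<in> mor A X Y"
  shows "roof_of A S f = roof_class X Y (Idt A X) f"
proof -
  have "f \<in> mor A X' Y' \<longleftrightarrow> X' = X \<and> Y' = Y" for X' Y' using assms hom_disjoint by blast
  then show ?thesis unfolding roof_of_def by auto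
qed

lemma roof_of_refine:
  assumes "f \<in> mor A X Y" "s \<in> W X1 X"
  shows "roof_of A S f = roof_class X Y s (f \<cdot> s)"
proof -
  have X: "X \<in> Obj A" using assms mor_Obj by blast
  note [simp] = assms(1)[THEN mor_arr] assms(2)[THEN W_arr]
  show ?thesis
    using roof_class_refine[OF W_id[OF X] assms(1) W_mor[OF assms(2)]] assms(2)
    by (simp add: roof_of_class[OF assms(1)])
qed

lemma roof_of_mor: "f \<in> mor A X Y \<Longrightarrow> roof_of A S f \<in> mor B X Y"
  unfolding roof_of_class using roof_class_mor W_id mor_Obj by metis

text \<open>Both denominators are identities, so the two maps of a witness coincide and lie in
  \<open>W\<close> themselves. This supplies faithfulness of \<open>Q\<close> on morphisms into
  closed objects and, later, saturation.\<close>

lemma roof_of_eqD: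
  assumes "f \<in> mor A X Y" "g \<in> mor A X Y" "roof_of A S f = roof_of A S g"
  obtains P u where "u \<in> W P X" "f \<cdot> u = g \<cdot> u"
proof -
  have X: "X \<in> Obj A" using assms mor_Obj by blast
  have "((Idt A X, f), (Idt A X, g)) \<in> roof_rel A S X Y"
    using assms(3) roof_class_eq_iff[OF W_id[OF X] assms(1) W_id[OF X] assms(2)]
    by (simp add: roof_of_class[OF assms(1)] roof_of_class[OF assms(2)])
  then obtain X1 X2 P u v where *: "Idt A X \<in> W X1 X" "Idt A X \<in> W X2 X"
    "u \<in> mor A P X1" "v \<in> mor A P X2" "Idt A X \<cdot> u = Idt A X \<cdot> v" "Idt A X \<cdot> u \<in> W P X"
    "f \<cdot> u = g \<cdot> v" by (rule roof_relE)
  have "X1 = X" "X2 = X" using *(1,2) X W_mor hom_disjoint id_mor by blast+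
  with * have "u = v" "u \<in> W P X" by (simp_all add: mor_iff)
  with * that show ?thesis by blast
qed

lemma roof_of_add:
  assumes "f \<in> mor A X Y" "g \<in> mor A X Y"
  shows "roof_of A S (f \<otimes>\<^bsub>Hom A X Y\<^esub> g) = roof_add A S X Y (roof_of A S f) (roof_of A S g)"
proof -
  have X: "X \<in> Obj A" using assms mor_Obj by blast
  have "f \<otimes>\<^bsub>Hom A X Y\<^esub> g \<in> mor A X Y" using assms by (simp add: mor_iff)
  then show ?thesis
    using assms by (simp add: roof_of_class roof_add_class[OF W_id[OF X] assms])
qed

text \<open>A class contains its representative, whose denominator and numerator have determined
  targets. This gives the disjointness of Hom-sets in the quotient.\<close>

lemma roof_class_dom: "roof_class X Y s f = roof_class X' Y' s' f' \<Longrightarrow>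
    s \<in> W X1 X \<Longrightarrow> f \<in> mor A X1 Y \<Longrightarrow> X' = X \<and> Y' = Y"
proof -
  assume *: "roof_class X Y s f = roof_class X' Y' s' f'" "s \<in> W X1 X" "f \<in> mor A X1 Y"
  then have "(s, f) \<in> roof_class X' Y' s' f'" using roof_rel_refl by blast
  then have "((s', f'), (s, f)) \<in> roof_rel A S X' Y'" by blast
  then show ?thesis by (rule roof_relE) (use * W_mor hom_disjoint in blast)
qed

lemma roof_common3:
  assumes "s \<in> W P X" "c \<in> mor B X Z"
  obtains R w h where "w \<in> mor A R P" "s \<cdot> w \<in> W R X" "h \<in> mor A R Z"
    "c = roof_class X Z (s \<cdot> w) h"
proof -
  from assms obtain X1 t h where *: "t \<in> W X1 X" "h \<in> mor A X1 Z" "c = roof_class X Z t h"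
    unfolding mor_B_iff by blast
  obtain R u v where uv: "u \<in> mor A R P" "v \<in> W R X1" "s \<cdot> u = t \<cdot> v" "s \<cdot> u \<in> W R X"
    using common_refinement[OF assms(1) *(1)] .
  show ?thesis
  proof (rule that[OF uv(1,4), of "h \<cdot> v"])
    show "h \<cdot> v \<in> mor A R Z" using comp_mor *(2) uv(2) W_mor by blast
    show "c = roof_class X Z (s \<cdot> u) (h \<cdot> v)"
      unfolding *(3) uv(3) by (rule roof_class_refine[OF *(1,2)]) (use uv W_mor in auto)
  qed
qed

lemma roof_comp_of:
  assumes "s \<in> W X1 X" "f \<in> mor A X1 Y" "g \<in> mor A Y Z"
  shows "roof_comp A S (roof_of A S g) (roof_class X Y s f) = roof_class X Z s (g \<cdot> f)"
proof -
  have O: "X1 \<in> Obj A" "Y \<in> Obj A" using assms mor_Obj by blast+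
  note [simp] = assms(1)[THEN W_arr] assms(2,3)[THEN mor_arr]
  show ?thesis
    using roof_comp_class[OF assms(1,2) W_id[OF O(2)] assms(3) W_id[OF O(1)] assms(2)] O
    by (simp add: roof_of_class[OF assms(3)])
qed

lemma roof_of_comp:
  assumes "f \<in> mor A X Y" "g \<in> mor A Y Z"
  shows "roof_of A S (g \<cdot> f) = roof_comp A S (roof_of A S g) (roof_of A S f)"
proof -
  have X: "X \<in> Obj A" using assms mor_Obj by blast
  show ?thesis
    using roof_comp_of[OF W_id[OF X] assms] comp_mor[OF assms]
    by (simp add: roof_of_class[OF assms(1)] roof_of_class[of "g \<cdot> f" X Z])
qed

text \<open>The inverse of \<open>s\<close> in the quotient is the roof with denominator
  \<open>s\<close> and identity numerator.\<close>

lemma roof_of_W_iso: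
  assumes "s \<in> W X1 X"
  shows "roof_comp A S (roof_class X X1 s (Idt A X1)) (roof_of A S s) = roof_of A S (Idt A X1)"
    and "roof_comp A S (roof_of A S s) (roof_class X X1 s (Idt A X1)) = roof_of A S (Idt A X)"
proof -
  have O: "X1 \<in> Obj A" "X \<in> Obj A" using assms mor_Obj W_mor by blast+
  note [simp] = assms(1)[THEN W_arr]
  note I = id_mor[OF O(1)]
  show "roof_comp A S (roof_class X X1 s (Idt A X1)) (roof_of A S s) = roof_of A S (Idt A X1)"
    using roof_comp_class[OF W_id[OF O(1)] W_mor[OF assms] assms I W_id[OF O(1)] I] O
    by (simp add: roof_of_class[OF W_mor[OF assms]] roof_of_class[OF I])
  show "roof_comp A S (roof_of A S s) (roof_class X X1 s (Idt A X1)) = roof_of A S (Idt A X)"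
    using roof_comp_of[OF assms I W_mor[OF assms]] roof_of_refine[OF id_mor[OF O(2)] assms] O
    by simp
qed

lemma is_iso_roof_of:
  assumes "s \<in> W X1 X"
  shows "is_iso B X1 X (roof_of A S s)"
  unfolding is_iso_def using roof_of_W_iso[OF assms] roof_of_mor[OF W_mor[OF assms]]
    roof_class_mor[OF assms id_mor] mor_Obj(1)[OF W_mor[OF assms]]
  by (auto intro!: bexI[of _ "roof_class X X1 s (Idt A X1)"])

lemma roof_zero:
  assumes "s \<in> W X1 X" "Y \<in> Obj A"
  shows "roof_of A S \<one>\<^bsub>Hom A X Y\<^esub> = roof_class X Y s \<one>\<^bsub>Hom A X1 Y\<^esub>"
proof -
  have O: "X \<in> Obj A" using assms mor_Obj W_mor by blast
  then have "\<one>\<^bsub>Hom A X Y\<^esub> \<in> mor A X Y" using assms by (simp add: mor_iff)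
  from roof_of_refine[OF this assms(1)] show ?thesis
    using assms(2) W_arr[OF assms(1)] O by simp
qed

lemma B_hom_group:
  assumes "X \<in> Obj A" "Y \<in> Obj A"
  shows "comm_group (Hom B X Y)"
proof (rule comm_groupI, unfold carrier_B_iff[OF assms] B_simps)
  have z: "\<one>\<^bsub>Hom A X Y\<^esub> \<in> mor A X Y" using assms by (simp add: mor_iff)
  then show "roof_of A S \<one>\<^bsub>Hom A X Y\<^esub> \<in> mor B X Y" by (rule roof_of_mor)
  fix a assume a: "a \<in> mor B X Y"
  then obtain X1 s f where sf: "s \<in> W X1 X" "f \<in> mor A X1 Y" "a = roof_class X Y s f"
    unfolding mor_B_iff by blast
  note [simp] = sf(1)[THEN W_arr] sf(2)[THEN mor_arr]
  have X1: "X1 \<in> Obj A" using sf mor_Obj by blast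
  have z1: "\<one>\<^bsub>Hom A X1 Y\<^esub> \<in> mor A X1 Y" "inv\<^bsub>Hom A X1 Y\<^esub> f \<in> mor A X1 Y"
    using assms X1 by (simp_all add: mor_iff)
  show "roof_add A S X Y (roof_of A S \<one>\<^bsub>Hom A X Y\<^esub>) a = a"
    using roof_add_class[OF sf(1) z1(1) sf(2)]
    by (simp add: roof_zero[OF sf(1) assms(2)] sf(3) add_simps)
  show "\<exists>b\<in>carrier (Hom B X Y). roof_add A S X Y b a = roof_of A S \<one>\<^bsub>Hom A X Y\<^esub>"
    using roof_add_class[OF sf(1) z1(2) sf(2)] roof_class_mor[OF sf(1) z1(2)]
    by (intro bexI[of _ "roof_class X Y s (inv\<^bsub>Hom A X1 Y\<^esub> f)"])
      (simp_all add: roof_zero[OF sf(1) assms(2)] sf(3) add_simps carrier_B_iff assms)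
  fix b assume b: "b \<in> mor B X Y"
  obtain P s f g where 1: "s \<in> W P X" "f \<in> mor A P Y" "g \<in> mor A P Y"
    "a = roof_class X Y s f" "b = roof_class X Y s g" using roof_class_common[OF a b] .
  have fg: "f \<otimes>\<^bsub>Hom A P Y\<^esub> g \<in> mor A P Y" using 1 by (simp add: mor_iff)
  show "roof_add A S X Y a b \<in> mor B X Y"
    using roof_add_class[OF 1(1-3)] roof_class_mor[OF 1(1) fg] by (simp add: 1)
  show "roof_add A S X Y a b = roof_add A S X Y b a"
    using roof_add_class[OF 1(1-3)] roof_add_class[OF 1(1,3,2)] add_ac(1)[OF 1(2,3)]
    by (simp add: 1)
  fix c assume c: "c \<in> mor B X Y"
  obtain R w h where 2: "w \<in> mor A R P" "s \<cdot> w \<in> W R X" "h \<in> mor A R Y"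
    "c = roof_class X Y (s \<cdot> w) h" using roof_common3[OF 1(1) c] .
  have a2: "a = roof_class X Y (s \<cdot> w) (f \<cdot> w)" and b2: "b = roof_class X Y (s \<cdot> w) (g \<cdot> w)"
    unfolding 1 by (rule roof_class_refine[OF 1(1) _ 2(1,2)], fact)+
  have m: "f \<cdot> w \<in> mor A R Y" "g \<cdot> w \<in> mor A R Y" using 1 2 comp_mor by blast+
  have m2: "f \<cdot> w \<otimes>\<^bsub>Hom A R Y\<^esub> g \<cdot> w \<in> mor A R Y" "g \<cdot> w \<otimes>\<^bsub>Hom A R Y\<^esub> h \<in> mor A R Y"
    using m 2(3) by (simp_all add: mor_iff)
  show "roof_add A S X Y (roof_add A S X Y a b) c = roof_add A S X Y a (roof_add A S X Y b c)"
    unfolding a2 b2 2(4) roof_add_class[OF 2(2) m] roof_add_class[OF 2(2) m(2) 2(3)]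
      roof_add_class[OF 2(2) m2(1) 2(3)] roof_add_class[OF 2(2) m(1) m2(2)]
    using add_ac(2)[OF m 2(3)] by simp
qed

text \<open>Rewriting \<open>a\<close> so that its numerator factors through \<open>t\<close>
  computes its composite with every roof of denominator \<open>t\<close> by one formula. Uniformity
  in \<open>Z\<close> and \<open>g\<close> serves distributivity and associativity, where several
  numerators over \<open>t\<close> are composed with the same \<open>a\<close>.\<close>

lemma roof_comp_ore:
  assumes "a \<in> mor B X Y" "t \<in> W Y1 Y"
  shows "\<exists>P s f. s \<in> W P X \<and> f \<in> mor A P Y1 \<and> a = roof_class X Y s (t \<cdot> f) \<and>
    (\<forall>Z g. g \<in> mor A Y1 Z \<longrightarrow>
      roof_comp A S (roof_class Y Z t g) a = roof_class X Z s (g \<cdot> f))"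
proof -
  obtain X1 s f where sf: "s \<in> W X1 X" "f \<in> mor A X1 Y" "a = roof_class X Y s f"
    using assms(1) unfolding mor_B_iff by blast
  obtain P t' f' where o: "t' \<in> W P X1" "f' \<in> mor A P Y1" "t \<cdot> f' = f \<cdot> t'"
    using W_ore[OF assms(2) sf(2)] by blast
  have st: "s \<cdot> t' \<in> W P X" using sf o W_comp by blast
  have "a = roof_class X Y (s \<cdot> t') (t \<cdot> f')"
    unfolding sf(3) o(3) by (rule roof_class_refine) (use sf o st W_mor in auto)
  moreover have "roof_comp A S (roof_class Y Z t g) a = roof_class X Z (s \<cdot> t') (g \<cdot> f')"
    if "g \<in> mor A Y1 Z" for Z g
    unfolding sf(3) by (rule roof_comp_class[OF sf(1,2) assms(2) that o(1,2) o(3)[symmetric]])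
  ultimately show ?thesis using st o(2) by blast
qed

lemma preadditive_B: "preadditive_category B"
proof (rule preadditive_category.intro)
  show "comm_group (Hom B X Y)" if "X \<in> Obj B" "Y \<in> Obj B" for X Y
    using B_hom_group that by simp
  show "X = X' \<and> Y = Y'" if "f \<in> mor B X Y" "f \<in> mor B X' Y'" for f X Y X' Y'
    using that roof_class_dom unfolding mor_B_iff by metis
  show "Idt B X \<in> mor B X X" if "X \<in> Obj B" for X
    using that roof_of_mor[OF id_mor] by simp
  fix a X Y assume a: "a \<in> mor B X Y"
  then obtain X1 s f where sf: "s \<in> W X1 X" "f \<in> mor A X1 Y" "a = roof_class X Y s f"
    unfolding mor_B_iff by blast
  note [simp] = sf(1)[THEN W_arr] sf(2)[THEN mor_arr]
  have O: "X1 \<in> Obj A" "X \<in> Obj A" "Y \<in> Obj A" using sf mor_Obj W_mor by blast+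
  show "a \<cdot>\<^bsub>B\<^esub> Idt B X = a"
    using roof_comp_class[OF W_id[OF O(2)] id_mor[OF O(2)] sf(1,2) sf(1) id_mor[OF O(1)]] O
    by (simp add: roof_of_class[OF id_mor[OF O(2)]] sf(3))
  show "Idt B Y \<cdot>\<^bsub>B\<^esub> a = a"
    using roof_comp_of[OF sf(1,2) id_mor[OF O(3)]] by (simp add: sf(3))
  fix b Z assume b: "b \<in> mor B Y Z"
  then obtain Y1 t g where tg: "t \<in> W Y1 Y" "g \<in> mor A Y1 Z" "b = roof_class Y Z t g"
    unfolding mor_B_iff by blast
  obtain P s' f' where o: "s' \<in> W P X" "f' \<in> mor A P Y1" "a = roof_class X Y s' (t \<cdot> f')"
    "\<forall>Z g. g \<in> mor A Y1 Z \<longrightarrow> roof_comp A S (roof_class Y Z t g) a = roof_class X Z s' (g \<cdot> f')"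
    using roof_comp_ore[OF a tg(1)] by blast
  have ba: "b \<cdot>\<^bsub>B\<^esub> a = roof_class X Z s' (g \<cdot> f')" using o(4)[rule_format, OF tg(2)] tg(3) by simp
  note [simp] = o(2)[THEN mor_arr] tg(1)[THEN W_arr] tg(2)[THEN mor_arr]
  show "b \<cdot>\<^bsub>B\<^esub> a \<in> mor B X Z"
    unfolding ba by (rule roof_class_mor[OF o(1)]) (simp add: mor_iff)
  show "(b \<otimes>\<^bsub>Hom B Y Z\<^esub> b') \<cdot>\<^bsub>B\<^esub> a = (b \<cdot>\<^bsub>B\<^esub> a) \<otimes>\<^bsub>Hom B X Z\<^esub> (b' \<cdot>\<^bsub>B\<^esub> a)" if b': "b' \<in> mor B Y Z" for b'
  proof -
    obtain Y1 t g g' where tg: "t \<in> W Y1 Y" "g \<in> mor A Y1 Z" "g' \<in> mor A Y1 Z"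
      "b = roof_class Y Z t g" "b' = roof_class Y Z t g'" using roof_class_common[OF b b'] .
    obtain P s f where o: "s \<in> W P X" "f \<in> mor A P Y1" "a = roof_class X Y s (t \<cdot> f)"
      "\<forall>Z g. g \<in> mor A Y1 Z \<longrightarrow> roof_comp A S (roof_class Y Z t g) a = roof_class X Z s (g \<cdot> f)"
      using roof_comp_ore[OF a tg(1)] by blast
    have m: "g \<otimes>\<^bsub>Hom A Y1 Z\<^esub> g' \<in> mor A Y1 Z" "g \<cdot> f \<in> mor A P Z" "g' \<cdot> f \<in> mor A P Z"
      using tg(2,3) o(2) by (simp_all add: mor_iff)
    show ?thesis
      using o(4)[rule_format, OF m(1)] o(4)[rule_format, OF tg(2)] o(4)[rule_format, OF tg(3)] roof_add_class[OF tg(1-3)]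
        roof_add_class[OF o(1) m(2,3)] mor_arr[OF tg(2)] mor_arr[OF tg(3)] mor_arr[OF o(2)]
      by (simp add: tg(4,5))
  qed
  show "b \<cdot>\<^bsub>B\<^esub> (a \<otimes>\<^bsub>Hom B X Y\<^esub> a') = (b \<cdot>\<^bsub>B\<^esub> a) \<otimes>\<^bsub>Hom B X Z\<^esub> (b \<cdot>\<^bsub>B\<^esub> a')" if a': "a' \<in> mor B X Y" for a'
  proof -
    obtain P2 s2 f2 where o2: "s2 \<in> W P2 X" "f2 \<in> mor A P2 Y1" "a' = roof_class X Y s2 (t \<cdot> f2)"
      "\<forall>Z g. g \<in> mor A Y1 Z \<longrightarrow> roof_comp A S (roof_class Y Z t g) a' = roof_class X Z s2 (g \<cdot> f2)"
      using roof_comp_ore[OF a' tg(1)] by blast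
    \<comment> \<open>Both numerators now factor through \<open>t\<close>. Over a common denominator
      their sum does as well, its factor being the sum of \<open>f' \<cdot> u\<close> and
      \<open>f2 \<cdot> v\<close>, so the composite with \<open>b\<close> is obtained by applying
      \<open>g\<close> to this factor.\<close>
    obtain R u v where uv: "u \<in> mor A R P" "v \<in> W R P2" "s' \<cdot> u = s2 \<cdot> v" "s' \<cdot> u \<in> W R X"
      using common_refinement[OF o(1) o2(1)] .
    note [simp] = o2(2)[THEN mor_arr] uv(1)[THEN mor_arr] uv(2)[THEN W_arr]
    have m: "f' \<cdot> u \<in> mor A R Y1" "f2 \<cdot> v \<in> mor A R Y1" by (simp_all add: mor_iff)
    have tm: "t \<cdot> f' \<cdot> u \<in> mor A R Y" "t \<cdot> f2 \<cdot> v \<in> mor A R Y"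
      "t \<cdot> f' \<in> mor A P Y" "t \<cdot> f2 \<in> mor A P2 Y" "g \<cdot> f' \<in> mor A P Z" "g \<cdot> f2 \<in> mor A P2 Z"
      "g \<cdot> f' \<cdot> u \<in> mor A R Z" "g \<cdot> f2 \<cdot> v \<in> mor A R Z"
      "t \<cdot> (f' \<cdot> u \<otimes>\<^bsub>Hom A R Y1\<^esub> f2 \<cdot> v) \<in> mor A R Y" by (simp_all add: mor_iff)
    have a: "a = roof_class X Y (s' \<cdot> u) (t \<cdot> f' \<cdot> u)"
      unfolding o(3) using roof_class_refine[OF o(1) tm(3) uv(1,4)] by simp
    have a': "a' = roof_class X Y (s' \<cdot> u) (t \<cdot> f2 \<cdot> v)"
      unfolding o2(3) using roof_class_refine[OF o2(1) tm(4) W_mor[OF uv(2)]] uv(3,4) by simp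
    have ba1: "b \<cdot>\<^bsub>B\<^esub> a = roof_class X Z (s' \<cdot> u) (g \<cdot> f' \<cdot> u)"
      unfolding ba using roof_class_refine[OF o(1) tm(5) uv(1,4)] by simp
    have ba2: "b \<cdot>\<^bsub>B\<^esub> a' = roof_class X Z (s' \<cdot> u) (g \<cdot> f2 \<cdot> v)"
      using o2(4)[rule_format, OF tg(2)] roof_class_refine[OF o2(1) tm(6) W_mor[OF uv(2)]] uv(3,4)
      by (simp add: tg(3))
    have sum: "a \<otimes>\<^bsub>Hom B X Y\<^esub> a' = roof_class X Y (s' \<cdot> u) (t \<cdot> (f' \<cdot> u \<otimes>\<^bsub>Hom A R Y1\<^esub> f2 \<cdot> v))"
      unfolding a a' using roof_add_class[OF uv(4) tm(1,2)] by simp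
    have R: "R \<in> Obj A" using uv mor_Obj by blast
    have add: "f' \<cdot> u \<otimes>\<^bsub>Hom A R Y1\<^esub> f2 \<cdot> v \<in> mor A R Y1" by (simp add: mor_iff)
    have "b \<cdot>\<^bsub>B\<^esub> (a \<otimes>\<^bsub>Hom B X Y\<^esub> a') =
        roof_class X Z ((s' \<cdot> u) \<cdot> Idt A R) (g \<cdot> (f' \<cdot> u \<otimes>\<^bsub>Hom A R Y1\<^esub> f2 \<cdot> v))"
      unfolding sum unfolding tg(3) B_simps
      by (rule roof_comp_class[OF uv(4) tm(9) tg(1,2) W_id[OF R] add])
        (use R in \<open>simp\<close>)
    also have "\<dots> = (b \<cdot>\<^bsub>B\<^esub> a) \<otimes>\<^bsub>Hom B X Z\<^esub> (b \<cdot>\<^bsub>B\<^esub> a')"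
      unfolding ba1 ba2 using roof_add_class[OF uv(4) tm(7,8)] R o(1)[THEN W_arr] by simp
    finally show ?thesis .
  qed
  show "(c \<cdot>\<^bsub>B\<^esub> b) \<cdot>\<^bsub>B\<^esub> a = c \<cdot>\<^bsub>B\<^esub> (b \<cdot>\<^bsub>B\<^esub> a)" if c: "c \<in> mor B Z V" for c V
  proof -
    \<comment> \<open>Representatives are adapted from the outermost inwards: \<open>b\<close> is
      rewritten through the denominator of \<open>c\<close>, then \<open>a\<close> through the new
      denominator of \<open>b\<close>. Both bracketings then have the numerator
      \<open>h \<cdot> g1 \<cdot> f\<close>.\<close>
    obtain Z1 r h where rh: "r \<in> W Z1 Z" "h \<in> mor A Z1 V" "c = roof_class Z V r h"
      using c unfolding mor_B_iff by blast
    obtain P1 t1 g1 where o1: "t1 \<in> W P1 Y" "g1 \<in> mor A P1 Z1" "b = roof_class Y Z t1 (r \<cdot> g1)"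
      "\<forall>V h. h \<in> mor A Z1 V \<longrightarrow> roof_comp A S (roof_class Z V r h) b = roof_class Y V t1 (h \<cdot> g1)"
      using roof_comp_ore[OF b rh(1)] by blast
    obtain P s f where o: "s \<in> W P X" "f \<in> mor A P P1"
      "\<forall>Z g. g \<in> mor A P1 Z \<longrightarrow> roof_comp A S (roof_class Y Z t1 g) a = roof_class X Z s (g \<cdot> f)"
      using roof_comp_ore[OF a o1(1)] by blast
    note [simp] = rh(1)[THEN W_arr] rh(2)[THEN mor_arr] o1(2)[THEN mor_arr] o(2)[THEN mor_arr]
      o(1)[THEN W_arr]
    have m: "h \<cdot> g1 \<in> mor A P1 V" "r \<cdot> g1 \<in> mor A P1 Z" "g1 \<cdot> f \<in> mor A P Z1"
      "r \<cdot> g1 \<cdot> f \<in> mor A P Z" by (simp_all add: mor_iff)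
    have P: "P \<in> Obj A" using o mor_Obj by blast
    have cb: "c \<cdot>\<^bsub>B\<^esub> b = roof_class Y V t1 (h \<cdot> g1)" using o1(4)[rule_format, OF rh(2)] rh(3) by simp
    have ba: "b \<cdot>\<^bsub>B\<^esub> a = roof_class X Z s (r \<cdot> g1 \<cdot> f)" using o(3)[rule_format, OF m(2)] o1(3) by simp
    have "(c \<cdot>\<^bsub>B\<^esub> b) \<cdot>\<^bsub>B\<^esub> a = roof_class X V s (h \<cdot> g1 \<cdot> f)"
      using o(3)[rule_format, OF m(1)] unfolding cb by simp
    moreover have "c \<cdot>\<^bsub>B\<^esub> (b \<cdot>\<^bsub>B\<^esub> a) = roof_class X V (s \<cdot> Idt A P) (h \<cdot> g1 \<cdot> f)"
      unfolding ba unfolding rh(3) B_simps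
      by (rule roof_comp_class[OF o(1) m(4) rh(1,2) W_id[OF P] m(3)]) (use P in simp)
    ultimately show ?thesis by simp
  qed
qed

text \<open>Zero objects and biproducts are described by equations, which \<open>roof_of\<close>
  carries over from \<open>A\<close>.\<close>

lemma additive_B: "additive_category B"
proof -
  interpret B: preadditive_category B by (rule preadditive_B)
  show ?thesis
  proof
    obtain Z where "is_zero_object A Z" using has_zero_object by blast
    then have "is_zero_object B Z" unfolding zero_object_iff B.zero_object_iff by simp
    then show "\<exists>Z. is_zero_object B Z" ..
    fix X Y assume "X \<in> Obj B" "Y \<in> Obj B"
    then have "X \<in> Obj A" "Y \<in> Obj A" by simp_all
    then obtain P i j p q where "is_biproduct A X Y P i j p q" using has_biproducts by blast
    then have *: "i \<in> mor A X P" "j \<in> mor A Y P" "p \<in> mor A P X" "q \<in> mor A P Y"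
     "p \<cdot> i = Idt A X" "q \<cdot> j = Idt A Y" "p \<cdot> j = \<one>\<^bsub>Hom A Y X\<^esub>" "q \<cdot> i = \<one>\<^bsub>Hom A X Y\<^esub>"
     "(i \<cdot> p) \<otimes>\<^bsub>Hom A P P\<^esub> (j \<cdot> q) = Idt A P" unfolding is_biproduct_def by auto
    have "is_biproduct B X Y P (roof_of A S i) (roof_of A S j) (roof_of A S p) (roof_of A S q)"
      unfolding is_biproduct_def B_simps
      using *(5-9) roof_of_comp[OF *(1,3)] roof_of_comp[OF *(2,4)] roof_of_comp[OF *(2,3)]
        roof_of_comp[OF *(1,4)] roof_of_comp[OF *(3,1)] roof_of_comp[OF *(4,2)]
        roof_of_add[OF comp_mor[OF *(3,1)] comp_mor[OF *(4,2)]] roof_of_mor[OF *(1)]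
        roof_of_mor[OF *(2)] roof_of_mor[OF *(3)] roof_of_mor[OF *(4)]
      by simp
    then show "\<exists>P i j p q. is_biproduct B X Y P i j p q" by blast
  qed
qed

lemma additive_functor_Q: "additive_functor A B Q"
proof -
  interpret B: additive_category B by (rule additive_B)
  show ?thesis
  proof
    show "AMap Q \<in> hom (Hom A X Y) (Hom B (OMap Q X) (OMap Q Y))" if "X \<in> Obj A" "Y \<in> Obj A" for X Y
      using that roof_of_mor roof_of_add unfolding hom_def
      by (simp add: carrier_B_iff carrier_Hom_iff)
  qed (use roof_of_comp in auto)
qed

text \<open>The equivalence demanded by the definition is the identity functor of the
  quotient.\<close>

lemma is_serre_quotient_B:
  assumes "serre_subcategory A S"
  shows "is_serre_quotient A S B Q"
proof -
  interpret B: additive_category B by (rule additive_B)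
  have "naturally_isomorphic A B Q Q"
    by (rule B.naturally_isomorphic_refl) (use additive_functor_mor[OF additive_functor_Q] in auto)
  then show ?thesis
    unfolding is_serre_quotient_def using assms additive_functor_Q is_equivalence_id[OF additive_B]
    by (intro conjI exI[of _ id_functor]) simp_all
qed

end

section \<open>Closed objects and the right adjoint of the quotient functor\<close>

lemma additive_functor_comp:
  assumes "additive_functor A B F" "additive_functor B D G"
  shows "additive_functor A D (comp_functor G F)"
proof -
  interpret F: additive_functor A B F by fact
  interpret G: additive_functor B D G by fact
  note m = additive_functor_mor[OF assms(1)]
  show ?thesis
  proof
    show "AMap (comp_functor G F) \<in> hom (Hom A X Y) (Hom D (OMap (comp_functor G F) X) (OMap (comp_functor G F) Y))"
      if "X \<in> Obj A" "Y \<in> Obj A" for X Y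
      using Group.hom_compose[OF F.arr[OF that] G.arr[OF F.obj F.obj]] that
      by (simp add: comp_functor_def)
    show "AMap (comp_functor G F) (g \<cdot>\<^bsub>A\<^esub> f) = AMap (comp_functor G F) g \<cdot>\<^bsub>D\<^esub> AMap (comp_functor G F) f"
      if "f \<in> mor A X Y" "g \<in> mor A Y Z" for f g X Y Z
      using F.compose[OF that] G.compose[OF m[OF that(1)] m[OF that(2)]]
      by (simp add: comp_functor_def)
  qed (simp_all add: comp_functor_def F.obj G.obj F.ident G.ident)
qed

lemma (in additive_category) additive_functor_inclusion:
  assumes "T \<subseteq> Obj C" "additive_category (full_subcategory C T)"
  shows "additive_functor (full_subcategory C T) C id_functor"
proof -
  interpret T: additive_category "full_subcategory C T" by fact
  show ?thesis
    by unfold_locales (use assms(1) in \<open>auto simp: hom_def\<close>)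
qed

text \<open>A Serre subcategory is closed under extensions, so by this sequence it contains the
  biproducts of its objects and is itself additive.\<close>

lemma (in preadditive_category) biproduct_short_exact:
  assumes "is_biproduct C X Y P i j p q"
  shows "short_exact C X P Y i q"
proof -
  have *: "i \<in> mor C X P" "j \<in> mor C Y P" "p \<in> mor C P X" "q \<in> mor C P Y"
     "p \<cdot> i = Idt C X" "q \<cdot> j = Idt C Y" "p \<cdot> j = \<one>\<^bsub>Hom C Y X\<^esub>" "q \<cdot> i = \<one>\<^bsub>Hom C X Y\<^esub>"
     "(i \<cdot> p) \<otimes>\<^bsub>Hom C P P\<^esub> (j \<cdot> q) = Idt C P" using assms unfolding is_biproduct_def by auto
  note [simp] = *(1-4)[THEN mor_arr]
  have O: "X \<in> Obj C" "Y \<in> Obj C" "P \<in> Obj C" using * mor_Obj by blast+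
  show ?thesis
    unfolding short_exact_def is_kernel_def is_cokernel_def
  proof (intro conjI allI ballI impI *(1,4,8))
    fix V h assume h: "h \<in> mor C V P" "q \<cdot> h = \<one>\<^bsub>Hom C V Y\<^esub>"
    note [simp] = h(1)[THEN mor_arr]
    have V: "V \<in> Obj C" using h mor_Obj by blast
    have "h = ((i \<cdot> p) \<otimes>\<^bsub>Hom C P P\<^esub> (j \<cdot> q)) \<cdot> h" unfolding *(9) using O by simp
    also have "\<dots> = i \<cdot> p \<cdot> h" using h(2) V by (simp add: add_simps)
    finally have e: "i \<cdot> p \<cdot> h = h" ..
    show "\<exists>!u. u \<in> mor C V X \<and> i \<cdot> u = h"
    proof (rule ex1I[of _ "p \<cdot> h"])
      fix u assume u: "u \<in> mor C V X \<and> i \<cdot> u = h"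
      then have "p \<cdot> h = (p \<cdot> i) \<cdot> u" using mor_arr[of u V X] by auto
      then show "u = p \<cdot> h" using u mor_arr[of u V X] by (simp add: *(5))
    qed (simp add: e mor_iff)
  next
    fix V h assume h: "h \<in> mor C P V" "h \<cdot> i = \<one>\<^bsub>Hom C X V\<^esub>"
    note [simp] = h(1)[THEN mor_arr]
    have V: "V \<in> Obj C" using h mor_Obj by blast
    have z: "h \<cdot> i \<cdot> p = \<one>\<^bsub>Hom C P V\<^esub>" using h(2)[THEN comp_eq_ext1, of p] V by simp
    have "h = h \<cdot> ((i \<cdot> p) \<otimes>\<^bsub>Hom C P P\<^esub> (j \<cdot> q))" unfolding *(9) using O by simp
    also have "\<dots> = h \<cdot> j \<cdot> q" using V by (simp add: add_simps z)
    finally have e: "h \<cdot> j \<cdot> q = h" ..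
    show "\<exists>!u. u \<in> mor C Y V \<and> u \<cdot> q = h"
    proof (rule ex1I[of _ "h \<cdot> j"])
      fix u assume u: "u \<in> mor C Y V \<and> u \<cdot> q = h"
      then have "h \<cdot> j = u \<cdot> (q \<cdot> j)" using mor_arr[of u Y V] by auto
      then show "u = h \<cdot> j" using u mor_arr[of u Y V] by (simp add: *(6))
    qed (simp add: e mor_iff)
  qed
qed

section \<open>Objects local with respect to the denominators\<close>

context right_fractions
begin

definition closed_objects :: "'o set" where
  "closed_objects = {L \<in> Obj A. \<forall>G H. \<forall>s\<in>W G H. \<forall>\<psi>\<in>mor A G L. \<exists>!\<phi>. \<phi> \<in> mor A H L \<and> \<phi> \<cdot> s = \<psi>}"

abbreviation closed_cat :: "('o, 'm) cat" where
  "closed_cat \<equiv> full_subcategory A closed_objects"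

lemma closed_Obj: "L \<in> closed_objects \<Longrightarrow> L \<in> Obj A"
  by (simp add: closed_objects_def)

lemma closed_sub: "closed_objects \<subseteq> Obj A"
  by (auto simp: closed_objects_def)

lemma closed_ext:
  assumes "L \<in> closed_objects" "s \<in> W G H" "\<psi> \<in> mor A G L"
  obtains \<phi> where "\<phi> \<in> mor A H L" "\<phi> \<cdot> s = \<psi>"
  using assms unfolding closed_objects_def by blast

lemma closed_uniq:
  assumes "L \<in> closed_objects" "s \<in> W G H" "\<phi> \<in> mor A H L" "\<phi>' \<in> mor A H L" "\<phi> \<cdot> s = \<phi>' \<cdot> s"
  shows "\<phi> = \<phi>'"
proof -
  have "\<phi> \<cdot> s \<in> mor A G L" using comp_mor W_mor assms by blast
  then have "\<exists>!\<theta>. \<theta> \<in> mor A H L \<and> \<theta> \<cdot> s = \<phi> \<cdot> s"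
    using assms unfolding closed_objects_def by blast
  with assms show ?thesis by metis
qed

lemma additive_closed: "additive_category closed_cat"
proof -
  obtain Z where Z: "is_zero_object A Z" using has_zero_object by blast
  have ZO: "Z \<in> Obj A" using Z zero_object_iff by blast
  have "Z \<in> closed_objects"
    unfolding closed_objects_def
  proof (intro CollectI conjI allI ballI ZO)
    fix G H s \<psi> assume *: "s \<in> W G H" "\<psi> \<in> mor A G Z"
    then have H: "H \<in> Obj A" using mor_Obj W_mor by blast
    let ?z = "\<one>\<^bsub>Hom A H Z\<^esub>"
    have z: "?z \<in> mor A H Z" using H ZO by (simp add: mor_iff)
    have "?z \<cdot> s \<in> mor A G Z" using comp_mor[OF W_mor[OF *(1)] z] .
    then have "?z \<cdot> s = \<psi>" using zero_object_mor(1)[OF Z] *(2) by metis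
    then show "\<exists>!\<phi>. \<phi> \<in> mor A H Z \<and> \<phi> \<cdot> s = \<psi>"
      using z zero_object_mor(1)[OF Z] by metis
  qed
  with closed_sub Z show ?thesis
  proof (rule additive_full)
    fix X Y P i j p q
    assume XY: "X \<in> closed_objects" "Y \<in> closed_objects" and b: "is_biproduct A X Y P i j p q"
    have *: "i \<in> mor A X P" "j \<in> mor A Y P" "p \<in> mor A P X" "q \<in> mor A P Y"
     "(i \<cdot> p) \<otimes>\<^bsub>Hom A P P\<^esub> (j \<cdot> q) = Idt A P" using b unfolding is_biproduct_def by auto
    note [simp] = *(1-4)[THEN mor_arr]
    have O: "X \<in> Obj A" "Y \<in> Obj A" "P \<in> Obj A" using * mor_Obj by blast+
    \<comment> \<open>A morphism into the biproduct is recovered from its two components, so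
      extensions along \<open>s\<close> exist and are unique as soon as they do
      componentwise.\<close>
    have dec: "f = (i \<cdot> p \<cdot> f) \<otimes>\<^bsub>Hom A V P\<^esub> (j \<cdot> q \<cdot> f)" if f: "f \<in> mor A V P" for f V
    proof -
      have "f = ((i \<cdot> p) \<otimes>\<^bsub>Hom A P P\<^esub> (j \<cdot> q)) \<cdot> f" unfolding *(5) using O mor_arr[OF f] by simp
      also have "\<dots> = (i \<cdot> p \<cdot> f) \<otimes>\<^bsub>Hom A V P\<^esub> (j \<cdot> q \<cdot> f)" using mor_arr[OF f] by simp
      finally show ?thesis .
    qed
    show "P \<in> closed_objects"
      unfolding closed_objects_def
    proof (intro CollectI conjI allI ballI O)
      fix G H s \<psi> assume s: "s \<in> W G H" and \<psi>: "\<psi> \<in> mor A G P"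
      note [simp] = s[THEN W_arr] \<psi>[THEN mor_arr]
      have m: "p \<cdot> \<psi> \<in> mor A G X" "q \<cdot> \<psi> \<in> mor A G Y" by (simp_all add: mor_iff)
      obtain a where a: "a \<in> mor A H X" "a \<cdot> s = p \<cdot> \<psi>" using closed_ext[OF XY(1) s m(1)] .
      obtain b where b: "b \<in> mor A H Y" "b \<cdot> s = q \<cdot> \<psi>" using closed_ext[OF XY(2) s m(2)] .
      note [simp] = a(1)[THEN mor_arr] b(1)[THEN mor_arr]
      let ?f = "(i \<cdot> a) \<otimes>\<^bsub>Hom A H P\<^esub> (j \<cdot> b)"
      have f: "?f \<in> mor A H P" "?f \<cdot> s = \<psi>"
        using dec[OF \<psi>] by (simp_all add: mor_iff a b)
      show "\<exists>!\<phi>. \<phi> \<in> mor A H P \<and> \<phi> \<cdot> s = \<psi>"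
      proof (rule ex1I[of _ ?f])
        fix g assume g: "g \<in> mor A H P \<and> g \<cdot> s = \<psi>"
        then have gm: "g \<in> mor A H P" and gs: "g \<cdot> s = \<psi>" by auto
        note [simp] = gm[THEN mor_arr]
        have "p \<cdot> g = a"
          by (rule closed_uniq[OF XY(1) s _ a(1)]) (simp_all add: mor_iff gs a(2))
        moreover have "q \<cdot> g = b"
          by (rule closed_uniq[OF XY(2) s _ b(1)]) (simp_all add: mor_iff gs b(2))
        ultimately show "g = ?f" using dec[OF gm] by simp
      qed (use f in simp)
    qed
  qed
qed

text \<open>The numerator of a roof into a closed object extends along its denominator, so the
  denominator can be removed. Together with \<open>closed_faithful\<close> this makes
  \<open>Q\<close> bijective on morphisms into closed objects.\<close>

lemma closed_full:
  assumes "L \<in> closed_objects" "b \<in> mor B X L"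
  obtains f where "f \<in> mor A X L" "b = roof_of A S f"
proof -
  obtain X1 s g where sg: "s \<in> W X1 X" "g \<in> mor A X1 L" "b = roof_class X L s g"
    using assms(2) unfolding mor_B_iff by blast
  obtain f where f: "f \<in> mor A X L" "f \<cdot> s = g" using closed_ext[OF assms(1) sg(1,2)] .
  with roof_of_refine[OF f(1) sg(1)] sg(3) that show ?thesis by simp
qed

lemma closed_faithful:
  assumes "L \<in> closed_objects" "f \<in> mor A X L" "g \<in> mor A X L" "roof_of A S f = roof_of A S g"
  shows "f = g"
proof -
  obtain P u where "u \<in> W P X" "f \<cdot> u = g \<cdot> u" using roof_of_eqD[OF assms(2-4)] .
  then show ?thesis using closed_uniq[OF assms(1) _ assms(2,3)] by blast
qed

text \<open>By adjunction, Hom into \<open>OMap R Y\<close> is a Hom of the quotient precomposed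
  with \<open>Q\<close>, so it inverts \<open>W\<close>: the values of \<open>R\<close> are closed.
  A triangle identity makes the counit \<epsilon> a left inverse of the image of the unit
  \<open>n\<close>. The other composite is an endomorphism of a closed object in the quotient;
  \<open>closed_full\<close> lifts it to \<open>A\<close>, where the adjunction identifies it with
  the identity.\<close>

lemma adjoint_unit:
  assumes "has_right_adjoint A B Q" "X \<in> Obj A"
  obtains L n where "L \<in> closed_objects" "n \<in> mor A X L" "is_iso B X L (roof_of A S n)"
proof -
  interpret B: additive_category B by (rule additive_B)
  obtain R \<phi> where R: "additive_functor B A R"
    and bij: "\<And>X Y. X \<in> Obj A \<Longrightarrow> Y \<in> Obj A \<Longrightarrow> bij_betw (\<phi> X Y) (mor B X Y) (mor A X (OMap R Y))"
    and nat: "\<And>X' X Y Y' a b h. a \<in> mor A X' X \<Longrightarrow> b \<in> mor B Y Y' \<Longrightarrow> h \<in> mor B X Y \<Longrightarrow>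
       \<phi> X' Y' (b \<cdot>\<^bsub>B\<^esub> (h \<cdot>\<^bsub>B\<^esub> roof_of A S a)) = AMap R b \<cdot> (\<phi> X Y h \<cdot> a)"
    using assms(1) unfolding has_right_adjoint_def is_right_adjoint_def Q_simps id_apply B_simps(1)
    by blast
  interpret R: additive_functor B A R by (rule R)
  have RO: "OMap R Y \<in> Obj A" if "Y \<in> Obj A" for Y using R.obj that by simp
  have \<phi>m: "\<phi> X Y h \<in> mor A X (OMap R Y)" if "h \<in> mor B X Y" for X Y h
    using bij[of X Y] that B.mor_Obj[OF that] by (auto simp: bij_betw_def)
  have \<phi>inj: "h = h'" if "h \<in> mor B X Y" "h' \<in> mor B X Y" "\<phi> X Y h = \<phi> X Y h'" for X Y h h'
    using bij[of X Y] that B.mor_Obj[OF that(1)] by (auto simp: bij_betw_def inj_on_def)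
  have \<phi>surj: "\<exists>h. h \<in> mor B X Y \<and> \<phi> X Y h = f" if "f \<in> mor A X (OMap R Y)" "Y \<in> Obj A" for X Y f
  proof -
    have "f \<in> \<phi> X Y ` mor B X Y"
      using bij[of X Y] that mor_Obj[OF that(1)] by (simp add: bij_betw_def)
    then show ?thesis by blast
  qed
  have nat1: "\<phi> X' Y (h \<cdot>\<^bsub>B\<^esub> roof_of A S a) = \<phi> X Y h \<cdot> a"
    if "a \<in> mor A X' X" "h \<in> mor B X Y" for X' X Y a h
  proof -
    have Y: "Y \<in> Obj A" using B.mor_Obj(2)[OF that(2)] by simp
    have m: "h \<cdot>\<^bsub>B\<^esub> roof_of A S a \<in> mor B X' Y"
      using B.comp_mor[OF roof_of_mor[OF that(1)] that(2)] .
    have "Idt B Y \<in> mor B Y Y" using B.id_mor Y by simp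
    from nat[OF that(1) this that(2)]
    have "\<phi> X' Y (h \<cdot>\<^bsub>B\<^esub> roof_of A S a) = AMap R (Idt B Y) \<cdot> (\<phi> X Y h \<cdot> a)"
      using B.comp_id_left[OF m] by simp
    also have "\<dots> = \<phi> X Y h \<cdot> a"
      using R.ident[of Y] Y comp_id_left[OF comp_mor[OF that(1) \<phi>m[OF that(2)]]] by simp
    finally show ?thesis .
  qed
  have closed: "OMap R Y \<in> closed_objects" if Y: "Y \<in> Obj A" for Y
    unfolding closed_objects_def
  proof (intro CollectI conjI allI ballI RO[OF Y])
    fix G H s \<psi> assume s: "s \<in> W G H" and \<psi>: "\<psi> \<in> mor A G (OMap R Y)"
    obtain t where t: "t \<in> mor B H G" "t \<cdot>\<^bsub>B\<^esub> roof_of A S s = Idt B G" "roof_of A S s \<cdot>\<^bsub>B\<^esub> t = Idt B H"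
      using is_iso_roof_of[OF s] unfolding is_iso_def by blast
    have sm: "roof_of A S s \<in> mor B G H" using roof_of_mor W_mor s by blast
    obtain h where h: "h \<in> mor B G Y" "\<phi> G Y h = \<psi>" using \<phi>surj[OF \<psi> Y] by blast
    \<comment> \<open>Composition with the inverse \<open>t\<close> of the image of \<open>s\<close>
      extends \<open>h\<close> along \<open>s\<close> in the quotient; the adjunction transports
      this extension to \<open>A\<close>.\<close>
    have hs: "(h \<cdot>\<^bsub>B\<^esub> t) \<cdot>\<^bsub>B\<^esub> roof_of A S s = h"
      using B.comp_assoc[OF sm t(1) h(1)] t(2) B.comp_id_right[OF h(1)] by simp
    have ht: "h \<cdot>\<^bsub>B\<^esub> t \<in> mor B H Y" using B.comp_mor[OF t(1) h(1)] .
    show "\<exists>!f. f \<in> mor A H (OMap R Y) \<and> f \<cdot> s = \<psi>"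
    proof (rule ex1I[of _ "\<phi> H Y (h \<cdot>\<^bsub>B\<^esub> t)"])
      show "\<phi> H Y (h \<cdot>\<^bsub>B\<^esub> t) \<in> mor A H (OMap R Y) \<and> \<phi> H Y (h \<cdot>\<^bsub>B\<^esub> t) \<cdot> s = \<psi>"
        using \<phi>m[OF ht] nat1[OF W_mor[OF s] ht] hs h(2) by simp
      fix f assume f: "f \<in> mor A H (OMap R Y) \<and> f \<cdot> s = \<psi>"
      then obtain k where k: "k \<in> mor B H Y" "\<phi> H Y k = f" using \<phi>surj[OF _ Y] by blast
      have ks: "k \<cdot>\<^bsub>B\<^esub> roof_of A S s \<in> mor B G Y" using B.comp_mor[OF sm k(1)] .
      have "\<phi> G Y (k \<cdot>\<^bsub>B\<^esub> roof_of A S s) = \<phi> G Y h"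
        using nat1[OF W_mor[OF s] k(1)] k(2) f h(2) by simp
      then have "k \<cdot>\<^bsub>B\<^esub> roof_of A S s = h" using \<phi>inj[OF ks h(1)] by blast
      then have "k = h \<cdot>\<^bsub>B\<^esub> t"
        using B.comp_assoc[OF t(1) sm k(1)] t(3) B.comp_id_right[OF k(1)] by simp
      then show "f = \<phi> H Y (h \<cdot>\<^bsub>B\<^esub> t)" using k(2) by simp
    qed
  qed
  let ?L = "OMap R X"
  have L: "?L \<in> closed_objects" "?L \<in> Obj A" using closed RO assms(2) by auto
  have iX: "Idt B X \<in> mor B X X" using B.id_mor assms(2) by simp
  define n where "n = \<phi> X X (Idt B X)"
  have n: "n \<in> mor A X ?L" unfolding n_def using \<phi>m iX by blast
  obtain \<epsilon> where \<epsilon>: "\<epsilon> \<in> mor B ?L X" "\<phi> ?L X \<epsilon> = Idt A ?L"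
    using \<phi>surj[OF id_mor[OF L(2)] assms(2)] by blast
  have qn: "roof_of A S n \<in> mor B X ?L" using roof_of_mor[OF n] .
  have en: "\<epsilon> \<cdot>\<^bsub>B\<^esub> roof_of A S n = Idt B X"
    using \<phi>inj[OF B.comp_mor[OF qn \<epsilon>(1)] iX] nat1[OF n \<epsilon>(1)] \<epsilon>(2) comp_id_left[OF n] n_def
    by simp
  \<comment> \<open>Composing \<epsilon> with the image of \<open>e\<close> gives \<epsilon> again,
    by the identity \<open>en\<close>. Since the adjunction sends \<epsilon> to the identity of
    \<open>?L\<close>, it turns this equation into the statement that \<open>e\<close> is the
    identity.\<close>
  obtain e where e: "e \<in> mor A ?L ?L" "roof_of A S n \<cdot>\<^bsub>B\<^esub> \<epsilon> = roof_of A S e"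
    using closed_full[OF L(1) B.comp_mor[OF \<epsilon>(1) qn]] by blast
  have "\<epsilon> \<cdot>\<^bsub>B\<^esub> roof_of A S e = \<epsilon>"
    unfolding e(2)[symmetric]
    using B.comp_assoc[OF \<epsilon>(1) qn \<epsilon>(1)] en B.comp_id_left[OF \<epsilon>(1)] by simp
  then have "e = Idt A ?L" using nat1[OF e(1) \<epsilon>(1)] \<epsilon>(2) comp_id_left[OF e(1)] by simp
  then have "roof_of A S n \<cdot>\<^bsub>B\<^esub> \<epsilon> = Idt B ?L" using e(2) by simp
  then have "is_iso B X ?L (roof_of A S n)" unfolding is_iso_def using qn \<epsilon>(1) en by blast
  with L(1) n that show ?thesis by blast
qed

end

section \<open>Reflection onto closed objects and coreflection onto the Serre subcategory\<close>

locale saturated_fractions = right_fractions +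
  assumes serre: "serre_subcategory A S"
    and W_saturated: "f \<in> mor A X Y \<Longrightarrow> is_iso (serre_quotient A S) X Y (roof_of A S f) \<Longrightarrow>
      f \<in> quot_inv A S X Y"
begin

text \<open>The morphism from \<open>D\<close> to a zero object has kernel \<open>D\<close> and zero
  cokernel, so it lies in \<open>W\<close>; hence \<open>f\<close> extends over the zero
  object.\<close>

lemma closed_from_S:
  assumes "L \<in> closed_objects" "D \<in> S" "f \<in> mor A D L"
  shows "f = \<one>\<^bsub>Hom A D L\<^esub>"
proof -
  obtain Z where Z: "Z \<in> S" "is_zero_object A Z" using serre unfolding serre_subcategory_def by blast
  have O: "D \<in> Obj A" "Z \<in> Obj A" "L \<in> Obj A"
    using assms Z mor_Obj zero_object_iff by blast+
  let ?z = "\<one>\<^bsub>Hom A D Z\<^esub>"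
  have z: "?z \<in> mor A D Z" using O by (simp add: mor_iff)
  have "is_kernel A D D Z (Idt A D) ?z"
    unfolding is_kernel_def using O by (auto simp: mor_iff)
  moreover have "is_cokernel A D Z Z ?z (Idt A Z)"
    unfolding is_cokernel_def using O by (auto simp: mor_iff)
  ultimately have "?z \<in> W D Z" unfolding quot_inv_def using z Z assms by blast
  from closed_ext[OF assms(1) this assms(3)] obtain g where g: "g \<in> mor A Z L" "g \<cdot> ?z = f" .
  then show ?thesis using mor_arr[OF g(1)] O by simp
qed

text \<open>The coreflection of \<open>X\<close> is the kernel of its unit \<open>n\<close>. It lies
  in \<open>S\<close> because \<open>n\<close> is in \<open>W\<close>, and a morphism from an object
  of \<open>S\<close> to \<open>X\<close> becomes zero in the closed object \<open>L\<close>, so it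
  factors uniquely through this kernel.\<close>

lemma coreflection:
  assumes refl: "\<And>X. X \<in> Obj A \<Longrightarrow> \<exists>L\<in>closed_objects. \<exists>n. n \<in> W X L"
  shows "has_right_adjoint (full_subcategory A S) A id_functor"
proof -
  have S: "S \<subseteq> Obj A" using serre by (simp add: serre_subcategory_def)
  obtain Z where "Z \<in> S" "is_zero_object A Z" using serre unfolding serre_subcategory_def by blast
  then have addS: "additive_category (full_subcategory A S)"
    using biproduct_short_exact serre unfolding serre_subcategory_def
    by (intro additive_full[OF S]) blast+
  have "\<exists>K k. K \<in> S \<and> k \<in> mor A K X \<and>
      (\<forall>D h. D \<in> S \<longrightarrow> h \<in> mor A D X \<longrightarrow> (\<exists>!u. u \<in> mor A D K \<and> k \<cdot> u = h))" if X: "X \<in> Obj A" for X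
  proof -
    obtain L n where L: "L \<in> closed_objects" "n \<in> W X L" using refl[OF X] by blast
    then obtain K k where k: "K \<in> S" "is_kernel A K X L k n" unfolding quot_inv_def by blast
    have "n \<cdot> h = \<one>\<^bsub>Hom A D L\<^esub>" if "D \<in> S" "h \<in> mor A D X" for D h
      by (rule closed_from_S[OF L(1) that(1)]) (use comp_mor W_mor L that in blast)
    then show ?thesis using k unfolding is_kernel_def by blast
  qed
  then have "\<forall>X\<in>Obj A. \<exists>Kk. fst Kk \<in> S \<and> snd Kk \<in> mor A (fst Kk) X \<and>
      (\<forall>D h. D \<in> S \<longrightarrow> h \<in> mor A D X \<longrightarrow> (\<exists>!u. u \<in> mor A D (fst Kk) \<and> snd Kk \<cdot> u = h))"
    by simp
  then obtain Kk where Kk: "\<forall>X\<in>Obj A. fst (Kk X) \<in> S \<and> snd (Kk X) \<in> mor A (fst (Kk X)) X \<and>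
      (\<forall>D h. D \<in> S \<longrightarrow> h \<in> mor A D X \<longrightarrow> (\<exists>!u. u \<in> mor A D (fst (Kk X)) \<and> snd (Kk X) \<cdot> u = h))"
    by (rule bchoice[THEN exE])
  define K where "K X = fst (Kk X)" for X
  define k where "k X = snd (Kk X)" for X
  have K: "K X \<in> S" "k X \<in> mor A (K X) X" if "X \<in> Obj A" for X
    using Kk that by (auto simp: K_def k_def)
  have ex: "\<exists>!u. u \<in> mor A D (K X) \<and> k X \<cdot> u = h" if "D \<in> S" "h \<in> mor A D X" for X D h
    using Kk that mor_Obj by (auto simp: K_def k_def)
  define lift where "lift X D h = (THE u. u \<in> mor A D (K X) \<and> k X \<cdot> u = h)" for X D h
  have lift: "lift X D h \<in> mor A D (K X)" "k X \<cdot> lift X D h = h"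
    if "D \<in> S" "h \<in> mor A D X" for X D h
    using theI'[OF ex[OF that]] by (auto simp: lift_def)
  have uniq: "u = v" if "u \<in> mor A D (K X)" "v \<in> mor A D (K X)" "k X \<cdot> u = k X \<cdot> v" "D \<in> S" "X \<in> Obj A"
    for u v D X
    using ex[of D "k X \<cdot> v" X] that comp_mor[OF that(2) K(2)] by blast
  \<comment> \<open>The value on \<open>f\<close> is the factorization of \<open>f\<close> composed
    with the counit \<open>k\<close>. Each functor law then follows from \<open>uniq\<close>,
    because both sides agree after composition with \<open>k\<close>.\<close>
  define R where "R = \<lparr>OMap = K, AMap = (\<lambda>f. lift (tgt f) (K (src f)) (f \<cdot> k (src f)))\<rparr>"
  have R: "AMap R f \<in> mor A (K X) (K Y)" "k Y \<cdot> AMap R f = f \<cdot> k X" if "f \<in> mor A X Y" for f X Y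
    using lift[OF K(1) comp_mor[OF K(2) that]] mor_Obj[OF that] mor_arr[OF that]
    by (simp_all add: R_def)
  have RO [simp]: "OMap R = K" by (simp add: R_def)
  interpret AS: additive_category "full_subcategory A S" by (rule addS)
  have addR: "additive_functor A (full_subcategory A S) R"
  proof
    show "OMap R X \<in> Obj (full_subcategory A S)" if "X \<in> Obj A" for X using K that by simp
    show "AMap R (Idt A X) = Idt (full_subcategory A S) (OMap R X)" if "X \<in> Obj A" for X
    proof -
      have KO: "K X \<in> Obj A" using K that S by blast
      show ?thesis
        using uniq[OF R(1)[OF id_mor[OF that]] id_mor[OF KO] _ K(1)] R(2)[OF id_mor[OF that]]
          mor_arr[OF K(2)[OF that]] that by simp
    qed
    show "AMap R \<in> hom (Hom A X Y) (Hom (full_subcategory A S) (OMap R X) (OMap R Y))"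
      if O: "X \<in> Obj A" "Y \<in> Obj A" for X Y
    proof (rule homI)
      have KO: "K X \<in> Obj A" "K Y \<in> Obj A" using K O S by blast+
      fix f assume "f \<in> carrier (Hom A X Y)"
      then have f: "f \<in> mor A X Y" using O by (simp add: carrier_Hom_iff)
      then show "AMap R f \<in> carrier (Hom (full_subcategory A S) (OMap R X) (OMap R Y))"
        using R(1) mor_carrier by simp
      fix g assume "g \<in> carrier (Hom A X Y)"
      then have g: "g \<in> mor A X Y" using O by (simp add: carrier_Hom_iff)
      have fg: "f \<otimes>\<^bsub>Hom A X Y\<^esub> g \<in> mor A X Y" using f g by (simp add: mor_iff)
      note [simp] = mor_arr[OF R(1)[OF f]] mor_arr[OF R(1)[OF g]] mor_arr[OF f] mor_arr[OF g]
        mor_arr[OF K(2)[OF O(1)]] mor_arr[OF K(2)[OF O(2)]]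
      show "AMap R (f \<otimes>\<^bsub>Hom A X Y\<^esub> g) =
        AMap R f \<otimes>\<^bsub>Hom (full_subcategory A S) (OMap R X) (OMap R Y)\<^esub> AMap R g"
        by (rule uniq[OF R(1)[OF fg] _ _ K(1)[OF O(1)] O(2)])
          (simp_all add: mor_iff R(2)[OF f] R(2)[OF g] R(2)[OF fg])
    qed
    show "AMap R (g \<cdot> f) = AMap R g \<cdot>\<^bsub>full_subcategory A S\<^esub> AMap R f"
      if f: "f \<in> mor A X Y" and g: "g \<in> mor A Y Z" for f g X Y Z
    proof -
      have O: "X \<in> Obj A" "Y \<in> Obj A" "Z \<in> Obj A" using f g mor_Obj by blast+
      note [simp] = mor_arr[OF R(1)[OF f]] mor_arr[OF R(1)[OF g]] mor_arr[OF f] mor_arr[OF g]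
        mor_arr[OF K(2)[OF O(1)]] mor_arr[OF K(2)[OF O(2)]] mor_arr[OF K(2)[OF O(3)]]
      have "AMap R (g \<cdot> f) = AMap R g \<cdot> AMap R f"
        by (rule uniq[OF R(1)[OF comp_mor[OF f g]] _ _ K(1)[OF O(1)] O(3)])
          (simp_all add: mor_iff R(2)[OF f] R(2)[OF comp_mor[OF f g]] R(2)[OF g, THEN comp_eq_ext])
      then show ?thesis by simp
    qed
  qed
  have "is_right_adjoint (full_subcategory A S) A id_functor R"
    unfolding is_right_adjoint_def
  proof (intro conjI exI[of _ "\<lambda>D X h. lift X D h"] ballI allI addR)
    show "additive_functor (full_subcategory A S) A id_functor"
      by (rule additive_functor_inclusion[OF S addS])
    fix D X assume D: "D \<in> Obj (full_subcategory A S)" and X: "X \<in> Obj A"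
    show "bij_betw (lift X D) (mor A (OMap id_functor D) X) (mor (full_subcategory A S) D (OMap R X))"
    proof (rule bij_betw_byWitness[where f' = "\<lambda>u. k X \<cdot> u"])
      show "\<forall>h\<in>mor A (OMap id_functor D) X. k X \<cdot> lift X D h = h" using lift D by simp
      show "\<forall>u\<in>mor (full_subcategory A S) D (OMap R X). lift X D (k X \<cdot> u) = u"
        using uniq[OF lift(1) _ lift(2)] D X K(2)[OF X] comp_mor S by auto
      show "lift X D ` mor A (OMap id_functor D) X \<subseteq> mor (full_subcategory A S) D (OMap R X)"
        using lift D K X S by auto
      show "(\<cdot>) (k X) ` mor (full_subcategory A S) D (OMap R X) \<subseteq> mor A (OMap id_functor D) X"
        using S comp_mor[OF _ K(2)[OF X]] by auto
    qed
  next
    fix D' D X X' a b h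
    assume a: "a \<in> mor (full_subcategory A S) D' D" and b: "b \<in> mor A X X'"
      and h: "h \<in> mor A (OMap id_functor D) X"
    have a: "a \<in> mor A D' D" "D' \<in> S" "D \<in> S" and h: "h \<in> mor A D X" using a h S by auto
    have O: "X \<in> Obj A" "X' \<in> Obj A" using b mor_Obj by blast+
    note [simp] = mor_arr[OF a(1)] mor_arr[OF b] mor_arr[OF h] mor_arr[OF lift(1)[OF a(3) h]]
      mor_arr[OF R(1)[OF b]] mor_arr[OF K(2)[OF O(1)]] mor_arr[OF K(2)[OF O(2)]]
    have m: "b \<cdot> h \<cdot> a \<in> mor A D' X'" by (simp add: mor_iff)
    have "lift X' D' (b \<cdot> h \<cdot> a) = AMap R b \<cdot> lift X D h \<cdot> a"
      by (rule uniq[OF lift(1)[OF a(2) m] _ _ a(2) O(2)])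
        (simp_all add: mor_iff lift(2)[OF a(2) m] R(2)[OF b, THEN comp_eq_ext]
          lift(2)[OF a(3) h, THEN comp_eq_ext1])
    then show "lift X' D' (b \<cdot> (h \<cdot> AMap id_functor a)) = AMap R b \<cdot>\<^bsub>full_subcategory A S\<^esub> (lift X D h \<cdot>\<^bsub>full_subcategory A S\<^esub> a)"
      by simp
  qed
  then show ?thesis unfolding has_right_adjoint_def by blast
qed

text \<open>Since \<open>Q\<close> is bijective on morphisms into closed objects, every morphism
  \<open>X -> Y\<close> of the quotient corresponds to a unique morphism \<open>L X -> L Y\<close>
  of \<open>A\<close> compatible with the units. This defines an equivalence \<open>E\<close> from
  the quotient to the closed objects. The reflector is \<open>E\<close> after \<open>Q\<close>, and
  its adjunction bijection is composition with the unit.\<close>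

lemma reflection:
  assumes refl: "\<And>X. X \<in> Obj A \<Longrightarrow> \<exists>L\<in>closed_objects. \<exists>n. n \<in> W X L"
  shows "\<exists>Q'. is_serre_quotient A S closed_cat Q' \<and> is_right_adjoint A closed_cat Q' id_functor"
proof -
  interpret B: additive_category B by (rule additive_B)
  interpret T: additive_category closed_cat by (rule additive_closed)
  have "\<forall>X\<in>Obj A. \<exists>Ln. fst Ln \<in> closed_objects \<and> snd Ln \<in> W X (fst Ln)" using refl by fastforce
  then obtain Ln where Ln: "\<forall>X\<in>Obj A. fst (Ln X) \<in> closed_objects \<and> snd (Ln X) \<in> W X (fst (Ln X))"
    by (rule bchoice[THEN exE])
  define L where "L X = fst (Ln X)" for X
  define n where "n X = snd (Ln X)" for X
  have L: "L X \<in> closed_objects" and nW: "n X \<in> W X (L X)" if "X \<in> Obj A" for X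
    using Ln that by (auto simp: L_def n_def)
  have n: "n X \<in> mor A X (L X)" if "X \<in> Obj A" for X using nW[OF that] W_mor by blast
  have qn: "roof_of A S (n X) \<in> mor B X (L X)" if "X \<in> Obj A" for X using roof_of_mor[OF n[OF that]] .
  have "\<forall>X\<in>Obj A. \<exists>m. m \<in> mor B (L X) X \<and> m \<cdot>\<^bsub>B\<^esub> roof_of A S (n X) = Idt B X \<and>
      roof_of A S (n X) \<cdot>\<^bsub>B\<^esub> m = Idt B (L X)"
    using is_iso_roof_of[OF nW] unfolding is_iso_def by blast
  then obtain m where "\<forall>X\<in>Obj A. m X \<in> mor B (L X) X \<and> m X \<cdot>\<^bsub>B\<^esub> roof_of A S (n X) = Idt B X \<and>
      roof_of A S (n X) \<cdot>\<^bsub>B\<^esub> m X = Idt B (L X)" by (rule bchoice[THEN exE])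
  then have m: "m X \<in> mor B (L X) X" "m X \<cdot>\<^bsub>B\<^esub> roof_of A S (n X) = Idt B X"
      "roof_of A S (n X) \<cdot>\<^bsub>B\<^esub> m X = Idt B (L X)" if "X \<in> Obj A" for X using that by blast+
  have ex: "\<exists>g. g \<in> mor A (L X) (L Y) \<and> roof_of A S g \<cdot>\<^bsub>B\<^esub> roof_of A S (n X) = roof_of A S (n Y) \<cdot>\<^bsub>B\<^esub> \<beta>"
    if \<beta>: "\<beta> \<in> mor B X Y" for \<beta> X Y
  proof -
    have O: "X \<in> Obj A" "Y \<in> Obj A" using B.mor_Obj[OF \<beta>] by simp_all
    note a = qn[OF O(1), THEN B.mor_arr] qn[OF O(2), THEN B.mor_arr] m(1)[OF O(1), THEN B.mor_arr]
      B.mor_arr[OF \<beta>]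
    have "roof_of A S (n Y) \<cdot>\<^bsub>B\<^esub> (\<beta> \<cdot>\<^bsub>B\<^esub> m X) \<in> mor B (L X) (L Y)"
      using a by (simp add: B.mor_iff del: B_simps)
    then obtain g where g: "g \<in> mor A (L X) (L Y)" "roof_of A S (n Y) \<cdot>\<^bsub>B\<^esub> (\<beta> \<cdot>\<^bsub>B\<^esub> m X) = roof_of A S g"
      using closed_full[OF L[OF O(2)]] by blast
    then show ?thesis using a m(2)[OF O(1)]
      by (intro exI[of _ g]) (simp add: g(2)[symmetric] del: B_simps(2-))
  qed
  have uniq: "g = g'" if "g \<in> mor A (L X) (L Y)" "g' \<in> mor A (L X) (L Y)" "X \<in> Obj A" "Y \<in> Obj A"
    "roof_of A S g \<cdot>\<^bsub>B\<^esub> roof_of A S (n X) = roof_of A S g' \<cdot>\<^bsub>B\<^esub> roof_of A S (n X)" for g g' X Y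
  proof (rule closed_uniq[OF L[OF that(4)] nW[OF that(3)] that(1,2)])
    show "g \<cdot> n X = g' \<cdot> n X"
      using closed_faithful[OF L[OF that(4)] comp_mor[OF n[OF that(3)] that(1)]
          comp_mor[OF n[OF that(3)] that(2)]] that(5)
        roof_of_comp[OF n[OF that(3)] that(1)] roof_of_comp[OF n[OF that(3)] that(2)] by simp
  qed
  \<comment> \<open>The choice is determined: by \<open>uniq\<close> at most one \<open>g\<close>
    satisfies the condition. The functor laws below are instances of this uniqueness.\<close>
  define E where "E = \<lparr>OMap = L, AMap = (\<lambda>\<beta>. SOME g. g \<in> mor A (L (B.src \<beta>)) (L (B.tgt \<beta>)) \<and>
    roof_of A S g \<cdot>\<^bsub>B\<^esub> roof_of A S (n (B.src \<beta>)) = roof_of A S (n (B.tgt \<beta>)) \<cdot>\<^bsub>B\<^esub> \<beta>)\<rparr>"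
  have EO [simp]: "OMap E = L" by (simp add: E_def)
  have E: "AMap E \<beta> \<in> mor A (L X) (L Y)"
    "roof_of A S (AMap E \<beta>) \<cdot>\<^bsub>B\<^esub> roof_of A S (n X) = roof_of A S (n Y) \<cdot>\<^bsub>B\<^esub> \<beta>"
    if \<beta>: "\<beta> \<in> mor B X Y" for \<beta> X Y
    using someI_ex[OF ex[OF \<beta>]] B.mor_arr[OF \<beta>] by (simp_all add: E_def)
  have Emor: "AMap E \<beta> \<in> mor closed_cat (L X) (L Y)" if \<beta>: "\<beta> \<in> mor B X Y" for \<beta> X Y
    using E(1)[OF \<beta>] L B.mor_Obj[OF \<beta>] closed_sub by simp
  have addE: "additive_functor B closed_cat E"
  proof
    show "OMap E X \<in> Obj closed_cat" if "X \<in> Obj B" for X using L that by simp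
    show "AMap E (Idt B X) = Idt closed_cat (OMap E X)" if "X \<in> Obj B" for X
    proof -
      have X: "X \<in> Obj A" using that by simp
      have LX: "L X \<in> Obj A" using L closed_Obj X by blast
      have "AMap E (Idt B X) = Idt A (L X)"
      proof (rule uniq[OF E(1)[OF B.id_mor[OF that]] id_mor[OF LX] X X])
        show "roof_of A S (AMap E (Idt B X)) \<cdot>\<^bsub>B\<^esub> roof_of A S (n X) =
          roof_of A S (Idt A (L X)) \<cdot>\<^bsub>B\<^esub> roof_of A S (n X)"
          using E(2)[OF B.id_mor[OF that]] B.comp_id_right[OF qn[OF X]] B.comp_id_left[OF qn[OF X]]
          by simp
      qed
      then show ?thesis by simp
    qed
    show "AMap E (b \<cdot>\<^bsub>B\<^esub> a) = AMap E b \<cdot>\<^bsub>closed_cat\<^esub> AMap E a"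
      if a: "a \<in> mor B X Y" and b: "b \<in> mor B Y Z" for a b X Y Z
    proof -
      have O: "X \<in> Obj A" "Y \<in> Obj A" "Z \<in> Obj A" using B.mor_Obj[OF a] B.mor_Obj[OF b] by simp_all
      note c = B.comp_mor[OF a b]
      have r: "roof_of A S (AMap E a) \<in> mor B (L X) (L Y)" "roof_of A S (AMap E b) \<in> mor B (L Y) (L Z)"
        using roof_of_mor[OF E(1)[OF a]] roof_of_mor[OF E(1)[OF b]] .
      have "AMap E (b \<cdot>\<^bsub>B\<^esub> a) = AMap E b \<cdot> AMap E a"
      proof (rule uniq[OF E(1)[OF c] comp_mor[OF E(1)[OF a] E(1)[OF b]] O(1,3)])
        have "roof_of A S (AMap E b \<cdot> AMap E a) \<cdot>\<^bsub>B\<^esub> roof_of A S (n X)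
            = roof_of A S (AMap E b) \<cdot>\<^bsub>B\<^esub> (roof_of A S (AMap E a) \<cdot>\<^bsub>B\<^esub> roof_of A S (n X))"
          using roof_of_comp[OF E(1)[OF a] E(1)[OF b]] B.comp_assoc[OF qn[OF O(1)] r] by simp
        also have "\<dots> = (roof_of A S (AMap E b) \<cdot>\<^bsub>B\<^esub> roof_of A S (n Y)) \<cdot>\<^bsub>B\<^esub> a"
          unfolding E(2)[OF a] using B.comp_assoc[OF a qn[OF O(2)] r(2)] by simp
        also have "\<dots> = roof_of A S (n Z) \<cdot>\<^bsub>B\<^esub> (b \<cdot>\<^bsub>B\<^esub> a)"
          unfolding E(2)[OF b] using B.comp_assoc[OF a b qn[OF O(3)]] by simp
        also have "\<dots> = roof_of A S (AMap E (b \<cdot>\<^bsub>B\<^esub> a)) \<cdot>\<^bsub>B\<^esub> roof_of A S (n X)" using E(2)[OF c] by simp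
        finally show "roof_of A S (AMap E (b \<cdot>\<^bsub>B\<^esub> a)) \<cdot>\<^bsub>B\<^esub> roof_of A S (n X) =
          roof_of A S (AMap E b \<cdot> AMap E a) \<cdot>\<^bsub>B\<^esub> roof_of A S (n X)" ..
      qed
      then show ?thesis by simp
    qed
    show "AMap E \<in> hom (Hom B X Y) (Hom closed_cat (OMap E X) (OMap E Y))"
      if "X \<in> Obj B" "Y \<in> Obj B" for X Y
    proof (rule homI)
      have O: "X \<in> Obj A" "Y \<in> Obj A" using that by simp_all
      fix a assume "a \<in> carrier (Hom B X Y)"
      then have a: "a \<in> mor B X Y" using O by (simp add: carrier_B_iff)
      then show "AMap E a \<in> carrier (Hom closed_cat (OMap E X) (OMap E Y))"
        using E(1) mor_carrier by simp
      fix b assume "b \<in> carrier (Hom B X Y)"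
      then have b: "b \<in> mor B X Y" using O by (simp add: carrier_B_iff)
      have c: "a \<otimes>\<^bsub>Hom B X Y\<^esub> b \<in> mor B X Y"
        using a b by (simp add: B.mor_iff del: B_simps)
      note Ea = E(1)[OF a] and Eb = E(1)[OF b]
      have Eab: "AMap E a \<otimes>\<^bsub>Hom A (L X) (L Y)\<^esub> AMap E b \<in> mor A (L X) (L Y)"
        using Ea Eb by (simp add: mor_iff)
      have "roof_of A S (AMap E a \<otimes>\<^bsub>Hom A (L X) (L Y)\<^esub> AMap E b) \<cdot>\<^bsub>B\<^esub> roof_of A S (n X) =
          (roof_of A S (AMap E a) \<otimes>\<^bsub>Hom B (L X) (L Y)\<^esub> roof_of A S (AMap E b)) \<cdot>\<^bsub>B\<^esub> roof_of A S (n X)"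
        using roof_of_add[OF Ea Eb] by simp
      also have "\<dots> = (roof_of A S (n Y) \<cdot>\<^bsub>B\<^esub> a) \<otimes>\<^bsub>Hom B X (L Y)\<^esub> (roof_of A S (n Y) \<cdot>\<^bsub>B\<^esub> b)"
        unfolding B.comp_add_left[OF qn[OF O(1)] roof_of_mor[OF Ea] roof_of_mor[OF Eb]] E(2)[OF a] E(2)[OF b] ..
      also have "\<dots> = roof_of A S (n Y) \<cdot>\<^bsub>B\<^esub> (a \<otimes>\<^bsub>Hom B X Y\<^esub> b)"
        using B.comp_add_right[OF a b qn[OF O(2)]] by simp
      finally have "roof_of A S (AMap E (a \<otimes>\<^bsub>Hom B X Y\<^esub> b)) \<cdot>\<^bsub>B\<^esub> roof_of A S (n X) =
          roof_of A S (AMap E a \<otimes>\<^bsub>Hom A (L X) (L Y)\<^esub> AMap E b) \<cdot>\<^bsub>B\<^esub> roof_of A S (n X)"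
        unfolding E(2)[OF c] ..
      from uniq[OF E(1)[OF c] Eab O this]
      show "AMap E (a \<otimes>\<^bsub>Hom B X Y\<^esub> b) = AMap E a \<otimes>\<^bsub>Hom closed_cat (OMap E X) (OMap E Y)\<^esub> AMap E b"
        by simp
    qed
  qed
  define Q' where "Q' = comp_functor E Q"
  have Q'O [simp]: "OMap Q' = L" and Q'A [simp]: "AMap Q' f = AMap E (roof_of A S f)" for f
    by (simp_all add: Q'_def comp_functor_def)
  have addQ': "additive_functor A closed_cat Q'"
    unfolding Q'_def by (rule additive_functor_comp[OF additive_functor_Q addE])
  have En: "AMap E (roof_of A S f) \<cdot> n X = n Y \<cdot> f" if f: "f \<in> mor A X Y" for f X Y
  proof -
    have O: "X \<in> Obj A" "Y \<in> Obj A" using mor_Obj f by blast+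
    show ?thesis
      using closed_faithful[OF L[OF O(2)] comp_mor[OF n[OF O(1)] E(1)[OF roof_of_mor[OF f]]] comp_mor[OF f n[OF O(2)]]]
        E(2)[OF roof_of_mor[OF f]] roof_of_comp[OF f n[OF O(2)]]
        roof_of_comp[OF n[OF O(1)] E(1)[OF roof_of_mor[OF f]]]
      by simp
  qed
  have adj: "is_right_adjoint A closed_cat Q' id_functor"
    unfolding is_right_adjoint_def
  proof (intro conjI exI[of _ "\<lambda>X Y h. h \<cdot> n X"] ballI allI addQ')
    show "additive_functor closed_cat A id_functor"
      by (rule additive_functor_inclusion[OF closed_sub additive_closed])
    fix X Y assume X: "X \<in> Obj A" and "Y \<in> Obj closed_cat"
    then have Y: "Y \<in> closed_objects" by simp
    show "bij_betw (\<lambda>h. h \<cdot> n X) (mor closed_cat (OMap Q' X) Y) (mor A X (OMap id_functor Y))"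
      unfolding bij_betw_def
    proof
      show "inj_on (\<lambda>h. h \<cdot> n X) (mor closed_cat (OMap Q' X) Y)"
        using closed_uniq[OF Y nW[OF X]] closed_sub by (auto simp: inj_on_def)
      show "(\<lambda>h. h \<cdot> n X) ` mor closed_cat (OMap Q' X) Y = mor A X (OMap id_functor Y)"
      proof
        show "(\<lambda>h. h \<cdot> n X) ` mor closed_cat (OMap Q' X) Y \<subseteq> mor A X (OMap id_functor Y)"
          using comp_mor[OF n[OF X]] closed_sub by auto
        show "mor A X (OMap id_functor Y) \<subseteq> (\<lambda>h. h \<cdot> n X) ` mor closed_cat (OMap Q' X) Y"
        proof
          fix f assume "f \<in> mor A X (OMap id_functor Y)"
          then have "f \<in> mor A X Y" by simp
          from closed_ext[OF Y nW[OF X] this] obtain g where "g \<in> mor A (L X) Y" "g \<cdot> n X = f" .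
          then show "f \<in> (\<lambda>h. h \<cdot> n X) ` mor closed_cat (OMap Q' X) Y"
            using Y L[OF X] closed_sub by (intro image_eqI[of _ _ g]) auto
        qed
      qed
    qed
  next
    fix X' X Y Y' a b h
    assume a: "a \<in> mor A X' X" and "b \<in> mor closed_cat Y Y'" "h \<in> mor closed_cat (OMap Q' X) Y"
    then have b: "b \<in> mor A Y Y'" and h: "h \<in> mor A (L X) Y" using closed_sub by auto
    have O: "X' \<in> Obj A" "X \<in> Obj A" using mor_Obj a by blast+
    note [simp] = mor_arr[OF a] mor_arr[OF b] mor_arr[OF h] mor_arr[OF n[OF O(1)]] mor_arr[OF n[OF O(2)]]
      mor_arr[OF E(1)[OF roof_of_mor[OF a]]]
    show "(b \<cdot>\<^bsub>closed_cat\<^esub> (h \<cdot>\<^bsub>closed_cat\<^esub> AMap Q' a)) \<cdot> n X' = AMap id_functor b \<cdot> ((h \<cdot> n X) \<cdot> a)"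
      by (simp add: En[OF a])
  qed
  have eq: "is_equivalence B closed_cat E"
    unfolding is_equivalence_def
  proof (intro conjI exI[of _ Q] addE)
    show addQ: "additive_functor closed_cat B Q"
      using additive_functor_comp[OF additive_functor_inclusion[OF closed_sub additive_closed] additive_functor_Q]
      by simp
    show "naturally_isomorphic B B (comp_functor Q E) id_functor"
      unfolding naturally_isomorphic_def
    proof (intro exI[of _ m] conjI ballI allI)
      fix X assume "X \<in> Obj B"
      then have X: "X \<in> Obj A" by simp
      then show "is_iso B (OMap (comp_functor Q E) X) (OMap id_functor X) (m X)"
        using m[OF X] qn[OF X] by (auto simp: is_iso_def comp_functor_def)
    next
      fix X Y f assume f: "f \<in> mor B X Y"
      then have O: "X \<in> Obj A" "Y \<in> Obj A" using B.mor_Obj[OF f] by simp_all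
      let ?g = "roof_of A S (AMap E f)"
      have g: "?g \<in> mor B (L X) (L Y)" using roof_of_mor[OF E(1)[OF f]] .
      note c = B.comp_assoc
      have "f \<cdot>\<^bsub>B\<^esub> m X = ((m Y \<cdot>\<^bsub>B\<^esub> roof_of A S (n Y)) \<cdot>\<^bsub>B\<^esub> f) \<cdot>\<^bsub>B\<^esub> m X"
        unfolding m(2)[OF O(2)] B.comp_id_left[OF f] ..
      also have "\<dots> = m Y \<cdot>\<^bsub>B\<^esub> ((?g \<cdot>\<^bsub>B\<^esub> roof_of A S (n X)) \<cdot>\<^bsub>B\<^esub> m X)"
        unfolding E(2)[OF f] c[OF f qn[OF O(2)] m(1)[OF O(2)]]
        using c[OF m(1)[OF O(1)] B.comp_mor[OF f qn[OF O(2)]] m(1)[OF O(2)]] .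
      also have "\<dots> = m Y \<cdot>\<^bsub>B\<^esub> ?g"
        unfolding c[OF m(1)[OF O(1)] qn[OF O(1)] g] m(3)[OF O(1)] B.comp_id_right[OF g] ..
      finally show "AMap id_functor f \<cdot>\<^bsub>B\<^esub> m X = m Y \<cdot>\<^bsub>B\<^esub> AMap (comp_functor Q E) f"
        by (simp add: comp_functor_def)
    qed
    \<comment> \<open>On a closed object the unit is invertible already in \<open>A\<close>:
      \<open>r\<close> extends the identity along \<open>n X\<close>, and
      \<open>n X \<cdot> r\<close> is the identity because both extend \<open>n X\<close> along
      itself.\<close>
    have "\<forall>X\<in>closed_objects. \<exists>r. r \<in> mor A (L X) X \<and> r \<cdot> n X = Idt A X \<and> n X \<cdot> r = Idt A (L X)"
    proof
      fix X assume X: "X \<in> closed_objects"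
      have XO: "X \<in> Obj A" using X closed_Obj by blast
      have LO: "L X \<in> Obj A" using L[OF XO] closed_Obj by blast
      obtain r where r: "r \<in> mor A (L X) X" "r \<cdot> n X = Idt A X"
        using closed_ext[OF X nW[OF XO] id_mor[OF XO]] .
      note [simp] = mor_arr[OF r(1)] mor_arr[OF n[OF XO]]
      have "n X \<cdot> r = Idt A (L X)"
        by (rule closed_uniq[OF L[OF XO] nW[OF XO]])
          (use XO LO in \<open>simp_all add: mor_iff r(2)\<close>)
      with r show "\<exists>r. r \<in> mor A (L X) X \<and> r \<cdot> n X = Idt A X \<and> n X \<cdot> r = Idt A (L X)" by blast
    qed
    then obtain r where r': "\<forall>X\<in>closed_objects. r X \<in> mor A (L X) X \<and> r X \<cdot> n X = Idt A X \<and>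
        n X \<cdot> r X = Idt A (L X)" by (rule bchoice[THEN exE])
    then have r: "r X \<in> mor A (L X) X" "r X \<cdot> n X = Idt A X" "n X \<cdot> r X = Idt A (L X)"
      if "X \<in> closed_objects" for X using that by blast+
    show "naturally_isomorphic closed_cat closed_cat (comp_functor E Q) id_functor"
      unfolding naturally_isomorphic_def
    proof (intro exI[of _ r] conjI ballI allI)
      fix X assume "X \<in> Obj closed_cat"
      then have X: "X \<in> closed_objects" by simp
      then show "is_iso closed_cat (OMap (comp_functor E Q) X) (OMap id_functor X) (r X)"
        using r[OF X] n[OF closed_Obj[OF X]] L[OF closed_Obj[OF X]] closed_sub
        unfolding is_iso_def by (auto simp: comp_functor_def)
    next
      fix X Y f assume "f \<in> mor closed_cat X Y"
      then have O: "X \<in> closed_objects" "Y \<in> closed_objects" and f: "f \<in> mor A X Y"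
        using closed_sub by auto
      note OO = O[THEN closed_Obj]
      note [simp] = mor_arr[OF f] mor_arr[OF r(1)[OF O(1)]] mor_arr[OF r(1)[OF O(2)]]
        mor_arr[OF n[OF OO(1)]] mor_arr[OF n[OF OO(2)]] mor_arr[OF E(1)[OF roof_of_mor[OF f]]]
      have "f \<cdot> r X = r Y \<cdot> AMap E (roof_of A S f)"
        by (rule closed_uniq[OF O(2) nW[OF OO(1)]])
          (use OO in \<open>simp_all add: mor_iff r(2)[OF O(1)] En[OF f] r(2)[OF O(2), THEN comp_eq_ext1]\<close>)
      then show "AMap id_functor f \<cdot>\<^bsub>closed_cat\<^esub> r X = r Y \<cdot>\<^bsub>closed_cat\<^esub> AMap (comp_functor E Q) f"
        by (simp add: comp_functor_def)
    qed
  qed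
  have "naturally_isomorphic A closed_cat Q' Q'"
    by (rule T.naturally_isomorphic_refl)
      (use additive_functor_mor[OF addQ'] L in \<open>auto simp del: full_mor\<close>)
  then have "is_serre_quotient A S closed_cat Q'"
    unfolding is_serre_quotient_def using serre additive_functor_Q addQ' eq
    by (intro conjI exI[of _ E]) (simp_all add: Q'_def)
  with adj show ?thesis by blast
qed

text \<open>The unit supplied by the adjunction is known to be invertible only in the quotient;
  saturation places it in \<open>W\<close>, as both the reflection and the coreflection
  require.\<close>

theorem localization_closed:
  assumes "has_right_adjoint A B Q"
  shows "\<exists>Q'. localization_sequence A S closed_cat Q' \<and> is_right_adjoint A closed_cat Q' id_functor"
proof -
  have "\<exists>L\<in>closed_objects. \<exists>n. n \<in> W X L" if "X \<in> Obj A" for X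
    using adjoint_unit[OF assms that] W_saturated by metis
  from reflection[OF this] coreflection[OF this] show ?thesis
    unfolding localization_sequence_def has_right_adjoint_def[of A closed_cat] by blast
qed

end

section \<open>Presheaves and presentations\<close>

text \<open>The elements of the quotient of \<open>G\<close> by \<open>N\<close> are cosets and have
  the wrong type. One representative is chosen in each coset and transported along \<iota>, which
  realizes the quotient as a group over \<open>'u\<close>. This is how smallness of the Hom-sets is
  used.\<close>

lemma quotient_group_embedding:
  fixes G :: "'v monoid" and \<iota> :: "'v \<Rightarrow> 'u"
  assumes "comm_group G" "subgroup N G" "inj_on \<iota> (carrier G)"
  shows "\<exists>(H :: 'u monoid) \<pi>. comm_group H \<and> \<pi> \<in> hom G H \<and> \<pi> ` carrier G = carrier H \<and>
    (\<forall>u\<in>carrier G. \<pi> u = \<one>\<^bsub>H\<^esub> \<longleftrightarrow> u \<in> N)"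
proof -
  interpret comm_group G by fact
  interpret N: normal N G by (rule subgroup_imp_normal) fact
  \<comment> \<open>The choice sees only the coset, so \<open>r\<close> is constant on
    cosets.\<close>
  define r where "r u = (SOME v. v \<in> N #>\<^bsub>G\<^esub> u)" for u
  define \<pi> where "\<pi> u = \<iota> (r u)" for u
  have r: "r u \<in> N #>\<^bsub>G\<^esub> u" if "u \<in> carrier G" for u
    using someI[of "\<lambda>v. v \<in> N #>\<^bsub>G\<^esub> u"] rcos_self[OF that assms(2)] by (simp add: r_def)
  have rc: "r u \<in> carrier G" if "u \<in> carrier G" for u
    using r[OF that] r_coset_subset_G[OF N.subset that] by blast
  have coset: "N #>\<^bsub>G\<^esub> u = N #>\<^bsub>G\<^esub> r u" if "u \<in> carrier G" for u
    by (rule repr_independence[OF r[OF that] that assms(2)])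
  have eq: "\<pi> u = \<pi> v \<longleftrightarrow> N #>\<^bsub>G\<^esub> u = N #>\<^bsub>G\<^esub> v" if "u \<in> carrier G" "v \<in> carrier G" for u v
  proof
    assume "\<pi> u = \<pi> v"
    then have "r u = r v" using assms(3) rc that by (auto simp: \<pi>_def dest: inj_onD)
    then show "N #>\<^bsub>G\<^esub> u = N #>\<^bsub>G\<^esub> v" using coset that by metis
  qed (simp add: \<pi>_def r_def)
  define s where "s = inv_into (carrier G) \<pi>"
  have s: "s (\<pi> u) \<in> carrier G" "\<pi> (s (\<pi> u)) = \<pi> u" if "u \<in> carrier G" for u
    using that unfolding s_def by (simp_all add: inv_into_into f_inv_into_f)
  \<comment> \<open>\<open>H0\<close> carries the transported multiplication on all of
    \<open>'u\<close> and need not be a group. It is an auxiliary target for the homomorphism \<pi>,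
    whose image is then a group.\<close>
  define H0 :: "'u monoid" where "H0 = \<lparr>carrier = UNIV, mult = (\<lambda>x y. \<pi> (s x \<otimes>\<^bsub>G\<^esub> s y)), one = \<pi> \<one>\<^bsub>G\<^esub>\<rparr>"
  define H where "H = H0\<lparr>carrier := \<pi> ` carrier G, one := \<pi> \<one>\<^bsub>G\<^esub>\<rparr>"
  have mult: "\<pi> (u \<otimes>\<^bsub>G\<^esub> v) = \<pi> (s (\<pi> u) \<otimes>\<^bsub>G\<^esub> s (\<pi> v))" if "u \<in> carrier G" "v \<in> carrier G" for u v
  proof -
    have "N #>\<^bsub>G\<^esub> u = N #>\<^bsub>G\<^esub> s (\<pi> u)" "N #>\<^bsub>G\<^esub> v = N #>\<^bsub>G\<^esub> s (\<pi> v)"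
      using eq s that by metis+
    then have "N #>\<^bsub>G\<^esub> (u \<otimes>\<^bsub>G\<^esub> v) = N #>\<^bsub>G\<^esub> (s (\<pi> u) \<otimes>\<^bsub>G\<^esub> s (\<pi> v))"
      using N.rcos_sum that s by metis
    then show ?thesis using eq that s by simp
  qed
  have h0: "\<pi> \<in> hom G H0" by (rule homI) (use mult in \<open>auto simp: H0_def\<close>)
  have "comm_group H" unfolding H_def by (rule hom_imp_img_comm_group[OF h0])
  moreover have "\<pi> \<in> hom G H" by (rule homI) (use mult in \<open>auto simp: H_def H0_def\<close>)
  moreover have "\<pi> ` carrier G = carrier H" by (simp add: H_def)
  moreover have "\<pi> u = \<one>\<^bsub>H\<^esub> \<longleftrightarrow> u \<in> N" if u: "u \<in> carrier G" for u
  proof -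
    have "\<pi> u = \<one>\<^bsub>H\<^esub> \<longleftrightarrow> N #>\<^bsub>G\<^esub> u = N" using eq[OF u one_closed] N.subset by (simp add: H_def coset_mult_one)
    also have "\<dots> \<longleftrightarrow> u \<in> N" using coset_join1 coset_join2 u assms(2) by blast
    finally show ?thesis .
  qed
  ultimately show ?thesis by blast
qed

section \<open>Elementary rules and factorizations for contravariant functors\<close>

context preadditive_category
begin

abbreviation psh :: "('o, 'm, 'v) presheaf \<Rightarrow> bool" where
  "psh F \<equiv> contravariant_functor C F"

lemma psh_comm_group: "psh F \<Longrightarrow> X \<in> Obj C \<Longrightarrow> comm_group (Val F X)"
  using contravariant_functor.val_group .

lemma psh_group: "psh F \<Longrightarrow> X \<in> Obj C \<Longrightarrow> group (Val F X)"
  using psh_comm_group comm_group.axioms(2) by blast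

lemma psh_one [simp]: "psh F \<Longrightarrow> X \<in> Obj C \<Longrightarrow> \<one>\<^bsub>Val F X\<^esub> \<in> carrier (Val F X)"
  using psh_group group.is_monoid monoid.one_closed by blast

lemma act_hom: "psh F \<Longrightarrow> arr a \<Longrightarrow> Act F a \<in> hom (Val F (tgt a)) (Val F (src a))"
  by (simp add: contravariant_functor.act_hom mor_iff)

lemma act_closed [simp]:
  "psh F \<Longrightarrow> arr a \<Longrightarrow> src a = X \<Longrightarrow> u \<in> carrier (Val F (tgt a)) \<Longrightarrow> Act F a u \<in> carrier (Val F X)"
  using act_hom[of F a] by (auto simp: hom_def)

lemma act_Idt [simp]:
  "psh F \<Longrightarrow> X \<in> Obj C \<Longrightarrow> u \<in> carrier (Val F X) \<Longrightarrow> Act F (Idt C X) u = u"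
  by (rule contravariant_functor.act_id)

lemma act_comp [simp]:
  "psh F \<Longrightarrow> arr a \<Longrightarrow> arr b \<Longrightarrow> tgt a = src b \<Longrightarrow> u \<in> carrier (Val F (tgt b)) \<Longrightarrow>
    Act F (b \<cdot> a) u = Act F a (Act F b u)"
  by (rule contravariant_functor.act_comp) (auto simp: mor_iff)

lemma act_mult [simp]:
  "psh F \<Longrightarrow> arr a \<Longrightarrow> tgt a = Y \<Longrightarrow> u \<in> carrier (Val F Y) \<Longrightarrow> v \<in> carrier (Val F Y) \<Longrightarrow>
    Act F a (u \<otimes>\<^bsub>Val F Y\<^esub> v) = Act F a u \<otimes>\<^bsub>Val F (src a)\<^esub> Act F a v"
  using act_hom[of F a] by (auto simp: hom_def)

lemma act_one [simp]: "psh F \<Longrightarrow> arr a \<Longrightarrow> tgt a = Y \<Longrightarrow> Act F a \<one>\<^bsub>Val F Y\<^esub> = \<one>\<^bsub>Val F (src a)\<^esub>"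
  using hom_one[OF act_hom psh_group psh_group, of F a] by auto

lemma act_add [simp]:
  "psh F \<Longrightarrow> arr a \<Longrightarrow> arr a' \<Longrightarrow> src a = X \<Longrightarrow> src a' = X \<Longrightarrow> tgt a = Y \<Longrightarrow> tgt a' = Y \<Longrightarrow>
    u \<in> carrier (Val F Y) \<Longrightarrow>
    Act F (a \<otimes>\<^bsub>Hom C X Y\<^esub> a') u = Act F a u \<otimes>\<^bsub>Val F X\<^esub> Act F a' u"
  by (rule contravariant_functor.act_add) (auto simp: mor_iff)

lemma act_zero [simp]:
  assumes "psh F" "X \<in> Obj C" "Y \<in> Obj C" "u \<in> carrier (Val F Y)"
  shows "Act F \<one>\<^bsub>Hom C X Y\<^esub> u = \<one>\<^bsub>Val F X\<^esub>"
proof -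
  interpret group "Val F X" using psh_group assms by blast
  let ?z = "\<one>\<^bsub>Hom C X Y\<^esub>"
  have "Act F ?z u = Act F (?z \<otimes>\<^bsub>Hom C X Y\<^esub> ?z) u" using assms by (simp add: add_simps)
  also have "\<dots> = Act F ?z u \<otimes>\<^bsub>Val F X\<^esub> Act F ?z u" using assms by simp
  finally show ?thesis using assms by simp
qed

lemma act_diff:
  assumes "psh F" "h \<in> mor C X Y" "h' \<in> mor C X Y" "u \<in> carrier (Val F Y)"
  shows "Act F (h \<otimes>\<^bsub>Hom C X Y\<^esub> inv\<^bsub>Hom C X Y\<^esub> h') u = \<one>\<^bsub>Val F X\<^esub> \<longleftrightarrow> Act F h u = Act F h' u"
proof -
  note [simp] = mor_arr[OF assms(2)] mor_arr[OF assms(3)]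
  have O: "X \<in> Obj C" "Y \<in> Obj C" using assms mor_Obj by blast+
  interpret comm_group "Val F X" using psh_comm_group assms O by blast
  let ?n = "inv\<^bsub>Hom C X Y\<^esub> h'"
  have c: "Act F h u \<in> carrier (Val F X)" "Act F h' u \<in> carrier (Val F X)" "Act F ?n u \<in> carrier (Val F X)"
    using assms(1,4) by simp_all
  have "Act F (h' \<otimes>\<^bsub>Hom C X Y\<^esub> ?n) u = \<one>\<^bsub>Val F X\<^esub>" using assms(1,4) O by (simp add: add_simps)
  then have "Act F h' u \<otimes>\<^bsub>Val F X\<^esub> Act F ?n u = \<one>\<^bsub>Val F X\<^esub>" using assms(1,4) by simp
  moreover have "Act F (h \<otimes>\<^bsub>Hom C X Y\<^esub> ?n) u = Act F h u \<otimes>\<^bsub>Val F X\<^esub> Act F ?n u"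
    using assms(1,4) by simp
  ultimately show ?thesis using c by (metis right_cancel)
qed

lemma nat_hom: "nat_trans C F G \<eta> \<Longrightarrow> W \<in> Obj C \<Longrightarrow> \<eta> W \<in> hom (Val F W) (Val G W)"
  by (simp add: nat_trans_def)

lemma nat_closed:
  "nat_trans C F G \<eta> \<Longrightarrow> W \<in> Obj C \<Longrightarrow> u \<in> carrier (Val F W) \<Longrightarrow> \<eta> W u \<in> carrier (Val G W)"
  using nat_hom[of F G \<eta> W] by (auto simp: hom_def)

lemma nat_mult:
  "nat_trans C F G \<eta> \<Longrightarrow> W \<in> Obj C \<Longrightarrow> u \<in> carrier (Val F W) \<Longrightarrow> v \<in> carrier (Val F W) \<Longrightarrow>
    \<eta> W (u \<otimes>\<^bsub>Val F W\<^esub> v) = \<eta> W u \<otimes>\<^bsub>Val G W\<^esub> \<eta> W v"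
  using nat_hom[of F G \<eta> W] by (auto simp: hom_def)

lemma nat_one:
  "nat_trans C F G \<eta> \<Longrightarrow> psh F \<Longrightarrow> psh G \<Longrightarrow> W \<in> Obj C \<Longrightarrow> \<eta> W \<one>\<^bsub>Val F W\<^esub> = \<one>\<^bsub>Val G W\<^esub>"
  using hom_one[OF nat_hom psh_group psh_group] .

lemma nat_act:
  "nat_trans C F G \<eta> \<Longrightarrow> arr a \<Longrightarrow> src a = X \<Longrightarrow> u \<in> carrier (Val F (tgt a)) \<Longrightarrow>
    \<eta> X (Act F a u) = Act G a (\<eta> (tgt a) u)"
  by (auto simp: nat_trans_def mor_iff)

lemma nat_eq_iff:
  assumes "nat_trans C F G \<eta>" "psh F" "psh G" "W \<in> Obj C" "u \<in> carrier (Val F W)" "v \<in> carrier (Val F W)"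
  shows "\<eta> W u = \<eta> W v \<longleftrightarrow> \<eta> W (u \<otimes>\<^bsub>Val F W\<^esub> inv\<^bsub>Val F W\<^esub> v) = \<one>\<^bsub>Val G W\<^esub>"
proof -
  interpret group_hom "Val F W" "Val G W" "\<eta> W"
    using psh_group[OF assms(2,4)] psh_group[OF assms(3,4)] nat_hom[OF assms(1,4)]
    by (simp add: group_hom_def group_hom_axioms_def)
  have "\<eta> W (u \<otimes>\<^bsub>Val F W\<^esub> inv\<^bsub>Val F W\<^esub> v) = \<eta> W u \<otimes>\<^bsub>Val G W\<^esub> inv\<^bsub>Val G W\<^esub> \<eta> W v"
    using assms by simp
  also have "\<dots> = \<one>\<^bsub>Val G W\<^esub> \<longleftrightarrow> \<eta> W u = \<eta> W v"
    using H.inv_equality[of "\<eta> W u" "inv\<^bsub>Val G W\<^esub> \<eta> W v"] assms by auto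
  finally show ?thesis by blast
qed

lemma nat_injI:
  assumes "nat_trans C F G \<eta>" "psh F" "psh G" "W \<in> Obj C"
    "\<And>u. u \<in> carrier (Val F W) \<Longrightarrow> \<eta> W u = \<one>\<^bsub>Val G W\<^esub> \<Longrightarrow> u = \<one>\<^bsub>Val F W\<^esub>"
  shows "inj_on (\<eta> W) (carrier (Val F W))"
proof -
  interpret group_hom "Val F W" "Val G W" "\<eta> W"
    using psh_group[OF assms(2,4)] psh_group[OF assms(3,4)] nat_hom[OF assms(1,4)]
    by (simp add: group_hom_def group_hom_axioms_def)
  show ?thesis using inj_on_one_iff assms(5) by blast
qed

lemma nat_transI:
  assumes "\<And>W u. W \<in> Obj C \<Longrightarrow> u \<in> carrier (Val F W) \<Longrightarrow> \<eta> W u \<in> carrier (Val G W)"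
    and "\<And>W u v. W \<in> Obj C \<Longrightarrow> u \<in> carrier (Val F W) \<Longrightarrow> v \<in> carrier (Val F W) \<Longrightarrow>
      \<eta> W (u \<otimes>\<^bsub>Val F W\<^esub> v) = \<eta> W u \<otimes>\<^bsub>Val G W\<^esub> \<eta> W v"
    and "\<And>X Y a u. a \<in> mor C X Y \<Longrightarrow> u \<in> carrier (Val F Y) \<Longrightarrow> \<eta> X (Act F a u) = Act G a (\<eta> Y u)"
  shows "nat_trans C F G \<eta>"
  unfolding nat_trans_def using assms by (auto intro: homI)

text \<open>The cokernel property of a pointwise surjection. The three functors may take values over
  different types, so that a representable functor can stand in the place of
  \<open>F\<close>.\<close>

lemma factor_surjection:
  assumes c: "nat_trans C F L c" and h: "nat_trans C F H h" and psh: "psh F" "psh L" "psh H"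
    and surj: "\<And>W. W \<in> Obj C \<Longrightarrow> c W ` carrier (Val F W) = carrier (Val L W)"
    and ker: "\<And>W u. W \<in> Obj C \<Longrightarrow> u \<in> carrier (Val F W) \<Longrightarrow> c W u = \<one>\<^bsub>Val L W\<^esub> \<Longrightarrow> h W u = \<one>\<^bsub>Val H W\<^esub>"
  shows "\<exists>\<theta>. nat_trans C L H \<theta> \<and> (\<forall>W\<in>Obj C. \<forall>u\<in>carrier (Val F W). \<theta> W (c W u) = h W u)"
proof -
  have wd: "h W u = h W v"
    if "W \<in> Obj C" "u \<in> carrier (Val F W)" "v \<in> carrier (Val F W)" "c W u = c W v" for W u v
  proof -
    interpret group "Val F W" using psh_group psh that by blast
    have "c W (u \<otimes>\<^bsub>Val F W\<^esub> inv\<^bsub>Val F W\<^esub> v) = \<one>\<^bsub>Val L W\<^esub>"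
      using nat_eq_iff[OF c psh(1,2) that(1-3)] that(4) by simp
    then show ?thesis using nat_eq_iff[OF h psh(1,3) that(1-3)] ker that by simp
  qed
  define \<theta> where "\<theta> W l = h W (SOME u. u \<in> carrier (Val F W) \<and> c W u = l)" for W l
  have \<theta>: "\<theta> W (c W u) = h W u" if "W \<in> Obj C" "u \<in> carrier (Val F W)" for W u
  proof -
    have "\<exists>v. v \<in> carrier (Val F W) \<and> c W v = c W u" using that by blast
    from someI_ex[OF this] show ?thesis unfolding \<theta>_def using wd that by blast
  qed
  have "nat_trans C L H \<theta>"
  proof (rule nat_transI)
    fix W l assume W: "W \<in> Obj C" and "l \<in> carrier (Val L W)"
    then obtain u where u: "u \<in> carrier (Val F W)" "l = c W u" using surj by blast
    show "\<theta> W l \<in> carrier (Val H W)" unfolding u \<theta>[OF W u(1)] by (rule nat_closed[OF h W u(1)])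
    fix k assume "k \<in> carrier (Val L W)"
    then obtain v where v: "v \<in> carrier (Val F W)" "k = c W v" using surj W by blast
    interpret group "Val F W" using psh_group psh W by blast
    show "\<theta> W (l \<otimes>\<^bsub>Val L W\<^esub> k) = \<theta> W l \<otimes>\<^bsub>Val H W\<^esub> \<theta> W k"
      using \<theta>[OF W, of "u \<otimes>\<^bsub>Val F W\<^esub> v"] u v W by (simp add: \<theta> nat_mult[OF c] nat_mult[OF h])
  next
    fix X Y a l assume a: "a \<in> mor C X Y" and l: "l \<in> carrier (Val L Y)"
    have O: "X \<in> Obj C" "Y \<in> Obj C" using mor_Obj a by blast+
    note [simp] = mor_arr[OF a]
    obtain u where u: "u \<in> carrier (Val F Y)" "l = c Y u" using l surj O by blast
    have "Act L a l = c X (Act F a u)" using nat_act[OF c, of a X u] u by simp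
    then show "\<theta> X (Act L a l) = Act H a (\<theta> Y l)"
      using \<theta>[OF O(1), of "Act F a u"] \<theta>[OF O(2) u(1)] nat_act[OF h, of a X u] u psh by simp
  qed
  with \<theta> show ?thesis by blast
qed

lemma factor_injection:
  assumes k: "nat_trans C K F k" and h: "nat_trans C H F h" and psh: "psh K" "psh F" "psh H"
    and inj: "\<And>W. W \<in> Obj C \<Longrightarrow> inj_on (k W) (carrier (Val K W))"
    and im: "\<And>W u. W \<in> Obj C \<Longrightarrow> u \<in> carrier (Val H W) \<Longrightarrow> h W u \<in> k W ` carrier (Val K W)"
  shows "\<exists>\<theta>. nat_trans C H K \<theta> \<and> (\<forall>W\<in>Obj C. \<forall>u\<in>carrier (Val H W). k W (\<theta> W u) = h W u)"
proof -
  define \<theta> where "\<theta> W u = inv_into (carrier (Val K W)) (k W) (h W u)" for W u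
  have \<theta>: "\<theta> W u \<in> carrier (Val K W)" "k W (\<theta> W u) = h W u" if "W \<in> Obj C" "u \<in> carrier (Val H W)" for W u
    using im[OF that] unfolding \<theta>_def by (simp_all add: inv_into_into f_inv_into_f)
  have "nat_trans C H K \<theta>"
  proof (rule nat_transI)
    fix W u v assume W: "W \<in> Obj C" "u \<in> carrier (Val H W)"
    show "\<theta> W u \<in> carrier (Val K W)" using \<theta> W by blast
    assume v: "v \<in> carrier (Val H W)"
    interpret H: group "Val H W" using psh_group psh W by blast
    interpret K: group "Val K W" using psh_group psh W by blast
    show "\<theta> W (u \<otimes>\<^bsub>Val H W\<^esub> v) = \<theta> W u \<otimes>\<^bsub>Val K W\<^esub> \<theta> W v"
      by (rule inj_onD[OF inj[OF W(1)]])
        (use W v \<theta> in \<open>simp_all add: nat_mult[OF k] nat_mult[OF h]\<close>)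
  next
    fix X Y a u assume a: "a \<in> mor C X Y" and u: "u \<in> carrier (Val H Y)"
    have O: "X \<in> Obj C" "Y \<in> Obj C" using mor_Obj a by blast+
    note [simp] = mor_arr[OF a]
    show "\<theta> X (Act H a u) = Act K a (\<theta> Y u)"
      by (rule inj_onD[OF inj[OF O(1)]])
        (use u O \<theta> psh in \<open>simp_all add: nat_act[OF k] nat_act[OF h]\<close>)
  qed
  with \<theta> show ?thesis by blast
qed

text \<open>The pointwise quotient by a subfunctor \<open>N\<close>, with values moved to
  \<open>'u\<close> by \<open>quotient_group_embedding\<close>. The action is computed on chosen
  lifts along \<pi>; stability of \<open>N\<close> under the action makes the result independent of
  the lift.\<close>

lemma quotient_presheaf:
  fixes G :: "('o, 'm, 'v) presheaf" and U :: "'u itself"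
  assumes G: "psh G" and N: "\<And>W. W \<in> Obj C \<Longrightarrow> subgroup (N W) (Val G W)"
    and act: "\<And>a X Y u. a \<in> mor C X Y \<Longrightarrow> u \<in> N Y \<Longrightarrow> Act G a u \<in> N X"
    and small: "\<And>W. W \<in> Obj C \<Longrightarrow> \<exists>\<iota> :: 'v \<Rightarrow> 'u. inj_on \<iota> (carrier (Val G W))"
  shows "\<exists>(F :: ('o, 'm, 'u) presheaf) \<pi>. psh F \<and> nat_trans C G F \<pi> \<and>
    (\<forall>W\<in>Obj C. \<pi> W ` carrier (Val G W) = carrier (Val F W) \<and>
      (\<forall>u\<in>carrier (Val G W). \<pi> W u = \<one>\<^bsub>Val F W\<^esub> \<longleftrightarrow> u \<in> N W))"
proof -
  have "\<forall>W\<in>Obj C. \<exists>H\<pi> :: 'u monoid \<times> ('v \<Rightarrow> 'u). comm_group (fst H\<pi>) \<and> snd H\<pi> \<in> hom (Val G W) (fst H\<pi>) \<and>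
      snd H\<pi> ` carrier (Val G W) = carrier (fst H\<pi>) \<and>
      (\<forall>u\<in>carrier (Val G W). snd H\<pi> u = \<one>\<^bsub>fst H\<pi>\<^esub> \<longleftrightarrow> u \<in> N W)"
    using quotient_group_embedding[OF psh_comm_group[OF G] N] small by (simp add: split_paired_Ex) blast
  then obtain H\<pi> :: "'o \<Rightarrow> 'u monoid \<times> ('v \<Rightarrow> 'u)" where
    H\<pi>: "\<forall>W\<in>Obj C. comm_group (fst (H\<pi> W)) \<and> snd (H\<pi> W) \<in> hom (Val G W) (fst (H\<pi> W)) \<and>
      snd (H\<pi> W) ` carrier (Val G W) = carrier (fst (H\<pi> W)) \<and>
      (\<forall>u\<in>carrier (Val G W). snd (H\<pi> W) u = \<one>\<^bsub>fst (H\<pi> W)\<^esub> \<longleftrightarrow> u \<in> N W)"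
    by (rule bchoice[THEN exE])
  define \<pi> where "\<pi> W = snd (H\<pi> W)" for W
  define lft where "lft Y y = (SOME u. u \<in> carrier (Val G Y) \<and> \<pi> Y u = y)" for Y y
  define F where "F = \<lparr>Val = (\<lambda>W. fst (H\<pi> W)), Act = (\<lambda>a y. \<pi> (src a) (Act G a (lft (tgt a) y)))\<rparr>"
  have \<pi>: "comm_group (Val F W)" "\<pi> W \<in> hom (Val G W) (Val F W)"
    "\<pi> W ` carrier (Val G W) = carrier (Val F W)"
    "\<And>u. u \<in> carrier (Val G W) \<Longrightarrow> \<pi> W u = \<one>\<^bsub>Val F W\<^esub> \<longleftrightarrow> u \<in> N W" if "W \<in> Obj C" for W
    using H\<pi> that by (simp_all add: F_def \<pi>_def)
  have \<pi>c: "\<pi> W u \<in> carrier (Val F W)" if "W \<in> Obj C" "u \<in> carrier (Val G W)" for W u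
    using \<pi>(3) that by blast
  have \<pi>m: "\<pi> W (u \<otimes>\<^bsub>Val G W\<^esub> v) = \<pi> W u \<otimes>\<^bsub>Val F W\<^esub> \<pi> W v"
    if "W \<in> Obj C" "u \<in> carrier (Val G W)" "v \<in> carrier (Val G W)" for W u v
    using hom_mult[OF \<pi>(2)] that by blast
  have eq: "\<pi> X (Act G a u) = \<pi> X (Act G a v)"
    if a: "a \<in> mor C X Y" and u: "u \<in> carrier (Val G Y)" and v: "v \<in> carrier (Val G Y)" and e: "\<pi> Y u = \<pi> Y v"
    for a X Y u v
  proof -
    have O: "X \<in> Obj C" "Y \<in> Obj C" using mor_Obj a by blast+
    note [simp] = mor_arr[OF a]
    interpret Y: group_hom "Val G Y" "Val F Y" "\<pi> Y"
      using psh_group[OF G O(2)] \<pi>[OF O(2)] by (simp add: group_hom_def group_hom_axioms_def comm_group_def)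
    interpret X: group_hom "Val G X" "Val F X" "\<pi> X"
      using psh_group[OF G O(1)] \<pi>[OF O(1)] by (simp add: group_hom_def group_hom_axioms_def comm_group_def)
    define w where "w = u \<otimes>\<^bsub>Val G Y\<^esub> inv\<^bsub>Val G Y\<^esub> v"
    have w: "w \<in> carrier (Val G Y)" using u v by (simp add: w_def)
    have "\<pi> Y w = \<one>\<^bsub>Val F Y\<^esub>" using u v e by (simp add: w_def)
    then have "w \<in> N Y" using \<pi>(4)[OF O(2) w] by simp
    then have "\<pi> X (Act G a w) = \<one>\<^bsub>Val F X\<^esub>" using act[OF a] \<pi>(4)[OF O(1)] w G by simp
    moreover have "u = w \<otimes>\<^bsub>Val G Y\<^esub> v" using u v by (simp add: w_def Y.G.m_assoc)
    ultimately show ?thesis using w v G by simp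
  qed
  have act\<pi>: "Act F a (\<pi> Y u) = \<pi> X (Act G a u)"
    if a: "a \<in> mor C X Y" and u: "u \<in> carrier (Val G Y)" for a X Y u
  proof -
    have "\<exists>v. v \<in> carrier (Val G Y) \<and> \<pi> Y v = \<pi> Y u" using u by blast
    from someI_ex[OF this] have "lft Y (\<pi> Y u) \<in> carrier (Val G Y)" "\<pi> Y (lft Y (\<pi> Y u)) = \<pi> Y u"
      unfolding lft_def by blast+
    then show ?thesis using eq[OF a _ u] mor_arr[OF a] by (simp add: F_def)
  qed
  have surj: "\<exists>u\<in>carrier (Val G W). y = \<pi> W u" if "W \<in> Obj C" "y \<in> carrier (Val F W)" for W y
    using \<pi>(3)[OF that(1)] that(2) by blast
  have F: "psh F"
  proof (rule contravariant_functor.intro)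
    show "comm_group (Val F X)" if "X \<in> Obj C" for X using \<pi> that by blast
    show "Act F (Idt C X) y = y" if X: "X \<in> Obj C" and "y \<in> carrier (Val F X)" for X y
      using surj[OF that] act\<pi>[OF id_mor[OF X]] G X by auto
    fix a X Y assume a: "a \<in> mor C X Y"
    have O: "X \<in> Obj C" "Y \<in> Obj C" using mor_Obj a by blast+
    note [simp] = mor_arr[OF a]
    interpret Y: group "Val G Y" using psh_group[OF G O(2)] .
    show "Act F a \<in> hom (Val F Y) (Val F X)"
    proof (rule homI)
      fix y assume "y \<in> carrier (Val F Y)"
      then obtain u where u: "u \<in> carrier (Val G Y)" "y = \<pi> Y u" using surj O by blast
      then show "Act F a y \<in> carrier (Val F X)" using \<pi>c[OF O(1)] act\<pi>[OF a u(1)] G by simp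
      fix z assume "z \<in> carrier (Val F Y)"
      then obtain v where v: "v \<in> carrier (Val G Y)" "z = \<pi> Y v" using surj O by blast
      show "Act F a (y \<otimes>\<^bsub>Val F Y\<^esub> z) = Act F a y \<otimes>\<^bsub>Val F X\<^esub> Act F a z"
        using act\<pi>[OF a u(1)] act\<pi>[OF a v(1)] act\<pi>[OF a Y.m_closed[OF u(1) v(1)]] u v G
        by (simp add: \<pi>m[OF O(2), symmetric] \<pi>m[OF O(1)])
    qed
    show "Act F (b \<cdot> a) y = Act F a (Act F b y)" if b: "b \<in> mor C Y Z" and y: "y \<in> carrier (Val F Z)" for b Z y
    proof -
      obtain u where u: "u \<in> carrier (Val G Z)" "y = \<pi> Z u" using surj mor_Obj b y by blast
      note [simp] = mor_arr[OF b]
      have "Act G b u \<in> carrier (Val G Y)" using G u by simp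
      then show ?thesis
        unfolding u using act\<pi>[OF comp_mor[OF a b] u(1)] act\<pi>[OF b u(1)] act\<pi>[OF a] G u by simp
    qed
    show "Act F (a \<otimes>\<^bsub>Hom C X Y\<^esub> a') y = Act F a y \<otimes>\<^bsub>Val F X\<^esub> Act F a' y"
      if a': "a' \<in> mor C X Y" and y: "y \<in> carrier (Val F Y)" for a' y
    proof -
      obtain u where u: "u \<in> carrier (Val G Y)" "y = \<pi> Y u" using surj O y by blast
      note [simp] = mor_arr[OF a']
      have "a \<otimes>\<^bsub>Hom C X Y\<^esub> a' \<in> mor C X Y" by (simp add: mor_iff)
      from act\<pi>[OF this u(1)] act\<pi>[OF a u(1)] act\<pi>[OF a' u(1)] show ?thesis
        unfolding u using G u by (simp add: \<pi>m[OF O(1)])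
    qed
  qed
  have "nat_trans C G F \<pi>"
    by (rule nat_transI) (use \<pi>c \<pi>m act\<pi> in auto)
  with F \<pi>(3,4) show ?thesis by blast
qed

lemma carrier_Hom_eq: "X \<in> Obj C \<Longrightarrow> Y \<in> Obj C \<Longrightarrow> carrier (Hom C X Y) = mor C X Y"
  by (auto simp: mor_def)

section \<open>Representable functors and presentations\<close>

lemma psh_representable:
  assumes "X \<in> Obj C"
  shows "psh (representable C X)"
proof (rule contravariant_functor.intro)
  show "comm_group (Val (representable C X) W)" if "W \<in> Obj C" for W
    using assms that hom_group by (simp add: representable_def)
qed (use assms in \<open>auto simp: representable_def mor_iff carrier_Hom_iff hom_def\<close>)

text \<open>Exactness of C(-,X1) -> C(-,X0) -> F -> 0 expressed by elements: by Yoneda the two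
  arrows are a relation \<open>a\<close> and a generator \<open>x\<close>. In this form no functor
  with values over the type of morphisms occurs.\<close>

definition presents :: "('o, 'm, 'v) presheaf \<Rightarrow> 'o \<Rightarrow> 'o \<Rightarrow> 'v \<Rightarrow> 'm \<Rightarrow> bool" where
  "presents F X0 X1 x a \<longleftrightarrow> x \<in> carrier (Val F X0) \<and> a \<in> mor C X1 X0 \<and>
     (\<forall>W\<in>Obj C. \<forall>u\<in>carrier (Val F W). \<exists>h\<in>mor C W X0. u = Act F h x) \<and>
     (\<forall>W. \<forall>h\<in>mor C W X0. Act F h x = \<one>\<^bsub>Val F W\<^esub> \<longleftrightarrow> (\<exists>k\<in>mor C W X1. h = a \<cdot> k))"

lemma presentsD:
  assumes "presents F X0 X1 x a"
  shows "x \<in> carrier (Val F X0)" "a \<in> mor C X1 X0"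
    "W \<in> Obj C \<Longrightarrow> u \<in> carrier (Val F W) \<Longrightarrow> \<exists>h\<in>mor C W X0. u = Act F h x"
    "h \<in> mor C W X0 \<Longrightarrow> Act F h x = \<one>\<^bsub>Val F W\<^esub> \<longleftrightarrow> (\<exists>k\<in>mor C W X1. h = a \<cdot> k)"
  using assms unfolding presents_def by blast+

lemma representable_nat_trans:
  assumes "psh F" "X \<in> Obj C" "x \<in> carrier (Val F X)"
  shows "nat_trans C (representable C X) F (\<lambda>W h. Act F h x)"
  by (rule nat_transI)
    (use assms in \<open>auto simp: representable_def carrier_Hom_iff mor_iff\<close>)

lemma yoneda:
  assumes F: "psh F" and \<beta>: "nat_trans C (representable C X) F \<beta>" and h: "h \<in> mor C W X"
  shows "\<beta> W h = Act F h (\<beta> X (Idt C X))"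
proof -
  have O: "W \<in> Obj C" "X \<in> Obj C" using h mor_Obj by blast+
  have "\<beta> W (Act (representable C X) h (Idt C X)) = Act F h (\<beta> X (Idt C X))"
    using nat_act[OF \<beta>, of h W "Idt C X"] mor_arr[OF h] O
    by (simp add: representable_def carrier_Hom_iff mor_iff)
  then show ?thesis using mor_arr[OF h] by (simp add: representable_def)
qed

text \<open>Generator and relation are the images of identities under the two transformations of the
  definition; conversely Yoneda recovers these transformations from them.\<close>

lemma finitely_presented_iff:
  "finitely_presented C F \<longleftrightarrow> psh F \<and> (\<exists>X0 X1 x a. presents F X0 X1 x a)"
proof
  assume fp: "finitely_presented C F"
  then have F: "psh F" by (simp add: finitely_presented_def)
  from fp obtain X1 X0 \<alpha> \<beta> where O: "X1 \<in> Obj C" "X0 \<in> Obj C"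
    and \<alpha>: "nat_trans C (representable C X1) (representable C X0) \<alpha>"
    and \<beta>: "nat_trans C (representable C X0) F \<beta>"
    and ex0: "\<forall>W\<in>Obj C. \<alpha> W ` carrier (Hom C W X1) = kernel (Hom C W X0) (Val F W) (\<beta> W) \<and>
      \<beta> W ` carrier (Hom C W X0) = carrier (Val F W)"
    unfolding finitely_presented_def by (elim conjE bexE exE) (rule that; assumption)
  note ex = ex0[rule_format, THEN conjunct1] ex0[rule_format, THEN conjunct2]
  let ?x = "\<beta> X0 (Idt C X0)" and ?a = "\<alpha> X1 (Idt C X1)"
  have x: "?x \<in> carrier (Val F X0)"
    using nat_closed[OF \<beta> O(2), of "Idt C X0"] O by (simp add: representable_def carrier_Hom_iff mor_iff)
  have a: "?a \<in> mor C X1 X0"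
    using nat_closed[OF \<alpha> O(1), of "Idt C X1"] O by (simp add: representable_def carrier_Hom_iff mor_iff)
  have \<alpha>': "\<alpha> W k = ?a \<cdot> k" if "k \<in> mor C W X1" for W k
    using yoneda[OF psh_representable[OF O(2)] \<alpha> that] by (simp add: representable_def)
  have "presents F X0 X1 ?x ?a"
    unfolding presents_def
  proof (intro conjI ballI allI x a)
    show "\<exists>h\<in>mor C W X0. u = Act F h ?x" if W: "W \<in> Obj C" and u: "u \<in> carrier (Val F W)" for W u
    proof -
      have "u \<in> \<beta> W ` mor C W X0"
        using ex(2)[OF W] u by (simp add: carrier_Hom_eq[OF W O(2)])
      then obtain h where "h \<in> mor C W X0" "u = \<beta> W h" by blast
      with yoneda[OF F \<beta>] show ?thesis by blast
    qed
    fix W h assume h: "h \<in> mor C W X0"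
    have W: "W \<in> Obj C" using h mor_Obj by blast
    have "Act F h ?x = \<one>\<^bsub>Val F W\<^esub> \<longleftrightarrow> h \<in> kernel (Hom C W X0) (Val F W) (\<beta> W)"
      using yoneda[OF F \<beta> h] mor_carrier[OF h] by (simp add: kernel_def)
    also have "\<dots> \<longleftrightarrow> h \<in> \<alpha> W ` carrier (Hom C W X1)" using ex(1)[OF W] by simp
    also have "\<dots> \<longleftrightarrow> (\<exists>k\<in>mor C W X1. h = ?a \<cdot> k)"
      using \<alpha>' W O by (auto simp: image_iff carrier_Hom_iff)
    finally show "Act F h ?x = \<one>\<^bsub>Val F W\<^esub> \<longleftrightarrow> (\<exists>k\<in>mor C W X1. h = ?a \<cdot> k)" .
  qed
  with F show "psh F \<and> (\<exists>X0 X1 x a. presents F X0 X1 x a)" by blast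
next
  assume "psh F \<and> (\<exists>X0 X1 x a. presents F X0 X1 x a)"
  then obtain X0 X1 x a where F: "psh F" and p: "presents F X0 X1 x a" by blast
  note P = presentsD[OF p]
  have O: "X1 \<in> Obj C" "X0 \<in> Obj C" using P(2) mor_Obj by blast+
  have "nat_trans C (representable C X1) (representable C X0) (\<lambda>W h. Act (representable C X0) h a)"
    by (rule representable_nat_trans) (use O P(2) psh_representable in \<open>auto simp: representable_def mor_carrier\<close>)
  moreover have "nat_trans C (representable C X0) F (\<lambda>W h. Act F h x)"
    by (rule representable_nat_trans[OF F O(2) P(1)])
  moreover have "(\<lambda>h. Act (representable C X0) h a) ` carrier (Hom C W X1) =
      kernel (Hom C W X0) (Val F W) (\<lambda>h. Act F h x)" if "W \<in> Obj C" for W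
    using P(2,4) that O comp_mor
    by (auto simp: representable_def kernel_def carrier_Hom_eq image_iff)
  moreover have "(\<lambda>h. Act F h x) ` carrier (Hom C W X0) = carrier (Val F W)" if "W \<in> Obj C" for W
    using P(1) P(3)[OF that] that O F mor_arr by (auto simp: carrier_Hom_eq image_iff)
  ultimately show "finitely_presented C F"
    unfolding finitely_presented_def using F O by blast
qed

text \<open>By Yoneda \<open>y\<close> gives a transformation from the representable functor of
  \<open>X0\<close>; it kills the multiples of \<open>a\<close> and so factors through
  \<open>F\<close>. With \<open>presents_ext\<close>, morphisms from \<open>F\<close> to
  \<open>G\<close> are thus the elements of \<open>G(X0)\<close> annihilated by
  \<open>a\<close>.\<close>

lemma presents_lift:
  assumes F: "psh F" and G: "psh G" and p: "presents F X0 X1 x a"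
    and y: "y \<in> carrier (Val G X0)" "Act G a y = \<one>\<^bsub>Val G X1\<^esub>"
  shows "\<exists>\<phi>. nat_trans C F G \<phi> \<and> (\<forall>W. \<forall>h\<in>mor C W X0. \<phi> W (Act F h x) = Act G h y)"
proof -
  note P = presentsD[OF p]
  have O: "X1 \<in> Obj C" "X0 \<in> Obj C" using P(2) mor_Obj by blast+
  have "\<exists>\<phi>. nat_trans C F G \<phi> \<and> (\<forall>W\<in>Obj C. \<forall>h\<in>carrier (Val (representable C X0) W). \<phi> W (Act F h x) = Act G h y)"
  proof (rule factor_surjection[OF representable_nat_trans representable_nat_trans])
    show "(\<lambda>h. Act F h x) ` carrier (Val (representable C X0) W) = carrier (Val F W)" if "W \<in> Obj C" for W
      using P(1) P(3)[OF that] that O F mor_arr by (auto simp: carrier_Hom_eq image_iff representable_def)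
    fix W h assume "W \<in> Obj C" "h \<in> carrier (Val (representable C X0) W)" "Act F h x = \<one>\<^bsub>Val F W\<^esub>"
    then have h: "h \<in> mor C W X0" "Act F h x = \<one>\<^bsub>Val F W\<^esub>"
      using O by (simp_all add: representable_def carrier_Hom_iff)
    then obtain k where k: "k \<in> mor C W X1" "h = a \<cdot> k" using P(4) by blast
    then show "Act G h y = \<one>\<^bsub>Val G W\<^esub>"
      using y G mor_arr[OF k(1)] mor_arr[OF P(2)] by simp
  qed (use F G O P(1) y psh_representable in auto)
  then obtain \<phi> where "nat_trans C F G \<phi>" and \<phi>: "\<forall>W\<in>Obj C. \<forall>h\<in>carrier (Val (representable C X0) W). \<phi> W (Act F h x) = Act G h y"
    by blast
  moreover have "\<phi> W (Act F h x) = Act G h y" if "h \<in> mor C W X0" for W h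
    using \<phi> mor_Obj[OF that] mor_carrier[OF that] by (simp add: representable_def)
  ultimately show ?thesis by blast
qed

lemma presents_ext:
  assumes p: "presents F X0 X1 x a" and "nat_trans C F G \<phi>" "nat_trans C F G \<psi>"
    and "\<phi> X0 x = \<psi> X0 x" "W \<in> Obj C" "u \<in> carrier (Val F W)"
  shows "\<phi> W u = \<psi> W u"
proof -
  obtain h where h: "h \<in> mor C W X0" "u = Act F h x" using presentsD(3)[OF p assms(5,6)] by blast
  then show ?thesis
    using nat_act[OF assms(2), of h W x] nat_act[OF assms(3), of h W x] mor_arr[OF h(1)] presentsD(1)[OF p] assms(4)
    by simp
qed

end

section \<open>The categories of all and of finitely presented functors\<close>

context preadditive_category
begin

abbreviation mk :: "('o, 'm, 'u) presheaf \<Rightarrow> ('o \<Rightarrow> 'u \<Rightarrow> 'u) \<Rightarrow> ('o, 'm, 'u) presheaf \<Rightarrow>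
    ('o, 'm, 'u) presheaf_mor" where
  "mk F \<eta> G \<equiv> (F, normal_trans C F \<eta>, G)"

lemma normal_trans_app [simp]:
  "W \<in> Obj C \<Longrightarrow> u \<in> carrier (Val F W) \<Longrightarrow> normal_trans C F \<eta> W u = \<eta> W u"
  by (simp add: normal_trans_def)

lemma normal_trans_eqI:
  "(\<And>W u. W \<in> Obj C \<Longrightarrow> u \<in> carrier (Val F W) \<Longrightarrow> \<eta> W u = \<theta> W u) \<Longrightarrow>
    normal_trans C F \<eta> = normal_trans C F \<theta>"
  by (auto simp: normal_trans_def fun_eq_iff restrict_def)

lemma normal_trans_idem [simp]: "normal_trans C F (normal_trans C F \<eta>) = normal_trans C F \<eta>"
  by (rule normal_trans_eqI) simp

text \<open>Normalization changes values only off the objects and carriers. The carriers are closed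
  under multiplication and under the action, so naturality never looks at the changed
  values.\<close>

lemma nat_trans_normal [simp]:
  assumes F: "psh F"
  shows "nat_trans C F G (normal_trans C F \<eta>) \<longleftrightarrow> nat_trans C F G \<eta>"
proof -
  have "normal_trans C F \<eta> W \<in> hom (Val F W) (Val G W) \<longleftrightarrow> \<eta> W \<in> hom (Val F W) (Val G W)"
    if W: "W \<in> Obj C" for W
  proof -
    interpret group "Val F W" using psh_group[OF F W] .
    show ?thesis using W by (auto simp: hom_def Pi_iff)
  qed
  moreover have "normal_trans C F \<eta> X (Act F a u) = Act G a (normal_trans C F \<eta> Y u) \<longleftrightarrow>
      \<eta> X (Act F a u) = Act G a (\<eta> Y u)"
    if "a \<in> mor C X Y" "u \<in> carrier (Val F Y)" for X Y a u
    using that mor_Obj[OF that(1)] mor_arr[OF that(1)] F by simp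
  ultimately show ?thesis unfolding nat_trans_def by simp
qed

lemma mor_presheaf_iff:
  "f \<in> mor (presheaf_cat U C) F G \<longleftrightarrow> psh F \<and> psh G \<and> (\<exists>\<eta>. f = mk F \<eta> G \<and> nat_trans C F G \<eta>)"
proof -
  have "f \<in> mor (presheaf_cat U C) F G \<longleftrightarrow>
      psh F \<and> psh G \<and> (\<exists>\<eta>. f = (F, \<eta>, G) \<and> nat_trans C F G \<eta> \<and> \<eta> = normal_trans C F \<eta>)"
    by (auto simp: mor_def presheaf_cat_def)
  then show ?thesis by (metis nat_trans_normal normal_trans_idem)
qed

lemma presheaf_add:
  "mk F \<eta> G \<otimes>\<^bsub>Hom (presheaf_cat U C) F G\<^esub> mk F \<theta> G = mk F (\<lambda>X u. \<eta> X u \<otimes>\<^bsub>Val G X\<^esub> \<theta> X u) G"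
  by (auto simp: presheaf_cat_def intro: normal_trans_eqI)

lemma presheaf_comp:
  assumes "nat_trans C F G \<eta>"
  shows "mk G \<theta> H \<cdot>\<^bsub>presheaf_cat U C\<^esub> mk F \<eta> G = mk F (\<lambda>X u. \<theta> X (\<eta> X u)) H"
  by (auto simp: presheaf_cat_def nat_closed[OF assms] intro: normal_trans_eqI)

lemma presheaf_simps [simp]:
  "Obj (presheaf_cat U C) = {F. psh F}"
  "Idt (presheaf_cat U C) F = mk F (\<lambda>X u. u) F"
  "one (Hom (presheaf_cat U C) F G) = mk F (\<lambda>X u. \<one>\<^bsub>Val G X\<^esub>) G"
  by (simp_all add: presheaf_cat_def)

lemma nat_trans_comp:
  assumes "nat_trans C F G \<eta>" "nat_trans C G H \<theta>"
  shows "nat_trans C F H (\<lambda>X u. \<theta> X (\<eta> X u))"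
  by (rule nat_transI)
    (use assms in \<open>auto simp: nat_closed nat_mult nat_closed[OF assms(1)] nat_act mor_iff\<close>)

lemma nat_trans_id: "nat_trans C F F (\<lambda>X u. u)"
  by (rule nat_transI) auto

lemma nat_trans_zero:
  assumes "psh F" "psh G"
  shows "nat_trans C F G (\<lambda>X u. \<one>\<^bsub>Val G X\<^esub>)"
proof (rule nat_transI)
  fix W assume W: "W \<in> Obj C"
  interpret group "Val G W" using psh_group[OF assms(2) W] .
  show "\<one>\<^bsub>Val G W\<^esub> \<in> carrier (Val G W)" "\<one>\<^bsub>Val G W\<^esub> = \<one>\<^bsub>Val G W\<^esub> \<otimes>\<^bsub>Val G W\<^esub> \<one>\<^bsub>Val G W\<^esub>" by simp_all
qed (use assms in \<open>simp add: mor_iff\<close>)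

lemma nat_trans_mult:
  assumes "psh G" "nat_trans C F G \<eta>" "nat_trans C F G \<theta>"
  shows "nat_trans C F G (\<lambda>X u. \<eta> X u \<otimes>\<^bsub>Val G X\<^esub> \<theta> X u)"
proof (rule nat_transI)
  fix W u v assume W: "W \<in> Obj C" and u: "u \<in> carrier (Val F W)"
  interpret comm_group "Val G W" using psh_comm_group[OF assms(1) W] .
  note c = nat_closed[OF assms(2) W] nat_closed[OF assms(3) W]
  show "\<eta> W u \<otimes>\<^bsub>Val G W\<^esub> \<theta> W u \<in> carrier (Val G W)" using u c by simp
  assume v: "v \<in> carrier (Val F W)"
  show "\<eta> W (u \<otimes>\<^bsub>Val F W\<^esub> v) \<otimes>\<^bsub>Val G W\<^esub> \<theta> W (u \<otimes>\<^bsub>Val F W\<^esub> v) =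
      \<eta> W u \<otimes>\<^bsub>Val G W\<^esub> \<theta> W u \<otimes>\<^bsub>Val G W\<^esub> (\<eta> W v \<otimes>\<^bsub>Val G W\<^esub> \<theta> W v)"
    using nat_mult[OF assms(2) W u v] nat_mult[OF assms(3) W u v] c u v by (simp add: m_ac)
next
  fix X Y a u assume a: "a \<in> mor C X Y" and u: "u \<in> carrier (Val F Y)"
  note [simp] = mor_arr[OF a]
  have Y: "Y \<in> Obj C" using a mor_Obj by blast
  show "\<eta> X (Act F a u) \<otimes>\<^bsub>Val G X\<^esub> \<theta> X (Act F a u) = Act G a (\<eta> Y u \<otimes>\<^bsub>Val G Y\<^esub> \<theta> Y u)"
    using nat_act[OF assms(2), of a X u] nat_act[OF assms(3), of a X u] u assms(1)
      nat_closed[OF assms(2) Y] nat_closed[OF assms(3) Y] by simp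
qed

lemma nat_trans_inv:
  assumes "psh F" "psh G" "nat_trans C F G \<eta>"
  shows "nat_trans C F G (\<lambda>X u. inv\<^bsub>Val G X\<^esub> \<eta> X u)"
proof (rule nat_transI)
  fix W u v assume W: "W \<in> Obj C" and u: "u \<in> carrier (Val F W)"
  interpret comm_group "Val G W" using psh_comm_group[OF assms(2) W] .
  note c = nat_closed[OF assms(3) W]
  show "inv\<^bsub>Val G W\<^esub> \<eta> W u \<in> carrier (Val G W)" using u c by simp
  assume v: "v \<in> carrier (Val F W)"
  show "inv\<^bsub>Val G W\<^esub> \<eta> W (u \<otimes>\<^bsub>Val F W\<^esub> v) = inv\<^bsub>Val G W\<^esub> \<eta> W u \<otimes>\<^bsub>Val G W\<^esub> inv\<^bsub>Val G W\<^esub> \<eta> W v"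
    using nat_mult[OF assms(3) W u v] c u v by (simp add: inv_mult)
next
  fix X Y a u assume a: "a \<in> mor C X Y" and u: "u \<in> carrier (Val F Y)"
  note [simp] = mor_arr[OF a]
  have O: "X \<in> Obj C" "Y \<in> Obj C" using a mor_Obj by blast+
  interpret group_hom "Val G Y" "Val G X" "Act G a"
    using psh_group[OF assms(2) O(1)] psh_group[OF assms(2) O(2)] act_hom[OF assms(2), of a]
    by (simp add: group_hom_def group_hom_axioms_def)
  show "inv\<^bsub>Val G X\<^esub> \<eta> X (Act F a u) = Act G a (inv\<^bsub>Val G Y\<^esub> \<eta> Y u)"
    using nat_act[OF assms(3), of a X u] u nat_closed[OF assms(3) O(2)] by simp
qed

lemma comm_group_presheaf_Hom:
  fixes F G :: "('o, 'm, 'u) presheaf" and U :: "'u itself"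
  assumes F: "psh F" and G: "psh G"
  shows "comm_group (Hom (presheaf_cat U C) F G)"
proof (rule comm_groupI)
  let ?H = "Hom (presheaf_cat U C) F G"
  have car: "f \<in> carrier ?H \<longleftrightarrow> (\<exists>\<eta>. f = mk F \<eta> G \<and> nat_trans C F G \<eta>)" for f
    using mor_presheaf_iff[of f U F G] F G by (simp add: mor_def)
  note grp = psh_comm_group[OF G]
  show "\<one>\<^bsub>?H\<^esub> \<in> carrier ?H" unfolding car using nat_trans_zero[OF F G] by auto
  fix f assume "f \<in> carrier ?H"
  then obtain \<eta> where f: "f = mk F \<eta> G" "nat_trans C F G \<eta>" unfolding car by blast
  have z: "\<one>\<^bsub>Val G W\<^esub> \<otimes>\<^bsub>Val G W\<^esub> \<eta> W u = \<eta> W u" if "W \<in> Obj C" "u \<in> carrier (Val F W)" for W u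
  proof -
    interpret comm_group "Val G W" using grp[OF that(1)] .
    show ?thesis using nat_closed[OF f(2) that] by simp
  qed
  show "\<one>\<^bsub>?H\<^esub> \<otimes>\<^bsub>?H\<^esub> f = f"
    unfolding f(1) presheaf_simps presheaf_add using z by (auto intro: normal_trans_eqI)
  have iv: "inv\<^bsub>Val G W\<^esub> \<eta> W u \<otimes>\<^bsub>Val G W\<^esub> \<eta> W u = \<one>\<^bsub>Val G W\<^esub>" if "W \<in> Obj C" "u \<in> carrier (Val F W)" for W u
  proof -
    interpret comm_group "Val G W" using grp[OF that(1)] .
    show ?thesis using nat_closed[OF f(2) that] by simp
  qed
  show "\<exists>g\<in>carrier ?H. g \<otimes>\<^bsub>?H\<^esub> f = \<one>\<^bsub>?H\<^esub>"
  proof (rule bexI[of _ "mk F (\<lambda>X u. inv\<^bsub>Val G X\<^esub> \<eta> X u) G"])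
    show "mk F (\<lambda>X u. inv\<^bsub>Val G X\<^esub> \<eta> X u) G \<otimes>\<^bsub>?H\<^esub> f = \<one>\<^bsub>?H\<^esub>"
      unfolding f(1) presheaf_simps presheaf_add using iv by (auto intro: normal_trans_eqI)
    show "mk F (\<lambda>X u. inv\<^bsub>Val G X\<^esub> \<eta> X u) G \<in> carrier ?H"
      unfolding car using nat_trans_inv[OF F G f(2)] by blast
  qed
  fix g assume "g \<in> carrier ?H"
  then obtain \<theta> where g: "g = mk F \<theta> G" "nat_trans C F G \<theta>" unfolding car by blast
  show "f \<otimes>\<^bsub>?H\<^esub> g \<in> carrier ?H"
    unfolding f(1) g(1) presheaf_add car using nat_trans_mult[OF G f(2) g(2)] by blast
  have cm: "\<eta> W u \<otimes>\<^bsub>Val G W\<^esub> \<theta> W u = \<theta> W u \<otimes>\<^bsub>Val G W\<^esub> \<eta> W u" if "W \<in> Obj C" "u \<in> carrier (Val F W)" for W u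
  proof -
    interpret comm_group "Val G W" using grp[OF that(1)] .
    show ?thesis using nat_closed[OF f(2) that] nat_closed[OF g(2) that] by (simp add: m_comm)
  qed
  show "f \<otimes>\<^bsub>?H\<^esub> g = g \<otimes>\<^bsub>?H\<^esub> f"
    unfolding f(1) g(1) presheaf_add using cm by (auto intro: normal_trans_eqI)
  fix h assume "h \<in> carrier ?H"
  then obtain \<kappa> where h: "h = mk F \<kappa> G" "nat_trans C F G \<kappa>" unfolding car by blast
  have as: "\<eta> W u \<otimes>\<^bsub>Val G W\<^esub> \<theta> W u \<otimes>\<^bsub>Val G W\<^esub> \<kappa> W u = \<eta> W u \<otimes>\<^bsub>Val G W\<^esub> (\<theta> W u \<otimes>\<^bsub>Val G W\<^esub> \<kappa> W u)"
    if "W \<in> Obj C" "u \<in> carrier (Val F W)" for W u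
  proof -
    interpret comm_group "Val G W" using grp[OF that(1)] .
    show ?thesis
      using nat_closed[OF f(2) that] nat_closed[OF g(2) that] nat_closed[OF h(2) that] by (simp add: m_assoc)
  qed
  show "f \<otimes>\<^bsub>?H\<^esub> g \<otimes>\<^bsub>?H\<^esub> h = f \<otimes>\<^bsub>?H\<^esub> (g \<otimes>\<^bsub>?H\<^esub> h)"
    unfolding f(1) g(1) h(1) presheaf_add using as by (auto intro: normal_trans_eqI)
qed

lemma preadditive_presheaf_cat: "preadditive_category (presheaf_cat (U :: 'u itself) C)"
proof (rule preadditive_category.intro)
  let ?P = "presheaf_cat U C"
  show "comm_group (Hom ?P X Y)" if "X \<in> Obj ?P" "Y \<in> Obj ?P" for X Y
    using that comm_group_presheaf_Hom by simp
  show "X = X' \<and> Y = Y'" if "f \<in> mor ?P X Y" "f \<in> mor ?P X' Y'" for f X Y X' Y'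
    using that unfolding mor_presheaf_iff by blast
  show "Idt ?P X \<in> mor ?P X X" if "X \<in> Obj ?P" for X
    using that nat_trans_id unfolding mor_presheaf_iff by auto
  fix f X Y assume "f \<in> mor ?P X Y"
  then obtain \<eta> where f: "f = mk X \<eta> Y" "nat_trans C X Y \<eta>" "psh X" "psh Y"
    unfolding mor_presheaf_iff by blast
  show "f \<cdot>\<^bsub>?P\<^esub> Idt ?P X = f" "Idt ?P Y \<cdot>\<^bsub>?P\<^esub> f = f"
    by (simp_all add: f(1) presheaf_comp[OF nat_trans_id] presheaf_comp[OF f(2)])
  fix g Z assume "g \<in> mor ?P Y Z"
  then obtain \<theta> where g: "g = mk Y \<theta> Z" "nat_trans C Y Z \<theta>" "psh Z"
    unfolding mor_presheaf_iff by blast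
  note gf = nat_trans_comp[OF f(2) g(2)]
  show "g \<cdot>\<^bsub>?P\<^esub> f \<in> mor ?P X Z"
    unfolding mor_presheaf_iff using f g gf presheaf_comp[OF f(2)] by blast
  show "(h \<cdot>\<^bsub>?P\<^esub> g) \<cdot>\<^bsub>?P\<^esub> f = h \<cdot>\<^bsub>?P\<^esub> (g \<cdot>\<^bsub>?P\<^esub> f)" if "h \<in> mor ?P Z V" for h V
  proof -
    obtain \<kappa> where h: "h = mk Z \<kappa> V" "nat_trans C Z V \<kappa>" using \<open>h \<in> _\<close> unfolding mor_presheaf_iff by blast
    show ?thesis unfolding f(1) g(1) h(1) presheaf_comp[OF f(2)] presheaf_comp[OF g(2)] presheaf_comp[OF gf] ..
  qed
  show "(g \<otimes>\<^bsub>Hom ?P Y Z\<^esub> g') \<cdot>\<^bsub>?P\<^esub> f = (g \<cdot>\<^bsub>?P\<^esub> f) \<otimes>\<^bsub>Hom ?P X Z\<^esub> (g' \<cdot>\<^bsub>?P\<^esub> f)" if "g' \<in> mor ?P Y Z" for g'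
  proof -
    obtain \<theta>' where g': "g' = mk Y \<theta>' Z" using \<open>g' \<in> _\<close> unfolding mor_presheaf_iff by blast
    show ?thesis unfolding f(1) g(1) g'(1) presheaf_comp[OF f(2)] presheaf_add ..
  qed
  show "g \<cdot>\<^bsub>?P\<^esub> (f \<otimes>\<^bsub>Hom ?P X Y\<^esub> f') = (g \<cdot>\<^bsub>?P\<^esub> f) \<otimes>\<^bsub>Hom ?P X Z\<^esub> (g \<cdot>\<^bsub>?P\<^esub> f')" if "f' \<in> mor ?P X Y" for f'
  proof -
    obtain \<eta>' where f': "f' = mk X \<eta>' Y" "nat_trans C X Y \<eta>'" using \<open>f' \<in> _\<close> unfolding mor_presheaf_iff by blast
    show ?thesis
      unfolding f(1) g(1) f'(1) presheaf_comp[OF f(2)] presheaf_comp[OF f'(2)] presheaf_add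
        presheaf_comp[OF nat_trans_mult[OF f(4) f(2) f'(2)]]
      by (auto intro!: normal_trans_eqI simp: nat_mult[OF g(2)] nat_closed[OF f(2)] nat_closed[OF f'(2)])
  qed
qed

lemma preadditive_mod_cat: "preadditive_category (mod_cat (U :: 'u itself) C)"
  unfolding mod_cat_def
  by (rule preadditive_category.preadditive_full[OF preadditive_presheaf_cat])
    (auto simp: finitely_presented_iff)

definition app :: "('o, 'm, 'u) presheaf_mor \<Rightarrow> 'o \<Rightarrow> 'u \<Rightarrow> 'u" where
  "app f = fst (snd f)"

abbreviation fp :: "('o, 'm, 'v) presheaf \<Rightarrow> bool" where
  "fp F \<equiv> finitely_presented C F"

lemma fp_psh: "fp F \<Longrightarrow> psh F"
  by (simp add: finitely_presented_iff)

lemma mod_Obj [simp]: "F \<in> Obj (mod_cat U C) \<longleftrightarrow> fp F"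
  by (simp add: mod_cat_def)

lemma mor_mod_iff:
  "f \<in> mor (mod_cat U C) F G \<longleftrightarrow> fp F \<and> fp G \<and> (\<exists>\<eta>. f = mk F \<eta> G \<and> nat_trans C F G \<eta>)"
proof -
  have "{F. fp F} \<subseteq> Obj (presheaf_cat U C)" by (auto simp: finitely_presented_iff)
  then show ?thesis by (auto simp: mod_cat_def mor_presheaf_iff finitely_presented_iff)
qed

lemma mor_mod_fp: "f \<in> mor (mod_cat U C) F G \<Longrightarrow> fp F" "f \<in> mor (mod_cat U C) F G \<Longrightarrow> fp G"
  by (simp_all add: mor_mod_iff)

lemma mor_mod_psh: "f \<in> mor (mod_cat U C) F G \<Longrightarrow> psh F" "f \<in> mor (mod_cat U C) F G \<Longrightarrow> psh G"
  by (simp_all add: mor_mod_iff finitely_presented_iff)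

lemma app_nat: "f \<in> mor (mod_cat U C) F G \<Longrightarrow> nat_trans C F G (app f)"
  by (auto simp: mor_mod_iff app_def finitely_presented_iff)

lemma mod_ext:
  assumes "f \<in> mor (mod_cat U C) F G" "g \<in> mor (mod_cat U C) F G"
    "\<And>W u. W \<in> Obj C \<Longrightarrow> u \<in> carrier (Val F W) \<Longrightarrow> app f W u = app g W u"
  shows "f = g"
  using assms by (auto simp: mor_mod_iff app_def intro: normal_trans_eqI)

lemma mod_obtain:
  assumes "fp F" "fp G" "nat_trans C F G \<eta>"
  shows "\<exists>f\<in>mor (mod_cat U C) F G. \<forall>W\<in>Obj C. \<forall>u\<in>carrier (Val F W). app f W u = \<eta> W u"
  by (rule bexI[of _ "mk F \<eta> G"]) (use assms in \<open>auto simp: mor_mod_iff app_def\<close>)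

lemma app_comp:
  assumes "f \<in> mor (mod_cat U C) F G" "g \<in> mor (mod_cat U C) G H" "W \<in> Obj C" "u \<in> carrier (Val F W)"
  shows "app (g \<cdot>\<^bsub>mod_cat U C\<^esub> f) W u = app g W (app f W u)"
proof -
  obtain \<eta> \<theta> where f: "f = mk F \<eta> G" "nat_trans C F G \<eta>" and g: "g = mk G \<theta> H"
    using assms(1,2) unfolding mor_mod_iff by blast
  show ?thesis using assms(3,4) nat_closed[OF f(2) assms(3,4)]
    by (simp add: f(1) g mod_cat_def presheaf_comp[OF f(2)] app_def)
qed

lemma app_Idt: "W \<in> Obj C \<Longrightarrow> u \<in> carrier (Val F W) \<Longrightarrow> app (Idt (mod_cat U C) F) W u = u"
  by (simp add: mod_cat_def app_def)

lemma app_zero: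
  "W \<in> Obj C \<Longrightarrow> u \<in> carrier (Val F W) \<Longrightarrow> app \<one>\<^bsub>Hom (mod_cat U C) F G\<^esub> W u = \<one>\<^bsub>Val G W\<^esub>"
  by (simp add: mod_cat_def app_def)

lemma app_add:
  assumes "f \<in> mor (mod_cat U C) F G" "g \<in> mor (mod_cat U C) F G" "W \<in> Obj C" "u \<in> carrier (Val F W)"
  shows "app (f \<otimes>\<^bsub>Hom (mod_cat U C) F G\<^esub> g) W u = app f W u \<otimes>\<^bsub>Val G W\<^esub> app g W u"
proof -
  obtain \<eta> \<theta> where f: "f = mk F \<eta> G" and g: "g = mk F \<theta> G"
    using assms(1,2) unfolding mor_mod_iff by blast
  show ?thesis using assms(3,4) presheaf_add[where U = U and \<eta> = \<eta> and \<theta> = \<theta> and F = F and G = G]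
    by (simp add: f g mod_cat_def app_def)
qed

lemma zero_mod_iff:
  assumes "f \<in> mor (mod_cat U C) F G"
  shows "f = \<one>\<^bsub>Hom (mod_cat U C) F G\<^esub> \<longleftrightarrow>
    (\<forall>W\<in>Obj C. \<forall>u\<in>carrier (Val F W). app f W u = \<one>\<^bsub>Val G W\<^esub>)"
proof -
  interpret A: preadditive_category "mod_cat U C" by (rule preadditive_mod_cat)
  have "\<one>\<^bsub>Hom (mod_cat U C) F G\<^esub> \<in> mor (mod_cat U C) F G"
    using mor_mod_fp[OF assms] by (simp add: A.mor_iff)
  then show ?thesis using mod_ext[OF assms] app_zero by metis
qed

section \<open>Kernels and cokernels computed pointwise\<close>

definition pointwise_kernel :: "('o, 'm, 'u) presheaf \<Rightarrow> ('o, 'm, 'u) presheaf \<Rightarrow> ('o, 'm, 'u) presheaf \<Rightarrow>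
    ('o, 'm, 'u) presheaf_mor \<Rightarrow> ('o, 'm, 'u) presheaf_mor \<Rightarrow> bool" where
  "pointwise_kernel K F G k f \<longleftrightarrow> (\<forall>W\<in>Obj C. inj_on (app k W) (carrier (Val K W)) \<and>
     (\<forall>u\<in>carrier (Val F W). app f W u = \<one>\<^bsub>Val G W\<^esub> \<longleftrightarrow> u \<in> app k W ` carrier (Val K W)))"

definition pointwise_cokernel :: "('o, 'm, 'u) presheaf \<Rightarrow> ('o, 'm, 'u) presheaf \<Rightarrow> ('o, 'm, 'u) presheaf \<Rightarrow>
    ('o, 'm, 'u) presheaf_mor \<Rightarrow> ('o, 'm, 'u) presheaf_mor \<Rightarrow> bool" where
  "pointwise_cokernel F G L f c \<longleftrightarrow> (\<forall>W\<in>Obj C. app c W ` carrier (Val G W) = carrier (Val L W) \<and>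
     (\<forall>u\<in>carrier (Val G W). app c W u = \<one>\<^bsub>Val L W\<^esub> \<longleftrightarrow> u \<in> app f W ` carrier (Val F W)))"

lemma is_kernel_pointwise:
  fixes U :: "'u itself"
  assumes k: "k \<in> mor (mod_cat U C) K F" and f: "f \<in> mor (mod_cat U C) F G"
    and pk: "pointwise_kernel K F G k f"
  shows "is_kernel (mod_cat U C) K F G k f"
proof -
  interpret A: preadditive_category "mod_cat U C" by (rule preadditive_mod_cat)
  note nk = app_nat[OF k] and nf = app_nat[OF f]
  have "app (f \<cdot>\<^bsub>mod_cat U C\<^esub> k) W u = \<one>\<^bsub>Val G W\<^esub>" if "W \<in> Obj C" "u \<in> carrier (Val K W)" for W u
    using that pk nat_closed[OF nk that] app_comp[OF k f that] unfolding pointwise_kernel_def by auto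
  then have z: "f \<cdot>\<^bsub>mod_cat U C\<^esub> k = \<one>\<^bsub>Hom (mod_cat U C) K G\<^esub>"
    using zero_mod_iff[OF A.comp_mor[OF k f]] by blast
  show ?thesis
    unfolding is_kernel_def
  proof (intro conjI k f z allI ballI impI)
    fix H h assume h: "h \<in> mor (mod_cat U C) H F" and fh: "f \<cdot>\<^bsub>mod_cat U C\<^esub> h = \<one>\<^bsub>Hom (mod_cat U C) H G\<^esub>"
    have im: "app h W u \<in> app k W ` carrier (Val K W)" if "W \<in> Obj C" "u \<in> carrier (Val H W)" for W u
    proof -
      have "app f W (app h W u) = \<one>\<^bsub>Val G W\<^esub>"
        using app_comp[OF h f that] fh app_zero[OF that] by simp
      then show ?thesis using pk that nat_closed[OF app_nat[OF h] that] unfolding pointwise_kernel_def by blast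
    qed
    have inj: "inj_on (app k W) (carrier (Val K W))" if "W \<in> Obj C" for W
      using pk that unfolding pointwise_kernel_def by blast
    obtain \<theta> where \<theta>: "nat_trans C H K \<theta>" "\<forall>W\<in>Obj C. \<forall>u\<in>carrier (Val H W). app k W (\<theta> W u) = app h W u"
      using factor_injection[OF nk app_nat[OF h] mor_mod_psh(1)[OF k] mor_mod_psh(1)[OF f] mor_mod_psh(1)[OF h] inj im]
      by blast
    obtain t where t: "t \<in> mor (mod_cat U C) H K"
      "\<forall>W\<in>Obj C. \<forall>u\<in>carrier (Val H W). app t W u = \<theta> W u"
      using mod_obtain[OF mor_mod_fp(1)[OF h] mor_mod_fp(1)[OF k] \<theta>(1), where U = U] by blast
    have kt: "k \<cdot>\<^bsub>mod_cat U C\<^esub> t = h"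
      by (rule mod_ext[OF A.comp_mor[OF t(1) k] h]) (use \<theta>(2) t in \<open>simp add: app_comp[OF t(1) k]\<close>)
    show "\<exists>!u. u \<in> mor (mod_cat U C) H K \<and> k \<cdot>\<^bsub>mod_cat U C\<^esub> u = h"
    proof (rule ex1I[of _ t])
      show "t \<in> mor (mod_cat U C) H K \<and> k \<cdot>\<^bsub>mod_cat U C\<^esub> t = h" using t kt by blast
      fix v assume v: "v \<in> mor (mod_cat U C) H K \<and> k \<cdot>\<^bsub>mod_cat U C\<^esub> v = h"
      then have vm: "v \<in> mor (mod_cat U C) H K" by blast
      show "v = t"
      proof (rule mod_ext[OF vm t(1)])
        fix W u assume W: "W \<in> Obj C" "u \<in> carrier (Val H W)"
        have "app k W (app v W u) = app k W (app t W u)"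
          using app_comp[OF vm k W] app_comp[OF t(1) k W] v kt by simp
        then show "app v W u = app t W u"
          using inj_onD[OF inj[OF W(1)]] nat_closed[OF app_nat[OF vm] W] nat_closed[OF app_nat[OF t(1)] W] by blast
      qed
    qed
  qed
qed

lemma is_cokernel_pointwise:
  fixes U :: "'u itself"
  assumes f: "f \<in> mor (mod_cat U C) F G" and c: "c \<in> mor (mod_cat U C) G L"
    and pc: "pointwise_cokernel F G L f c"
  shows "is_cokernel (mod_cat U C) F G L f c"
proof -
  interpret A: preadditive_category "mod_cat U C" by (rule preadditive_mod_cat)
  note nc = app_nat[OF c] and nf = app_nat[OF f]
  have "app (c \<cdot>\<^bsub>mod_cat U C\<^esub> f) W u = \<one>\<^bsub>Val L W\<^esub>" if "W \<in> Obj C" "u \<in> carrier (Val F W)" for W u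
    using that pc nat_closed[OF nf that] app_comp[OF f c that] unfolding pointwise_cokernel_def by auto
  then have z: "c \<cdot>\<^bsub>mod_cat U C\<^esub> f = \<one>\<^bsub>Hom (mod_cat U C) F L\<^esub>"
    using zero_mod_iff[OF A.comp_mor[OF f c]] by blast
  have surj: "app c W ` carrier (Val G W) = carrier (Val L W)" if "W \<in> Obj C" for W
    using pc that unfolding pointwise_cokernel_def by blast
  show ?thesis
    unfolding is_cokernel_def
  proof (intro conjI f c z allI ballI impI)
    fix H h assume h: "h \<in> mor (mod_cat U C) G H" and hf: "h \<cdot>\<^bsub>mod_cat U C\<^esub> f = \<one>\<^bsub>Hom (mod_cat U C) F H\<^esub>"
    have ker: "app h W u = \<one>\<^bsub>Val H W\<^esub>" if "W \<in> Obj C" "u \<in> carrier (Val G W)" "app c W u = \<one>\<^bsub>Val L W\<^esub>" for W u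
    proof -
      have "u \<in> app f W ` carrier (Val F W)"
        using pc that unfolding pointwise_cokernel_def by simp
      then obtain v where v: "v \<in> carrier (Val F W)" "u = app f W v" by blast
      show ?thesis using app_comp[OF f h that(1) v(1)] hf app_zero[OF that(1) v(1)] v(2) by simp
    qed
    obtain \<theta> where \<theta>: "nat_trans C L H \<theta>" "\<forall>W\<in>Obj C. \<forall>u\<in>carrier (Val G W). \<theta> W (app c W u) = app h W u"
      using factor_surjection[OF nc app_nat[OF h] mor_mod_psh(1)[OF c] mor_mod_psh(2)[OF c] mor_mod_psh(2)[OF h] surj ker]
      by blast
    obtain t where t: "t \<in> mor (mod_cat U C) L H"
      "\<forall>W\<in>Obj C. \<forall>u\<in>carrier (Val L W). app t W u = \<theta> W u"
      using mod_obtain[OF mor_mod_fp(2)[OF c] mor_mod_fp(2)[OF h] \<theta>(1), where U = U] by blast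
    have tc: "t \<cdot>\<^bsub>mod_cat U C\<^esub> c = h"
      by (rule mod_ext[OF A.comp_mor[OF c t(1)] h])
        (use \<theta>(2) t(2) nat_closed[OF nc] app_comp[OF c t(1)] in metis)
    show "\<exists>!u. u \<in> mor (mod_cat U C) L H \<and> u \<cdot>\<^bsub>mod_cat U C\<^esub> c = h"
    proof (rule ex1I[of _ t])
      show "t \<in> mor (mod_cat U C) L H \<and> t \<cdot>\<^bsub>mod_cat U C\<^esub> c = h" using t tc by blast
      fix v assume v: "v \<in> mor (mod_cat U C) L H \<and> v \<cdot>\<^bsub>mod_cat U C\<^esub> c = h"
      then have vm: "v \<in> mor (mod_cat U C) L H" by blast
      show "v = t"
      proof (rule mod_ext[OF vm t(1)])
        fix W l assume W: "W \<in> Obj C" and "l \<in> carrier (Val L W)"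
        then obtain u where u: "u \<in> carrier (Val G W)" "l = app c W u" using surj by blast
        show "app v W l = app t W l"
          using app_comp[OF c vm W u(1)] app_comp[OF c t(1) W u(1)] v tc u(2) by simp
      qed
    qed
  qed
qed

end

section \<open>The abelian category of finitely presented functors\<close>

lemma (in preadditive_category) biproductD:
  assumes "is_biproduct C X Y P i j p q"
  shows "i \<in> mor C X P" "j \<in> mor C Y P" "p \<in> mor C P X" "q \<in> mor C P Y"
    and "p \<cdot> i = Idt C X" "q \<cdot> j = Idt C Y" "p \<cdot> j = \<one>\<^bsub>Hom C Y X\<^esub>" "q \<cdot> i = \<one>\<^bsub>Hom C X Y\<^esub>"
    and "(i \<cdot> p) \<otimes>\<^bsub>Hom C P P\<^esub> (j \<cdot> q) = Idt C P"
  using assms unfolding is_biproduct_def by auto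

lemma comm_group_subgroup:
  assumes "comm_group G" "subgroup H G"
  shows "comm_group (G\<lparr>carrier := H\<rparr>)"
proof -
  interpret comm_group G by fact
  interpret H: subgroup H G by fact
  show ?thesis
    by (rule group.group_comm_groupI[OF H.subgroup_is_group]) (use H.subset in \<open>auto intro: m_comm\<close>)
qed

section \<open>Finitely presented functors over a category with weak kernels\<close>

locale weak_kernel_category = additive_category C for C :: "('o, 'm) cat" (structure) +
  fixes U :: "'u itself"
  assumes weak_kernels: "has_weak_kernels C" and small: "locally_small U C"
begin

abbreviation A :: "(('o, 'm, 'u) presheaf, ('o, 'm, 'u) presheaf_mor) cat" where
  "A \<equiv> mod_cat U C"

lemma A_preadditive: "preadditive_category A"
  by (rule preadditive_mod_cat)

lemma weak_kernel:
  assumes "f \<in> mor C X Y"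
  obtains W g where "g \<in> mor C W X"
    "\<And>V h. h \<in> mor C V X \<Longrightarrow> f \<cdot> h = \<one>\<^bsub>Hom C V Y\<^esub> \<longleftrightarrow> (\<exists>l\<in>mor C V W. h = g \<cdot> l)"
proof -
  obtain W g where g: "g \<in> mor C W X" and ex: "\<forall>V\<in>Obj C. (\<lambda>h. g \<cdot> h) ` carrier (Hom C V W) =
      kernel (Hom C V X) (Hom C V Y) (\<lambda>h. f \<cdot> h)"
    using weak_kernels assms unfolding has_weak_kernels_def by blast
  have O: "W \<in> Obj C" "X \<in> Obj C" using g mor_Obj by blast+
  show ?thesis
  proof (rule that[OF g])
    fix V h assume h: "h \<in> mor C V X"
    then have V: "V \<in> Obj C" using mor_Obj by blast
    have "f \<cdot> h = \<one>\<^bsub>Hom C V Y\<^esub> \<longleftrightarrow> h \<in> kernel (Hom C V X) (Hom C V Y) (\<lambda>h. f \<cdot> h)"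
      using h mor_carrier by (simp add: kernel_def)
    also have "\<dots> \<longleftrightarrow> h \<in> (\<lambda>h. g \<cdot> h) ` mor C V W"
      using ex[rule_format, OF V] by (simp add: carrier_Hom_eq[OF V O(1)])
    finally show "f \<cdot> h = \<one>\<^bsub>Hom C V Y\<^esub> \<longleftrightarrow> (\<exists>l\<in>mor C V W. h = g \<cdot> l)" by blast
  qed
qed

text \<open>Built as a weak kernel of the difference of \<open>f p\<close> and \<open>g q\<close> on
  the biproduct of \<open>X\<close> and \<open>Y\<close>. The conclusion records the first leg:
  \<open>f \<cdot> h\<close> factors through \<open>g\<close> exactly when \<open>h\<close> factors
  through \<open>p\<close>, which is what describes generators and relations of kernels.\<close>

lemma weak_pullback:
  assumes f: "f \<in> mor C X Z" and g: "g \<in> mor C Y Z"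
  obtains P p q where "p \<in> mor C P X" "q \<in> mor C P Y" "f \<cdot> p = g \<cdot> q"
    "\<And>V h k. h \<in> mor C V X \<Longrightarrow> k \<in> mor C V Y \<Longrightarrow> f \<cdot> h = g \<cdot> k \<Longrightarrow> \<exists>l\<in>mor C V P. h = p \<cdot> l"
proof -
  have O: "X \<in> Obj C" "Y \<in> Obj C" "Z \<in> Obj C" using f g mor_Obj by blast+
  obtain B i j p q where b: "is_biproduct C X Y B i j p q" using has_biproducts O by blast
  note B = biproductD[OF b]
  note [simp] = B(1-4)[THEN mor_arr] mor_arr[OF f] mor_arr[OF g]
  define d where "d = (f \<cdot> p) \<otimes>\<^bsub>Hom C B Z\<^esub> inv\<^bsub>Hom C B Z\<^esub> (g \<cdot> q)"
  have d: "d \<in> mor C B Z" by (simp add: d_def mor_iff)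
  have dl: "d \<cdot> l = \<one>\<^bsub>Hom C V Z\<^esub> \<longleftrightarrow> f \<cdot> p \<cdot> l = g \<cdot> q \<cdot> l" if "l \<in> mor C V B" for V l
  proof -
    note [simp] = mor_arr[OF that]
    have "d \<cdot> l = (f \<cdot> p \<cdot> l) \<otimes>\<^bsub>Hom C V Z\<^esub> inv\<^bsub>Hom C V Z\<^esub> (g \<cdot> q \<cdot> l)" by (simp add: d_def)
    then show ?thesis using diff_zero_iff[of "f \<cdot> p \<cdot> l" V Z "g \<cdot> q \<cdot> l"] by (simp add: mor_iff)
  qed
  obtain K w where w: "w \<in> mor C K B"
    and univ: "\<And>V h. h \<in> mor C V B \<Longrightarrow> d \<cdot> h = \<one>\<^bsub>Hom C V Z\<^esub> \<longleftrightarrow> (\<exists>l\<in>mor C V K. h = w \<cdot> l)"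
    using weak_kernel[OF d] by metis
  note [simp] = mor_arr[OF w]
  have K: "K \<in> Obj C" using w mor_Obj by blast
  show ?thesis
  proof (rule that[of "p \<cdot> w" K "q \<cdot> w"])
    show "p \<cdot> w \<in> mor C K X" "q \<cdot> w \<in> mor C K Y" by (simp_all add: mor_iff)
    have "\<exists>l\<in>mor C K K. w = w \<cdot> l" by (rule bexI[of _ "Idt C K"]) (use K in \<open>simp_all add: mor_iff\<close>)
    then have "d \<cdot> w = \<one>\<^bsub>Hom C K Z\<^esub>" using univ[OF w] by blast
    then show "f \<cdot> p \<cdot> w = g \<cdot> q \<cdot> w" using dl[OF w] by simp
    fix V h k assume h: "h \<in> mor C V X" and k: "k \<in> mor C V Y" and e: "f \<cdot> h = g \<cdot> k"
    note [simp] = mor_arr[OF h] mor_arr[OF k]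
    have V: "V \<in> Obj C" using h mor_Obj by blast
    let ?l = "(i \<cdot> h) \<otimes>\<^bsub>Hom C V B\<^esub> (j \<cdot> k)"
    have l: "?l \<in> mor C V B" by (simp add: mor_iff)
    have pl: "p \<cdot> ?l = h" "q \<cdot> ?l = k"
      using O V by (simp_all add: B(5-8)[THEN comp_eq_ext1] add_simps)
    then have "d \<cdot> ?l = \<one>\<^bsub>Hom C V Z\<^esub>" using dl[OF l] e by simp
    then obtain m where m: "m \<in> mor C V K" "?l = w \<cdot> m" using univ[OF l] by blast
    then have "h = (p \<cdot> w) \<cdot> m" using pl(1) mor_arr[OF m(1)] by simp
    with m show "\<exists>l\<in>mor C V K. h = (p \<cdot> w) \<cdot> l" by blast
  qed
qed

text \<open>The quotient of the representable functor of \<open>X0\<close> by the image of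
  \<open>a\<close>, with values moved to \<open>'u\<close>. It stands for the cokernel of a morphism
  of representables, and for zero \<open>a\<close> it stands for the representable functor
  itself.\<close>

lemma exists_presentation:
  assumes a: "a \<in> mor C X1 X0"
  shows "\<exists>(F :: ('o, 'm, 'u) presheaf) x. fp F \<and> presents F X0 X1 x a"
proof -
  have O: "X1 \<in> Obj C" "X0 \<in> Obj C" using a mor_Obj by blast+
  note [simp] = mor_arr[OF a]
  let ?R = "representable C X0"
  have R: "psh ?R" using psh_representable O by blast
  define N where "N W = {a \<cdot> k |k. k \<in> mor C W X1}" for W
  have N: "subgroup (N W) (Val ?R W)" if W: "W \<in> Obj C" for W
  proof -
    interpret group "Hom C W X0" using W O by simp
    have "subgroup (N W) (Hom C W X0)"
    proof (rule subgroupI)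
      show "N W \<subseteq> carrier (Hom C W X0)" using comp_mor[OF _ a] mor_carrier by (auto simp: N_def)
      show "N W \<noteq> {}" using zero_arr[OF W O(1)] by (auto simp: N_def mor_iff)
      fix h assume "h \<in> N W"
      then obtain k where k: "k \<in> mor C W X1" "h = a \<cdot> k" by (auto simp: N_def)
      then show "inv\<^bsub>Hom C W X0\<^esub> h \<in> N W"
        using mor_arr[OF k(1)] unfolding N_def
        by (intro CollectI exI[of _ "inv\<^bsub>Hom C W X1\<^esub> k"]) (simp add: mor_iff)
      fix h' assume "h' \<in> N W"
      then obtain k' where k': "k' \<in> mor C W X1" "h' = a \<cdot> k'" by (auto simp: N_def)
      show "h \<otimes>\<^bsub>Hom C W X0\<^esub> h' \<in> N W"
        using mor_arr[OF k(1)] mor_arr[OF k'(1)] k(2) k'(2) unfolding N_def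
        by (intro CollectI exI[of _ "k \<otimes>\<^bsub>Hom C W X1\<^esub> k'"]) (simp add: mor_iff)
    qed
    then show ?thesis by (simp add: representable_def)
  qed
  have act: "Act ?R b u \<in> N V" if "b \<in> mor C V W" "u \<in> N W" for b V W u
  proof -
    obtain k where k: "k \<in> mor C W X1" "u = a \<cdot> k" using \<open>u \<in> N W\<close> by (auto simp: N_def)
    then show ?thesis using mor_arr[OF k(1)] mor_arr[OF that(1)] unfolding N_def
      by (intro CollectI exI[of _ "k \<cdot> b"]) (simp add: representable_def mor_iff)
  qed
  have sm: "\<exists>\<iota> :: 'm \<Rightarrow> 'u. inj_on \<iota> (carrier (Val ?R W))" if "W \<in> Obj C" for W
    using small that O unfolding locally_small_def by (simp add: representable_def)
  have "\<exists>(F :: ('o, 'm, 'u) presheaf) \<pi>. psh F \<and> nat_trans C ?R F \<pi> \<and>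
      (\<forall>W\<in>Obj C. \<pi> W ` carrier (Val ?R W) = carrier (Val F W) \<and>
        (\<forall>u\<in>carrier (Val ?R W). \<pi> W u = \<one>\<^bsub>Val F W\<^esub> \<longleftrightarrow> u \<in> N W))"
    by (intro quotient_presheaf[OF R] N act sm; assumption)
  then obtain F :: "('o, 'm, 'u) presheaf" and \<pi> where F: "psh F"
    and \<pi>: "nat_trans C ?R F \<pi>" and \<pi>2: "\<forall>W\<in>Obj C. \<pi> W ` carrier (Val ?R W) = carrier (Val F W) \<and>
      (\<forall>u\<in>carrier (Val ?R W). \<pi> W u = \<one>\<^bsub>Val F W\<^esub> \<longleftrightarrow> u \<in> N W)"
    by blast
  let ?x = "\<pi> X0 (Idt C X0)"
  note y = yoneda[OF F \<pi>]
  have "presents F X0 X1 ?x a"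
    unfolding presents_def
  proof (intro conjI ballI allI a)
    show "?x \<in> carrier (Val F X0)"
      using nat_closed[OF \<pi> O(2), of "Idt C X0"] O by (simp add: representable_def carrier_Hom_iff mor_iff)
    show "\<exists>h\<in>mor C W X0. u = Act F h ?x" if W: "W \<in> Obj C" and u: "u \<in> carrier (Val F W)" for W u
    proof -
      have "u \<in> \<pi> W ` mor C W X0" using \<pi>2 W u O by (simp add: representable_def carrier_Hom_eq)
      then show ?thesis using y by blast
    qed
    fix W h assume h: "h \<in> mor C W X0"
    then have "W \<in> Obj C" using mor_Obj by blast
    then have "Act F h ?x = \<one>\<^bsub>Val F W\<^esub> \<longleftrightarrow> h \<in> N W"
      using \<pi>2 mor_carrier[OF h] by (simp add: representable_def y[OF h, symmetric])
    then show "Act F h ?x = \<one>\<^bsub>Val F W\<^esub> \<longleftrightarrow> (\<exists>k\<in>mor C W X1. h = a \<cdot> k)"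
      unfolding N_def by blast
  qed
  with F show ?thesis using finitely_presented_iff by blast
qed

text \<open>Let \<open>p\<close> lift \<open>f\<close> to generators. The element of
  \<open>F\<close> given by \<open>h\<close> lies in the pointwise kernel exactly when
  \<open>p \<cdot> h\<close> is a relation of \<open>G\<close>, i.e. factors through
  \<open>b\<close>; a weak pullback of \<open>p\<close> and \<open>b\<close> provides a generator
  over \<open>W0\<close> for these elements. Its relations are given by a weak pullback of
  \<open>w1\<close> and \<open>a\<close>.\<close>

lemma exists_kernel:
  assumes f: "f \<in> mor A F G"
  shows "\<exists>K k. k \<in> mor A K F \<and> pointwise_kernel K F G k f"
proof -
  note F = mor_mod_psh(1)[OF f] and G = mor_mod_psh(2)[OF f] and nf = app_nat[OF f]
  define N where "N W = {u \<in> carrier (Val F W). app f W u = \<one>\<^bsub>Val G W\<^esub>}" for W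
  have N: "subgroup (N W) (Val F W)" if "W \<in> Obj C" for W
  proof -
    interpret group_hom "Val F W" "Val G W" "app f W"
      using psh_group[OF F that] psh_group[OF G that] nat_hom[OF nf that]
      by (simp add: group_hom_def group_hom_axioms_def)
    show ?thesis using subgroup_kernel by (simp add: N_def kernel_def)
  qed
  have act: "Act F b u \<in> N V" if "b \<in> mor C V W" "u \<in> N W" for b V W u
    using that mor_arr[OF that(1)] F G nat_act[OF nf, of b V u] by (auto simp: N_def)
  define K where "K = F\<lparr>Val := \<lambda>W. (Val F W)\<lparr>carrier := N W\<rparr>\<rparr>"
  have K [simp]: "carrier (Val K W) = N W" "mult (Val K W) = mult (Val F W)" "one (Val K W) = one (Val F W)"
    "Act K = Act F" for W by (simp_all add: K_def)
  have NF: "u \<in> carrier (Val F W)" if "u \<in> N W" for u W using that by (simp add: N_def)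
  have Kpsh: "psh K"
  proof (rule contravariant_functor.intro)
    show "comm_group (Val K X)" if "X \<in> Obj C" for X
      using comm_group_subgroup[OF psh_comm_group[OF F that] N[OF that]] by (simp add: K_def)
    fix a X Y assume a: "a \<in> mor C X Y"
    show "Act K a \<in> hom (Val K Y) (Val K X)"
      by (rule homI) (use act[OF a] NF F mor_arr[OF a] in auto)
  qed (use NF F in \<open>auto simp: mor_iff\<close>)
  obtain X0 X1 x a where Fp: "presents F X0 X1 x a"
    using mor_mod_fp(1)[OF f] unfolding finitely_presented_iff by blast
  obtain Y0 Y1 y b where Gp: "presents G Y0 Y1 y b"
    using mor_mod_fp(2)[OF f] unfolding finitely_presented_iff by blast
  note P = presentsD[OF Fp] and R = presentsD[OF Gp]
  have O: "X0 \<in> Obj C" "X1 \<in> Obj C" using P(2) mor_Obj by blast+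
  obtain p where p: "p \<in> mor C X0 Y0" "app f X0 x = Act G p y"
    using R(3)[OF O(1) nat_closed[OF nf O(1) P(1)]] by blast
  have fh: "app f W (Act F h x) = Act G (p \<cdot> h) y" if "h \<in> mor C W X0" for W h
    using nat_act[OF nf, of h W x] P(1) R(1) p mor_arr[OF that] mor_arr[OF p(1)] G by simp
  obtain W0 w1 w2 where w: "w1 \<in> mor C W0 X0" "w2 \<in> mor C W0 Y1" "p \<cdot> w1 = b \<cdot> w2"
    and wu: "\<And>V h k. h \<in> mor C V X0 \<Longrightarrow> k \<in> mor C V Y1 \<Longrightarrow> p \<cdot> h = b \<cdot> k \<Longrightarrow> \<exists>l\<in>mor C V W0. h = w1 \<cdot> l"
    using weak_pullback[OF p(1) R(2)] by metis
  obtain W1 r1 r2 where r: "r1 \<in> mor C W1 W0" "r2 \<in> mor C W1 X1" "w1 \<cdot> r1 = a \<cdot> r2"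
    and ru: "\<And>V h k. h \<in> mor C V W0 \<Longrightarrow> k \<in> mor C V X1 \<Longrightarrow> w1 \<cdot> h = a \<cdot> k \<Longrightarrow> \<exists>l\<in>mor C V W1. h = r1 \<cdot> l"
    using weak_pullback[OF w(1) P(2)] by metis
  note [simp] = mor_arr[OF w(1)] mor_arr[OF w(2)] mor_arr[OF r(1)] mor_arr[OF r(2)] mor_arr[OF P(2)]
    mor_arr[OF R(2)] mor_arr[OF p(1)]
  let ?x = "Act F w1 x"
  have Nx: "Act F h x \<in> N W \<longleftrightarrow> (\<exists>k\<in>mor C W Y1. p \<cdot> h = b \<cdot> k)" if h: "h \<in> mor C W X0" for W h
    using fh[OF h] R(4)[OF comp_mor[OF h p(1)]] mor_arr[OF h] P(1) F by (simp add: N_def)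
  have "presents K W0 W1 ?x r1"
    unfolding presents_def K
  proof (intro conjI allI ballI r(1))
    show "?x \<in> N W0" using Nx[OF w(1)] w by blast
    fix W u assume W: "W \<in> Obj C" and u: "u \<in> N W"
    then obtain h where h: "h \<in> mor C W X0" "u = Act F h x" using P(3) NF by blast
    then obtain k where "k \<in> mor C W Y1" "p \<cdot> h = b \<cdot> k" using Nx u by blast
    then obtain l where l: "l \<in> mor C W W0" "h = w1 \<cdot> l" using wu h by blast
    then show "\<exists>l\<in>mor C W W0. u = Act F l ?x"
      using h(2) mor_arr[OF l(1)] P(1) F by (intro bexI[of _ l]) simp_all
  next
    fix W h assume h: "h \<in> mor C W W0"
    have "Act F h ?x = \<one>\<^bsub>Val F W\<^esub> \<longleftrightarrow> (\<exists>k\<in>mor C W X1. w1 \<cdot> h = a \<cdot> k)"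
      using P(4)[OF comp_mor[OF h w(1)]] mor_arr[OF h] P(1) F by simp
    also have "\<dots> \<longleftrightarrow> (\<exists>l\<in>mor C W W1. h = r1 \<cdot> l)"
    proof
      assume "\<exists>k\<in>mor C W X1. w1 \<cdot> h = a \<cdot> k"
      then show "\<exists>l\<in>mor C W W1. h = r1 \<cdot> l" using ru[OF h] by blast
    next
      assume "\<exists>l\<in>mor C W W1. h = r1 \<cdot> l"
      then obtain l where l: "l \<in> mor C W W1" "h = r1 \<cdot> l" by blast
      note [simp] = mor_arr[OF l(1)]
      show "\<exists>k\<in>mor C W X1. w1 \<cdot> h = a \<cdot> k"
        by (rule bexI[of _ "r2 \<cdot> l"]) (simp_all add: l(2) r(3)[THEN comp_eq_ext] mor_iff)
    qed
    finally show "Act F h ?x = \<one>\<^bsub>Val F W\<^esub> \<longleftrightarrow> (\<exists>l\<in>mor C W W1. h = r1 \<cdot> l)" .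
  qed
  then have Kfp: "fp K" using Kpsh finitely_presented_iff by blast
  have "nat_trans C K F (\<lambda>W u. u)" by (rule nat_transI) (use NF in auto)
  then obtain k where k: "k \<in> mor A K F" "\<forall>W\<in>Obj C. \<forall>u\<in>carrier (Val K W). app k W u = u"
    using mod_obtain[OF Kfp mor_mod_fp(1)[OF f], where U = U] by blast
  have "pointwise_kernel K F G k f"
    unfolding pointwise_kernel_def using k(2) by (auto simp: N_def inj_on_def image_iff)
  with k(1) show ?thesis by blast
qed

text \<open>The quotient of \<open>G\<close> by the image of \<open>f\<close> keeps the generator of
  \<open>G\<close> and gains relations from the generator of \<open>F\<close>. If \<open>r\<close>
  lifts \<open>f\<close> to generators, all relations together form the row \<open>[r, b]\<close> on
  the biproduct of \<open>X0\<close> and \<open>Y1\<close>.\<close>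

lemma exists_cokernel:
  assumes f: "f \<in> mor A F G"
  shows "\<exists>L c. c \<in> mor A G L \<and> pointwise_cokernel F G L f c"
proof -
  note F = mor_mod_psh(1)[OF f] and G = mor_mod_psh(2)[OF f] and nf = app_nat[OF f]
  define N where "N W = app f W ` carrier (Val F W)" for W
  have N: "subgroup (N W) (Val G W)" if "W \<in> Obj C" for W
  proof -
    interpret group_hom "Val F W" "Val G W" "app f W"
      using psh_group[OF F that] psh_group[OF G that] nat_hom[OF nf that]
      by (simp add: group_hom_def group_hom_axioms_def)
    show ?thesis using img_is_subgroup by (simp add: N_def)
  qed
  have act: "Act G b u \<in> N V" if "b \<in> mor C V W" "u \<in> N W" for b V W u
  proof -
    obtain v where v: "v \<in> carrier (Val F W)" "u = app f W v" using \<open>u \<in> N W\<close> by (auto simp: N_def)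
    have "Act G b u = app f V (Act F b v)" using nat_act[OF nf, of b V v] mor_arr[OF that(1)] v by simp
    then show ?thesis using v mor_arr[OF that(1)] F by (auto simp: N_def)
  qed
  have sm: "\<exists>\<iota> :: 'u \<Rightarrow> 'u. inj_on \<iota> (carrier (Val G W))" for W by (rule exI[of _ id]) simp
  have "\<exists>(L :: ('o, 'm, 'u) presheaf) \<pi>. psh L \<and> nat_trans C G L \<pi> \<and>
      (\<forall>W\<in>Obj C. \<pi> W ` carrier (Val G W) = carrier (Val L W) \<and>
        (\<forall>u\<in>carrier (Val G W). \<pi> W u = \<one>\<^bsub>Val L W\<^esub> \<longleftrightarrow> u \<in> N W))"
    by (intro quotient_presheaf[OF G] N act sm; assumption)
  then obtain L :: "('o, 'm, 'u) presheaf" and \<pi> where L: "psh L"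
    and \<pi>: "nat_trans C G L \<pi>" and \<pi>2: "\<forall>W\<in>Obj C. \<pi> W ` carrier (Val G W) = carrier (Val L W) \<and>
      (\<forall>u\<in>carrier (Val G W). \<pi> W u = \<one>\<^bsub>Val L W\<^esub> \<longleftrightarrow> u \<in> N W)"
    by blast
  obtain X0 X1 x a where Fp: "presents F X0 X1 x a"
    using mor_mod_fp(1)[OF f] unfolding finitely_presented_iff by blast
  obtain Y0 Y1 y b where Gp: "presents G Y0 Y1 y b"
    using mor_mod_fp(2)[OF f] unfolding finitely_presented_iff by blast
  note P = presentsD[OF Fp] and R = presentsD[OF Gp]
  have O: "X0 \<in> Obj C" "Y1 \<in> Obj C" "Y0 \<in> Obj C" using P(2) R(2) mor_Obj by blast+
  obtain r where r: "r \<in> mor C X0 Y0" "app f X0 x = Act G r y"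
    using R(3)[OF O(1) nat_closed[OF nf O(1) P(1)]] by blast
  obtain B i j p q where bi: "is_biproduct C X0 Y1 B i j p q" using has_biproducts O by blast
  note B = biproductD[OF bi]
  note [simp] = B(1-4)[THEN mor_arr] mor_arr[OF r(1)] mor_arr[OF R(2)] mor_arr[OF P(2)]
  define d where "d = (r \<cdot> p) \<otimes>\<^bsub>Hom C B Y0\<^esub> (b \<cdot> q)"
  have d: "d \<in> mor C B Y0" by (simp add: d_def mor_iff)
  have Lh: "Act L h (\<pi> Y0 y) = \<pi> W (Act G h y)" if "h \<in> mor C W Y0" for W h
    using nat_act[OF \<pi>, of h W y] mor_arr[OF that] R(1) by simp
  have fm: "app f W (Act F m x) = Act G (r \<cdot> m) y" if "m \<in> mor C W X0" for W m
    using nat_act[OF nf, of m W x] P(1) R(1) r mor_arr[OF that] G by simp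
  have "presents L Y0 B (\<pi> Y0 y) d"
    unfolding presents_def
  proof (intro conjI allI ballI d)
    show "\<pi> Y0 y \<in> carrier (Val L Y0)" using nat_closed[OF \<pi> O(3) R(1)] .
    show "\<exists>h\<in>mor C W Y0. u = Act L h (\<pi> Y0 y)" if W: "W \<in> Obj C" and u: "u \<in> carrier (Val L W)" for W u
    proof -
      obtain v where v: "v \<in> carrier (Val G W)" "u = \<pi> W v" using \<pi>2 W u by blast
      then show ?thesis using R(3)[OF W v(1)] Lh by auto
    qed
    fix W h assume h: "h \<in> mor C W Y0"
    then have W: "W \<in> Obj C" using mor_Obj by blast
    note [simp] = mor_arr[OF h]
    have "Act L h (\<pi> Y0 y) = \<one>\<^bsub>Val L W\<^esub> \<longleftrightarrow> Act G h y \<in> N W"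
      using Lh[OF h] \<pi>2 W R(1) G by simp
    also have "\<dots> \<longleftrightarrow> (\<exists>m\<in>mor C W X0. Act G h y = Act G (r \<cdot> m) y)"
    proof
      assume "Act G h y \<in> N W"
      then obtain v where v: "v \<in> carrier (Val F W)" "Act G h y = app f W v" by (auto simp: N_def)
      then show "\<exists>m\<in>mor C W X0. Act G h y = Act G (r \<cdot> m) y" using P(3)[OF W v(1)] fm by auto
    next
      assume "\<exists>m\<in>mor C W X0. Act G h y = Act G (r \<cdot> m) y"
      then obtain m where m: "m \<in> mor C W X0" "Act G h y = app f W (Act F m x)" using fm by auto
      then show "Act G h y \<in> N W" using mor_arr[OF m(1)] P(1) F by (auto simp: N_def)
    qed
    \<comment> \<open>The morphisms \<open>h\<close> and \<open>r \<cdot> m\<close> give the same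
      element of \<open>G\<close> exactly when their difference is a relation of \<open>G\<close>,
      i.e. of the form \<open>b \<cdot> k\<close>.\<close>
    also have "\<dots> \<longleftrightarrow> (\<exists>m\<in>mor C W X0. \<exists>k\<in>mor C W Y1. h = (r \<cdot> m) \<otimes>\<^bsub>Hom C W Y0\<^esub> (b \<cdot> k))"
    proof (rule bex_cong[OF refl])
      fix m assume m: "m \<in> mor C W X0"
      note [simp] = mor_arr[OF m]
      have rm: "r \<cdot> m \<in> mor C W Y0" by (simp add: mor_iff)
      let ?n = "h \<otimes>\<^bsub>Hom C W Y0\<^esub> inv\<^bsub>Hom C W Y0\<^esub> (r \<cdot> m)"
      have n: "?n \<in> mor C W Y0" by (simp add: mor_iff)
      have "Act G h y = Act G (r \<cdot> m) y \<longleftrightarrow> Act G ?n y = \<one>\<^bsub>Val G W\<^esub>"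
        using act_diff[OF G h rm R(1)] by simp
      also have "\<dots> \<longleftrightarrow> (\<exists>k\<in>mor C W Y1. ?n = b \<cdot> k)" by (rule R(4)[OF n])
      also have "\<dots> \<longleftrightarrow> (\<exists>k\<in>mor C W Y1. h = (r \<cdot> m) \<otimes>\<^bsub>Hom C W Y0\<^esub> (b \<cdot> k))"
      proof (rule bex_cong[OF refl])
        fix k assume k: "k \<in> mor C W Y1"
        interpret comm_group "Hom C W Y0" using hom_group W O by blast
        have "b \<cdot> k \<in> mor C W Y0" using comp_mor[OF k R(2)] .
        then have c: "h \<in> carrier (Hom C W Y0)" "r \<cdot> m \<in> carrier (Hom C W Y0)" "b \<cdot> k \<in> carrier (Hom C W Y0)"
          using h rm mor_carrier by blast+
        show "?n = b \<cdot> k \<longleftrightarrow> h = (r \<cdot> m) \<otimes>\<^bsub>Hom C W Y0\<^esub> (b \<cdot> k)"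
        proof
          assume "?n = b \<cdot> k"
          then have "(r \<cdot> m) \<otimes>\<^bsub>Hom C W Y0\<^esub> (b \<cdot> k) = ?n \<otimes>\<^bsub>Hom C W Y0\<^esub> (r \<cdot> m)" using c by (simp add: m_comm)
          then show "h = (r \<cdot> m) \<otimes>\<^bsub>Hom C W Y0\<^esub> (b \<cdot> k)" using c by (simp add: m_assoc)
        next
          assume e: "h = (r \<cdot> m) \<otimes>\<^bsub>Hom C W Y0\<^esub> (b \<cdot> k)"
          then have "?n = (b \<cdot> k) \<otimes>\<^bsub>Hom C W Y0\<^esub> (r \<cdot> m) \<otimes>\<^bsub>Hom C W Y0\<^esub> inv\<^bsub>Hom C W Y0\<^esub> (r \<cdot> m)"
            using c by (simp add: m_comm)
          then show "?n = b \<cdot> k" using c by (simp add: m_assoc)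
        qed
      qed
      finally show "Act G h y = Act G (r \<cdot> m) y \<longleftrightarrow> (\<exists>k\<in>mor C W Y1. h = (r \<cdot> m) \<otimes>\<^bsub>Hom C W Y0\<^esub> (b \<cdot> k))" .
    qed
    also have "\<dots> \<longleftrightarrow> (\<exists>l\<in>mor C W B. h = d \<cdot> l)"
    proof
      assume "\<exists>m\<in>mor C W X0. \<exists>k\<in>mor C W Y1. h = (r \<cdot> m) \<otimes>\<^bsub>Hom C W Y0\<^esub> (b \<cdot> k)"
      then obtain m k where m: "m \<in> mor C W X0" and k: "k \<in> mor C W Y1"
        and e: "h = (r \<cdot> m) \<otimes>\<^bsub>Hom C W Y0\<^esub> (b \<cdot> k)" by blast
      note [simp] = mor_arr[OF m] mor_arr[OF k]
      let ?l = "(i \<cdot> m) \<otimes>\<^bsub>Hom C W B\<^esub> (j \<cdot> k)"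
      have pl: "p \<cdot> ?l = m" "q \<cdot> ?l = k"
        using O W by (simp_all add: B(5-8)[THEN comp_eq_ext1] add_simps)
      have l: "?l \<in> mor C W B" by (simp add: mor_iff)
      have "d \<cdot> ?l = (r \<cdot> (p \<cdot> ?l)) \<otimes>\<^bsub>Hom C W Y0\<^esub> (b \<cdot> (q \<cdot> ?l))"
        using mor_arr[OF l] unfolding d_def by (simp del: distrib(2))
      then have "h = d \<cdot> ?l" using e pl by simp
      with l show "\<exists>l\<in>mor C W B. h = d \<cdot> l" by blast
    next
      assume "\<exists>l\<in>mor C W B. h = d \<cdot> l"
      then obtain l where l: "l \<in> mor C W B" "h = d \<cdot> l" by blast
      note [simp] = mor_arr[OF l(1)]
      show "\<exists>m\<in>mor C W X0. \<exists>k\<in>mor C W Y1. h = (r \<cdot> m) \<otimes>\<^bsub>Hom C W Y0\<^esub> (b \<cdot> k)"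
        by (rule bexI[of _ "p \<cdot> l"], rule bexI[of _ "q \<cdot> l"]) (simp_all add: l(2) d_def mor_iff)
    qed
    finally show "Act L h (\<pi> Y0 y) = \<one>\<^bsub>Val L W\<^esub> \<longleftrightarrow> (\<exists>l\<in>mor C W B. h = d \<cdot> l)" .
  qed
  then have Lfp: "fp L" using L finitely_presented_iff by blast
  obtain c where c: "c \<in> mor A G L" "\<forall>W\<in>Obj C. \<forall>u\<in>carrier (Val G W). app c W u = \<pi> W u"
    using mod_obtain[OF mor_mod_fp(2)[OF f] Lfp \<pi>, where U = U] by blast
  have "app c W ` carrier (Val G W) = \<pi> W ` carrier (Val G W)" if "W \<in> Obj C" for W
    using c(2) that by (intro image_cong) auto
  then have "pointwise_cokernel F G L f c"
    unfolding pointwise_cokernel_def using c(2) \<pi>2 by (simp add: N_def)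
  with c(1) show ?thesis by blast
qed

lemma presents_mod_ext:
  assumes "presents F X0 X1 x a" "f \<in> mor A F G" "g \<in> mor A F G" "app f X0 x = app g X0 x"
  shows "f = g"
  by (rule mod_ext[OF assms(2,3)]) (rule presents_ext[OF assms(1) app_nat[OF assms(2)] app_nat[OF assms(3)] assms(4)])

lemma presents_mod_lift:
  assumes "fp F" "fp G" "presents F X0 X1 x a" "y \<in> carrier (Val G X0)" "Act G a y = \<one>\<^bsub>Val G X1\<^esub>"
  shows "\<exists>f\<in>mor A F G. (\<forall>W. \<forall>h\<in>mor C W X0. app f W (Act F h x) = Act G h y) \<and> app f X0 x = y"
proof -
  note F = fp_psh[OF assms(1)] and G = fp_psh[OF assms(2)]
  have O: "X0 \<in> Obj C" using presentsD(2)[OF assms(3)] mor_Obj by blast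
  obtain \<phi> where \<phi>: "nat_trans C F G \<phi>" "\<forall>W. \<forall>h\<in>mor C W X0. \<phi> W (Act F h x) = Act G h y"
    using presents_lift[OF F G assms(3-5)] by blast
  obtain f where f: "f \<in> mor A F G" "\<forall>W\<in>Obj C. \<forall>u\<in>carrier (Val F W). app f W u = \<phi> W u"
    using mod_obtain[OF assms(1,2) \<phi>(1), where U = U] by blast
  have fh: "app f W (Act F h x) = Act G h y" if h: "h \<in> mor C W X0" for W h
  proof -
    have "W \<in> Obj C" using h mor_Obj by blast
    moreover have "Act F h x \<in> carrier (Val F W)" using mor_arr[OF h] presentsD(1)[OF assms(3)] F by simp
    ultimately show ?thesis using f(2) \<phi>(2) h by simp
  qed
  have "app f X0 x = y" using fh[OF id_mor[OF O]] F G O assms(4) presentsD(1)[OF assms(3)] by simp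
  with f(1) fh show ?thesis by blast
qed

text \<open>A zero object is presented by an identity, and the biproduct of \<open>F\<close> and
  \<open>G\<close> by the diagonal matrix of their relations. Injections and projections are defined
  on generators by \<open>presents_mod_lift\<close>, and the biproduct equations are checked on
  generators.\<close>

lemma additive_A: "additive_category A"
proof -
  interpret A: preadditive_category A by (rule A_preadditive)
  show ?thesis
  proof
    obtain X where X: "X \<in> Obj C" using has_zero_object unfolding is_zero_object_def by blast
    obtain Z :: "('o, 'm, 'u) presheaf" and z where Z: "fp Z" "presents Z X X z (Idt C X)"
      using exists_presentation[OF id_mor[OF X]] by blast
    have "u = \<one>\<^bsub>Val Z W\<^esub>" if W: "W \<in> Obj C" and u: "u \<in> carrier (Val Z W)" for W u
    proof -
      obtain h where h: "h \<in> mor C W X" "u = Act Z h z" using presentsD(3)[OF Z(2) W u] by blast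
      then have "h = Idt C X \<cdot> h" by (simp add: mor_iff)
      then show ?thesis using presentsD(4)[OF Z(2) h(1)] h by blast
    qed
    then have "Idt A Z = \<one>\<^bsub>Hom A Z Z\<^esub>"
      using zero_mod_iff[OF A.id_mor, of Z] Z(1) app_Idt[of _ _ Z U] by simp
    then show "\<exists>Z. is_zero_object A Z" using Z(1) A.zero_object_iff by auto
  next
    fix F G assume "F \<in> Obj A" "G \<in> Obj A"
    then have fg: "fp F" "fp G" by simp_all
    note F = fp_psh[OF fg(1)] and G = fp_psh[OF fg(2)]
    obtain X0 X1 x a where Fp: "presents F X0 X1 x a" using fg unfolding finitely_presented_iff by blast
    obtain Y0 Y1 y b where Gp: "presents G Y0 Y1 y b" using fg unfolding finitely_presented_iff by blast
    note P = presentsD[OF Fp] and R = presentsD[OF Gp]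
    have O: "X0 \<in> Obj C" "X1 \<in> Obj C" "Y1 \<in> Obj C" "Y0 \<in> Obj C" using P(2) R(2) mor_Obj by blast+
    obtain P0 i0 j0 p0 q0 where b0: "is_biproduct C X0 Y0 P0 i0 j0 p0 q0" using has_biproducts O by blast
    obtain P1 i1 j1 p1 q1 where b1: "is_biproduct C X1 Y1 P1 i1 j1 p1 q1" using has_biproducts O by blast
    note B0 = biproductD[OF b0] and B1 = biproductD[OF b1]
    note [simp] = B0(1-4)[THEN mor_arr] B1(1-4)[THEN mor_arr] mor_arr[OF P(2)] mor_arr[OF R(2)]
    have PO: "P0 \<in> Obj C" "P1 \<in> Obj C" using B0(1) B1(1) mor_Obj by blast+
    \<comment> \<open>The diagonal matrix with entries \<open>a\<close> and \<open>b\<close>. The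
      equations \<open>ci\<close> say that it commutes with the structure maps of the biproducts of
      generators and of relations, so these maps induce the morphisms \<open>i\<close>,
      \<open>j\<close>, \<open>p\<close> and \<open>q\<close>.\<close>
    define c where "c = (i0 \<cdot> a \<cdot> p1) \<otimes>\<^bsub>Hom C P1 P0\<^esub> (j0 \<cdot> b \<cdot> q1)"
    have c: "c \<in> mor C P1 P0" by (simp add: c_def mor_iff)
    note [simp] = mor_arr[OF c]
    have ci: "c \<cdot> i1 = i0 \<cdot> a" "c \<cdot> j1 = j0 \<cdot> b" "p0 \<cdot> c = a \<cdot> p1" "q0 \<cdot> c = b \<cdot> q1"
      using O PO by (simp_all add: c_def B1(5-8) B0(5-8)[THEN comp_eq_ext1] add_simps)
    obtain B :: "('o, 'm, 'u) presheaf" and z where Bf: "fp B" and Bp: "presents B P0 P1 z c"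
      using exists_presentation[OF c] by blast
    note T = presentsD[OF Bp] and Bpsh = fp_psh[OF Bf]
    have act1: "Act B a (Act B i0 z) = \<one>\<^bsub>Val B X1\<^esub>" "Act B b (Act B j0 z) = \<one>\<^bsub>Val B Y1\<^esub>"
    proof -
      have "Act B (i0 \<cdot> a) z = \<one>\<^bsub>Val B X1\<^esub>"
        using T(4)[OF comp_mor[OF P(2) B0(1)]] B1(1) ci(1)[symmetric] by blast
      moreover have "Act B (j0 \<cdot> b) z = \<one>\<^bsub>Val B Y1\<^esub>"
        using T(4)[OF comp_mor[OF R(2) B0(2)]] B1(2) ci(2)[symmetric] by blast
      ultimately show "Act B a (Act B i0 z) = \<one>\<^bsub>Val B X1\<^esub>" "Act B b (Act B j0 z) = \<one>\<^bsub>Val B Y1\<^esub>"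
        using Bpsh T(1) by simp_all
    qed
    have z0: "Act B i0 z \<in> carrier (Val B X0)" "Act B j0 z \<in> carrier (Val B Y0)"
      "Act F p0 x \<in> carrier (Val F P0)" "Act G q0 y \<in> carrier (Val G P0)"
      using T(1) P(1) R(1) Bpsh F G by simp_all
    have ax: "Act F a x = \<one>\<^bsub>Val F X1\<^esub>" "Act G b y = \<one>\<^bsub>Val G Y1\<^esub>"
      using P(4)[OF P(2)] R(4)[OF R(2)] id_mor[OF O(2)] id_mor[OF O(3)] comp_id_right[OF P(2)] comp_id_right[OF R(2)]
      by metis+
    have "Act F (p0 \<cdot> c) x = \<one>\<^bsub>Val F P1\<^esub>" "Act G (q0 \<cdot> c) y = \<one>\<^bsub>Val G P1\<^esub>"
      unfolding ci using P(1) R(1) F G ax O by simp_all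
    then have act2: "Act F c (Act F p0 x) = \<one>\<^bsub>Val F P1\<^esub>" "Act G c (Act G q0 y) = \<one>\<^bsub>Val G P1\<^esub>"
      using P(1) R(1) F G by simp_all
    obtain i where i: "i \<in> mor A F B" "\<forall>W. \<forall>h\<in>mor C W X0. app i W (Act F h x) = Act B h (Act B i0 z)"
      "app i X0 x = Act B i0 z" using presents_mod_lift[OF fg(1) Bf Fp z0(1) act1(1)] by blast
    obtain j where j: "j \<in> mor A G B" "\<forall>W. \<forall>h\<in>mor C W Y0. app j W (Act G h y) = Act B h (Act B j0 z)"
      "app j Y0 y = Act B j0 z" using presents_mod_lift[OF fg(2) Bf Gp z0(2) act1(2)] by blast
    obtain p where p: "p \<in> mor A B F" "\<forall>W. \<forall>h\<in>mor C W P0. app p W (Act B h z) = Act F h (Act F p0 x)"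
      "app p P0 z = Act F p0 x" using presents_mod_lift[OF Bf fg(1) Bp z0(3) act2(1)] by blast
    obtain q where q: "q \<in> mor A B G" "\<forall>W. \<forall>h\<in>mor C W P0. app q W (Act B h z) = Act G h (Act G q0 y)"
      "app q P0 z = Act G q0 y" using presents_mod_lift[OF Bf fg(2) Bp z0(4) act2(2)] by blast
    note [simp] = i(1)[THEN A.mor_arr] j(1)[THEN A.mor_arr] p(1)[THEN A.mor_arr] q(1)[THEN A.mor_arr]
    note [simp] = fg Bf
    have FF: "Act F i0 (Act F p0 x) = x" "Act G j0 (Act G q0 y) = y"
      "Act F j0 (Act F p0 x) = \<one>\<^bsub>Val F Y0\<^esub>" "Act G i0 (Act G q0 y) = \<one>\<^bsub>Val G X0\<^esub>"
      using act_comp[OF F, of i0 p0 x] act_comp[OF G, of j0 q0 y] act_comp[OF F, of j0 p0 x] act_comp[OF G, of i0 q0 y]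
        P(1) R(1) O F G by (simp_all add: B0(5-8))
    have "is_biproduct A F G B i j p q"
      unfolding is_biproduct_def
    proof (intro conjI i(1) j(1) p(1) q(1))
      show "p \<cdot>\<^bsub>A\<^esub> i = Idt A F"
        by (rule presents_mod_ext[OF Fp A.comp_mor[OF i(1) p(1)] A.id_mor])
          (simp_all add: app_comp[OF i(1) p(1) O(1) P(1)] i(3) p(2)[rule_format, OF B0(1)] app_Idt[OF O(1) P(1)] FF)
      show "q \<cdot>\<^bsub>A\<^esub> j = Idt A G"
        by (rule presents_mod_ext[OF Gp A.comp_mor[OF j(1) q(1)] A.id_mor])
          (simp_all add: app_comp[OF j(1) q(1) O(4) R(1)] j(3) q(2)[rule_format, OF B0(2)] app_Idt[OF O(4) R(1)] FF)
      show "p \<cdot>\<^bsub>A\<^esub> j = \<one>\<^bsub>Hom A G F\<^esub>"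
        by (rule presents_mod_ext[OF Gp A.comp_mor[OF j(1) p(1)]])
          (simp_all add: A.mor_iff app_comp[OF j(1) p(1) O(4) R(1)] j(3) p(2)[rule_format, OF B0(2)] app_zero[OF O(4) R(1)] FF)
      show "q \<cdot>\<^bsub>A\<^esub> i = \<one>\<^bsub>Hom A F G\<^esub>"
        by (rule presents_mod_ext[OF Fp A.comp_mor[OF i(1) q(1)]])
          (simp_all add: A.mor_iff app_comp[OF i(1) q(1) O(1) P(1)] i(3) q(2)[rule_format, OF B0(1)] app_zero[OF O(1) P(1)] FF)
      have "Act B ((i0 \<cdot> p0) \<otimes>\<^bsub>Hom C P0 P0\<^esub> (j0 \<cdot> q0)) z = z" unfolding B0(9) using Bpsh T(1) PO by simp
      then have "Act B p0 (Act B i0 z) \<otimes>\<^bsub>Val B P0\<^esub> Act B q0 (Act B j0 z) = z" using Bpsh T(1) by simp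
      then have "app (i \<cdot>\<^bsub>A\<^esub> p \<otimes>\<^bsub>Hom A B B\<^esub> j \<cdot>\<^bsub>A\<^esub> q) P0 z = z"
        using app_add[OF A.comp_mor[OF p(1) i(1)] A.comp_mor[OF q(1) j(1)] PO(1) T(1)]
          app_comp[OF p(1) i(1) PO(1) T(1)] app_comp[OF q(1) j(1) PO(1) T(1)]
          p(3) q(3) i(2)[rule_format, OF B0(3)] j(2)[rule_format, OF B0(4)] by simp
      then show "i \<cdot>\<^bsub>A\<^esub> p \<otimes>\<^bsub>Hom A B B\<^esub> j \<cdot>\<^bsub>A\<^esub> q = Idt A B"
        by (intro presents_mod_ext[OF Bp _ A.id_mor]) (simp_all add: A.mor_iff app_Idt[OF PO(1) T(1)])
    qed
    then show "\<exists>B i j p q. is_biproduct A F G B i j p q" by blast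
  qed
qed

text \<open>A monomorphism is pointwise injective, because its pointwise kernel maps to it by zero;
  it is therefore the pointwise kernel of its pointwise cokernel. Dually, an epimorphism is
  pointwise surjective and is the cokernel of its kernel.\<close>

lemma abelian_A: "abelian_category A"
proof -
  interpret A: additive_category A by (rule additive_A)
  show ?thesis
  proof
    fix f F G assume f: "f \<in> mor A F G"
    show "\<exists>K k. is_kernel A K F G k f" using exists_kernel[OF f] is_kernel_pointwise[OF _ f] by blast
    show "\<exists>L c. is_cokernel A F G L f c" using exists_cokernel[OF f] is_cokernel_pointwise[OF f] by blast
  next
    fix F G f assume "is_mono A F G f"
    then have f: "f \<in> mor A F G" and mono: "\<And>H g h. g \<in> mor A H F \<Longrightarrow> h \<in> mor A H F \<Longrightarrow>
        f \<cdot>\<^bsub>A\<^esub> g = f \<cdot>\<^bsub>A\<^esub> h \<Longrightarrow> g = h" unfolding is_mono_def by blast+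
    note nf = app_nat[OF f] and psh = mor_mod_psh[OF f]
    obtain K k where k: "k \<in> mor A K F" "pointwise_kernel K F G k f" using exists_kernel[OF f] by blast
    note [simp] = mor_mod_fp[OF k(1)]
    let ?z = "\<one>\<^bsub>Hom A K F\<^esub>"
    have z: "?z \<in> mor A K F" by (simp add: A.mor_iff)
    have "f \<cdot>\<^bsub>A\<^esub> k = \<one>\<^bsub>Hom A K G\<^esub>" using is_kernel_pointwise[OF k(1) f k(2)] by (simp add: is_kernel_def)
    then have "k = ?z" by (intro mono[OF k(1) z]) (simp add: A.mor_arr[OF f])
    then have kz: "app k W u = \<one>\<^bsub>Val F W\<^esub>" if "W \<in> Obj C" "u \<in> carrier (Val K W)" for W u
      using zero_mod_iff[OF k(1)] that by blast
    have inj: "inj_on (app f W) (carrier (Val F W))" if W: "W \<in> Obj C" for W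
    proof (rule nat_injI[OF nf psh W])
      fix u assume "u \<in> carrier (Val F W)" "app f W u = \<one>\<^bsub>Val G W\<^esub>"
      then have "u \<in> app k W ` carrier (Val K W)" using k(2) W unfolding pointwise_kernel_def by blast
      then show "u = \<one>\<^bsub>Val F W\<^esub>" using kz[OF W] by blast
    qed
    obtain L c where c: "c \<in> mor A G L" "pointwise_cokernel F G L f c" using exists_cokernel[OF f] by blast
    then have "pointwise_kernel F G L f c"
      using inj unfolding pointwise_cokernel_def pointwise_kernel_def by blast
    then show "\<exists>L c. is_kernel A F G L f c" using is_kernel_pointwise[OF f c(1)] by blast
  next
    fix F G f assume "is_epi A F G f"
    then have f: "f \<in> mor A F G" and epi: "\<And>H g h. g \<in> mor A G H \<Longrightarrow> h \<in> mor A G H \<Longrightarrow>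
        g \<cdot>\<^bsub>A\<^esub> f = h \<cdot>\<^bsub>A\<^esub> f \<Longrightarrow> g = h" unfolding is_epi_def by blast+
    note nf = app_nat[OF f] and psh = mor_mod_psh[OF f]
    obtain L c where c: "c \<in> mor A G L" "pointwise_cokernel F G L f c" using exists_cokernel[OF f] by blast
    note [simp] = mor_mod_fp[OF c(1)]
    let ?z = "\<one>\<^bsub>Hom A G L\<^esub>"
    have z: "?z \<in> mor A G L" by (simp add: A.mor_iff)
    have "c \<cdot>\<^bsub>A\<^esub> f = \<one>\<^bsub>Hom A F L\<^esub>" using is_cokernel_pointwise[OF f c] by (simp add: is_cokernel_def)
    then have "c = ?z" by (intro epi[OF c(1) z]) (simp add: A.mor_arr[OF f])
    then have surj: "app f W ` carrier (Val F W) = carrier (Val G W)" if W: "W \<in> Obj C" for W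
      using zero_mod_iff[OF c(1)] W c(2) nat_closed[OF nf W] unfolding pointwise_cokernel_def by blast
    obtain K k where k: "k \<in> mor A K F" "pointwise_kernel K F G k f" using exists_kernel[OF f] by blast
    then have "pointwise_cokernel K F G k f"
      using surj unfolding pointwise_cokernel_def pointwise_kernel_def by blast
    then show "\<exists>K k. is_cokernel A K F G k f" using is_cokernel_pointwise[OF k(1) f] by blast
  qed
qed

text \<open>An arbitrary kernel and the pointwise one factor through each other, so they have the
  same image and the given one is injective too. This allows conditions stated with arbitrary
  kernels, as in the definitions of short exact sequences and of \<open>quot_inv\<close>, to be
  tested on elements.\<close>

lemma is_kernelD:
  assumes "is_kernel A K F G k f"
  shows "pointwise_kernel K F G k f"
proof -
  interpret A: additive_category A by (rule additive_A)
  have k: "k \<in> mor A K F" and f: "f \<in> mor A F G" and fk: "f \<cdot>\<^bsub>A\<^esub> k = \<one>\<^bsub>Hom A K G\<^esub>"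
    and univ: "\<And>H h. h \<in> mor A H F \<Longrightarrow> f \<cdot>\<^bsub>A\<^esub> h = \<one>\<^bsub>Hom A H G\<^esub> \<Longrightarrow> \<exists>!u. u \<in> mor A H K \<and> k \<cdot>\<^bsub>A\<^esub> u = h"
    using assms unfolding is_kernel_def by blast+
  obtain K' k' where k': "k' \<in> mor A K' F" "pointwise_kernel K' F G k' f" using exists_kernel[OF f] by blast
  have ker': "is_kernel A K' F G k' f" by (rule is_kernel_pointwise[OF k'(1) f k'(2)])
  obtain u where u: "u \<in> mor A K' K" "k \<cdot>\<^bsub>A\<^esub> u = k'"
    using univ[OF k'(1)] ker' unfolding is_kernel_def by blast
  obtain v where v: "v \<in> mor A K K'" "k' \<cdot>\<^bsub>A\<^esub> v = k"
    using ker' k fk unfolding is_kernel_def by blast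
  have KO: "K \<in> Obj A" using k mor_mod_fp(1) by simp
  have "k \<cdot>\<^bsub>A\<^esub> (u \<cdot>\<^bsub>A\<^esub> v) = k" using A.comp_assoc[OF v(1) u(1) k] u(2) v(2) by simp
  then have uv: "u \<cdot>\<^bsub>A\<^esub> v = Idt A K"
    using univ[OF k fk] A.comp_mor[OF v(1) u(1)] A.id_mor[OF KO] A.comp_id_right[OF k] by blast
  show ?thesis
    unfolding pointwise_kernel_def
  proof (intro ballI conjI)
    fix W assume W: "W \<in> Obj C"
    note cu = nat_closed[OF app_nat[OF u(1)] W] and cv = nat_closed[OF app_nat[OF v(1)] W]
    have kv: "app k W w = app k' W (app v W w)" if "w \<in> carrier (Val K W)" for w
      using app_comp[OF v(1) k'(1) W that] v(2) by simp
    have ku: "app k' W w = app k W (app u W w)" if "w \<in> carrier (Val K' W)" for w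
      using app_comp[OF u(1) k W that] u(2) by simp
    have uvw: "app u W (app v W w) = w" if "w \<in> carrier (Val K W)" for w
      using app_comp[OF v(1) u(1) W that] uv app_Idt[OF W that] by simp
    have inj: "inj_on (app k' W) (carrier (Val K' W))"
      and im: "\<And>x. x \<in> carrier (Val F W) \<Longrightarrow> app f W x = \<one>\<^bsub>Val G W\<^esub> \<longleftrightarrow> x \<in> app k' W ` carrier (Val K' W)"
      using k'(2) W unfolding pointwise_kernel_def by blast+
    show "inj_on (app k W) (carrier (Val K W))"
    proof (rule inj_onI)
      fix w w' assume w: "w \<in> carrier (Val K W)" "w' \<in> carrier (Val K W)" "app k W w = app k W w'"
      then have "app v W w = app v W w'" using kv inj_onD[OF inj] cv by simp
      then show "w = w'" using uvw w by metis
    qed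
    have "app k W ` carrier (Val K W) = app k' W ` carrier (Val K' W)"
    proof (intro subset_antisym image_subsetI)
      show "app k W w \<in> app k' W ` carrier (Val K' W)" if "w \<in> carrier (Val K W)" for w
        unfolding kv[OF that] using cv[OF that] by (rule imageI)
      show "app k' W w \<in> app k W ` carrier (Val K W)" if "w \<in> carrier (Val K' W)" for w
        unfolding ku[OF that] using cu[OF that] by (rule imageI)
    qed
    then show "app f W x = \<one>\<^bsub>Val G W\<^esub> \<longleftrightarrow> x \<in> app k W ` carrier (Val K W)"
      if "x \<in> carrier (Val F W)" for x using im[OF that] by simp
  qed
qed

lemma is_cokernelD:
  assumes "is_cokernel A F G L f c"
  shows "pointwise_cokernel F G L f c"
proof -
  interpret A: additive_category A by (rule additive_A)
  have f: "f \<in> mor A F G" and c: "c \<in> mor A G L" and cf: "c \<cdot>\<^bsub>A\<^esub> f = \<one>\<^bsub>Hom A F L\<^esub>"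
    and univ: "\<And>H h. h \<in> mor A G H \<Longrightarrow> h \<cdot>\<^bsub>A\<^esub> f = \<one>\<^bsub>Hom A F H\<^esub> \<Longrightarrow> \<exists>!u. u \<in> mor A L H \<and> u \<cdot>\<^bsub>A\<^esub> c = h"
    using assms unfolding is_cokernel_def by blast+
  obtain L' c' where c': "c' \<in> mor A G L'" "pointwise_cokernel F G L' f c'" using exists_cokernel[OF f] by blast
  have cok': "is_cokernel A F G L' f c'" by (rule is_cokernel_pointwise[OF f c'])
  obtain u where u: "u \<in> mor A L L'" "u \<cdot>\<^bsub>A\<^esub> c = c'"
    using univ[OF c'(1)] cok' unfolding is_cokernel_def by blast
  obtain v where v: "v \<in> mor A L' L" "v \<cdot>\<^bsub>A\<^esub> c' = c"
    using cok' c cf unfolding is_cokernel_def by blast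
  have LO: "L \<in> Obj A" using c mor_mod_fp(2) by simp
  have "(v \<cdot>\<^bsub>A\<^esub> u) \<cdot>\<^bsub>A\<^esub> c = c" using A.comp_assoc[OF c u(1) v(1)] u(2) v(2) by simp
  then have vu: "v \<cdot>\<^bsub>A\<^esub> u = Idt A L"
    using univ[OF c cf] A.comp_mor[OF u(1) v(1)] A.id_mor[OF LO] A.comp_id_left[OF c] by blast
  show ?thesis
    unfolding pointwise_cokernel_def
  proof (intro ballI conjI)
    fix W assume W: "W \<in> Obj C"
    note cu = nat_closed[OF app_nat[OF u(1)] W] and cv = nat_closed[OF app_nat[OF v(1)] W]
      and cc = nat_closed[OF app_nat[OF c] W] and cc' = nat_closed[OF app_nat[OF c'(1)] W]
    have cw: "app c W w = app v W (app c' W w)" if "w \<in> carrier (Val G W)" for w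
      using app_comp[OF c'(1) v(1) W that] v(2) by simp
    have cw': "app c' W w = app u W (app c W w)" if "w \<in> carrier (Val G W)" for w
      using app_comp[OF c u(1) W that] u(2) by simp
    have vuw: "app v W (app u W w) = w" if "w \<in> carrier (Val L W)" for w
      using app_comp[OF u(1) v(1) W that] vu app_Idt[OF W that] by simp
    have surj: "app c' W ` carrier (Val G W) = carrier (Val L' W)"
      and ker: "\<And>x. x \<in> carrier (Val G W) \<Longrightarrow> app c' W x = \<one>\<^bsub>Val L' W\<^esub> \<longleftrightarrow> x \<in> app f W ` carrier (Val F W)"
      using c'(2) W unfolding pointwise_cokernel_def by blast+
    show "app c W ` carrier (Val G W) = carrier (Val L W)"
    proof (rule subset_antisym)
      show "app c W ` carrier (Val G W) \<subseteq> carrier (Val L W)" using cc by blast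
      show "carrier (Val L W) \<subseteq> app c W ` carrier (Val G W)"
      proof
        fix l assume l: "l \<in> carrier (Val L W)"
        then have "app u W l \<in> app c' W ` carrier (Val G W)" using cu surj by simp
        then obtain w where w: "w \<in> carrier (Val G W)" "app u W l = app c' W w" by blast
        then have "l = app c W w" using vuw[OF l] cw by simp
        with w show "l \<in> app c W ` carrier (Val G W)" by blast
      qed
    qed
    fix x assume x: "x \<in> carrier (Val G W)"
    have "app c W x = \<one>\<^bsub>Val L W\<^esub> \<longleftrightarrow> app c' W x = \<one>\<^bsub>Val L' W\<^esub>"
      using cw[OF x] cw'[OF x] nat_one[OF app_nat[OF u(1)] mor_mod_psh[OF u(1)] W]
        nat_one[OF app_nat[OF v(1)] mor_mod_psh[OF v(1)] W] by metis
    then show "app c W x = \<one>\<^bsub>Val L W\<^esub> \<longleftrightarrow> x \<in> app f W ` carrier (Val F W)" using ker[OF x] by simp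
  qed
qed

end

section \<open>Deflations and effaceable functors\<close>

lemma opposite_mor [simp]: "mor (opposite C) X Y = mor C Y X"
  by (auto simp: mor_def opposite_def)

lemma opposite_Comp [simp]: "g \<cdot>\<^bsub>opposite C\<^esub> f = f \<cdot>\<^bsub>C\<^esub> g"
  by (simp add: opposite_def)

text \<open>The opposite structure reverses conflations, so the dual axioms can be applied directly
  to the original data.\<close>

lemma opposite_realizes [simp]:
  "realizes (opposite C) (opposite_ext E) (opposite_real s) Z Y X g f \<delta> \<longleftrightarrow> realizes C E s X Y Z f g \<delta>"
  by (auto simp: realizes_def opposite_ext_def opposite_real_def)

section \<open>Deflations and conflations\<close>

context extriangulated_category
begin

lemma realizesD:
  assumes "realizes C E s Z Y X g f \<delta>"
  shows "\<delta> \<in> carrier (EGrp E X Z)" "g \<in> mor C Z Y" "f \<in> mor C Y X"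
  using assms unfolding realizes_def by blast+

lemma realization: "is_realization C E s"
  using additive_realization unfolding additive_realization_def by blast

lemma exists_realizes:
  assumes "X \<in> Obj C" "Z \<in> Obj C" "\<delta> \<in> carrier (EGrp E X Z)"
  obtains Y g f where "realizes C E s Z Y X g f \<delta>"
proof -
  have "s X Z \<delta> \<in> sequences C Z X // seq_equiv C Z X"
    using realization assms unfolding is_realization_def by blast
  then obtain g f where gf: "(g, f) \<in> sequences C Z X" "s X Z \<delta> = seq_equiv C Z X `` {(g, f)}"
    by (auto elim!: quotientE)
  then obtain Y where m: "g \<in> mor C Z Y" "f \<in> mor C Y X" unfolding sequences_def by blast
  have Y: "Y \<in> Obj C" using m mor_Obj by blast
  have "((g, f), (g, f)) \<in> seq_equiv C Z X"
    unfolding seq_equiv_def using m is_iso_Idt[OF Y] mor_arr[OF m(1)] mor_arr[OF m(2)]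
    by (auto intro!: exI[of _ Y] exI[of _ "Idt C Y"])
  then have "realizes C E s Z Y X g f \<delta>" unfolding realizes_def using assms m gf(2) by blast
  then show ?thesis by (rule that)
qed

lemma split_realizes: "is_biproduct C Z X Y i j p q \<Longrightarrow> realizes C E s Z Y X i q \<one>\<^bsub>EGrp E X Z\<^esub>"
  using additive_realization unfolding additive_realization_def by blast

text \<open>With one summand zero, the split conflations become the trivial conflations X = X -> 0
  and 0 -> X = X, to which the axioms are applied below.\<close>

lemma biproduct_zero:
  assumes "is_zero_object C Z" "X \<in> Obj C"
  shows "is_biproduct C X Z X (Idt C X) \<one>\<^bsub>Hom C Z X\<^esub> (Idt C X) \<one>\<^bsub>Hom C X Z\<^esub>"
    and "is_biproduct C Z X X \<one>\<^bsub>Hom C Z X\<^esub> (Idt C X) \<one>\<^bsub>Hom C X Z\<^esub> (Idt C X)"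
proof -
  have "Z \<in> Obj C" "Idt C Z = \<one>\<^bsub>Hom C Z Z\<^esub>" using assms zero_object_iff by blast+
  then show "is_biproduct C X Z X (Idt C X) \<one>\<^bsub>Hom C Z X\<^esub> (Idt C X) \<one>\<^bsub>Hom C X Z\<^esub>"
    "is_biproduct C Z X X \<one>\<^bsub>Hom C Z X\<^esub> (Idt C X) \<one>\<^bsub>Hom C X Z\<^esub> (Idt C X)"
    unfolding is_biproduct_def using assms(2) by (simp_all add: mor_iff add_simps)
qed

definition deflation :: "'o \<Rightarrow> 'o \<Rightarrow> 'm \<Rightarrow> bool" where
  "deflation Y X f \<longleftrightarrow> (\<exists>Z g. conflation C E s Z Y X g f)"

lemma deflationI: "realizes C E s Z Y X g f \<delta> \<Longrightarrow> deflation Y X f"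
  unfolding deflation_def conflation_def by blast

lemma deflationE:
  assumes "deflation Y X f"
  obtains Z g \<delta> where "realizes C E s Z Y X g f \<delta>"
  using assms unfolding deflation_def conflation_def by blast

lemma deflation_mor: "deflation Y X f \<Longrightarrow> f \<in> mor C Y X"
  by (erule deflationE) (rule realizesD(3))

lemma deflation_arr: "deflation Y X f \<Longrightarrow> arr f \<and> src f = Y \<and> tgt f = X"
  using deflation_mor mor_arr by blast

lemma deflation_Obj: "deflation Y X f \<Longrightarrow> Y \<in> Obj C" "deflation Y X f \<Longrightarrow> X \<in> Obj C"
  using deflation_mor mor_Obj by blast+

lemma deflation_Idt:
  assumes "X \<in> Obj C"
  shows "deflation X X (Idt C X)"
proof -
  obtain Z where "is_zero_object C Z" using has_zero_object by blast
  from deflationI[OF split_realizes[OF biproduct_zero(2)[OF this assms]]] show ?thesis .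
qed

text \<open>In the opposite category \<open>h\<close> and \<open>f\<close> are composable
  inflations, and the first part of ET4 says that inflations compose.\<close>

lemma deflation_comp:
  assumes "deflation Y X f" "deflation X V h"
  shows "deflation Y V (h \<cdot> f)"
proof -
  obtain Z g \<delta> where 1: "realizes C E s Z Y X g f \<delta>" using assms(1) by (rule deflationE)
  obtain T k \<epsilon> where 2: "realizes C E s T X V k h \<epsilon>" using assms(2) by (rule deflationE)
  have "realizes (opposite C) (opposite_ext E) (opposite_real s) V X T h k \<epsilon>"
    "realizes (opposite C) (opposite_ext E) (opposite_real s) X Y Z f g \<delta>" using 1 2 by simp_all
  then have "\<exists>W g' f' b' a' \<delta>''. g' = f \<cdot>\<^bsub>opposite C\<^esub> h \<and>
      realizes (opposite C) (opposite_ext E) (opposite_real s) V Y W g' f' \<delta>''"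
    using ET4_op unfolding ET4_def by meson
  then obtain W f' \<delta>'' where "realizes C E s W Y V f' (h \<cdot> f) \<delta>''" by auto
  then show ?thesis by (rule deflationI)
qed

text \<open>The extension \<delta> is pulled back along \<open>h\<close> and realized. The identity
  of \<open>Z\<close> and \<open>h\<close> form a morphism of extensions, whose completion to the
  middle terms is \<open>y\<close>. The commuting square is the stability axiom of a
  topology.\<close>

lemma deflation_pullback:
  assumes "deflation Y X f" "h \<in> mor C W X"
  obtains V q y where "deflation V W q" "y \<in> mor C V Y" "f \<cdot> y = h \<cdot> q"
proof -
  obtain Z g \<delta> where 1: "realizes C E s Z Y X g f \<delta>" using assms(1) by (rule deflationE)
  note r = realizesD[OF 1]
  have O: "W \<in> Obj C" "Z \<in> Obj C" using assms(2) r(2) mor_Obj by blast+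
  let ?\<epsilon> = "EMap E h (Idt C Z) \<delta>"
  have \<epsilon>: "?\<epsilon> \<in> carrier (EGrp E W Z)"
    using ext_map[OF assms(2) id_mor[OF O(2)]] r(1) by (auto simp: hom_def)
  obtain V g' q where 2: "realizes C E s Z V W g' q ?\<epsilon>" using exists_realizes[OF O \<epsilon>] .
  have "ext_morphism C E W Z ?\<epsilon> X Z \<delta> (Idt C Z) h"
    unfolding ext_morphism_def push_def pull_def
    using \<epsilon> r(1) id_mor[OF O(2)] assms(2) ext_id[OF O \<epsilon>] by simp
  then obtain y where "y \<in> mor C V Y" "f \<cdot> y = h \<cdot> q"
    using realization 1 2 unfolding is_realization_def by blast
  then show ?thesis using that deflationI[OF 2] by blast
qed

text \<open>Pull one deflation back along the other and compose to \<open>X\<close>: any two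
  deflations of \<open>X\<close> have a common refinement.\<close>

lemma deflation_common:
  assumes "deflation Y X f" "deflation Y' X f'"
  obtains V y y' where "y \<in> mor C V Y" "y' \<in> mor C V Y'" "f \<cdot> y = f' \<cdot> y'" "deflation V X (f \<cdot> y)"
proof -
  obtain V q y where "deflation V Y' q" "y \<in> mor C V Y" "f \<cdot> y = f' \<cdot> q"
    using deflation_pullback[OF assms(1) deflation_mor[OF assms(2)]] .
  then show ?thesis using that deflation_comp[OF _ assms(2)] deflation_mor by metis
qed

text \<open>ET3 is applied to the identity of \<open>Z\<close> and to \<open>g\<close>, from the
  trivial conflation Z = Z -> 0 to the given one. The composite \<open>f \<cdot> g\<close> then
  factors through the third component, which starts at a zero object.\<close>

lemma conflation_comp_zero:
  assumes "realizes C E s Z Y X g f \<delta>"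
  shows "f \<cdot> g = \<one>\<^bsub>Hom C Z X\<^esub>"
proof -
  note r = realizesD[OF assms]
  note [simp] = mor_arr[OF r(2)] mor_arr[OF r(3)]
  have O: "Z \<in> Obj C" "X \<in> Obj C" using r mor_Obj by blast+
  obtain N where N: "is_zero_object C N" using has_zero_object by blast
  have NO: "N \<in> Obj C" using N zero_object_iff by blast
  have "realizes C E s Z Z N (Idt C Z) \<one>\<^bsub>Hom C Z N\<^esub> \<one>\<^bsub>EGrp E N Z\<^esub>"
    by (rule split_realizes[OF biproduct_zero(1)[OF N O(1)]])
  moreover have "g \<cdot> Idt C Z = g \<cdot> Idt C Z" ..
  ultimately have "\<exists>x. x \<in> mor C N X \<and> x \<cdot> \<one>\<^bsub>Hom C Z N\<^esub> = f \<cdot> g"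
    using ET3[unfolded ET3_def, rule_format,
        OF conjI[OF _ conjI[OF assms conjI[OF id_mor[OF O(1)] conjI[OF r(2)]]]]] by blast
  then obtain x where x: "x \<in> mor C N X" "x \<cdot> \<one>\<^bsub>Hom C Z N\<^esub> = f \<cdot> g" by blast
  then show ?thesis using mor_arr[OF x(1)] O NO by simp
qed

text \<open>The dual of ET3 completes \<open>k\<close> and the zero map to a morphism from the
  trivial conflation V = V -> 0 to the given one; its first component is \<open>l\<close>. Together
  with \<open>conflation_comp_zero\<close> this makes \<open>g\<close> a weak kernel of
  \<open>f\<close>.\<close>

lemma conflation_factor:
  assumes "realizes C E s Z Y X g f \<delta>" "k \<in> mor C V Y" "f \<cdot> k = \<one>\<^bsub>Hom C V X\<^esub>"
  shows "\<exists>l\<in>mor C V Z. k = g \<cdot> l"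
proof -
  note r = realizesD[OF assms(1)]
  note [simp] = mor_arr[OF r(2)] mor_arr[OF r(3)] mor_arr[OF assms(2)]
  have O: "V \<in> Obj C" "X \<in> Obj C" using r assms mor_Obj by blast+
  obtain N where N: "is_zero_object C N" using has_zero_object by blast
  have NO: "N \<in> Obj C" using N zero_object_iff by blast
  have "realizes C E s V V N (Idt C V) \<one>\<^bsub>Hom C V N\<^esub> \<one>\<^bsub>EGrp E N V\<^esub>"
    by (rule split_realizes[OF biproduct_zero(1)[OF N O(1)]])
  then have 1: "realizes (opposite C) (opposite_ext E) (opposite_real s) N V V \<one>\<^bsub>Hom C V N\<^esub> (Idt C V) \<one>\<^bsub>EGrp E N V\<^esub>"
    and 2: "realizes (opposite C) (opposite_ext E) (opposite_real s) X Y Z f g \<delta>" using assms(1) by simp_all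
  have 3: "\<one>\<^bsub>Hom C N X\<^esub> \<in> mor (opposite C) X N" "k \<in> mor (opposite C) Y V"
    using NO O assms(2) by (simp_all add: mor_iff)
  have 4: "k \<cdot>\<^bsub>opposite C\<^esub> f = \<one>\<^bsub>Hom C V N\<^esub> \<cdot>\<^bsub>opposite C\<^esub> \<one>\<^bsub>Hom C N X\<^esub>"
    using NO O assms(3) by simp
  have "\<exists>x. x \<in> mor (opposite C) Z V \<and> x \<cdot>\<^bsub>opposite C\<^esub> g = Idt C V \<cdot>\<^bsub>opposite C\<^esub> k"
    using ET3_op 1 2 3 4 unfolding ET3_def by meson
  then show ?thesis using O by auto
qed

text \<open>The row \<open>[f, a]\<close> is the direct sum of \<open>f\<close> and the identity of
  \<open>V\<close>, a deflation by additivity of the realization, followed by the row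
  \<open>[1, a]\<close> from the biproduct \<open>Q\<close> of \<open>X\<close> and \<open>V\<close>
  to \<open>X\<close>, which is a split deflation.\<close>

lemma deflation_row:
  assumes f: "deflation Y X f" and a: "a \<in> mor C V X" and b: "is_biproduct C Y V P i j p q"
  shows "deflation P X ((f \<cdot> p) \<otimes>\<^bsub>Hom C P X\<^esub> (a \<cdot> q))"
proof -
  obtain Z g \<delta> where 1: "realizes C E s Z Y X g f \<delta>" using f by (rule deflationE)
  note r = realizesD[OF 1]
  have O: "V \<in> Obj C" "X \<in> Obj C" "Y \<in> Obj C" "Z \<in> Obj C" using r a mor_Obj by blast+
  obtain N where N: "is_zero_object C N" using has_zero_object by blast
  have NO: "N \<in> Obj C" using N zero_object_iff by blast
  have 2: "realizes C E s N V V \<one>\<^bsub>Hom C N V\<^esub> (Idt C V) \<one>\<^bsub>EGrp E V N\<^esub>"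
    by (rule split_realizes[OF biproduct_zero(2)[OF N O(1)]])
  obtain Q i' j' p' q' where b': "is_biproduct C X V Q i' j' p' q'" using has_biproducts O by blast
  note B = biproductD[OF b] and B' = biproductD[OF b']
  note [simp] = B(1-4)[THEN mor_arr] B'(1-4)[THEN mor_arr] mor_arr[OF a] mor_arr[OF r(2)] mor_arr[OF r(3)]
  have PO: "P \<in> Obj C" "Q \<in> Obj C" using B(1) B'(1) mor_Obj by blast+
  let ?F = "(i' \<cdot> f \<cdot> p) \<otimes>\<^bsub>Hom C P Q\<^esub> (j' \<cdot> Idt C V \<cdot> q)"
  have "deflation P Q ?F"
    by (rule deflationI[OF additive_realization[unfolded additive_realization_def, THEN conjunct2,
          THEN conjunct2, rule_format, OF conjI[OF 1 conjI[OF 2 conjI[OF biproduct_zero(1)[OF N O(4)] conjI[OF b b']]]]]])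
  moreover define c where "c = p' \<otimes>\<^bsub>Hom C Q X\<^esub> (a \<cdot> q')"
  \<comment> \<open>The column with entries \<open>-a\<close> and \<open>1\<close>, which is killed
    by \<open>c\<close>. In the sheared decomposition of \<open>Q\<close> given by \<open>e\<close>
    and \<open>i'\<close>, the row \<open>c\<close> is the projection to \<open>X\<close>.\<close>
  define e where "e = j' \<otimes>\<^bsub>Hom C V Q\<^esub> inv\<^bsub>Hom C V Q\<^esub> (i' \<cdot> a)"
  have [simp]: "arr c" "src c = Q" "tgt c = X" "arr e" "src e = V" "tgt e = Q"
    by (simp_all add: c_def e_def)
  have "is_biproduct C V X Q e i' q' c"
    unfolding is_biproduct_def
  proof (intro conjI)
    show "e \<in> mor C V Q" "i' \<in> mor C X Q" "q' \<in> mor C Q V" "c \<in> mor C Q X" by (simp_all add: mor_iff)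
    have inv0: "inv\<^bsub>Hom C V V\<^esub> \<one>\<^bsub>Hom C V V\<^esub> = \<one>\<^bsub>Hom C V V\<^esub>"
      "inv\<^bsub>Hom C V X\<^esub> \<one>\<^bsub>Hom C V X\<^esub> = \<one>\<^bsub>Hom C V X\<^esub>"
      using Hom_group[OF O(1) O(1)] Hom_group[OF O(1) O(2)] by (simp_all add: group.is_monoid monoid.inv_one)
    show "q' \<cdot> e = Idt C V"
      using O by (simp add: e_def B'(5-8) B'(5-8)[THEN comp_eq_ext1] inv0 add_simps)
    show "c \<cdot> i' = Idt C X" using O by (simp add: c_def B'(5-8) add_simps)
    show "q' \<cdot> i' = \<one>\<^bsub>Hom C X V\<^esub>" by (rule B'(8))
    have "c \<cdot> e = (p' \<cdot> e) \<otimes>\<^bsub>Hom C V X\<^esub> (a \<cdot> (q' \<cdot> e))" unfolding c_def by simp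
    also have "q' \<cdot> e = Idt C V" by fact
    also have "p' \<cdot> e = inv\<^bsub>Hom C V X\<^esub> a"
      using O by (simp add: e_def B'(5-8) B'(5-8)[THEN comp_eq_ext1] add_simps)
    finally show "c \<cdot> e = \<one>\<^bsub>Hom C V X\<^esub>" using O by (simp add: add_simps)
    have m: "j' \<cdot> q' \<in> mor C Q Q" "inv\<^bsub>Hom C Q Q\<^esub> (i' \<cdot> a \<cdot> q') \<in> mor C Q Q" "i' \<cdot> p' \<in> mor C Q Q"
      "i' \<cdot> a \<cdot> q' \<in> mor C Q Q" by (simp_all add: mor_iff)
    interpret Q: comm_group "Hom C Q Q" using hom_group PO by blast
    note mc = m[THEN mor_carrier]
    have "(e \<cdot> q') \<otimes>\<^bsub>Hom C Q Q\<^esub> (i' \<cdot> c) =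
        ((j' \<cdot> q') \<otimes>\<^bsub>Hom C Q Q\<^esub> inv\<^bsub>Hom C Q Q\<^esub> (i' \<cdot> a \<cdot> q')) \<otimes>\<^bsub>Hom C Q Q\<^esub>
        ((i' \<cdot> p') \<otimes>\<^bsub>Hom C Q Q\<^esub> (i' \<cdot> a \<cdot> q'))"
      by (simp add: e_def c_def)
    also have "\<dots> = ((j' \<cdot> q') \<otimes>\<^bsub>Hom C Q Q\<^esub> (i' \<cdot> p')) \<otimes>\<^bsub>Hom C Q Q\<^esub>
        (inv\<^bsub>Hom C Q Q\<^esub> (i' \<cdot> a \<cdot> q') \<otimes>\<^bsub>Hom C Q Q\<^esub> (i' \<cdot> a \<cdot> q'))"
      using mc(1,3,4) by (simp add: Q.m_ac del: Q.l_inv)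
    also have "\<dots> = (i' \<cdot> p') \<otimes>\<^bsub>Hom C Q Q\<^esub> (j' \<cdot> q')"
      using mc(1,3,4) by (simp add: Q.m_comm)
    finally show "(e \<cdot> q') \<otimes>\<^bsub>Hom C Q Q\<^esub> (i' \<cdot> c) = Idt C Q" using B'(9) by simp
  qed
  then have "deflation Q X c" by (rule deflationI[OF split_realizes])
  ultimately have "deflation P X (c \<cdot> ?F)" by (rule deflation_comp)
  moreover have "c \<cdot> ?F = (f \<cdot> p) \<otimes>\<^bsub>Hom C P X\<^esub> (a \<cdot> q)"
  proof -
    have ci: "c \<cdot> i' = Idt C X" "c \<cdot> j' = a"
      using O by (simp_all add: c_def B'(5-8) add_simps)
    show ?thesis using O by (simp add: ci[THEN comp_eq_ext1])
  qed
  ultimately show ?thesis by simp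
qed

section \<open>Effaceable functors and defects\<close>

definition effaceable :: "('o, 'm, 'v) presheaf \<Rightarrow> bool" where
  "effaceable F \<longleftrightarrow> (\<forall>W\<in>Obj C. \<forall>u\<in>carrier (Val F W). \<exists>V q. deflation V W q \<and> Act F q u = \<one>\<^bsub>Val F V\<^esub>)"

lemma cokernel_representable:
  assumes d: "d \<in> mor C P X0"
  defines "N W \<equiv> (\<lambda>h. d \<cdot> h) ` carrier (Hom C W P)"
  defines "D \<equiv> cokernel_presheaf C (representable C P) (representable C X0) (\<lambda>W h. d \<cdot> h)"
  shows "Val D W = Hom C W X0 Mod N W"
    and "Act D b T = \<Union>{N V #>\<^bsub>Hom C V X0\<^esub> (h \<cdot> b) |V V' h. b \<in> mor C V V' \<and> h \<in> T}"
    and "W \<in> Obj C \<Longrightarrow> subgroup (N W) (Hom C W X0)"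
proof -
  show "Val D W = Hom C W X0 Mod N W"
    by (simp add: D_def N_def cokernel_presheaf_def representable_def)
  show "Act D b T = \<Union>{N V #>\<^bsub>Hom C V X0\<^esub> (h \<cdot> b) |V V' h. b \<in> mor C V V' \<and> h \<in> T}"
    by (simp add: D_def N_def cokernel_presheaf_def representable_def)
  assume W: "W \<in> Obj C"
  have O: "P \<in> Obj C" "X0 \<in> Obj C" using d mor_Obj by blast+
  interpret group_hom "Hom C W P" "Hom C W X0" "\<lambda>h. d \<cdot> h"
    using W O d mor_arr[OF d] comp_add_right[OF _ _ d] comp_mor[OF _ d]
    by (auto simp: group_hom_def group_hom_axioms_def hom_def carrier_Hom_iff)
  show "subgroup (N W) (Hom C W X0)" unfolding N_def by (rule img_is_subgroup)
qed

lemma cokernel_act: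
  assumes d: "d \<in> mor C P X0" and b: "b \<in> mor C V W"
  shows "Act (cokernel_presheaf C (representable C P) (representable C X0) (\<lambda>W h. d \<cdot> h)) b T =
    (\<Union>h\<in>T. (\<lambda>h. d \<cdot> h) ` carrier (Hom C V P) #>\<^bsub>Hom C V X0\<^esub> (h \<cdot> b))"
proof -
  have "b \<in> mor C V' W' \<longleftrightarrow> V' = V \<and> W' = W" for V' W' using b hom_disjoint by blast
  then show ?thesis unfolding cokernel_representable(2)[OF d] by auto
qed

text \<open>An element \<open>u\<close> of \<open>F(W)\<close> corresponds to the set of all
  \<open>h\<close> with \<open>Act F h x = u\<close>. By the presentation this fibre is a coset of
  the image of \<open>d\<close>, so it already is an element of the cokernel and no representative
  has to be chosen.\<close>

lemma presents_iso_cokernel: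
  assumes F: "psh F" and p: "presents F X0 P x d"
  shows "presheaf_isomorphic C F (cokernel_presheaf C (representable C P) (representable C X0) (\<lambda>W h. d \<cdot> h))"
    (is "presheaf_isomorphic C F ?D")
proof -
  note R = presentsD[OF p]
  have O: "P \<in> Obj C" "X0 \<in> Obj C" using R(2) mor_Obj by blast+
  define N where "N W = (\<lambda>h. d \<cdot> h) ` carrier (Hom C W P)" for W
  have ValD: "Val ?D W = Hom C W X0 Mod N W" for W unfolding N_def by (rule cokernel_representable(1)[OF R(2)])
  have sub: "subgroup (N W) (Hom C W X0)" if "W \<in> Obj C" for W
    unfolding N_def by (rule cokernel_representable(3)[OF R(2) that])
  have N: "h \<in> N W \<longleftrightarrow> Act F h x = \<one>\<^bsub>Val F W\<^esub>" if "h \<in> mor C W X0" for W h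
    using R(4)[OF that] mor_Obj(1)[OF that] O by (auto simp: N_def carrier_Hom_eq)
  define fib where "fib W u = {h \<in> mor C W X0. Act F h x = u}" for W u
  have coset: "N W #>\<^bsub>Hom C W X0\<^esub> h = fib W (Act F h x)" if h: "h \<in> mor C W X0" for W h
  proof -
    have W: "W \<in> Obj C" using h mor_Obj by blast
    interpret comm_group "Hom C W X0" using hom_group W O by blast
    have hc: "h \<in> carrier (Hom C W X0)" using h by (rule mor_carrier)
    have "h' \<in> N W #>\<^bsub>Hom C W X0\<^esub> h \<longleftrightarrow> h' \<in> fib W (Act F h x)" for h'
    proof (cases "h' \<in> mor C W X0")
      case True
      then have h'c: "h' \<in> carrier (Hom C W X0)" by (rule mor_carrier)
      have "h' \<in> N W #>\<^bsub>Hom C W X0\<^esub> h \<longleftrightarrow> h' \<otimes>\<^bsub>Hom C W X0\<^esub> inv\<^bsub>Hom C W X0\<^esub> h \<in> N W"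
      proof
        assume "h' \<in> N W #>\<^bsub>Hom C W X0\<^esub> h"
        then obtain n where n: "n \<in> N W" "h' = n \<otimes>\<^bsub>Hom C W X0\<^esub> h" unfolding r_coset_def by blast
        then have "n \<in> carrier (Hom C W X0)" using subgroup.mem_carrier[OF sub[OF W]] by blast
        then show "h' \<otimes>\<^bsub>Hom C W X0\<^esub> inv\<^bsub>Hom C W X0\<^esub> h \<in> N W" using n hc by (simp add: m_assoc)
      next
        assume "h' \<otimes>\<^bsub>Hom C W X0\<^esub> inv\<^bsub>Hom C W X0\<^esub> h \<in> N W"
        moreover have "h' = (h' \<otimes>\<^bsub>Hom C W X0\<^esub> inv\<^bsub>Hom C W X0\<^esub> h) \<otimes>\<^bsub>Hom C W X0\<^esub> h"
          using hc h'c by (simp add: m_assoc)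
        ultimately show "h' \<in> N W #>\<^bsub>Hom C W X0\<^esub> h" unfolding r_coset_def by blast
      qed
      also have "\<dots> \<longleftrightarrow> Act F h' x = Act F h x"
        using N[of "h' \<otimes>\<^bsub>Hom C W X0\<^esub> inv\<^bsub>Hom C W X0\<^esub> h" W] act_diff[OF F True h R(1)]
          mor_arr[OF True] mor_arr[OF h] by (simp add: mor_iff)
      finally show ?thesis using True by (simp add: fib_def)
    next
      case False
      then have "h' \<notin> N W #>\<^bsub>Hom C W X0\<^esub> h"
        using r_coset_subset_G[OF subgroup.subset[OF sub[OF W]] hc] W O by (auto simp: carrier_Hom_iff)
      with False show ?thesis by (simp add: fib_def)
    qed
    then show ?thesis by blast
  qed
  have "nat_trans C F ?D fib"
  proof (rule nat_transI)
    fix W u assume W: "W \<in> Obj C" and u: "u \<in> carrier (Val F W)"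
    obtain h where h: "h \<in> mor C W X0" "u = Act F h x" using R(3)[OF W u] by blast
    interpret N: normal "N W" "Hom C W X0"
      by (rule comm_group.subgroup_imp_normal[OF hom_group[OF W O(2)] sub[OF W]])
    show "fib W u \<in> carrier (Val ?D W)"
      using coset[OF h(1)] mor_carrier[OF h(1)] h(2) by (auto simp: ValD FactGroup_def RCOSETS_def)
    fix v assume v: "v \<in> carrier (Val F W)"
    obtain k where k: "k \<in> mor C W X0" "v = Act F k x" using R(3)[OF W v] by blast
    have hk: "h \<otimes>\<^bsub>Hom C W X0\<^esub> k \<in> mor C W X0" using h k by (simp add: mor_iff)
    have "Act F (h \<otimes>\<^bsub>Hom C W X0\<^esub> k) x = u \<otimes>\<^bsub>Val F W\<^esub> v"
      using mor_arr[OF h(1)] mor_arr[OF k(1)] F R(1) h k by simp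
    then show "fib W (u \<otimes>\<^bsub>Val F W\<^esub> v) = fib W u \<otimes>\<^bsub>Val ?D W\<^esub> fib W v"
      using N.rcos_sum[OF mor_carrier[OF h(1)] mor_carrier[OF k(1)]] coset[OF h(1)] coset[OF k(1)] coset[OF hk] h k
      by (simp add: ValD FactGroup_def)
  next
    fix V W b u assume b: "b \<in> mor C V W" and u: "u \<in> carrier (Val F W)"
    have O': "W \<in> Obj C" using b mor_Obj by blast
    obtain h where h: "h \<in> mor C W X0" "u = Act F h x" using R(3)[OF O' u] by blast
    have "N V #>\<^bsub>Hom C V X0\<^esub> (k \<cdot> b) = fib V (Act F b u)" if "k \<in> fib W u" for k
    proof -
      have k: "k \<in> mor C W X0" "Act F k x = u" using that by (simp_all add: fib_def)
      then show ?thesis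
        using coset[OF comp_mor[OF b k(1)]] mor_arr[OF b] mor_arr[OF k(1)] F R(1) by simp
    qed
    moreover have "h \<in> fib W u" using h by (simp add: fib_def)
    ultimately show "fib V (Act F b u) = Act ?D b (fib W u)"
      unfolding cokernel_act[OF R(2) b] N_def by blast
  qed
  moreover have "fib W \<in> iso (Val F W) (Val ?D W)" if W: "W \<in> Obj C" for W
  proof -
    have "bij_betw (fib W) (carrier (Val F W)) (carrier (Val ?D W))"
      unfolding bij_betw_def
    proof
      show "inj_on (fib W) (carrier (Val F W))"
      proof (rule inj_onI)
        fix u v assume u: "u \<in> carrier (Val F W)" and e: "fib W u = fib W v"
        obtain h where h: "h \<in> mor C W X0" "u = Act F h x" using R(3)[OF W u] by blast
        then have "h \<in> fib W v" using e by (auto simp: fib_def)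
        then show "u = v" using h by (simp add: fib_def)
      qed
      show "fib W ` carrier (Val F W) = carrier (Val ?D W)"
      proof (rule subset_antisym; rule subsetI)
        fix T assume "T \<in> fib W ` carrier (Val F W)"
        then show "T \<in> carrier (Val ?D W)" using nat_closed[OF calculation W] by blast
      next
        fix T assume "T \<in> carrier (Val ?D W)"
        then obtain h where h: "h \<in> mor C W X0" "T = N W #>\<^bsub>Hom C W X0\<^esub> h"
          using W O by (auto simp: ValD FactGroup_def RCOSETS_def carrier_Hom_eq)
        then have "T = fib W (Act F h x)" using coset by simp
        moreover have "Act F h x \<in> carrier (Val F W)" using mor_arr[OF h(1)] F R(1) by simp
        ultimately show "T \<in> fib W ` carrier (Val F W)" by blast
      qed
    qed
    then show ?thesis using nat_hom[OF calculation W] by (simp add: iso_def)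
  qed
  ultimately show ?thesis unfolding presheaf_isomorphic_def by blast
qed

text \<open>An element of the defect of \<open>f\<close> is the class of some \<open>h\<close> into
  \<open>X\<close>. Pulling \<open>f\<close> back along \<open>h\<close> gives a deflation
  \<open>q\<close> such that \<open>h \<cdot> q\<close> factors through \<open>f\<close>, so
  \<open>q\<close> kills the class.\<close>

lemma iso_defect_effaceable:
  assumes F: "psh F" and f: "deflation Y X f"
    and iso: "presheaf_isomorphic C F (cokernel_presheaf C (representable C Y) (representable C X) (\<lambda>W h. f \<cdot> h))"
      (is "presheaf_isomorphic C F ?D")
  shows "effaceable F"
  unfolding effaceable_def
proof (intro ballI)
  fix W u assume W: "W \<in> Obj C" and u: "u \<in> carrier (Val F W)"
  note fm = deflation_mor[OF f]
  have O: "Y \<in> Obj C" "X \<in> Obj C" using fm mor_Obj by blast+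
  define N where "N W = (\<lambda>h. f \<cdot> h) ` carrier (Hom C W Y)" for W
  have ValD: "Val ?D W = Hom C W X Mod N W" for W unfolding N_def by (rule cokernel_representable(1)[OF fm])
  have sub: "subgroup (N W) (Hom C W X)" if "W \<in> Obj C" for W
    unfolding N_def by (rule cokernel_representable(3)[OF fm that])
  obtain \<eta> where \<eta>: "nat_trans C F ?D \<eta>" "\<And>W. W \<in> Obj C \<Longrightarrow> \<eta> W \<in> iso (Val F W) (Val ?D W)"
    using iso unfolding presheaf_isomorphic_def by blast
  have "\<eta> W u \<in> carrier (Val ?D W)" by (rule nat_closed[OF \<eta>(1) W u])
  then obtain h where h: "h \<in> mor C W X" "\<eta> W u = N W #>\<^bsub>Hom C W X\<^esub> h"
    using W O by (auto simp: ValD FactGroup_def RCOSETS_def carrier_Hom_eq)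
  obtain V q y where q: "deflation V W q" "y \<in> mor C V Y" "f \<cdot> y = h \<cdot> q"
    using deflation_pullback[OF f h(1)] .
  note qm = deflation_mor[OF q(1)]
  note [simp] = mor_arr[OF fm] mor_arr[OF h(1)] mor_arr[OF q(2)] mor_arr[OF qm]
  have V: "V \<in> Obj C" using qm mor_Obj by blast
  interpret V: comm_group "Hom C V X" using hom_group V O by blast
  interpret NV: normal "N V" "Hom C V X" by (rule V.subgroup_imp_normal[OF sub[OF V]])
  interpret D: group "Val ?D V" unfolding ValD by (rule NV.factorgroup_is_group)
  \<comment> \<open>The action on a coset is a union over its members, so the factorization through
    \<open>f\<close> is shown for every member \<open>k\<close>, not only for
    \<open>h\<close>.\<close>
  have cos: "N V #>\<^bsub>Hom C V X\<^esub> (k \<cdot> q) = N V" if k: "k \<in> \<eta> W u" for k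
  proof -
    obtain m where m: "m \<in> mor C W Y" "k = (f \<cdot> m) \<otimes>\<^bsub>Hom C W X\<^esub> h"
      using k W O unfolding h(2) r_coset_def N_def by (auto simp: carrier_Hom_eq)
    note [simp] = mor_arr[OF m(1)]
    let ?l = "(m \<cdot> q) \<otimes>\<^bsub>Hom C V Y\<^esub> y"
    have "k \<cdot> q = f \<cdot> ?l" by (simp add: m(2) q(3))
    moreover have "?l \<in> mor C V Y" by (simp add: mor_iff)
    ultimately have "k \<cdot> q \<in> N V" unfolding N_def carrier_Hom_eq[OF V O(1)] by (rule image_eqI)
    then show ?thesis using V.coset_join2 sub[OF V] subgroup.mem_carrier by metis
  qed
  have "h \<in> \<eta> W u" unfolding h(2)
    using group.rcos_self[OF Hom_group[OF W O(2)] mor_carrier[OF h(1)] sub[OF W]] .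
  with cos have "Act ?D q (\<eta> W u) = N V" unfolding cokernel_act[OF fm qm] N_def by blast
  then have "\<eta> V (Act F q u) = \<one>\<^bsub>Val ?D V\<^esub>"
    using nat_act[OF \<eta>(1), of q V u] u by (simp add: ValD)
  moreover have "\<eta> V \<one>\<^bsub>Val F V\<^esub> = \<one>\<^bsub>Val ?D V\<^esub>"
    by (rule hom_one[OF nat_hom[OF \<eta>(1) V] psh_group[OF F V]]) unfold_locales
  moreover have "inj_on (\<eta> V) (carrier (Val F V))" using \<eta>(2)[OF V] by (simp add: iso_def bij_betw_def)
  moreover have "Act F q u \<in> carrier (Val F V)" "\<one>\<^bsub>Val F V\<^esub> \<in> carrier (Val F V)"
    using F V u by simp_all
  ultimately have "Act F q u = \<one>\<^bsub>Val F V\<^esub>" by (metis inj_onD)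
  with q(1) show "\<exists>V q. deflation V W q \<and> Act F q u = \<one>\<^bsub>Val F V\<^esub>" by blast
qed

text \<open>
  If \<open>x\<close> generates \<open>F\<close> with relations \<open>a\<close> and is killed by a deflation \<open>f = a k\<close>, then the row
  \<open>[f, a]\<close> is a deflation through which the same morphisms factor as through \<open>a\<close>.
\<close>

lemma effaceable_presents:
  assumes F: "psh F" and p: "presents F X0 X1 x a" and eff: "effaceable F"
  obtains P d where "deflation P X0 d" "presents F X0 P x d"
proof -
  note R = presentsD[OF p]
  have O: "X0 \<in> Obj C" "X1 \<in> Obj C" using R(2) mor_Obj by blast+
  obtain Y f where f: "deflation Y X0 f" "Act F f x = \<one>\<^bsub>Val F Y\<^esub>"
    using eff R(1) O unfolding effaceable_def by blast
  then obtain k where k: "k \<in> mor C Y X1" "f = a \<cdot> k" using R(4)[OF deflation_mor[OF f(1)]] by blast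
  have Y: "Y \<in> Obj C" using k mor_Obj by blast
  obtain P i j p q where b: "is_biproduct C Y X1 P i j p q" using has_biproducts Y O by blast
  note B = biproductD[OF b]
  note [simp] = B(1-4)[THEN mor_arr] mor_arr[OF R(2)] mor_arr[OF k(1)]
  let ?d = "(f \<cdot> p) \<otimes>\<^bsub>Hom C P X0\<^esub> (a \<cdot> q)"
  have d: "deflation P X0 ?d" by (rule deflation_row[OF f(1) R(2) b])
  have "(\<exists>l\<in>mor C W X1. h = a \<cdot> l) \<longleftrightarrow> (\<exists>m\<in>mor C W P. h = ?d \<cdot> m)" if h: "h \<in> mor C W X0" for W h
  proof
    have W: "W \<in> Obj C" using h mor_Obj by blast
    assume "\<exists>l\<in>mor C W X1. h = a \<cdot> l"
    then obtain l where l: "l \<in> mor C W X1" "h = a \<cdot> l" by blast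
    note [simp] = mor_arr[OF l(1)]
    show "\<exists>m\<in>mor C W P. h = ?d \<cdot> m"
      by (rule bexI[of _ "j \<cdot> l"])
        (use O Y W in \<open>simp_all add: l(2) k(2) B(5-8)[THEN comp_eq_ext1] add_simps mor_iff\<close>)
  next
    assume "\<exists>m\<in>mor C W P. h = ?d \<cdot> m"
    then obtain m where m: "m \<in> mor C W P" "h = ?d \<cdot> m" by blast
    note [simp] = mor_arr[OF m(1)]
    show "\<exists>l\<in>mor C W X1. h = a \<cdot> l"
      by (rule bexI[of _ "(k \<cdot> p \<cdot> m) \<otimes>\<^bsub>Hom C W X1\<^esub> (q \<cdot> m)"]) (simp_all add: m(2) k(2) mor_iff)
  qed
  then have "presents F X0 P x ?d"
    unfolding presents_def using R(1,3,4) deflation_mor[OF d] by simp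
  with d that show ?thesis by blast
qed

end

section \<open>The localization sequence\<close>

locale extriangulated_weak_kernels =
  extriangulated_category C E s + weak_kernel_category C U
  for C :: "('o, 'm) cat" (structure) and E :: "('o, 'm, 'e) bifunctor"
    and s :: "('o, 'm, 'e) realization" and U :: "'u itself"
begin

abbreviation S :: "('o, 'm, 'u) presheaf set" where
  "S \<equiv> def_objects U C E s"

lemma def_iff: "F \<in> S \<longleftrightarrow> fp F \<and> effaceable F"
proof
  assume "F \<in> S"
  then obtain Z Y X g f where F: "fp F" and "conflation C E s Z Y X g f"
    and iso: "presheaf_isomorphic C F (cokernel_presheaf C (representable C Y) (representable C X) (\<lambda>W h. f \<cdot> h))"
    unfolding def_objects_def by auto
  then have "deflation Y X f" unfolding deflation_def by blast
  then show "fp F \<and> effaceable F" using iso_defect_effaceable[OF fp_psh[OF F] _ iso] F by blast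
next
  assume *: "fp F \<and> effaceable F"
  then obtain X0 X1 x a where p: "presents F X0 X1 x a" unfolding finitely_presented_iff by blast
  note F = fp_psh[OF conjunct1[OF *]]
  obtain P d where d: "deflation P X0 d" "presents F X0 P x d"
    using effaceable_presents[OF F p] * by blast
  then obtain Z g where "conflation C E s Z P X0 g d" unfolding deflation_def by blast
  then show "F \<in> S"
    using * presents_iso_cokernel[OF F d(2)] unfolding def_objects_def mem_Collect_eq mod_Obj by blast
qed

lemma pointwise_kernel_inj: "app k W u = app k W v \<Longrightarrow> pointwise_kernel K F G k f \<Longrightarrow> W \<in> Obj C \<Longrightarrow>
    u \<in> carrier (Val K W) \<Longrightarrow> v \<in> carrier (Val K W) \<Longrightarrow> u = v"
  unfolding pointwise_kernel_def by (auto dest: inj_onD)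

lemma app_act: "f \<in> mor A F G \<Longrightarrow> arr a \<Longrightarrow> src a = X \<Longrightarrow> u \<in> carrier (Val F (tgt a)) \<Longrightarrow>
    app f X (Act F a u) = Act G a (app f (tgt a) u)"
  by (rule nat_act[OF app_nat])

lemma app_closed: "f \<in> mor A F G \<Longrightarrow> W \<in> Obj C \<Longrightarrow> u \<in> carrier (Val F W) \<Longrightarrow> app f W u \<in> carrier (Val G W)"
  by (rule nat_closed[OF app_nat])

lemma app_one: "f \<in> mor A F G \<Longrightarrow> W \<in> Obj C \<Longrightarrow> app f W \<one>\<^bsub>Val F W\<^esub> = \<one>\<^bsub>Val G W\<^esub>"
  using nat_one[OF app_nat] mor_mod_psh by blast

section \<open>Local isomorphisms\<close>

definition locally_injective :: "('o, 'm, 'u) presheaf \<Rightarrow> ('o, 'm, 'u) presheaf \<Rightarrow> ('o, 'm, 'u) presheaf_mor \<Rightarrow> bool" where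
  "locally_injective F G f \<longleftrightarrow> (\<forall>W\<in>Obj C. \<forall>u\<in>carrier (Val F W). app f W u = \<one>\<^bsub>Val G W\<^esub> \<longrightarrow>
     (\<exists>V q. deflation V W q \<and> Act F q u = \<one>\<^bsub>Val F V\<^esub>))"

definition locally_surjective :: "('o, 'm, 'u) presheaf \<Rightarrow> ('o, 'm, 'u) presheaf \<Rightarrow> ('o, 'm, 'u) presheaf_mor \<Rightarrow> bool" where
  "locally_surjective F G f \<longleftrightarrow> (\<forall>W\<in>Obj C. \<forall>w\<in>carrier (Val G W).
     \<exists>V q v. deflation V W q \<and> v \<in> carrier (Val F V) \<and> Act G q w = app f V v)"

lemma act_deflation_closed:
  "psh F \<Longrightarrow> deflation V W q \<Longrightarrow> u \<in> carrier (Val F W) \<Longrightarrow> Act F q u \<in> carrier (Val F V)"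
  using deflation_arr[of V W q] by simp

text \<open>Elements of the kernel are the elements of \<open>F\<close> killed by \<open>f\<close>,
  so the kernel is effaceable exactly when \<open>f\<close> is locally injective. An element of
  \<open>G\<close> vanishes in the cokernel after a deflation exactly when its restriction lies in
  the image of \<open>f\<close>, so the cokernel is effaceable exactly when \<open>f\<close> is
  locally surjective.\<close>

lemma quot_inv_iff:
  "f \<in> quot_inv A S F G \<longleftrightarrow> f \<in> mor A F G \<and> locally_injective F G f \<and> locally_surjective F G f"
proof
  assume "f \<in> quot_inv A S F G"
  then obtain K k L c where f: "f \<in> mor A F G" and K: "K \<in> S" "is_kernel A K F G k f"
    and L: "L \<in> S" "is_cokernel A F G L f c" unfolding quot_inv_def by blast
  note pk = is_kernelD[OF K(2)] and pc = is_cokernelD[OF L(2)]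
  have k: "k \<in> mor A K F" and c: "c \<in> mor A G L" using K L unfolding is_kernel_def is_cokernel_def by blast+
  have "locally_injective F G f"
    unfolding locally_injective_def
  proof (intro ballI impI)
    fix W u assume W: "W \<in> Obj C" and "u \<in> carrier (Val F W)" "app f W u = \<one>\<^bsub>Val G W\<^esub>"
    then obtain v where v: "v \<in> carrier (Val K W)" "u = app k W v" using pk unfolding pointwise_kernel_def by blast
    then obtain V q where q: "deflation V W q" "Act K q v = \<one>\<^bsub>Val K V\<^esub>"
      using K(1) W unfolding def_iff effaceable_def by blast
    then have "Act F q u = \<one>\<^bsub>Val F V\<^esub>"
      using app_act[OF k, of q V v] deflation_arr[OF q(1)] v app_one[OF k deflation_Obj(1)[OF q(1)]] by simp
    with q show "\<exists>V q. deflation V W q \<and> Act F q u = \<one>\<^bsub>Val F V\<^esub>" by blast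
  qed
  moreover have "locally_surjective F G f"
    unfolding locally_surjective_def
  proof (intro ballI)
    fix W w assume W: "W \<in> Obj C" and w: "w \<in> carrier (Val G W)"
    then obtain V q where q: "deflation V W q" "Act L q (app c W w) = \<one>\<^bsub>Val L V\<^esub>"
      using L(1) app_closed[OF c W w] unfolding def_iff effaceable_def by blast
    then have "app c V (Act G q w) = \<one>\<^bsub>Val L V\<^esub>"
      using app_act[OF c, of q V w] deflation_arr[OF q(1)] w by simp
    moreover have "Act G q w \<in> carrier (Val G V)" using act_deflation_closed[OF mor_mod_psh(2)[OF f] q(1) w] .
    ultimately have "Act G q w \<in> app f V ` carrier (Val F V)"
      using pc deflation_Obj(1)[OF q(1)] unfolding pointwise_cokernel_def by blast
    with q show "\<exists>V q v. deflation V W q \<and> v \<in> carrier (Val F V) \<and> Act G q w = app f V v" by blast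
  qed
  ultimately show "f \<in> mor A F G \<and> locally_injective F G f \<and> locally_surjective F G f" using f by blast
next
  assume *: "f \<in> mor A F G \<and> locally_injective F G f \<and> locally_surjective F G f"
  then have f: "f \<in> mor A F G" by blast
  obtain K k where k: "k \<in> mor A K F" "pointwise_kernel K F G k f" using exists_kernel[OF f] by blast
  obtain L c where c: "c \<in> mor A G L" "pointwise_cokernel F G L f c" using exists_cokernel[OF f] by blast
  have "effaceable K"
    unfolding effaceable_def
  proof (intro ballI)
    fix W u assume W: "W \<in> Obj C" and u: "u \<in> carrier (Val K W)"
    note ku = app_closed[OF k(1) W u]
    have "app f W (app k W u) = \<one>\<^bsub>Val G W\<^esub>" using k(2) W u ku unfolding pointwise_kernel_def by blast
    then obtain V q where q: "deflation V W q" "Act F q (app k W u) = \<one>\<^bsub>Val F V\<^esub>"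
      using * W ku unfolding locally_injective_def by blast
    note V = deflation_Obj(1)[OF q(1)]
    have "app k V (Act K q u) = app k V \<one>\<^bsub>Val K V\<^esub>"
      using app_act[OF k(1), of q V u] deflation_arr[OF q(1)] u q(2) app_one[OF k(1) V] by simp
    then have "Act K q u = \<one>\<^bsub>Val K V\<^esub>"
      by (rule pointwise_kernel_inj[OF _ k(2) V]) (use act_deflation_closed[OF mor_mod_psh(1)[OF k(1)] q(1) u] mor_mod_psh(1)[OF k(1)] V in auto)
    with q show "\<exists>V q. deflation V W q \<and> Act K q u = \<one>\<^bsub>Val K V\<^esub>" by blast
  qed
  then have "K \<in> S" using mor_mod_fp[OF k(1)] def_iff by blast
  moreover have "effaceable L"
    unfolding effaceable_def
  proof (intro ballI)
    fix W l assume W: "W \<in> Obj C" and "l \<in> carrier (Val L W)"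
    then obtain w where w: "w \<in> carrier (Val G W)" "l = app c W w" using c(2) unfolding pointwise_cokernel_def by blast
    obtain V q v where q: "deflation V W q" "v \<in> carrier (Val F V)" "Act G q w = app f V v"
      using * W w(1) unfolding locally_surjective_def by blast
    note V = deflation_Obj(1)[OF q(1)]
    have "app c V (app f V v) = \<one>\<^bsub>Val L V\<^esub>"
      using c(2) V app_closed[OF f V q(2)] q(2) unfolding pointwise_cokernel_def by blast
    then have "Act L q l = \<one>\<^bsub>Val L V\<^esub>"
      using app_act[OF c(1), of q V w] deflation_arr[OF q(1)] w q(3) by simp
    with q show "\<exists>V q. deflation V W q \<and> Act L q l = \<one>\<^bsub>Val L V\<^esub>" by blast
  qed
  then have "L \<in> S" using mor_mod_fp[OF c(1)] def_iff by blast
  ultimately show "f \<in> quot_inv A S F G"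
    unfolding quot_inv_def using f is_kernel_pointwise[OF k(1) f k(2)] is_cokernel_pointwise[OF f c] by blast
qed

lemma zero_in_def:
  assumes "is_zero_object A Z"
  shows "Z \<in> S"
proof -
  interpret A: additive_category A by (rule additive_A)
  have Z: "fp Z" "Idt A Z = \<one>\<^bsub>Hom A Z Z\<^esub>" using assms A.zero_object_iff by auto
  have "u = \<one>\<^bsub>Val Z W\<^esub>" if "W \<in> Obj C" "u \<in> carrier (Val Z W)" for W u
    using app_Idt[OF that, of U] app_zero[OF that, of U Z] Z(2) by simp
  then have "effaceable Z"
    unfolding effaceable_def using deflation_Idt fp_psh[OF Z(1)] by (metis act_Idt)
  then show ?thesis using Z def_iff by blast
qed

text \<open>Subobjects and quotients inherit killing deflations directly. For an extension, an
  element of \<open>G\<close> is killed in two stages: a deflation kills its image in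
  \<open>H\<close>, so its restriction comes from \<open>F\<close>, where a second deflation kills
  it; the composite is again a deflation.\<close>

theorem serre_subcategory_defects: "serre_subcategory A S"
proof -
  interpret A: additive_category A by (rule additive_A)
  have "G \<in> S \<longleftrightarrow> F \<in> S \<and> H \<in> S" if se: "short_exact A F G H f g" for F G H f g
  proof -
    have f: "f \<in> mor A F G" and g: "g \<in> mor A G H" using se unfolding short_exact_def is_kernel_def by blast+
    have pk: "pointwise_kernel F G H f g" and pc: "pointwise_cokernel F G H f g"
      using se is_kernelD is_cokernelD unfolding short_exact_def by blast+
    note psh = mor_mod_psh[OF f] mor_mod_psh(2)[OF g]
    have "effaceable F" if eff: "effaceable G"
      unfolding effaceable_def
    proof (intro ballI)
      fix W u assume W: "W \<in> Obj C" and u: "u \<in> carrier (Val F W)"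
      obtain V q where q: "deflation V W q" "Act G q (app f W u) = \<one>\<^bsub>Val G V\<^esub>"
        using eff W app_closed[OF f W u] unfolding effaceable_def by blast
      note V = deflation_Obj(1)[OF q(1)]
      have "app f V (Act F q u) = app f V \<one>\<^bsub>Val F V\<^esub>"
        using app_act[OF f, of q V u] deflation_arr[OF q(1)] u q(2) app_one[OF f V] by simp
      then have "Act F q u = \<one>\<^bsub>Val F V\<^esub>"
        by (rule pointwise_kernel_inj[OF _ pk V]) (use act_deflation_closed[OF psh(1) q(1) u] psh(1) V in auto)
      with q show "\<exists>V q. deflation V W q \<and> Act F q u = \<one>\<^bsub>Val F V\<^esub>" by blast
    qed
    moreover have "effaceable H" if eff: "effaceable G"
      unfolding effaceable_def
    proof (intro ballI)
      fix W w assume W: "W \<in> Obj C" and "w \<in> carrier (Val H W)"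
      then obtain u where u: "u \<in> carrier (Val G W)" "w = app g W u" using pc unfolding pointwise_cokernel_def by blast
      obtain V q where q: "deflation V W q" "Act G q u = \<one>\<^bsub>Val G V\<^esub>"
        using eff W u unfolding effaceable_def by blast
      then have "Act H q w = \<one>\<^bsub>Val H V\<^esub>"
        using app_act[OF g, of q V u] deflation_arr[OF q(1)] u app_one[OF g deflation_Obj(1)[OF q(1)]] by simp
      with q show "\<exists>V q. deflation V W q \<and> Act H q w = \<one>\<^bsub>Val H V\<^esub>" by blast
    qed
    moreover have "effaceable G" if effF: "effaceable F" and effH: "effaceable H"
      unfolding effaceable_def
    proof (intro ballI)
      fix W u assume W: "W \<in> Obj C" and u: "u \<in> carrier (Val G W)"
      obtain V q where q: "deflation V W q" "Act H q (app g W u) = \<one>\<^bsub>Val H V\<^esub>"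
        using effH W app_closed[OF g W u] unfolding effaceable_def by blast
      note V = deflation_Obj(1)[OF q(1)] and c = act_deflation_closed[OF psh(2) q(1) u]
      have "app g V (Act G q u) = \<one>\<^bsub>Val H V\<^esub>"
        using app_act[OF g, of q V u] deflation_arr[OF q(1)] u q(2) by simp
      then obtain v where v: "v \<in> carrier (Val F V)" "Act G q u = app f V v"
        using pk V c unfolding pointwise_kernel_def by blast
      obtain V' q' where q': "deflation V' V q'" "Act F q' v = \<one>\<^bsub>Val F V'\<^esub>"
        using effF V v unfolding effaceable_def by blast
      have "Act G (q \<cdot> q') u = Act G q' (Act G q u)"
        using deflation_arr[OF q(1)] deflation_arr[OF q'(1)] u psh by simp
      also have "\<dots> = \<one>\<^bsub>Val G V'\<^esub>"
        using app_act[OF f, of q' V' v] deflation_arr[OF q'(1)] v q'(2) app_one[OF f deflation_Obj(1)[OF q'(1)]]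
        by simp
      finally show "\<exists>V q. deflation V W q \<and> Act G q u = \<one>\<^bsub>Val G V\<^esub>"
        using deflation_comp[OF q'(1) q(1)] by blast
    qed
    ultimately show ?thesis using mor_mod_fp[OF f] mor_mod_fp[OF g] def_iff by blast
  qed
  then show ?thesis
    unfolding serre_subcategory_def using abelian_A zero_in_def A.has_zero_object
    by (auto simp: def_iff)
qed

lemma app_diff:
  assumes f: "f \<in> mor A F G" and g: "g \<in> mor A F G" and W: "W \<in> Obj C" and u: "u \<in> carrier (Val F W)"
  shows "app (f \<otimes>\<^bsub>Hom A F G\<^esub> inv\<^bsub>Hom A F G\<^esub> g) W u = \<one>\<^bsub>Val G W\<^esub> \<longleftrightarrow> app f W u = app g W u"
proof -
  interpret A: additive_category A by (rule additive_A)
  interpret H: comm_group "Hom A F G" using A.hom_group mor_mod_fp[OF f] by simp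
  interpret G: group "Val G W" using psh_group[OF mor_mod_psh(2)[OF f] W] .
  let ?h = "f \<otimes>\<^bsub>Hom A F G\<^esub> inv\<^bsub>Hom A F G\<^esub> g"
  have h: "?h \<in> mor A F G" using A.mor_arr[OF f] A.mor_arr[OF g] by (simp add: A.mor_iff)
  have "f = ?h \<otimes>\<^bsub>Hom A F G\<^esub> g" using A.mor_carrier[OF f] A.mor_carrier[OF g] by (simp add: H.m_assoc)
  then have "app f W u = app ?h W u \<otimes>\<^bsub>Val G W\<^esub> app g W u" using app_add[OF h g W u] by simp
  then show ?thesis using app_closed[OF h W u] app_closed[OF g W u] by (metis G.l_one G.r_cancel_one)
qed

lemma locally_injectiveD:
  assumes "f \<in> mor A F G" "locally_injective F G f" "W \<in> Obj C" "u \<in> carrier (Val F W)" "v \<in> carrier (Val F W)"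
    and "app f W u = app f W v"
  obtains V q where "deflation V W q" "Act F q u = Act F q v"
proof -
  note psh = mor_mod_psh[OF assms(1)]
  interpret F: comm_group "Val F W" using psh_comm_group[OF psh(1) assms(3)] .
  define w where "w = u \<otimes>\<^bsub>Val F W\<^esub> inv\<^bsub>Val F W\<^esub> v"
  have w: "w \<in> carrier (Val F W)" "u = w \<otimes>\<^bsub>Val F W\<^esub> v" using assms(4,5) by (simp_all add: w_def F.m_assoc)
  have "app f W w = \<one>\<^bsub>Val G W\<^esub>"
    using nat_eq_iff[OF app_nat[OF assms(1)] psh assms(3-5)] assms(6) by (simp add: w_def)
  then obtain V q where q: "deflation V W q" "Act F q w = \<one>\<^bsub>Val F V\<^esub>"
    using assms(2,3) w(1) unfolding locally_injective_def by blast
  interpret V: group "Val F V" using psh_group[OF psh(1) deflation_Obj(1)[OF q(1)]] .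
  have "Act F q u = Act F q v"
    using w(2) deflation_arr[OF q(1)] q(2) w(1) assms(5) psh act_deflation_closed[OF psh(1) q(1) assms(5)] by simp
  with q(1) that show ?thesis by blast
qed

section \<open>Right fractions for local isomorphisms\<close>

lemma quot_inv_id:
  assumes "fp F"
  shows "Idt A F \<in> quot_inv A S F F"
proof -
  interpret A: additive_category A by (rule additive_A)
  note F = fp_psh[OF assms]
  have "\<exists>V q. deflation V W q \<and> Act F q u = \<one>\<^bsub>Val F V\<^esub>"
    if "W \<in> Obj C" "u \<in> carrier (Val F W)" "app (Idt A F) W u = \<one>\<^bsub>Val F W\<^esub>" for W u
    using that deflation_Idt[OF that(1)] F app_Idt[OF that(1,2), of U]
    by (intro exI[of _ W] exI[of _ "Idt C W"]) simp
  moreover have "\<exists>V q v. deflation V W q \<and> v \<in> carrier (Val F V) \<and> Act F q w = app (Idt A F) V v"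
    if "W \<in> Obj C" "w \<in> carrier (Val F W)" for W w
    using that deflation_Idt[OF that(1)] F app_Idt[OF that, of U]
    by (intro exI[of _ W] exI[of _ "Idt C W"] exI[of _ w]) simp
  ultimately show ?thesis
    unfolding quot_inv_iff locally_injective_def locally_surjective_def using A.id_mor assms by simp
qed

lemma quot_inv_comp:
  assumes "f \<in> quot_inv A S F G" "g \<in> quot_inv A S G H"
  shows "g \<cdot>\<^bsub>A\<^esub> f \<in> quot_inv A S F H"
proof -
  interpret A: additive_category A by (rule additive_A)
  have f: "f \<in> mor A F G" "locally_injective F G f" "locally_surjective F G f"
    and g: "g \<in> mor A G H" "locally_injective G H g" "locally_surjective G H g"
    using assms unfolding quot_inv_iff by blast+
  note psh = mor_mod_psh[OF f(1)] mor_mod_psh(2)[OF g(1)]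
  note gf = app_comp[OF f(1) g(1)]
  have "\<exists>V q. deflation V W q \<and> Act F q u = \<one>\<^bsub>Val F V\<^esub>"
    if W: "W \<in> Obj C" and u: "u \<in> carrier (Val F W)" and e: "app (g \<cdot>\<^bsub>A\<^esub> f) W u = \<one>\<^bsub>Val H W\<^esub>" for W u
  proof -
    have "app g W (app f W u) = \<one>\<^bsub>Val H W\<^esub>" using e gf[OF W u] by simp
    then obtain V q where q: "deflation V W q" "Act G q (app f W u) = \<one>\<^bsub>Val G V\<^esub>"
      using g(2) W app_closed[OF f(1) W u] unfolding locally_injective_def by blast
    have "app f V (Act F q u) = \<one>\<^bsub>Val G V\<^esub>"
      using app_act[OF f(1), of q V u] deflation_arr[OF q(1)] u q(2) by simp
    then obtain V' q' where q': "deflation V' V q'" "Act F q' (Act F q u) = \<one>\<^bsub>Val F V'\<^esub>"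
      using f(2) deflation_Obj(1)[OF q(1)] act_deflation_closed[OF psh(1) q(1) u] unfolding locally_injective_def by blast
    then have "Act F (q \<cdot> q') u = \<one>\<^bsub>Val F V'\<^esub>"
      using deflation_arr[OF q(1)] deflation_arr[OF q'(1)] u psh by simp
    then show ?thesis using deflation_comp[OF q'(1) q(1)] by blast
  qed
  moreover have "\<exists>V q v. deflation V W q \<and> v \<in> carrier (Val F V) \<and> Act H q w = app (g \<cdot>\<^bsub>A\<^esub> f) V v"
    if W: "W \<in> Obj C" and w: "w \<in> carrier (Val H W)" for W w
  proof -
    obtain V q v where q: "deflation V W q" "v \<in> carrier (Val G V)" "Act H q w = app g V v"
      using g(3) W w unfolding locally_surjective_def by blast
    obtain V' q' v' where q': "deflation V' V q'" "v' \<in> carrier (Val F V')" "Act G q' v = app f V' v'"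
      using f(3) deflation_Obj(1)[OF q(1)] q(2) unfolding locally_surjective_def by blast
    have "Act H (q \<cdot> q') w = app (g \<cdot>\<^bsub>A\<^esub> f) V' v'"
      using deflation_arr[OF q(1)] deflation_arr[OF q'(1)] w psh q(2,3) q'(3) app_act[OF g(1), of q' V' v]
        gf[OF deflation_Obj(1)[OF q'(1)] q'(2)] by simp
    then show ?thesis using deflation_comp[OF q'(1) q(1)] q'(2) by blast
  qed
  ultimately show ?thesis
    unfolding quot_inv_iff locally_injective_def locally_surjective_def using A.comp_mor[OF f(1) g(1)] by blast
qed

text \<open>The square is the pullback, built as the kernel of the difference of \<open>t p\<close>
  and \<open>f q\<close> on the biproduct of \<open>F'\<close> and \<open>H\<close>. Its projection
  to \<open>H\<close> inherits both local properties from \<open>t\<close>: an element over zero in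
  \<open>H\<close> is determined by its component in \<open>F'\<close>, which \<open>t\<close>
  kills; and a lift along \<open>t\<close> of the image of \<open>w\<close> under \<open>f\<close>,
  after a deflation, gives a lift of the restriction of \<open>w\<close>.\<close>

lemma quot_inv_ore:
  assumes "t \<in> quot_inv A S F' F" "f \<in> mor A H F"
  shows "\<exists>K. \<exists>t'\<in>quot_inv A S K H. \<exists>f'\<in>mor A K F'. t \<cdot>\<^bsub>A\<^esub> f' = f \<cdot>\<^bsub>A\<^esub> t'"
proof -
  interpret A: additive_category A by (rule additive_A)
  have t: "t \<in> mor A F' F" "locally_injective F' F t" "locally_surjective F' F t"
    using assms unfolding quot_inv_iff by blast+
  note f = assms(2)
  note psh = mor_mod_psh[OF t(1)] mor_mod_psh(1)[OF f]
  obtain B i j p q where b: "is_biproduct A F' H B i j p q"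
    using A.has_biproducts[of F' H] mor_mod_fp[OF t(1)] mor_mod_fp[OF f] by auto
  note B = A.biproductD[OF b]
  note Bpsh = mor_mod_psh(2)[OF B(1)]
  define g where "g = (t \<cdot>\<^bsub>A\<^esub> p) \<otimes>\<^bsub>Hom A B F\<^esub> inv\<^bsub>Hom A B F\<^esub> (f \<cdot>\<^bsub>A\<^esub> q)"
  note tp = A.comp_mor[OF B(3) t(1)] and fq = A.comp_mor[OF B(4) f]
  have g: "g \<in> mor A B F" using A.mor_arr[OF tp] A.mor_arr[OF fq] by (simp add: g_def A.mor_iff)
  have gz: "app g W z = \<one>\<^bsub>Val F W\<^esub> \<longleftrightarrow> app t W (app p W z) = app f W (app q W z)"
    if "W \<in> Obj C" "z \<in> carrier (Val B W)" for W z
    unfolding g_def using app_diff[OF tp fq that] app_comp[OF B(3) t(1) that] app_comp[OF B(4) f that] by simp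
  obtain K k where k: "k \<in> mor A K B" "pointwise_kernel K B F k g" using exists_kernel[OF g] by blast
  note Kpsh = mor_mod_psh(1)[OF k(1)]
  let ?t = "q \<cdot>\<^bsub>A\<^esub> k" and ?f = "p \<cdot>\<^bsub>A\<^esub> k"
  note tm = A.comp_mor[OF k(1) B(4)] and fm = A.comp_mor[OF k(1) B(3)]
  have sq: "app t W (app p W (app k W u)) = app f W (app q W (app k W u))"
    if W: "W \<in> Obj C" and u: "u \<in> carrier (Val K W)" for W u
    using gz[OF W app_closed[OF k(1) W u]] k(2) W u app_closed[OF k(1) W u] unfolding pointwise_kernel_def by blast
  have eq: "t \<cdot>\<^bsub>A\<^esub> ?f = f \<cdot>\<^bsub>A\<^esub> ?t"
    by (rule mod_ext[OF A.comp_mor[OF fm t(1)] A.comp_mor[OF tm f]])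
      (simp add: app_comp[OF fm t(1)] app_comp[OF tm f] app_comp[OF k(1) B(3)] app_comp[OF k(1) B(4)] sq)
  have dec: "z = app i W (app p W z) \<otimes>\<^bsub>Val B W\<^esub> app j W (app q W z)" if "W \<in> Obj C" "z \<in> carrier (Val B W)" for W z
    using app_add[OF A.comp_mor[OF B(3,1)] A.comp_mor[OF B(4,2)] that] app_comp[OF B(3,1) that]
      app_comp[OF B(4,2) that] app_Idt[OF that, of U] B(9) by simp
  have "\<exists>V d. deflation V W d \<and> Act K d u = \<one>\<^bsub>Val K V\<^esub>"
    if W: "W \<in> Obj C" and u: "u \<in> carrier (Val K W)" and e: "app ?t W u = \<one>\<^bsub>Val H W\<^esub>" for W u
  proof -
    let ?z = "app k W u"
    have z: "?z \<in> carrier (Val B W)" by (rule app_closed[OF k(1) W u])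
    have qz: "app q W ?z = \<one>\<^bsub>Val H W\<^esub>" using e app_comp[OF k(1) B(4) W u] by simp
    then have "app t W (app p W ?z) = \<one>\<^bsub>Val F W\<^esub>" using sq[OF W u] app_one[OF f W] by simp
    then obtain V d where d: "deflation V W d" "Act F' d (app p W ?z) = \<one>\<^bsub>Val F' V\<^esub>"
      using t(2) W app_closed[OF B(3) W z] unfolding locally_injective_def by blast
    note V = deflation_Obj(1)[OF d(1)] and dz = act_deflation_closed[OF Bpsh d(1) z]
    interpret BV: group "Val B V" using psh_group[OF Bpsh V] .
    have "app p V (Act B d ?z) = \<one>\<^bsub>Val F' V\<^esub>" "app q V (Act B d ?z) = \<one>\<^bsub>Val H V\<^esub>"
      using app_act[OF B(3), of d V ?z] app_act[OF B(4), of d V ?z] deflation_arr[OF d(1)] z d(2) qz psh by simp_all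
    then have "Act B d ?z = \<one>\<^bsub>Val B V\<^esub>"
      using dec[OF V dz] app_one[OF B(1) V] app_one[OF B(2) V] by simp
    then have "app k V (Act K d u) = app k V \<one>\<^bsub>Val K V\<^esub>"
      using app_act[OF k(1), of d V u] deflation_arr[OF d(1)] u app_one[OF k(1) V] by simp
    then have "Act K d u = \<one>\<^bsub>Val K V\<^esub>"
      by (rule pointwise_kernel_inj[OF _ k(2) V]) (use act_deflation_closed[OF Kpsh d(1) u] Kpsh V in auto)
    with d show ?thesis by blast
  qed
  moreover have "\<exists>V d v. deflation V W d \<and> v \<in> carrier (Val K V) \<and> Act H d w = app ?t V v"
    if W: "W \<in> Obj C" and w: "w \<in> carrier (Val H W)" for W w
  proof -
    obtain V d v where d: "deflation V W d" "v \<in> carrier (Val F' V)" "Act F d (app f W w) = app t V v"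
      using t(3) W app_closed[OF f W w] unfolding locally_surjective_def by blast
    note V = deflation_Obj(1)[OF d(1)] and dw = act_deflation_closed[OF psh(3) d(1) w]
    \<comment> \<open>The element of the biproduct with components \<open>v\<close> and the
      restriction of \<open>w\<close> along \<open>d\<close>; the choice of \<open>v\<close> puts it
      into the pullback.\<close>
    let ?z = "app i V v \<otimes>\<^bsub>Val B V\<^esub> app j V (Act H d w)"
    have c: "app i V v \<in> carrier (Val B V)" "app j V (Act H d w) \<in> carrier (Val B V)"
      using app_closed[OF B(1) V d(2)] app_closed[OF B(2) V dw] .
    interpret BV: group "Val B V" using psh_group[OF Bpsh V] .
    interpret FV: group "Val F' V" using psh_group[OF psh(1) V] .
    interpret HV: group "Val H V" using psh_group[OF psh(3) V] .
    have z: "?z \<in> carrier (Val B V)" using c by simp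
    have "app p V ?z = app p V (app i V v) \<otimes>\<^bsub>Val F' V\<^esub> app p V (app j V (Act H d w))"
      by (rule nat_mult[OF app_nat[OF B(3)] V c])
    also have "\<dots> = v"
      using d(2) by (simp add: app_comp[OF B(1,3) V d(2), symmetric] app_comp[OF B(2,3) V dw, symmetric]
        B(5,7) app_Idt[OF V d(2)] app_zero[OF V dw])
    finally have pz: "app p V ?z = v" .
    have "app q V ?z = app q V (app i V v) \<otimes>\<^bsub>Val H V\<^esub> app q V (app j V (Act H d w))"
      by (rule nat_mult[OF app_nat[OF B(4)] V c])
    also have "\<dots> = Act H d w"
      using dw by (simp add: app_comp[OF B(1,4) V d(2), symmetric] app_comp[OF B(2,4) V dw, symmetric]
        B(6,8) app_Idt[OF V dw] app_zero[OF V d(2)])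
    finally have qz: "app q V ?z = Act H d w" .
    have "app g V ?z = \<one>\<^bsub>Val F V\<^esub>"
      unfolding gz[OF V z] pz qz using app_act[OF f, of d V w] deflation_arr[OF d(1)] w d(3) by simp
    then obtain u where u: "u \<in> carrier (Val K V)" "?z = app k V u"
      using k(2) V z unfolding pointwise_kernel_def by blast
    then have "Act H d w = app ?t V u" using qz app_comp[OF k(1) B(4) V u(1)] by simp
    with d(1) u(1) show ?thesis by blast
  qed
  ultimately have "?t \<in> quot_inv A S K H"
    unfolding quot_inv_iff locally_injective_def locally_surjective_def using tm by blast
  with eq fm show ?thesis by blast
qed

text \<open>The equalizer of \<open>f\<close> and \<open>g\<close> works. It is pointwise injective;
  and since \<open>t\<close> identifies the images of \<open>w\<close> under \<open>f\<close> and
  \<open>g\<close>, these agree after a deflation, which puts the restriction of \<open>w\<close>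
  into the equalizer.\<close>

lemma quot_inv_cancel:
  assumes "t \<in> quot_inv A S G H" "f \<in> mor A F G" "g \<in> mor A F G" "t \<cdot>\<^bsub>A\<^esub> f = t \<cdot>\<^bsub>A\<^esub> g"
  shows "\<exists>K. \<exists>k\<in>quot_inv A S K F. f \<cdot>\<^bsub>A\<^esub> k = g \<cdot>\<^bsub>A\<^esub> k"
proof -
  interpret A: additive_category A by (rule additive_A)
  have t: "t \<in> mor A G H" "locally_injective G H t" using assms unfolding quot_inv_iff by blast+
  note f = assms(2) and g = assms(3)
  note F = mor_mod_psh(1)[OF f]
  let ?h = "f \<otimes>\<^bsub>Hom A F G\<^esub> inv\<^bsub>Hom A F G\<^esub> g"
  have h: "?h \<in> mor A F G" using A.mor_arr[OF f] A.mor_arr[OF g] by (simp add: A.mor_iff)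
  obtain K k where k: "k \<in> mor A K F" "pointwise_kernel K F G k ?h" using exists_kernel[OF h] by blast
  note Kpsh = mor_mod_psh(1)[OF k(1)]
  have ker: "u \<in> app k W ` carrier (Val K W) \<longleftrightarrow> app f W u = app g W u" if "W \<in> Obj C" "u \<in> carrier (Val F W)" for W u
    using k(2) that app_diff[OF f g that] unfolding pointwise_kernel_def by blast
  have "app f W (app k W u) = app g W (app k W u)" if "W \<in> Obj C" "u \<in> carrier (Val K W)" for W u
    using ker[OF that(1) app_closed[OF k(1) that]] that(2) by blast
  then have eq: "f \<cdot>\<^bsub>A\<^esub> k = g \<cdot>\<^bsub>A\<^esub> k"
    by (intro mod_ext[OF A.comp_mor[OF k(1) f] A.comp_mor[OF k(1) g]])
      (simp add: app_comp[OF k(1) f] app_comp[OF k(1) g])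
  have "\<exists>V d. deflation V W d \<and> Act K d u = \<one>\<^bsub>Val K V\<^esub>"
    if W: "W \<in> Obj C" and u: "u \<in> carrier (Val K W)" and e: "app k W u = \<one>\<^bsub>Val F W\<^esub>" for W u
  proof -
    have "app k W u = app k W \<one>\<^bsub>Val K W\<^esub>" using e app_one[OF k(1) W] by simp
    then have "u = \<one>\<^bsub>Val K W\<^esub>" by (rule pointwise_kernel_inj[OF _ k(2) W]) (use u Kpsh W in auto)
    then have "Act K (Idt C W) u = \<one>\<^bsub>Val K W\<^esub>" using u Kpsh W by simp
    then show ?thesis using deflation_Idt[OF W] by blast
  qed
  moreover have "\<exists>V d v. deflation V W d \<and> v \<in> carrier (Val K V) \<and> Act F d w = app k V v"
    if W: "W \<in> Obj C" and w: "w \<in> carrier (Val F W)" for W w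
  proof -
    have "app t W (app f W w) = app t W (app g W w)"
      using app_comp[OF f t(1) W w] app_comp[OF g t(1) W w] assms(4) by simp
    then obtain V d where d: "deflation V W d" "Act G d (app f W w) = Act G d (app g W w)"
      using locally_injectiveD[OF t W app_closed[OF f W w] app_closed[OF g W w]] by blast
    have "app f V (Act F d w) = app g V (Act F d w)"
      using app_act[OF f, of d V w] app_act[OF g, of d V w] deflation_arr[OF d(1)] w d(2) by simp
    then have "Act F d w \<in> app k V ` carrier (Val K V)"
      using ker[OF deflation_Obj(1)[OF d(1)] act_deflation_closed[OF F d(1) w]] by blast
    with d(1) show ?thesis by blast
  qed
  ultimately have "k \<in> quot_inv A S K F"
    unfolding quot_inv_iff locally_injective_def locally_surjective_def using k(1) by blast
  with eq show ?thesis by blast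
qed

lemma right_fractions_defects: "right_fractions A S"
proof -
  interpret A: additive_category A by (rule additive_A)
  show ?thesis
    by unfold_locales (use quot_inv_id quot_inv_comp quot_inv_ore quot_inv_cancel in \<open>simp; fail\<close>)+
qed

sublocale loc: right_fractions A S
  by (rule right_fractions_defects)

text \<open>Since the image of \<open>f\<close> is invertible, its kernel \<open>k\<close> becomes
  zero in the quotient, hence \<open>k\<close> composed with some \<open>u\<close> in
  \<open>W\<close> is zero. As \<open>u\<close> is locally surjective, every element killed by
  \<open>f\<close> vanishes after a deflation, which is local injectivity. Local surjectivity
  follows likewise from the cokernel \<open>c\<close>, which vanishes after composition with some
  \<open>v\<close> in \<open>W\<close>.\<close>

lemma quot_inv_saturated:
  assumes f: "f \<in> mor A F G" and iso: "is_iso (serre_quotient A S) F G (roof_of A S f)"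
  shows "f \<in> quot_inv A S F G"
proof -
  interpret B: preadditive_category "serre_quotient A S" by (rule loc.preadditive_B)
  obtain h where h: "h \<in> mor loc.B G F" "h \<cdot>\<^bsub>loc.B\<^esub> roof_of A S f = Idt loc.B F"
    "roof_of A S f \<cdot>\<^bsub>loc.B\<^esub> h = Idt loc.B G" using iso unfolding is_iso_def by blast
  note qf = loc.roof_of_mor[OF f]
  have fpO: "fp F" "fp G" using mor_mod_fp[OF f] .
  obtain K k where k: "k \<in> mor A K F" "pointwise_kernel K F G k f" using exists_kernel[OF f] by blast
  obtain L c where c: "c \<in> mor A G L" "pointwise_cokernel F G L f c" using exists_cokernel[OF f] by blast
  have K: "fp K" "fp L" using mor_mod_fp(1)[OF k(1)] mor_mod_fp(2)[OF c(1)] .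
  have zk: "\<one>\<^bsub>Hom A K F\<^esub> \<in> mor A K F" "\<one>\<^bsub>Hom A G L\<^esub> \<in> mor A G L"
    using K fpO by (simp_all add: loc.mor_iff)
  have fk: "f \<cdot>\<^bsub>A\<^esub> k = f \<cdot>\<^bsub>A\<^esub> \<one>\<^bsub>Hom A K F\<^esub>"
    using is_kernel_pointwise[OF k(1) f k(2)] loc.mor_arr[OF f] K by (simp add: is_kernel_def)
  have cf: "c \<cdot>\<^bsub>A\<^esub> f = \<one>\<^bsub>Hom A G L\<^esub> \<cdot>\<^bsub>A\<^esub> f"
    using is_cokernel_pointwise[OF f c] loc.mor_arr[OF f] K by (simp add: is_cokernel_def)
  have "roof_of A S f \<cdot>\<^bsub>loc.B\<^esub> roof_of A S k = roof_of A S f \<cdot>\<^bsub>loc.B\<^esub> roof_of A S \<one>\<^bsub>Hom A K F\<^esub>"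
    using loc.roof_of_comp[OF k(1) f] loc.roof_of_comp[OF zk(1) f] fk by simp
  then have "(h \<cdot>\<^bsub>loc.B\<^esub> roof_of A S f) \<cdot>\<^bsub>loc.B\<^esub> roof_of A S k =
      (h \<cdot>\<^bsub>loc.B\<^esub> roof_of A S f) \<cdot>\<^bsub>loc.B\<^esub> roof_of A S \<one>\<^bsub>Hom A K F\<^esub>"
    using B.comp_assoc[OF loc.roof_of_mor[OF k(1)] qf h(1)] B.comp_assoc[OF loc.roof_of_mor[OF zk(1)] qf h(1)]
    by simp
  then have "roof_of A S k = roof_of A S \<one>\<^bsub>Hom A K F\<^esub>"
    unfolding h(2) B.comp_id_left[OF loc.roof_of_mor[OF k(1)]] B.comp_id_left[OF loc.roof_of_mor[OF zk(1)]] .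
  then obtain P u where u: "u \<in> quot_inv A S P K" "k \<cdot>\<^bsub>A\<^esub> u = \<one>\<^bsub>Hom A K F\<^esub> \<cdot>\<^bsub>A\<^esub> u"
    using loc.roof_of_eqD[OF k(1) zk(1)] by blast
  then have um: "u \<in> mor A P K" "locally_surjective P K u" unfolding quot_inv_iff by blast+
  have ku: "app k W (app u W v) = \<one>\<^bsub>Val F W\<^esub>" if "W \<in> Obj C" "v \<in> carrier (Val P W)" for W v
    using app_comp[OF um(1) k(1) that] app_comp[OF um(1) zk(1) that] u(2)
      app_zero[OF that(1) app_closed[OF um(1) that], of U F] by simp
  have "roof_of A S c \<cdot>\<^bsub>loc.B\<^esub> roof_of A S f = roof_of A S \<one>\<^bsub>Hom A G L\<^esub> \<cdot>\<^bsub>loc.B\<^esub> roof_of A S f"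
    using loc.roof_of_comp[OF f c(1)] loc.roof_of_comp[OF f zk(2)] cf by simp
  then have "roof_of A S c \<cdot>\<^bsub>loc.B\<^esub> (roof_of A S f \<cdot>\<^bsub>loc.B\<^esub> h) =
      roof_of A S \<one>\<^bsub>Hom A G L\<^esub> \<cdot>\<^bsub>loc.B\<^esub> (roof_of A S f \<cdot>\<^bsub>loc.B\<^esub> h)"
    using B.comp_assoc[OF h(1) qf loc.roof_of_mor[OF c(1)]] B.comp_assoc[OF h(1) qf loc.roof_of_mor[OF zk(2)]]
    by simp
  then have "roof_of A S c = roof_of A S \<one>\<^bsub>Hom A G L\<^esub>"
    unfolding h(3) B.comp_id_right[OF loc.roof_of_mor[OF c(1)]] B.comp_id_right[OF loc.roof_of_mor[OF zk(2)]] .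
  then obtain R v where v: "v \<in> quot_inv A S R G" "c \<cdot>\<^bsub>A\<^esub> v = \<one>\<^bsub>Hom A G L\<^esub> \<cdot>\<^bsub>A\<^esub> v"
    using loc.roof_of_eqD[OF c(1) zk(2)] by blast
  then have vm: "v \<in> mor A R G" "locally_surjective R G v" unfolding quot_inv_iff by blast+
  have cv: "app c W (app v W x) = \<one>\<^bsub>Val L W\<^esub>" if "W \<in> Obj C" "x \<in> carrier (Val R W)" for W x
    using app_comp[OF vm(1) c(1) that] app_comp[OF vm(1) zk(2) that] v(2)
      app_zero[OF that(1) app_closed[OF vm(1) that], of U L] by simp
  have "\<exists>V q. deflation V W q \<and> Act F q x = \<one>\<^bsub>Val F V\<^esub>"
    if W: "W \<in> Obj C" and x: "x \<in> carrier (Val F W)" and e: "app f W x = \<one>\<^bsub>Val G W\<^esub>" for W x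
  proof -
    obtain y where y: "y \<in> carrier (Val K W)" "x = app k W y"
      using k(2) W x e unfolding pointwise_kernel_def by blast
    obtain V q w where q: "deflation V W q" "w \<in> carrier (Val P V)" "Act K q y = app u V w"
      using um(2) W y(1) unfolding locally_surjective_def by blast
    have "Act F q x = \<one>\<^bsub>Val F V\<^esub>"
      using app_act[OF k(1), of q V y] deflation_arr[OF q(1)] y q(3) ku[OF deflation_Obj(1)[OF q(1)] q(2)] by simp
    with q(1) show ?thesis by blast
  qed
  moreover have "\<exists>V q x. deflation V W q \<and> x \<in> carrier (Val F V) \<and> Act G q w = app f V x"
    if W: "W \<in> Obj C" and w: "w \<in> carrier (Val G W)" for W w
  proof -
    obtain V q x where q: "deflation V W q" "x \<in> carrier (Val R V)" "Act G q w = app v V x"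
      using vm(2) W w unfolding locally_surjective_def by blast
    note V = deflation_Obj(1)[OF q(1)]
    have "Act G q w \<in> app f V ` carrier (Val F V)"
      using c(2) V cv[OF V q(2)] q(3) app_closed[OF vm(1) V q(2)] unfolding pointwise_cokernel_def by simp
    with q(1) show ?thesis by blast
  qed
  ultimately show ?thesis
    unfolding quot_inv_iff locally_injective_def locally_surjective_def using f by blast
qed

sublocale loc: saturated_fractions A S
  by unfold_locales (use serre_subcategory_defects quot_inv_saturated in auto)

text \<open>\<open>R\<close> stands for the representable functor of \<open>X\<close> and
  \<open>I\<close> for the cokernel of C(-,Z) -> C(-,Y). The morphism \<open>m : I -> R\<close>
  induced by \<open>f\<close> is a local isomorphism. Since Hom(R, L) is L(X) and Hom(I, L) is the
  kernel of \<open>Act L g\<close>, bijectivity of composition with \<open>m\<close> is left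
  exactness of \<open>L\<close> at this conflation.\<close>

lemma closed_imp_lex:
  assumes L: "L \<in> loc.closed_objects"
  shows "L \<in> lex_objects U C E s"
proof -
  have Lfp: "fp L" using loc.closed_Obj[OF L] by simp
  note Lpsh = fp_psh[OF Lfp]
  have "kernel (Val L X) (Val L Y) (Act L f) = {\<one>\<^bsub>Val L X\<^esub>} \<and>
     Act L f ` carrier (Val L X) = kernel (Val L Y) (Val L Z) (Act L g)"
    if "conflation C E s Z Y X g f" for Z Y X g f
  proof -
    obtain \<delta> where \<delta>: "realizes C E s Z Y X g f \<delta>" using \<open>conflation _ _ _ _ _ _ _ _\<close> unfolding conflation_def by blast
    note fg = realizesD[OF \<delta>] and f = deflationI[OF \<delta>]
    have O: "X \<in> Obj C" "Y \<in> Obj C" "Z \<in> Obj C" using fg mor_Obj by blast+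
    note [simp] = mor_arr[OF fg(2)] mor_arr[OF fg(3)]
    obtain N where N: "is_zero_object C N" using has_zero_object by blast
    have NO: "N \<in> Obj C" using N zero_object_iff by blast
    have n: "\<one>\<^bsub>Hom C N X\<^esub> \<in> mor C N X" using NO O by (simp add: mor_iff)
    \<comment> \<open>A presentation whose relation starts at the zero object \<open>N\<close>
      imposes nothing on the generator, so it yields a copy over \<open>'u\<close> of the
      representable functor of \<open>X\<close>.\<close>
    obtain R :: "('o, 'm, 'u) presheaf" and x where R: "fp R" "presents R X N x \<one>\<^bsub>Hom C N X\<^esub>"
      using exists_presentation[OF n] by blast
    obtain I :: "('o, 'm, 'u) presheaf" and y where I: "fp I" "presents I Y Z y g"
      using exists_presentation[OF fg(2)] by blast
    note PR = presentsD[OF R(2)] and PI = presentsD[OF I(2)]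
    note Rpsh = fp_psh[OF R(1)] and Ipsh = fp_psh[OF I(1)]
    have Rz: "Act R h x = \<one>\<^bsub>Val R W\<^esub> \<longleftrightarrow> h = \<one>\<^bsub>Hom C W X\<^esub>" if h: "h \<in> mor C W X" for W h
    proof -
      have W: "W \<in> Obj C" using h mor_Obj by blast
      have "\<one>\<^bsub>Hom C N X\<^esub> \<cdot> k = \<one>\<^bsub>Hom C W X\<^esub>" if "k \<in> mor C W N" for k
        using mor_arr[OF that] O NO by simp
      moreover have "\<one>\<^bsub>Hom C W N\<^esub> \<in> mor C W N" using W NO by (simp add: mor_iff)
      ultimately show ?thesis using PR(4)[OF h] by metis
    qed
    have fx: "Act R f x \<in> carrier (Val R Y)" "Act R g (Act R f x) = \<one>\<^bsub>Val R Z\<^esub>"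
      using Rpsh PR(1) act_comp[OF Rpsh, of g f x] conflation_comp_zero[OF \<delta>] O by simp_all
    obtain m where m: "m \<in> mor A I R" "\<forall>W. \<forall>h\<in>mor C W Y. app m W (Act I h y) = Act R h (Act R f x)"
      "app m Y y = Act R f x" using presents_mod_lift[OF I(1) R(1) I(2) fx] by blast
    \<comment> \<open>\<open>m\<close> is injective outright: if \<open>f \<cdot> h\<close> is zero,
      then \<open>h\<close> factors through \<open>g\<close> and is a relation of \<open>I\<close>,
      so the identity serves as deflation.\<close>
    have "\<exists>V q. deflation V W q \<and> Act I q u = \<one>\<^bsub>Val I V\<^esub>"
      if W: "W \<in> Obj C" and u: "u \<in> carrier (Val I W)" and e: "app m W u = \<one>\<^bsub>Val R W\<^esub>" for W u
    proof -
      obtain h where h: "h \<in> mor C W Y" "u = Act I h y" using PI(3)[OF W u] by blast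
      have "Act R (f \<cdot> h) x = \<one>\<^bsub>Val R W\<^esub>" using m(2) h e mor_arr[OF h(1)] Rpsh PR(1) by simp
      then have "f \<cdot> h = \<one>\<^bsub>Hom C W X\<^esub>" using Rz[OF comp_mor[OF h(1) fg(3)]] by blast
      then have "u = \<one>\<^bsub>Val I W\<^esub>" using conflation_factor[OF \<delta> h(1)] PI(4)[OF h(1)] h(2) by blast
      then have "Act I (Idt C W) u = \<one>\<^bsub>Val I W\<^esub>" using u Ipsh W by simp
      then show ?thesis using deflation_Idt[OF W] by blast
    qed
    \<comment> \<open>Local surjectivity: after the deflation \<open>q\<close> obtained by pulling
      \<open>f\<close> back along \<open>h\<close>, the morphism \<open>h\<close> factors through
      \<open>f\<close>.\<close>
    moreover have "\<exists>V q v. deflation V W q \<and> v \<in> carrier (Val I V) \<and> Act R q w = app m V v"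
      if W: "W \<in> Obj C" and w: "w \<in> carrier (Val R W)" for W w
    proof -
      obtain h where h: "h \<in> mor C W X" "w = Act R h x" using PR(3)[OF W w] by blast
      obtain V q k where q: "deflation V W q" "k \<in> mor C V Y" "f \<cdot> k = h \<cdot> q"
        using deflation_pullback[OF f h(1)] .
      note [simp] = mor_arr[OF h(1)] mor_arr[OF q(2)] deflation_arr[OF q(1)]
      have "Act R q w = Act R (f \<cdot> k) x" unfolding q(3) using h Rpsh PR(1) by simp
      also have "\<dots> = app m V (Act I k y)" using m(2) q(2) Rpsh PR(1) by simp
      finally have "Act R q w = app m V (Act I k y)" .
      moreover have "Act I k y \<in> carrier (Val I V)" using Ipsh PI(1) by simp
      ultimately show ?thesis using q(1) by blast
    qed
    ultimately have mW: "m \<in> quot_inv A S I R"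
      unfolding quot_inv_iff locally_injective_def locally_surjective_def using m(1) by blast
    have lift: "\<exists>\<phi>\<in>mor A R L. app \<phi> X x = u" if u: "u \<in> carrier (Val L X)" for u
      using presents_mod_lift[OF R(1) Lfp R(2) u] Lpsh O NO u by auto
    have phif: "app \<phi> Y (Act R f x) = Act L f (app \<phi> X x)" if "\<phi> \<in> mor A R L" for \<phi>
      using app_act[OF that, of f Y x] PR(1) by simp
    have "u = \<one>\<^bsub>Val L X\<^esub>" if u: "u \<in> carrier (Val L X)" "Act L f u = \<one>\<^bsub>Val L Y\<^esub>" for u
    proof -
      obtain \<phi> where \<phi>: "\<phi> \<in> mor A R L" "app \<phi> X x = u" using lift u by blast
      obtain \<psi> where \<psi>: "\<psi> \<in> mor A R L" "app \<psi> X x = \<one>\<^bsub>Val L X\<^esub>" using lift psh_one[OF Lpsh O(1)] by blast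
      have "\<phi> \<cdot>\<^bsub>A\<^esub> m = \<psi> \<cdot>\<^bsub>A\<^esub> m"
        by (rule presents_mod_ext[OF I(2) loc.comp_mor[OF m(1) \<phi>(1)] loc.comp_mor[OF m(1) \<psi>(1)]])
          (use app_comp[OF m(1) \<phi>(1) O(2) PI(1)] app_comp[OF m(1) \<psi>(1) O(2) PI(1)] m(3) phif[OF \<phi>(1)]
            phif[OF \<psi>(1)] \<phi>(2) \<psi>(2) u Lpsh in simp)
      then have "\<phi> = \<psi>" by (rule loc.closed_uniq[OF L mW \<phi>(1) \<psi>(1)])
      then show ?thesis using \<phi> \<psi> by simp
    qed
    then have ker: "kernel (Val L X) (Val L Y) (Act L f) = {\<one>\<^bsub>Val L X\<^esub>}"
      unfolding kernel_def using Lpsh O by auto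
    have "\<exists>u\<in>carrier (Val L X). v = Act L f u" if v: "v \<in> carrier (Val L Y)" "Act L g v = \<one>\<^bsub>Val L Z\<^esub>" for v
    proof -
      obtain \<psi> where \<psi>: "\<psi> \<in> mor A I L" "app \<psi> Y y = v" using presents_mod_lift[OF I(1) Lfp I(2) v] by blast
      obtain \<phi> where \<phi>: "\<phi> \<in> mor A R L" "\<phi> \<cdot>\<^bsub>A\<^esub> m = \<psi>" using loc.closed_ext[OF L mW \<psi>(1)] .
      have "v = Act L f (app \<phi> X x)"
        using app_comp[OF m(1) \<phi>(1) O(2) PI(1)] \<phi>(2) \<psi>(2) m(3) phif[OF \<phi>(1)] by simp
      then show ?thesis using app_closed[OF \<phi>(1) O(1) PR(1)] by blast
    qed
    moreover have "Act L f u \<in> kernel (Val L Y) (Val L Z) (Act L g)" if u: "u \<in> carrier (Val L X)" for u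
      using act_comp[OF Lpsh, of g f u] conflation_comp_zero[OF \<delta>] u Lpsh O by (simp add: kernel_def)
    ultimately have "Act L f ` carrier (Val L X) = kernel (Val L Y) (Val L Z) (Act L g)"
      unfolding kernel_def by blast
    with ker show ?thesis by blast
  qed
  then show ?thesis unfolding lex_objects_def using Lfp by simp
qed

text \<open>A left exact \<open>L\<close> is a sheaf for single deflations, so morphisms to
  \<open>L\<close> extend along a local isomorphism \<open>t\<close> by descent. An element
  \<open>w\<close> of \<open>H\<close> lifts along \<open>t\<close> after a deflation
  \<open>q\<close>. The restriction of this lift along the inflation belonging to \<open>q\<close>
  is killed by \<open>t\<close>, hence by \<psi>, so the value of \<psi> on the lift descends along
  \<open>q\<close>.\<close>

lemma lex_imp_closed:
  assumes "L \<in> lex_objects U C E s"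
  shows "L \<in> loc.closed_objects"
proof -
  have Lfp: "fp L" and lex: "\<And>Z Y X g f. conflation C E s Z Y X g f \<Longrightarrow>
     kernel (Val L X) (Val L Y) (Act L f) = {\<one>\<^bsub>Val L X\<^esub>} \<and>
     Act L f ` carrier (Val L X) = kernel (Val L Y) (Val L Z) (Act L g)"
    using assms unfolding lex_objects_def by auto
  note Lpsh = fp_psh[OF Lfp]
  \<comment> \<open>Separatedness of \<open>L\<close>: a section is determined by its restriction
    along a deflation.\<close>
  have Linj: "u = v" if q: "deflation V W q" and u: "u \<in> carrier (Val L W)" and v: "v \<in> carrier (Val L W)"
    and e: "Act L q u = Act L q v" for V W q u v
  proof -
    obtain Z g where "conflation C E s Z V W g q" using q unfolding deflation_def by blast
    then have k: "kernel (Val L W) (Val L V) (Act L q) = {\<one>\<^bsub>Val L W\<^esub>}" using lex by blast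
    interpret group_hom "Val L W" "Val L V" "Act L q"
      using psh_group[OF Lpsh deflation_Obj(1)[OF q]] psh_group[OF Lpsh deflation_Obj(2)[OF q]]
        act_hom[OF Lpsh, of q] deflation_arr[OF q] by (simp add: group_hom_def group_hom_axioms_def)
    have "inj_on (Act L q) (carrier (Val L W))"
      using inj_on_one_iff k unfolding kernel_def by blast
    then show ?thesis using u v e by (auto dest: inj_onD)
  qed
  show ?thesis
    unfolding loc.closed_objects_def
  proof (intro CollectI conjI allI ballI)
    show "L \<in> Obj A" using Lfp by simp
    fix G H t \<psi> assume "t \<in> quot_inv A S G H" and \<psi>: "\<psi> \<in> mor A G L"
    then have t: "t \<in> mor A G H" "locally_injective G H t" "locally_surjective G H t" unfolding quot_inv_iff by blast+
    note G = mor_mod_psh(1)[OF t(1)] and H = mor_mod_psh(2)[OF t(1)]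
    \<comment> \<open>Two elements that \<open>t\<close> identifies agree after a deflation, and
      \<open>L\<close> is separated; so \<psi> identifies them as well.\<close>
    have wd: "app \<psi> W v = app \<psi> W v'"
      if W: "W \<in> Obj C" and v: "v \<in> carrier (Val G W)" "v' \<in> carrier (Val G W)" and e: "app t W v = app t W v'" for W v v'
    proof -
      obtain V q where q: "deflation V W q" "Act G q v = Act G q v'" using locally_injectiveD[OF t(1,2) W v e] .
      then have "Act L q (app \<psi> W v) = Act L q (app \<psi> W v')"
        using app_act[OF \<psi>, of q V v] app_act[OF \<psi>, of q V v'] deflation_arr[OF q(1)] v by simp
      then show ?thesis using Linj[OF q(1)] app_closed[OF \<psi> W] v by blast
    qed
    \<comment> \<open>The graph of the extension, over all deflations and all lifts simultaneously.
      Additivity and naturality of the extension then become closure properties of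
      \<open>rel\<close>, and single-valuedness is \<open>uniq\<close>.\<close>
    define rel where "rel W w u \<longleftrightarrow> w \<in> carrier (Val H W) \<and> u \<in> carrier (Val L W) \<and>
      (\<exists>V q v. deflation V W q \<and> v \<in> carrier (Val G V) \<and> Act H q w = app t V v \<and> Act L q u = app \<psi> V v)" for W w u
    \<comment> \<open>Two related pairs can be witnessed over the same deflation, a common
      refinement of the two given ones. This serves both uniqueness and additivity.\<close>
    have common: "\<exists>V d v v'. deflation V W d \<and> v \<in> carrier (Val G V) \<and> v' \<in> carrier (Val G V) \<and>
        Act H d w = app t V v \<and> Act L d u = app \<psi> V v \<and> Act H d w' = app t V v' \<and> Act L d u' = app \<psi> V v'"
      if r: "rel W w u" "rel W w' u'" for W w u w' u'
    proof -
      obtain V q v where q: "w \<in> carrier (Val H W)" "u \<in> carrier (Val L W)" "deflation V W q"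
        "v \<in> carrier (Val G V)" "Act H q w = app t V v" "Act L q u = app \<psi> V v" using r(1) unfolding rel_def by blast
      obtain V' q' v' where q': "w' \<in> carrier (Val H W)" "u' \<in> carrier (Val L W)" "deflation V' W q'"
        "v' \<in> carrier (Val G V')" "Act H q' w' = app t V' v'" "Act L q' u' = app \<psi> V' v'" using r(2) unfolding rel_def by blast
      obtain T y y' where y: "y \<in> mor C T V" "y' \<in> mor C T V'" "q \<cdot> y = q' \<cdot> y'" "deflation T W (q \<cdot> y)"
        using deflation_common[OF q(3) q'(3)] .
      note [simp] = mor_arr[OF y(1)] mor_arr[OF y(2)] deflation_arr[OF q(3)] deflation_arr[OF q'(3)]
      have 1: "Act H (q \<cdot> y) w = app t T (Act G y v)" "Act L (q \<cdot> y) u = app \<psi> T (Act G y v)"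
        using app_act[OF t(1), of y T v] app_act[OF \<psi>, of y T v] q Lpsh H by simp_all
      have 2: "Act H (q \<cdot> y) w' = app t T (Act G y' v')" "Act L (q \<cdot> y) u' = app \<psi> T (Act G y' v')"
        unfolding y(3) using app_act[OF t(1), of y' T v'] app_act[OF \<psi>, of y' T v'] q' Lpsh H by simp_all
      have "Act G y v \<in> carrier (Val G T)" "Act G y' v' \<in> carrier (Val G T)" using G q(4) q'(4) by simp_all
      with 1 2 y(4) show ?thesis by blast
    qed
    have uniq: "u = u'" if r: "rel W w u" "rel W w u'" for W w u u'
    proof -
      obtain V d v v' where d: "deflation V W d" "v \<in> carrier (Val G V)" "v' \<in> carrier (Val G V)"
        "Act H d w = app t V v" "Act L d u = app \<psi> V v" "Act H d w = app t V v'" "Act L d u' = app \<psi> V v'"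
        using common[OF r] by blast
      have "Act L d u = Act L d u'" using wd[OF deflation_Obj(1)[OF d(1)] d(2,3)] d(4-7) by simp
      then show ?thesis using Linj[OF d(1)] r unfolding rel_def by blast
    qed
    have ex: "\<exists>u. rel W w u" if W: "W \<in> Obj C" and w: "w \<in> carrier (Val H W)" for W w
    proof -
      obtain Y q v where q: "deflation Y W q" "v \<in> carrier (Val G Y)" "Act H q w = app t Y v"
        using t(3) W w unfolding locally_surjective_def by blast
      obtain Z g where cf: "conflation C E s Z Y W g q" using q(1) unfolding deflation_def by blast
      then obtain \<delta> where \<delta>: "realizes C E s Z Y W g q \<delta>" unfolding conflation_def by blast
      note gm = realizesD(2)[OF \<delta>]
      have O: "Y \<in> Obj C" "Z \<in> Obj C" using gm mor_Obj by blast+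
      note [simp] = mor_arr[OF gm] deflation_arr[OF q(1)]
      have gv: "Act G g v \<in> carrier (Val G Z)" using G q(2) by simp
      \<comment> \<open>The composite \<open>q \<cdot> g\<close> is zero, so \<open>t\<close> kills
        the restriction of \<open>v\<close> along \<open>g\<close>, and by \<open>wd\<close> so does
        \<psi>. Left exactness then puts the value of \<psi> at \<open>v\<close> into the image of
        restriction along \<open>q\<close>.\<close>
      have "app t Z (Act G g v) = Act H g (Act H q w)" using app_act[OF t(1), of g Z v] q by simp
      also have "\<dots> = app t Z \<one>\<^bsub>Val G Z\<^esub>"
        using act_comp[OF H, of g q w] conflation_comp_zero[OF \<delta>] H w W O app_one[OF t(1) O(2)] by simp
      finally have "app \<psi> Z (Act G g v) = app \<psi> Z \<one>\<^bsub>Val G Z\<^esub>" using wd[OF O(2) gv] G O by simp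
      then have "Act L g (app \<psi> Y v) = \<one>\<^bsub>Val L Z\<^esub>"
        using app_act[OF \<psi>, of g Z v] q(2) app_one[OF \<psi> O(2)] by simp
      then have "app \<psi> Y v \<in> Act L q ` carrier (Val L W)"
        using lex[OF cf] app_closed[OF \<psi> O(1) q(2)] unfolding kernel_def by blast
      then obtain u where "u \<in> carrier (Val L W)" "Act L q u = app \<psi> Y v" by auto
      then show ?thesis unfolding rel_def using w q by blast
    qed
    define \<phi> where "\<phi> W w = (THE u. rel W w u)" for W w
    have \<phi>: "\<phi> W w = u" if "rel W w u" for W w u
      unfolding \<phi>_def using that uniq by (intro the_equality) auto
    have rel\<phi>: "rel W w (\<phi> W w)" if "W \<in> Obj C" "w \<in> carrier (Val H W)" for W w
      using ex[OF that] \<phi> by auto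
    have "nat_trans C H L \<phi>"
    proof (rule nat_transI)
      fix W w w' assume W: "W \<in> Obj C" and w: "w \<in> carrier (Val H W)"
      show "\<phi> W w \<in> carrier (Val L W)" using rel\<phi>[OF W w] unfolding rel_def by blast
      assume w': "w' \<in> carrier (Val H W)"
      have c: "\<phi> W w \<in> carrier (Val L W)" "\<phi> W w' \<in> carrier (Val L W)"
        using rel\<phi>[OF W w] rel\<phi>[OF W w'] unfolding rel_def by blast+
      obtain V d v v' where d: "deflation V W d" "v \<in> carrier (Val G V)" "v' \<in> carrier (Val G V)"
        "Act H d w = app t V v" "Act L d (\<phi> W w) = app \<psi> V v" "Act H d w' = app t V v'" "Act L d (\<phi> W w') = app \<psi> V v'"
        using common[OF rel\<phi>[OF W w] rel\<phi>[OF W w']] by blast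
      note V = deflation_Obj(1)[OF d(1)]
      interpret GV: group "Val G V" using psh_group[OF G V] .
      interpret HW: group "Val H W" using psh_group[OF H W] .
      interpret LW: group "Val L W" using psh_group[OF Lpsh W] .
      have "Act H d (w \<otimes>\<^bsub>Val H W\<^esub> w') = app t V (v \<otimes>\<^bsub>Val G V\<^esub> v')"
        using deflation_arr[OF d(1)] H w w' d nat_mult[OF app_nat[OF t(1)] V d(2,3)] by simp
      moreover have "Act L d (\<phi> W w \<otimes>\<^bsub>Val L W\<^esub> \<phi> W w') = app \<psi> V (v \<otimes>\<^bsub>Val G V\<^esub> v')"
        using deflation_arr[OF d(1)] Lpsh c d nat_mult[OF app_nat[OF \<psi>] V d(2,3)] by simp
      moreover have "v \<otimes>\<^bsub>Val G V\<^esub> v' \<in> carrier (Val G V)" "w \<otimes>\<^bsub>Val H W\<^esub> w' \<in> carrier (Val H W)"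
        "\<phi> W w \<otimes>\<^bsub>Val L W\<^esub> \<phi> W w' \<in> carrier (Val L W)" using d w w' c by simp_all
      ultimately have "rel W (w \<otimes>\<^bsub>Val H W\<^esub> w') (\<phi> W w \<otimes>\<^bsub>Val L W\<^esub> \<phi> W w')" unfolding rel_def using d(1) by blast
      then show "\<phi> W (w \<otimes>\<^bsub>Val H W\<^esub> w') = \<phi> W w \<otimes>\<^bsub>Val L W\<^esub> \<phi> W w'" by (rule \<phi>)
    next
      fix W' W a w assume a: "a \<in> mor C W' W" and w: "w \<in> carrier (Val H W)"
      have O: "W' \<in> Obj C" "W \<in> Obj C" using a mor_Obj by blast+
      obtain V q v where q: "\<phi> W w \<in> carrier (Val L W)" "deflation V W q" "v \<in> carrier (Val G V)"
        "Act H q w = app t V v" "Act L q (\<phi> W w) = app \<psi> V v" using rel\<phi>[OF O(2) w] unfolding rel_def by blast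
      obtain V' q' k where q': "deflation V' W' q'" "k \<in> mor C V' V" "q \<cdot> k = a \<cdot> q'"
        using deflation_pullback[OF q(2) a] .
      note [simp] = mor_arr[OF a] mor_arr[OF q'(2)] deflation_arr[OF q(2)] deflation_arr[OF q'(1)]
      have "Act H q' (Act H a w) = Act H (q \<cdot> k) w" unfolding q'(3) using H w by simp
      also have "\<dots> = app t V' (Act G k v)" using app_act[OF t(1), of k V' v] q H w by simp
      finally have 1: "Act H q' (Act H a w) = app t V' (Act G k v)" .
      have "Act L q' (Act L a (\<phi> W w)) = Act L (q \<cdot> k) (\<phi> W w)" unfolding q'(3) using Lpsh q(1) by simp
      also have "\<dots> = app \<psi> V' (Act G k v)" using app_act[OF \<psi>, of k V' v] q Lpsh by simp
      finally have 2: "Act L q' (Act L a (\<phi> W w)) = app \<psi> V' (Act G k v)" .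
      have "Act G k v \<in> carrier (Val G V')" "Act H a w \<in> carrier (Val H W')" "Act L a (\<phi> W w) \<in> carrier (Val L W')"
        using G H Lpsh q w by simp_all
      then have "rel W' (Act H a w) (Act L a (\<phi> W w))" unfolding rel_def using 1 2 q'(1) by blast
      then show "\<phi> W' (Act H a w) = Act L a (\<phi> W w)" by (rule \<phi>)
    qed
    from mod_obtain[OF mor_mod_fp(2)[OF t(1)] Lfp this, where U = U] obtain \<theta> where
      \<theta>: "\<theta> \<in> mor A H L" "\<forall>W\<in>Obj C. \<forall>u\<in>carrier (Val H W). app \<theta> W u = \<phi> W u" by blast
    have \<theta>t: "\<theta> \<cdot>\<^bsub>A\<^esub> t = \<psi>"
    proof (rule mod_ext[OF loc.comp_mor[OF t(1) \<theta>(1)] \<psi>])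
      fix W v assume W: "W \<in> Obj C" and v: "v \<in> carrier (Val G W)"
      note c = app_closed[OF t(1) W v] app_closed[OF \<psi> W v]
      have "rel W (app t W v) (app \<psi> W v)"
        unfolding rel_def using c v deflation_Idt[OF W] act_Idt[OF H W c(1)] act_Idt[OF Lpsh W c(2)] by blast
      then show "app (\<theta> \<cdot>\<^bsub>A\<^esub> t) W v = app \<psi> W v"
        using app_comp[OF t(1) \<theta>(1) W v] \<theta>(2) W c(1) \<phi> by simp
    qed
    show "\<exists>!\<phi>. \<phi> \<in> mor A H L \<and> \<phi> \<cdot>\<^bsub>A\<^esub> t = \<psi>"
    proof (rule ex1I[of _ \<theta>])
      fix \<kappa> assume "\<kappa> \<in> mor A H L \<and> \<kappa> \<cdot>\<^bsub>A\<^esub> t = \<psi>"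
      then have \<kappa>: "\<kappa> \<in> mor A H L" "\<kappa> \<cdot>\<^bsub>A\<^esub> t = \<psi>" by blast+
      show "\<kappa> = \<theta>"
      proof (rule mod_ext[OF \<kappa>(1) \<theta>(1)])
        fix W w assume W: "W \<in> Obj C" and w: "w \<in> carrier (Val H W)"
        obtain V q v where q: "deflation V W q" "v \<in> carrier (Val G V)" "Act H q w = app t V v"
          using t(3) W w unfolding locally_surjective_def by blast
        note V = deflation_Obj(1)[OF q(1)]
        \<comment> \<open>Any two extensions agree on the image of \<open>t\<close>, in particular
          on the restriction of \<open>w\<close> along \<open>q\<close>; separatedness of
          \<open>L\<close> transfers this to \<open>w\<close>.\<close>
        have "app \<kappa> V (Act H q w) = app \<theta> V (Act H q w)"
          unfolding q(3) using app_comp[OF t(1) \<kappa>(1) V q(2)] app_comp[OF t(1) \<theta>(1) V q(2)] \<kappa>(2) \<theta>t by simp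
        then have "Act L q (app \<kappa> W w) = Act L q (app \<theta> W w)"
          using app_act[OF \<kappa>(1), of q V w] app_act[OF \<theta>(1), of q V w] deflation_arr[OF q(1)] w by simp
        then show "app \<kappa> W w = app \<theta> W w"
          by (rule Linj[OF q(1) app_closed[OF \<kappa>(1) W w] app_closed[OF \<theta>(1) W w]])
      qed
    qed (use \<theta>(1) \<theta>t in blast)
  qed
qed

lemma closed_eq_lex: "loc.closed_objects = lex_objects U C E s"
  using closed_imp_lex lex_imp_closed by blast

end

theorem theorem2p9:
  fixes C :: "('o, 'm) cat"
    and E :: "('o, 'm, 'e) bifunctor"
    and s :: "('o, 'm, 'e) realization"
    and U :: "'u itself"
  assumes "extriangulated_category C E s"
    and "has_weak_kernels C"
    and "locally_small U C"
  shows "serre_subcategory (mod_cat U C) (def_objects U C E s) \<and>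
    is_serre_quotient (mod_cat U C) (def_objects U C E s)
      (serre_quotient (mod_cat U C) (def_objects U C E s))
      (quotient_functor (mod_cat U C) (def_objects U C E s)) \<and>
    (has_right_adjoint (mod_cat U C)
       (serre_quotient (mod_cat U C) (def_objects U C E s))
       (quotient_functor (mod_cat U C) (def_objects U C E s)) \<longrightarrow>
     (\<exists>Q. localization_sequence (mod_cat U C) (def_objects U C E s) (lex_cat U C E s) Q \<and>
          is_right_adjoint (mod_cat U C) (lex_cat U C E s) Q id_functor))"
proof -
  interpret extriangulated_category C E s by fact
  interpret extriangulated_weak_kernels C E s U
    by unfold_locales (use assms in auto)
  show ?thesis
    \<comment> \<open>The abstract result concerns the full subcategory on
      \<open>loc.closed_objects\<close>; \<open>closed_eq_lex\<close> identifies it with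
      \<open>lex_cat\<close>.\<close>
    using serre_subcategory_defects loc.is_serre_quotient_B[OF serre_subcategory_defects] loc.localization_closed
    by (simp add: lex_cat_def closed_eq_lex)
qed

end
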